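(* Let $V \in L^\infty(0,\pi; \mathbb{R})$ be such that the Dirichlet spectrum $(\lambda_n)_{n\ge1}$ of $-\partial_x^2 +V$ on $(0,\pi)$ is strongly non-resonant, let $\epsilon_0>0$ be the associated threshold (described in the context), and let $s> 1$ be a real number. For all $r\geq 1$, there exist $K>0$ and $\delta >0$ such that, provided that $u^{(0)}\in H^s(0,\pi;\mathbb{C}) \cap H^1_0(0,\pi;\mathbb{C})$ satisfies $\varepsilon := \| u^{(0)} \|_{H^s} \leq \epsilon_0$, the global solution $u$ of the nonlinear Schr\"odinger equation (NLS) on $(0,\pi)$ with homogeneous Dirichlet boundary conditions and initial datum $u^{(0)}$ satisfies $$|t|< \varepsilon^{-r} \quad \Longrightarrow \quad \big\| u(t) - \sum_{n\geq 1} e^{i\theta_n(t)} u_n(0) f_n \big\|_{H^1} \leq K \varepsilon^{1+\delta}$$ where $u_n(0) = \int_0^\pi u(0,x) f_n(x) \,\mathrm{d}x$ and the functions $\theta_n : \mathbb{R} \to \mathbb{R}$ depend only on $n$ and $u^{(0)}$.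
   Context: Notation: $\langle x\rangle=\sqrt{1+|x|^2}$; $\mathbb{Z}^*=\mathbb{Z}\setminus\{0\}$. Equation (NLS): $i\partial_t u(t,x) = -\partial_x^2 u(t,x) +V(x) u(t,x) + g(x,|u(t,x)|^2)\, u(t,x)$ for $t\in\mathbb{R}$, $x\in(0,\pi)$, with $u(t,0)=u(t,\pi)=0$ and $u(0,\cdot)=u^{(0)}$, $u$ complex valued. The nonlinearity $g$ is fixed: $(y \mapsto g(\cdot,y)) \in C^\infty(\mathbb{R}; H^{2}(0,\pi;\mathbb{R}))$ is of order $(p-2)/2 \geq 1$ at the origin (i.e. $p\ge4$ is an even integer and $g(\cdot,y)=\mathcal{O}(|y|^{(p-2)/2})$ as $y\to0$). Conserved quantities and global solution (known): let $\mathcal{M}(u)=\|u\|_{L^2}^2$, $G(\cdot,y)=\int_0^yg(\cdot,\mathrm{y})\mathrm{d}\mathrm{y}$ and $\mathcal{H}(u)=\frac12\int_0^\pi|\partial_xu|^2+V|u|^2+G(x,|u|^2)\,\mathrm{d}x$. For every $\rho>0$ one fixes $\varepsilon_\rho>0$, $\Lambda_\rho>0$ such that $\|V\|_{L^\infty}\le\rho$ and $\|u\|_{H^1}\le\Lambda_\rho\varepsilon_\rho$ imply $\Lambda_\rho^{-1}\|u\|_{H^1}^2\le\mathcal{H}(u)+(\rho+1)\mathcal{M}(u)\le\Lambda_\rho\|u\|_{H^1}^2$. If $\|V\|_{L^\infty}\le\rho$ and $\|u^{(0)}\|_{H^1_0}\le\varepsilon_\rho$ then (NLS) has a unique global solution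 $u\in C^0_b(\mathbb{R};H^1_0)\cap C^1(\mathbb{R};H^{-1})$, and it preserves $\mathcal{H}$ and $\mathcal{M}$. Dirichlet spectrum: $(\lambda_n)_{n\ge1}$ is the increasing sequence of eigenvalues and $(f_n)_{n\ge1}$ the Hilbertian basis of $L^2(0,\pi;\mathbb{R})$ of eigenfunctions $f_n\in H^2\cap H^1_0$ with $-\partial_x^2 f_n+Vf_n=\lambda_nf_n$ on $(0,\pi)$, $f_n(0)=f_n(\pi)=0$. Strong non-resonance: let $\mathbf{N}_d\subset\mathbb{Z}^d$ (here $d=1$, $\mathbf{N}_d=\{1,2,\dots\}$). Frequencies $\omega\in\mathbb{R}^{\mathbf{N}_d}$ are strongly non-resonant if for all $r>0$ there exist $\gamma_r>0$, $\alpha_r>0$ such that for all integers $1\le r_\star \leq r$, all $\ell_1,\dots,\ell_{r_\star} \in \mathbb{Z}^*$, all $n \in \mathbf{N}_d^{r_\star}$ injective (pairwise distinct entries), provided that $|\ell_1|+\cdots+|\ell_{r_\star}| \leq r$ and $\langle n_1 \rangle \leq \cdots \leq \langle n_{r_\star} \rangle$, we have $|\ell_1 \omega_{n_1} + \cdots + \ell_{r_\star} \omega_{n_{r_\star}} | \geq \gamma_{r} \langle n_1 \rangle^{-\alpha_r}$. The threshold $\epsilon_0$: it is a positive number, whose existence for such $V$ is another theorem of the paper, with $\epsilon_0\le\varepsilon_\rho$ for some $\rho\ge\|V\|_{L^\infty}$, such that for all $r\ge1$ there exist $\beta_r>0$, $C_r>0$ for which, whenever $\varepsilon':=\|u^{(0)}\|_{H^1_0}\le\epsilon_0$,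 the global solution satisfies: $|t|<(\varepsilon')^{-r}$ implies $\big||u_n(t)|^2-|u_n(0)|^2\big|\le C_r\langle n\rangle^{\beta_r}(\varepsilon')^p$ for all $n\ge1$, where $u_n(t)=\int_0^\pi u(t,x)f_n(x)\,\mathrm{d}x$. *)

theory Defs
  imports
    "HOL-Analysis.Analysis"
    "HOL-Probability.Essential_Supremum"
    "HOL-Library.Landau_Symbols"
begin

text \<open>
  Elements of Lebesgue and Sobolev spaces on (0, \<pi>) are represented by functions on the reals of
  which only the values on (0, \<pi>), up to null sets, are relevant; the norms below are therefore
  seminorms on functions. The codomain is real or complex.
\<close>

abbreviation \<mu> :: "real measure" where
  "\<mu> \<equiv> lebesgue_on {0<..<pi}"

definition jbracket :: "real \<Rightarrow> real" where
  "jbracket x = sqrt (1 + x\<^sup>2)"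


section \<open>Function spaces on the interval\<close>

definition L2 :: "(real \<Rightarrow> 'a::euclidean_space) set" where
  "L2 = {f. f \<in> borel_measurable \<mu> \<and> integrable \<mu> (\<lambda>x. (norm (f x))\<^sup>2)}"

definition L2_norm :: "(real \<Rightarrow> 'a::euclidean_space) \<Rightarrow> real" where
  "L2_norm f = sqrt (LINT x|\<mu>. (norm (f x))\<^sup>2)"

definition Linf_norm :: "(real \<Rightarrow> real) \<Rightarrow> ereal" where
  "Linf_norm V = esssup \<mu> (\<lambda>x. ereal \<bar>V x\<bar>)"

definition Linf :: "(real \<Rightarrow> real) set" where
  "Linf = {V. V \<in> borel_measurable \<mu> \<and> Linf_norm V < \<infinity>}"

definition test_functions :: "(real \<Rightarrow> 'a::euclidean_space) set" where
  "test_functions = {\<phi>.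
     (\<exists>D. D 0 = \<phi> \<and> (\<forall>k x. (D k has_vector_derivative D (Suc k) x) (at x))) \<and>
     (\<exists>a b. 0 < a \<and> b < pi \<and> (\<forall>x. x \<notin> {a..b} \<longrightarrow> \<phi> x = 0))}"

definition has_weak_deriv ::
    "(real \<Rightarrow> 'a::euclidean_space) \<Rightarrow> (real \<Rightarrow> 'a) \<Rightarrow> bool" where
  "has_weak_deriv f f' \<longleftrightarrow>
     (\<forall>\<phi> \<in> (test_functions :: (real \<Rightarrow> real) set).
        (LINT x|\<mu>. vector_derivative \<phi> (at x) *\<^sub>R f x) = - (LINT x|\<mu>. \<phi> x *\<^sub>R f' x))"

text \<open>The square integrable weak derivative; it is unique almost everywhere when it exists.\<close>

definition weak_deriv :: "(real \<Rightarrow> 'a::euclidean_space) \<Rightarrow> (real \<Rightarrow> 'a)" where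
  "weak_deriv f = (SOME f'. f' \<in> L2 \<and> has_weak_deriv f f')"

definition Hk :: "nat \<Rightarrow> (real \<Rightarrow> 'a::euclidean_space) set" where
  "Hk m = {f. \<exists>D. D 0 = f \<and> (\<forall>j\<le>m. D j \<in> L2) \<and> (\<forall>j<m. has_weak_deriv (D j) (D (Suc j)))}"

definition Hk_norm :: "nat \<Rightarrow> (real \<Rightarrow> 'a::euclidean_space) \<Rightarrow> real" where
  "Hk_norm m f = sqrt (\<Sum>j\<le>m. (L2_norm ((weak_deriv ^^ j) f))\<^sup>2)"

text \<open>
  Sobolev spaces of real order s \<ge> 0 (Sobolev-Slobodeckij): with m the integer part and \<sigma> the
  fractional part of s, the m-th derivative has a finite Gagliardo seminorm of order \<sigma>.
\<close>

definition gagliardo_integrand :: "real \<Rightarrow> (real \<Rightarrow> 'a::euclidean_space) \<Rightarrow> real \<times> real \<Rightarrow> real" where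
  "gagliardo_integrand \<sigma> h = (\<lambda>(x, y). (norm (h x - h y))\<^sup>2 / \<bar>x - y\<bar> powr (1 + 2 * \<sigma>))"

definition Hs :: "real \<Rightarrow> (real \<Rightarrow> 'a::euclidean_space) set" where
  "Hs s = {f \<in> Hk (nat \<lfloor>s\<rfloor>). frac s = 0 \<or>
     integrable (\<mu> \<Otimes>\<^sub>M \<mu>) (gagliardo_integrand (frac s) ((weak_deriv ^^ nat \<lfloor>s\<rfloor>) f))}"

definition Hs_norm :: "real \<Rightarrow> (real \<Rightarrow> 'a::euclidean_space) \<Rightarrow> real" where
  "Hs_norm s f = sqrt ((Hk_norm (nat \<lfloor>s\<rfloor>) f)\<^sup>2 +
     (if frac s = 0 then 0
      else LINT z|(\<mu> \<Otimes>\<^sub>M \<mu>). gagliardo_integrand (frac s) ((weak_deriv ^^ nat \<lfloor>s\<rfloor>) f) z))"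

text \<open>The closure of the test functions in the first Sobolev space, normed by \<^term>\<open>Hk_norm 1\<close>.\<close>

definition H10 :: "(real \<Rightarrow> 'a::euclidean_space) set" where
  "H10 = {f \<in> Hk 1. \<forall>e>0. \<exists>\<phi>\<in>test_functions. Hk_norm 1 (\<lambda>x. f x - \<phi> x) < e}"

text \<open>
  The dual space of \<^term>\<open>H10\<close>, for complex valued functions. Pairings are bilinear (without complex
  conjugation). Boundedness forces functionals to respect almost everywhere equality.
\<close>

definition Hm1 :: "((real \<Rightarrow> complex) \<Rightarrow> complex) set" where
  "Hm1 = {L. (\<forall>\<phi>\<in>H10. \<forall>\<psi>\<in>H10. L (\<lambda>x. \<phi> x + \<psi> x) = L \<phi> + L \<psi>) \<and>
             (\<forall>c. \<forall>\<phi>\<in>H10. L (\<lambda>x. c * \<phi> x) = c * L \<phi>) \<and>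
             (\<exists>C. \<forall>\<phi>\<in>H10. cmod (L \<phi>) \<le> C * Hk_norm 1 \<phi>)}"

definition Hm1_norm :: "((real \<Rightarrow> complex) \<Rightarrow> complex) \<Rightarrow> real" where
  "Hm1_norm L = (SUP \<phi> \<in> {\<phi> \<in> H10. Hk_norm 1 \<phi> \<le> 1}. cmod (L \<phi>))"

definition L2_to_Hm1 :: "(real \<Rightarrow> complex) \<Rightarrow> (real \<Rightarrow> complex) \<Rightarrow> complex" where
  "L2_to_Hm1 v = (\<lambda>\<phi>. LINT x|\<mu>. v x * \<phi> x)"

text \<open>The negative second derivative as an operator from \<^term>\<open>H10\<close> to its dual.\<close>

definition neg_laplace :: "(real \<Rightarrow> complex) \<Rightarrow> (real \<Rightarrow> complex) \<Rightarrow> complex" where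
  "neg_laplace v = (\<lambda>\<phi>. LINT x|\<mu>. weak_deriv v x * weak_deriv \<phi> x)"

text \<open>Convergence in the first Sobolev space of a series indexed by n \<ge> 1.\<close>

definition H1_sums :: "(nat \<Rightarrow> real \<Rightarrow> complex) \<Rightarrow> (real \<Rightarrow> complex) \<Rightarrow> bool" where
  "H1_sums F w \<longleftrightarrow> (\<forall>n\<ge>1. F n \<in> Hk 1) \<and> w \<in> Hk 1 \<and>
     (\<lambda>N. Hk_norm 1 (\<lambda>x. w x - (\<Sum>n=1..N. F n x))) \<longlonglongrightarrow> 0"


section \<open>Dirichlet spectrum and non-resonance\<close>

text \<open>
  All sequences are indexed by n \<ge> 1; the value at 0 is irrelevant. The third and fourth clauses say
  that the eigenfunctions form a Hilbertian basis (an orthonormal family with dense span).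
\<close>

definition dirichlet_spectrum ::
    "(real \<Rightarrow> real) \<Rightarrow> (nat \<Rightarrow> real) \<Rightarrow> (nat \<Rightarrow> real \<Rightarrow> real) \<Rightarrow> bool" where
  "dirichlet_spectrum V lam f \<longleftrightarrow>
     strict_mono_on {1..} lam \<and>
     (\<forall>n\<ge>1. f n \<in> Hk 2 \<inter> H10 \<and>
        (AE x in \<mu>. - (weak_deriv ^^ 2) (f n) x + V x * f n x = lam n * f n x)) \<and>
     (\<forall>m\<ge>1. \<forall>n\<ge>1. (LINT x|\<mu>. f m x * f n x) = (if m = n then 1 else 0)) \<and>
     (\<forall>h\<in>L2. \<forall>e>0. \<exists>N c. L2_norm (\<lambda>x. h x - (\<Sum>n=1..N. c n * f n x)) < e)"

definition eigen_coeff :: "(nat \<Rightarrow> real \<Rightarrow> real) \<Rightarrow> (real \<Rightarrow> complex) \<Rightarrow> nat \<Rightarrow> complex" where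
  "eigen_coeff f v n = (LINT x|\<mu>. v x * complex_of_real (f n x))"

definition strongly_nonresonant :: "(nat \<Rightarrow> real) \<Rightarrow> bool" where
  "strongly_nonresonant \<omega> \<longleftrightarrow>
     (\<forall>r::real. r > 0 \<longrightarrow> (\<exists>\<gamma>>0. \<exists>\<alpha>>0. \<forall>k::nat. 1 \<le> k \<and> real k \<le> r \<longrightarrow>
        (\<forall>(l :: nat \<Rightarrow> int) (n :: nat \<Rightarrow> nat).
           (\<forall>i\<in>{1..k}. l i \<noteq> 0) \<and> (\<forall>i\<in>{1..k}. n i \<ge> 1) \<and> inj_on n {1..k} \<and>
           real_of_int (\<Sum>i=1..k. \<bar>l i\<bar>) \<le> r \<and> mono_on {1..k} (\<lambda>i. jbracket (real (n i))) \<longrightarrow>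
           \<bar>\<Sum>i=1..k. real_of_int (l i) * \<omega> (n i)\<bar> \<ge> \<gamma> * jbracket (real (n 1)) powr (- \<alpha>))))"


section \<open>The nonlinear Schroedinger equation\<close>

text \<open>
  D k y is the k-th derivative at y of the curve sending y to g(., y), valued in the second Sobolev
  space. The continuity clause selects the continuous representative of each g(., y): without it,
  the composition of g with the squared modulus of u would not be determined up to null sets.
\<close>

definition nonlinearity :: "nat \<Rightarrow> (real \<Rightarrow> real \<Rightarrow> real) \<Rightarrow> bool" where
  "nonlinearity p g \<longleftrightarrow>
     even p \<and> p \<ge> 4 \<and>
     (\<forall>y. continuous_on {0<..<pi} (\<lambda>x. g x y)) \<and>
     (\<exists>D :: nat \<Rightarrow> real \<Rightarrow> real \<Rightarrow> real.
        (\<forall>y. D 0 y = (\<lambda>x. g x y)) \<and>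
        (\<forall>k y. D k y \<in> Hk 2 \<and>
           ((\<lambda>h. Hk_norm 2 (\<lambda>x. (D k (y + h) x - D k y x) / h - D (Suc k) y x))
              \<longlongrightarrow> 0) (at 0))) \<and>
     (\<lambda>y. Hk_norm 2 (\<lambda>x. g x y)) \<in> O[at 0](\<lambda>y. \<bar>y\<bar> ^ ((p - 2) div 2))"

definition mass :: "(real \<Rightarrow> complex) \<Rightarrow> real" where
  "mass v = (L2_norm v)\<^sup>2"

definition primitive :: "(real \<Rightarrow> real \<Rightarrow> real) \<Rightarrow> real \<Rightarrow> real \<Rightarrow> real" where
  "primitive g x y = (LBINT z=0..ereal y. g x z)"

definition hamiltonian ::
    "(real \<Rightarrow> real) \<Rightarrow> (real \<Rightarrow> real \<Rightarrow> real) \<Rightarrow> (real \<Rightarrow> complex) \<Rightarrow> real" where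
  "hamiltonian V g v = 1/2 * (LINT x|\<mu>.
     (cmod (weak_deriv v x))\<^sup>2 + V x * (cmod (v x))\<^sup>2 + primitive g x ((cmod (v x))\<^sup>2))"

text \<open>Bounded continuous curves in \<^term>\<open>H10\<close>, continuously differentiable in the dual
  \<^term>\<open>Hm1\<close> with derivative ut, that solve the equation in \<^term>\<open>Hm1\<close> for all times.\<close>

definition global_solution ::
    "(real \<Rightarrow> real) \<Rightarrow> (real \<Rightarrow> real \<Rightarrow> real) \<Rightarrow> (real \<Rightarrow> complex) \<Rightarrow> (real \<Rightarrow> real \<Rightarrow> complex) \<Rightarrow> bool"
  where
  "global_solution V g u0 u \<longleftrightarrow>
     (\<forall>t. u t \<in> H10) \<and>
     (\<exists>B. \<forall>t. Hk_norm 1 (u t) \<le> B) \<and>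
     (\<forall>t. ((\<lambda>t'. Hk_norm 1 (\<lambda>x. u t' x - u t x)) \<longlongrightarrow> 0) (at t)) \<and>
     (\<exists>ut :: real \<Rightarrow> (real \<Rightarrow> complex) \<Rightarrow> complex.
        (\<forall>t. ut t \<in> Hm1) \<and>
        (\<forall>t. ((\<lambda>t'. Hm1_norm (\<lambda>\<phi>. ut t' \<phi> - ut t \<phi>)) \<longlongrightarrow> 0) (at t)) \<and>
        (\<forall>t. ((\<lambda>h. Hm1_norm (\<lambda>\<phi>.
           (L2_to_Hm1 (u (t + h)) \<phi> - L2_to_Hm1 (u t) \<phi>) / complex_of_real h - ut t \<phi>))
             \<longlongrightarrow> 0) (at 0)) \<and>
        (\<forall>t. \<forall>\<phi>\<in>H10. \<i> * ut t \<phi> =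
           neg_laplace (u t) \<phi>
           + L2_to_Hm1 (\<lambda>x. complex_of_real (V x) * u t x) \<phi>
           + L2_to_Hm1 (\<lambda>x. complex_of_real (g x ((cmod (u t x))\<^sup>2)) * u t x) \<phi>)) \<and>
     (AE x in \<mu>. u 0 x = u0 x)"

text \<open>The defining property of the constants associated with a bound \<rho> on the potential.\<close>

definition energy_constants :: "(real \<Rightarrow> real \<Rightarrow> real) \<Rightarrow> real \<Rightarrow> real \<Rightarrow> real \<Rightarrow> bool" where
  "energy_constants g \<rho> eps \<Lambda> \<longleftrightarrow> eps > 0 \<and> \<Lambda> > 0 \<and>
     (\<forall>W\<in>Linf. \<forall>v\<in>H10. Linf_norm W \<le> ereal \<rho> \<and> Hk_norm 1 v \<le> \<Lambda> * eps \<longrightarrow>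
        inverse \<Lambda> * (Hk_norm 1 v)\<^sup>2 \<le> hamiltonian W g v + (\<rho> + 1) * mass v \<and>
        hamiltonian W g v + (\<rho> + 1) * mass v \<le> \<Lambda> * (Hk_norm 1 v)\<^sup>2)"

text \<open>
  The time condition |t| < eps to the power -r. For eps = 0 the right-hand side is read as infinity,
  whereas \<^term>\<open>0 powr (- r)\<close> is 0.
\<close>

definition before_time :: "real \<Rightarrow> real \<Rightarrow> real \<Rightarrow> bool" where
  "before_time eps r t \<longleftrightarrow> eps = 0 \<or> \<bar>t\<bar> < eps powr (- r)"

definition threshold ::
    "(real \<Rightarrow> real) \<Rightarrow> nat \<Rightarrow> (real \<Rightarrow> real \<Rightarrow> real) \<Rightarrow> (nat \<Rightarrow> real \<Rightarrow> real) \<Rightarrow> real \<Rightarrow> bool" where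
  "threshold V p g f eps0 \<longleftrightarrow>
     eps0 > 0 \<and>
     (\<exists>\<rho>>0. Linf_norm V \<le> ereal \<rho> \<and> (\<exists>eps \<Lambda>. energy_constants g \<rho> eps \<Lambda> \<and> eps0 \<le> eps)) \<and>
     (\<forall>r::real. r \<ge> 1 \<longrightarrow> (\<exists>\<beta>>0. \<exists>C>0. \<forall>u0\<in>H10. Hk_norm 1 u0 \<le> eps0 \<longrightarrow>
        (\<forall>u. global_solution V g u0 u \<longrightarrow>
           (\<forall>t. before_time (Hk_norm 1 u0) r t \<longrightarrow>
              (\<forall>n\<ge>1. \<bar>(cmod (eigen_coeff f (u t) n))\<^sup>2 - (cmod (eigen_coeff f (u 0) n))\<^sup>2\<bar>
                 \<le> C * jbracket (real n) powr \<beta> * Hk_norm 1 u0 ^ p)))))"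

end

theory Submission imports Defs begin

text \<open>
  Let \<theta>_n(t) be the difference of the arguments of the n-th coefficients of the solution at the times t
  and 0. With this choice the n-th coefficient of the solution and of the rotated datum have the same
  argument at time t, so that their distance is the difference of two moduli
  (\<open>phase_difference\<close>), and the theorem becomes a statement about the moduli alone. These angles
  depend only on the datum because the equation determines the coefficients of the solution
  (\<open>nls_unique\<close>).

  Let e be the norm of the datum in the space of order s, let L \<ge> 1, and call a mode low if its eigenvalue,
  shifted so as to be at least 1, does not exceed L. The square of the distance in the first Sobolev
  space is at most a sum over the modes, weighted by the shifted eigenvalues (\<open>energy_Parseval\<close>).
  A low mode contributes at most a multiple of the change of its squared modulus, which the threshold
  controls by e to the power p \<ge> 4 at the price of a power of n; there are at most about L low modes
  (\<open>index_le_Lam\<close>), so all of them together contribute at most a power of L times the fourth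
  power of e.

  On the high modes no cancellation is used: each of the two functions is small there. For the datum
  this is its additional smoothness, and gives a negative power of L times the square of e
  (\<open>smooth_tail\<close>). For the solution it follows by conservation of mass and energy: the quadratic
  energy is conserved up to the potential energy of the nonlinearity, of order 4 in e, and the low modes
  hardly change their share of it, so neither do the high modes (\<open>tail_comparison\<close>). A small negative
  power of e for L balances the two kinds of error (\<open>balance_levels\<close>).

  The conservation laws and uniqueness come from one device. Each coefficient of the solution satisfies
  an ordinary differential equation (\<open>mode_equation\<close>), so sums over the first N modes can be
  differentiated in time; the derivative is shown to tend to 0, or to satisfy Gronwall's inequality, as
  N grows (\<open>limit_constant\<close>, \<open>limit_Gronwall\<close>). For the Hamiltonian this is delicate, because the
  velocities of the modes are only bounded by a quantity that grows like the square root of the last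
  eigenvalue. It is compensated by the gain of the same square root when the nonlinear term is projected
  (\<open>dcoef_le\<close>).

  The additional smoothness is exploited by duality: for every approximation z of the derivative of
  the datum that has itself a derivative z', the energy of the high modes is bounded by the error of the
  approximation and by the norm of z' divided by the square root of the eigenvalue
  (\<open>energy_tail_bound\<close>). Averages over short windows provide z for a datum of fractional
  regularity (\<open>Hs_approximation\<close>).
\<close>

section \<open>Square integrable functions\<close>

interpretation \<mu>: finite_measure \<mu>
  by (rule finite_measure_lebesgue_on) (simp add: lmeasurable_interval)

lemma measure_\<mu>_space: "measure \<mu> (space \<mu>) = pi"
  by (simp add: measure_restrict_space)

lemma L2_D: "f \<in> L2 \<Longrightarrow> f \<in> borel_measurable \<mu>" "f \<in> L2 \<Longrightarrow> integrable \<mu> (\<lambda>x. (norm (f x))\<^sup>2)"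
  by (auto simp: L2_def)

declare L2_D [simp] L2_D(1) [measurable_dest]

lemma L2_norm_nonneg [simp]: "0 \<le> L2_norm f"
  by (simp add: L2_norm_def)

lemma L2_norm_sq: "(L2_norm f)\<^sup>2 = (LINT x|\<mu>. (norm (f x))\<^sup>2)"
  by (simp add: L2_norm_def)

lemma L2_cong_AE:
  assumes "f \<in> L2" "AE x in \<mu>. f x = g x" "g \<in> borel_measurable \<mu>"
  shows "g \<in> L2"
proof -
  have "integrable \<mu> (\<lambda>x. (norm (g x))\<^sup>2)"
    using L2_D[OF assms(1)] assms(2,3)
    by (subst integrable_cong_AE[where g="\<lambda>x. (norm (f x))\<^sup>2"]) auto
  then show ?thesis using assms by (simp add: L2_def del: L2_D)
qed

lemma L2_norm_cong_AE:
  assumes "AE x in \<mu>. f x = g x" "f \<in> borel_measurable \<mu>" "g \<in> borel_measurable \<mu>"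
  shows "L2_norm f = L2_norm g"
  unfolding L2_norm_def using assms by (intro arg_cong[where f=sqrt] integral_cong_AE) auto

lemma L2_dominated:
  assumes "f \<in> L2" "g \<in> borel_measurable \<mu>" "AE x in \<mu>. norm (g x) \<le> C * norm (f x)"
  shows "g \<in> L2" "L2_norm g \<le> \<bar>C\<bar> * L2_norm f"
proof -
  have sq: "AE x in \<mu>. (norm (g x))\<^sup>2 \<le> C\<^sup>2 * (norm (f x))\<^sup>2"
    using assms(3)
  proof (rule AE_mp, intro AE_I2 impI)
    fix x assume "norm (g x) \<le> C * norm (f x)"
    then have "(norm (g x))\<^sup>2 \<le> (C * norm (f x))\<^sup>2" by (intro power_mono) auto
    then show "(norm (g x))\<^sup>2 \<le> C\<^sup>2 * (norm (f x))\<^sup>2" by (simp add: power_mult_distrib)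
  qed
  have i: "integrable \<mu> (\<lambda>x. C\<^sup>2 * (norm (f x))\<^sup>2)" using L2_D[OF assms(1)] by simp
  have g: "integrable \<mu> (\<lambda>x. (norm (g x))\<^sup>2)"
    by (rule Bochner_Integration.integrable_bound[OF i]) (use assms sq in auto)
  then show "g \<in> L2" using assms by (simp add: L2_def del: L2_D)
  have "(L2_norm g)\<^sup>2 \<le> C\<^sup>2 * (L2_norm f)\<^sup>2"
    unfolding L2_norm_sq using integral_mono_AE[OF g i sq] by simp
  also have "\<dots> = (\<bar>C\<bar> * L2_norm f)\<^sup>2" by (simp add: power_mult_distrib)
  finally show "L2_norm g \<le> \<bar>C\<bar> * L2_norm f" by (rule power2_le_imp_le) simp
qed

lemma L2_norm_product_integrable:
  assumes "f \<in> L2" "g \<in> L2"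
  shows "integrable \<mu> (\<lambda>x. norm (f x) * norm (g x))"
proof (rule Bochner_Integration.integrable_bound)
  show "integrable \<mu> (\<lambda>x. (norm (f x))\<^sup>2 + (norm (g x))\<^sup>2)" using assms by simp
  show "(\<lambda>x. norm (f x) * norm (g x)) \<in> borel_measurable \<mu>"
    using assms by simp
  have "a * b \<le> a\<^sup>2 + b\<^sup>2" if "a \<ge> 0" "b \<ge> 0" for a b :: real
    using sum_squares_bound[of a b] mult_nonneg_nonneg[OF that] by linarith
  then show "AE x in \<mu>. norm (norm (f x) * norm (g x)) \<le> norm ((norm (f x))\<^sup>2 + (norm (g x))\<^sup>2)"
    by (auto simp: abs_of_nonneg)
qed

lemma L2_norm_eq_0_iff:
  assumes "f \<in> L2"
  shows "L2_norm f = 0 \<longleftrightarrow> (AE x in \<mu>. f x = 0)"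
  using integral_nonneg_eq_0_iff_AE[OF L2_D(2)[OF assms]] by (simp add: L2_norm_def)

text \<open>The Cauchy-Schwarz inequality, obtained by optimising the weight in the arithmetic-geometric
  mean inequality.\<close>

lemma L2_Cauchy_Schwarz_norm:
  assumes "f \<in> L2" "g \<in> L2"
  shows "(LINT x|\<mu>. norm (f x) * norm (g x)) \<le> L2_norm f * L2_norm g"
proof (cases "L2_norm f = 0 \<or> L2_norm g = 0")
  case True
  then have "AE x in \<mu>. norm (f x) * norm (g x) = 0"
    using assms by (auto simp: L2_norm_eq_0_iff)
  then have "(LINT x|\<mu>. norm (f x) * norm (g x)) = 0"
    by (rule integral_eq_zero_AE)
  then show ?thesis by simp
next
  case False
  define a b where "a = L2_norm f" "b = L2_norm g"
  have ab: "a > 0" "b > 0" using False unfolding a_b_def by (auto simp: less_le)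
  have "(LINT x|\<mu>. norm (f x) * norm (g x))
      \<le> (LINT x|\<mu>. (b / (2*a)) * (norm (f x))\<^sup>2 + (a / (2*b)) * (norm (g x))\<^sup>2)"
  proof (rule integral_mono[OF L2_norm_product_integrable[OF assms]])
    show "integrable \<mu> (\<lambda>x. (b / (2*a)) * (norm (f x))\<^sup>2 + (a / (2*b)) * (norm (g x))\<^sup>2)"
      using assms by (intro Bochner_Integration.integrable_add integrable_mult_right) auto
    fix x
    have "0 \<le> (b * norm (f x) - a * norm (g x))\<^sup>2 / (2 * a * b)" using ab by simp
    also have "\<dots> = (b / (2*a)) * (norm (f x))\<^sup>2 + (a / (2*b)) * (norm (g x))\<^sup>2
        - norm (f x) * norm (g x)"
      using ab by (simp add: field_simps power2_eq_square)
    finally show "norm (f x) * norm (g x)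
      \<le> (b / (2*a)) * (norm (f x))\<^sup>2 + (a / (2*b)) * (norm (g x))\<^sup>2" by simp
  qed
  also have "\<dots> = (b / (2*a)) * a\<^sup>2 + (a / (2*b)) * b\<^sup>2"
    using assms unfolding a_b_def L2_norm_sq by simp
  also have "\<dots> = a * b" using ab by (simp add: field_simps power2_eq_square)
  finally show ?thesis by (simp add: a_b_def)
qed

lemma L2_Cauchy_Schwarz_dominated:
  fixes h :: "real \<Rightarrow> 'b::{banach, second_countable_topology}"
  assumes "f \<in> L2" "g \<in> L2" "h \<in> borel_measurable \<mu>"
    and "AE x in \<mu>. norm (h x) \<le> norm (f x) * norm (g x)"
  shows "integrable \<mu> h" "norm (LINT x|\<mu>. h x) \<le> L2_norm f * L2_norm g"
proof -
  note i = L2_norm_product_integrable[OF assms(1,2)]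
  show "integrable \<mu> h"
    by (rule Bochner_Integration.integrable_bound[OF i]) (use assms in auto)
  then have "norm (LINT x|\<mu>. h x) \<le> (LINT x|\<mu>. norm (f x) * norm (g x))"
    using i assms by (intro order_trans[OF integral_norm_bound] integral_mono_AE) auto
  also have "\<dots> \<le> L2_norm f * L2_norm g" by (rule L2_Cauchy_Schwarz_norm[OF assms(1,2)])
  finally show "norm (LINT x|\<mu>. h x) \<le> L2_norm f * L2_norm g" .
qed

lemma L2_mult_integrable:
  fixes f g :: "real \<Rightarrow> 'a::{euclidean_space, real_normed_algebra}"
  assumes "f \<in> L2" "g \<in> L2"
  shows "integrable \<mu> (\<lambda>x. f x * g x)"
  by (rule L2_Cauchy_Schwarz_dominated[OF assms])
    (use L2_D(1)[OF assms(1)] L2_D(1)[OF assms(2)] in \<open>auto intro: norm_mult_ineq\<close>)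

lemma L2_Cauchy_Schwarz:
  fixes f g :: "real \<Rightarrow> 'a::{euclidean_space, real_normed_algebra}"
  assumes "f \<in> L2" "g \<in> L2"
  shows "norm (LINT x|\<mu>. f x * g x) \<le> L2_norm f * L2_norm g"
  by (rule L2_Cauchy_Schwarz_dominated[OF assms])
    (use L2_D(1)[OF assms(1)] L2_D(1)[OF assms(2)] in \<open>auto intro: norm_mult_ineq\<close>)

lemma L2_scaleR_integrable:
  assumes "f \<in> L2" "g \<in> L2"
  shows "integrable \<mu> (\<lambda>x. f x *\<^sub>R g x)"
  by (rule L2_Cauchy_Schwarz_dominated[OF assms])
    (use L2_D(1)[OF assms(1)] L2_D(1)[OF assms(2)] in auto)

lemma L2_Cauchy_Schwarz_scaleR:
  assumes "f \<in> L2" "g \<in> L2"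
  shows "norm (LINT x|\<mu>. f x *\<^sub>R g x) \<le> L2_norm f * L2_norm g"
  by (rule L2_Cauchy_Schwarz_dominated[OF assms])
    (use L2_D(1)[OF assms(1)] L2_D(1)[OF assms(2)] in auto)

lemma bounded_in_L2:
  assumes "f \<in> borel_measurable \<mu>" "AE x in \<mu>. norm (f x) \<le> B"
  shows "f \<in> L2" "L2_norm f \<le> \<bar>B\<bar> * sqrt pi"
proof -
  have one: "(\<lambda>_. 1::real) \<in> L2" by (simp add: L2_def del: L2_D)
  have n: "L2_norm (\<lambda>_. 1::real) = sqrt pi" using measure_\<mu>_space by (simp add: L2_norm_def)
  show "f \<in> L2" "L2_norm f \<le> \<bar>B\<bar> * sqrt pi"
    using L2_dominated[OF one assms(1), of B] assms(2) n by auto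
qed

lemma L2_const [simp]: "(\<lambda>_. c) \<in> L2"
  by (rule bounded_in_L2[where B="norm c"]) auto

lemma L2_integrable:
  assumes "f \<in> L2" shows "integrable \<mu> f"
  using L2_scaleR_integrable[of "\<lambda>_. 1" f] assms by simp

lemma L2_integral_norm_le:
  assumes "f \<in> L2" shows "(LINT x|\<mu>. norm (f x)) \<le> sqrt pi * L2_norm f"
proof -
  have "L2_norm (\<lambda>_. 1::real) = sqrt pi" using measure_\<mu>_space by (simp add: L2_norm_def)
  then show ?thesis using L2_Cauchy_Schwarz_norm[of "\<lambda>_. 1::real" f] assms by simp
qed

lemma L2_add:
  assumes "f \<in> L2" "g \<in> L2"
  shows "(\<lambda>x. f x + g x) \<in> L2" "L2_norm (\<lambda>x. f x + g x) \<le> L2_norm f + L2_norm g"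
proof -
  have m: "(\<lambda>x. f x + g x) \<in> borel_measurable \<mu>" using assms by simp
  have b: "(norm (f x + g x))\<^sup>2 \<le> (norm (f x))\<^sup>2 + 2 * (norm (f x) * norm (g x)) + (norm (g x))\<^sup>2" for x
  proof -
    have "(norm (f x + g x))\<^sup>2 \<le> (norm (f x) + norm (g x))\<^sup>2"
      by (intro power_mono norm_triangle_ineq) auto
    then show ?thesis by (simp add: power2_sum)
  qed
  have i: "integrable \<mu> (\<lambda>x. (norm (f x))\<^sup>2 + 2 * (norm (f x) * norm (g x)) + (norm (g x))\<^sup>2)"
    using assms L2_norm_product_integrable[OF assms] by simp
  have i': "integrable \<mu> (\<lambda>x. (norm (f x + g x))\<^sup>2)"
    by (rule Bochner_Integration.integrable_bound[OF i]) (use m b in auto)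
  then show "(\<lambda>x. f x + g x) \<in> L2" using m by (simp add: L2_def del: L2_D)
  have "(L2_norm (\<lambda>x. f x + g x))\<^sup>2
      \<le> (LINT x|\<mu>. (norm (f x))\<^sup>2 + 2 * (norm (f x) * norm (g x)) + (norm (g x))\<^sup>2)"
    unfolding L2_norm_sq by (rule integral_mono[OF i' i b])
  also have "\<dots> = (L2_norm f)\<^sup>2 + 2 * (LINT x|\<mu>. norm (f x) * norm (g x)) + (L2_norm g)\<^sup>2"
    unfolding L2_norm_sq using assms L2_norm_product_integrable[OF assms] by simp
  also have "\<dots> \<le> (L2_norm f + L2_norm g)\<^sup>2"
    using L2_Cauchy_Schwarz_norm[OF assms] by (simp add: power2_sum)
  finally show "L2_norm (\<lambda>x. f x + g x) \<le> L2_norm f + L2_norm g"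
    by (rule power2_le_imp_le) simp
qed

lemma L2_bounded_linear:
  assumes "bounded_linear T" "f \<in> L2"
  shows "(\<lambda>x. T (f x)) \<in> L2"
proof -
  obtain C where C: "\<And>x. norm (T x) \<le> C * norm x"
    using bounded_linear.bounded[OF assms(1)] by (auto simp: mult.commute)
  have "T \<in> borel_measurable borel"
    by (intro borel_measurable_continuous_onI linear_continuous_on assms)
  then have "(\<lambda>x. T (f x)) \<in> borel_measurable \<mu>"
    using L2_D(1)[OF assms(2)] by (rule measurable_compose[rotated])
  then show ?thesis using L2_dominated(1)[OF assms(2), where C=C] C by auto
qed

lemma L2_scaleR: "f \<in> L2 \<Longrightarrow> (\<lambda>x. c *\<^sub>R f x) \<in> L2"
  by (rule L2_bounded_linear[OF bounded_linear_scaleR_right])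

lemma L2_cmult:
  fixes f :: "real \<Rightarrow> 'a::{euclidean_space, real_normed_algebra}"
  shows "f \<in> L2 \<Longrightarrow> (\<lambda>x. c * f x) \<in> L2"
  by (rule L2_bounded_linear[OF bounded_linear_mult_right])

lemma L2_uminus: "f \<in> L2 \<Longrightarrow> (\<lambda>x. - f x) \<in> L2"
  using L2_scaleR[of f "-1"] by simp

lemma L2_norm_uminus [simp]: "L2_norm (\<lambda>x. - f x) = L2_norm f"
  by (simp add: L2_norm_def)

lemma L2_norm_commute: "L2_norm (\<lambda>x. f x - g x) = L2_norm (\<lambda>x. g x - f x)"
  by (simp add: L2_norm_def norm_minus_commute)

lemma L2_norm_scaleR: "L2_norm (\<lambda>x. c *\<^sub>R f x) = \<bar>c\<bar> * L2_norm f"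
  by (simp add: L2_norm_def power_mult_distrib real_sqrt_mult)

lemma L2_norm_cmult:
  fixes f :: "real \<Rightarrow> 'a::{euclidean_space, real_normed_div_algebra}"
  shows "L2_norm (\<lambda>x. c * f x) = norm c * L2_norm f"
  by (simp add: L2_norm_def power_mult_distrib real_sqrt_mult norm_mult)

lemma L2_diff:
  assumes "f \<in> L2" "g \<in> L2"
  shows "(\<lambda>x. f x - g x) \<in> L2" "L2_norm (\<lambda>x. f x - g x) \<le> L2_norm f + L2_norm g"
  using L2_add[OF assms(1) L2_uminus[OF assms(2)]] by simp_all

lemma L2_sum:
  assumes "\<And>i. i \<in> I \<Longrightarrow> f i \<in> L2"
  shows "(\<lambda>x. \<Sum>i\<in>I. f i x) \<in> L2"
  using assms by (induction I rule: infinite_finite_induct) (auto intro: L2_add)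

lemma L2_norm_triangle:
  assumes "f \<in> L2" "g \<in> L2" "h \<in> L2"
  shows "L2_norm (\<lambda>x. f x - h x) \<le> L2_norm (\<lambda>x. f x - g x) + L2_norm (\<lambda>x. g x - h x)"
  using L2_add(2)[OF L2_diff(1)[OF assms(1,2)] L2_diff(1)[OF assms(2,3)]] by simp

lemma L2_pairing_tendsto:
  fixes h :: "real \<Rightarrow> 'a::{euclidean_space, real_normed_algebra}"
  assumes "\<And>n. F n \<in> L2" "G \<in> L2" "(\<lambda>n. L2_norm (\<lambda>x. F n x - G x)) \<longlonglongrightarrow> 0" "h \<in> L2"
  shows "(\<lambda>n. LINT x|\<mu>. F n x * h x) \<longlonglongrightarrow> (LINT x|\<mu>. G x * h x)"
proof (rule LIM_zero_cancel, rule Lim_null_comparison)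
  show "(\<lambda>n. L2_norm (\<lambda>x. F n x - G x) * L2_norm h) \<longlonglongrightarrow> 0"
    using tendsto_mult_left_zero[OF assms(3)] by simp
  have "(LINT x|\<mu>. F n x * h x) - (LINT x|\<mu>. G x * h x) = (LINT x|\<mu>. (F n x - G x) * h x)" for n
    using L2_mult_integrable[OF assms(1,4)] L2_mult_integrable[OF assms(2,4)]
    by (simp add: left_diff_distrib)
  then show "\<forall>\<^sub>F n in sequentially. norm ((LINT x|\<mu>. F n x * h x) - (LINT x|\<mu>. G x * h x))
      \<le> L2_norm (\<lambda>x. F n x - G x) * L2_norm h"
    using L2_Cauchy_Schwarz[OF L2_diff(1)[OF assms(1,2)] assms(4)] by auto
qed

text \<open>Completeness: along a fast subsequence the increments are summable almost everywhere, and the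
  pointwise limit is the norm limit by Fatou's lemma.\<close>

lemma L2_complete:
  fixes F :: "nat \<Rightarrow> real \<Rightarrow> 'a::euclidean_space"
  assumes F: "\<And>n. F n \<in> L2"
    and cauchy: "\<And>e. e > 0 \<Longrightarrow> \<exists>N. \<forall>m\<ge>N. \<forall>n\<ge>N. L2_norm (\<lambda>x. F m x - F n x) < e"
  obtains G where "G \<in> L2" "(\<lambda>n. L2_norm (\<lambda>x. F n x - G x)) \<longlonglongrightarrow> 0"
proof -
  have "\<forall>k. \<exists>N. \<forall>m\<ge>N. \<forall>n\<ge>N. L2_norm (\<lambda>x. F m x - F n x) < (1/2)^k"
    using cauchy by simp
  then obtain N where N: "\<And>k m n. m \<ge> N k \<Longrightarrow> n \<ge> N k \<Longrightarrow> L2_norm (\<lambda>x. F m x - F n x) < (1/2)^k"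
    by metis
  define r where "r k = (\<Sum>j\<le>k. N j)" for k
  have r1: "r k \<ge> N k" for k unfolding r_def by (rule member_le_sum) auto
  have r2: "r (Suc k) \<ge> r k" for k by (simp add: r_def)
  define d where "d k x = F (r (Suc k)) x - F (r k) x" for k x
  have [measurable]: "\<And>n. F n \<in> borel_measurable \<mu>" using F by simp
  have dL: "d k \<in> L2" for k unfolding d_def by (intro L2_diff F)
  have [measurable]: "\<And>n. d n \<in> borel_measurable \<mu>" using dL by simp
  have dn: "L2_norm (d k) \<le> (1/2)^k" for k
    unfolding d_def using N[of k "r (Suc k)" "r k"] r1[of k] r2[of k] by simp
  have "(\<integral>\<^sup>+x. (\<Sum>k. ennreal (norm (d k x))) \<partial>\<mu>) = (\<Sum>k. \<integral>\<^sup>+x. ennreal (norm (d k x)) \<partial>\<mu>)"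
    by (rule nn_integral_suminf) simp
  also have "\<dots> = (\<Sum>k. ennreal (LINT x|\<mu>. norm (d k x)))"
    by (intro suminf_cong nn_integral_eq_integral integrable_norm L2_integrable dL) auto
  also have "\<dots> \<le> (\<Sum>k. ennreal (sqrt pi * (1/2)^k))"
  proof (intro suminf_le summableI ennreal_leI)
    fix k show "(LINT x|\<mu>. norm (d k x)) \<le> sqrt pi * (1/2)^k"
      by (rule order_trans[OF L2_integral_norm_le[OF dL] mult_left_mono[OF dn]]) simp
  qed
  also have "\<dots> = ennreal (\<Sum>k. sqrt pi * (1/2)^k)"
    by (intro suminf_ennreal2 summable_mult summable_geometric) auto
  finally have "(\<integral>\<^sup>+x. (\<Sum>k. ennreal (norm (d k x))) \<partial>\<mu>) \<noteq> \<infinity>"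
    by (auto simp: top_unique)
  then have "AE x in \<mu>. (\<Sum>k. ennreal (norm (d k x))) \<noteq> \<infinity>"
    by (intro nn_integral_PInf_AE) auto
  then have conv: "AE x in \<mu>. convergent (\<lambda>k. F (r k) x)"
  proof (rule AE_mp, intro AE_I2 impI)
    fix x assume "(\<Sum>k. ennreal (norm (d k x))) \<noteq> \<infinity>"
    then have "summable (\<lambda>k. norm (d k x))" by (intro summable_suminf_not_top) auto
    then have "summable (\<lambda>k. d k x)" by (rule summable_norm_cancel)
    then have "convergent (\<lambda>n. \<Sum>k<n. d k x)" by (simp add: summable_iff_convergent)
    moreover have "(\<Sum>k<n. d k x) = F (r n) x - F (r 0) x" for n
      unfolding d_def by (rule sum_lessThan_telescope)
    ultimately have "convergent (\<lambda>n. (F (r n) x - F (r 0) x) + F (r 0) x)"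
      by (intro convergent_add convergent_const) simp
    then show "convergent (\<lambda>k. F (r k) x)" by simp
  qed
  define G where "G x = lim (\<lambda>k. F (r k) x)" for x
  have [measurable]: "G \<in> borel_measurable \<mu>"
    unfolding G_def by (rule borel_measurable_lim_metric) simp
  have G: "AE x in \<mu>. (\<lambda>k. F (r k) x) \<longlonglongrightarrow> G x"
    using conv unfolding G_def by (simp add: convergent_LIMSEQ_iff)
  have bound: "(\<integral>\<^sup>+x. ennreal ((norm (F n x - G x))\<^sup>2) \<partial>\<mu>) \<le> ennreal (((1/2)^k)\<^sup>2)" if "n \<ge> r k" for n k
  proof -
    have "(\<integral>\<^sup>+x. ennreal ((norm (F n x - G x))\<^sup>2) \<partial>\<mu>)
        = (\<integral>\<^sup>+x. liminf (\<lambda>j. ennreal ((norm (F n x - F (r j) x))\<^sup>2)) \<partial>\<mu>)"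
    proof (rule nn_integral_cong_AE, use G in \<open>rule AE_mp\<close>, intro AE_I2 impI)
      fix x assume "(\<lambda>k. F (r k) x) \<longlonglongrightarrow> G x"
      then have "(\<lambda>j. ennreal ((norm (F n x - F (r j) x))\<^sup>2)) \<longlonglongrightarrow> ennreal ((norm (F n x - G x))\<^sup>2)"
        by (intro tendsto_intros)
      then show "ennreal ((norm (F n x - G x))\<^sup>2) = liminf (\<lambda>j. ennreal ((norm (F n x - F (r j) x))\<^sup>2))"
        by (rule lim_imp_Liminf[OF trivial_limit_sequentially, symmetric])
    qed
    also have "\<dots> \<le> liminf (\<lambda>j. \<integral>\<^sup>+x. ennreal ((norm (F n x - F (r j) x))\<^sup>2) \<partial>\<mu>)"
      by (rule nn_integral_liminf) simp
    also have "\<dots> \<le> ennreal (((1/2)^k)\<^sup>2)"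
    proof (rule order_trans[OF Liminf_le_Limsup[OF trivial_limit_sequentially]])
      show "limsup (\<lambda>j. \<integral>\<^sup>+x. ennreal ((norm (F n x - F (r j) x))\<^sup>2) \<partial>\<mu>) \<le> ennreal (((1/2)^k)\<^sup>2)"
      proof (rule Limsup_bounded, rule eventually_sequentiallyI[of k])
        fix j assume "k \<le> j"
        then have "r j \<ge> r k" using lift_Suc_mono_le[of r, OF r2] by blast
        then have "L2_norm (\<lambda>x. F n x - F (r j) x) < (1/2)^k"
          using N[of k n "r j"] r1[of k] that by simp
        then have "(L2_norm (\<lambda>x. F n x - F (r j) x))\<^sup>2 \<le> ((1/2)^k)\<^sup>2" by (intro power_mono) auto
        then show "(\<integral>\<^sup>+x. ennreal ((norm (F n x - F (r j) x))\<^sup>2) \<partial>\<mu>) \<le> ennreal (((1/2)^k)\<^sup>2)"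
          unfolding L2_norm_sq
          using nn_integral_eq_integral[OF L2_D(2)[OF L2_diff(1)[OF F F]], of n "r j"]
          by (simp only: zero_le_power2 AE_I2 ennreal_leI)
      qed
    qed
    finally show ?thesis .
  qed
  have FG: "(\<lambda>x. F n x - G x) \<in> L2 \<and> L2_norm (\<lambda>x. F n x - G x) \<le> (1/2)^k" if "n \<ge> r k" for n k
  proof -
    have i: "integrable \<mu> (\<lambda>x. (norm (F n x - G x))\<^sup>2)"
      by (rule integrableI_bounded) (use bound[OF that] in \<open>auto simp: top_unique less_top[symmetric]\<close>)
    have "ennreal ((L2_norm (\<lambda>x. F n x - G x))\<^sup>2) \<le> ennreal (((1/2)^k)\<^sup>2)"
      unfolding L2_norm_sq using bound[OF that] i by (subst (asm) nn_integral_eq_integral) auto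
    then have "(L2_norm (\<lambda>x. F n x - G x))\<^sup>2 \<le> ((1/2)^k)\<^sup>2" by simp
    then have "L2_norm (\<lambda>x. F n x - G x) \<le> (1/2)^k" by (rule power2_le_imp_le) simp
    with i show ?thesis by (simp add: L2_def del: L2_D)
  qed
  show ?thesis
  proof
    have "(\<lambda>x. F (r 0) x - (F (r 0) x - G x)) \<in> L2" using L2_diff(1)[OF F] FG[of 0 "r 0"] by blast
    then show "G \<in> L2" by simp
    show "(\<lambda>n. L2_norm (\<lambda>x. F n x - G x)) \<longlonglongrightarrow> 0"
    proof (rule LIMSEQ_I)
      fix e :: real assume "e > 0"
      then obtain k where "(1/2)^k < e" using real_arch_pow_inv[of e "1/2"] by auto
      then show "\<exists>no. \<forall>n\<ge>no. norm (L2_norm (\<lambda>x. F n x - G x) - 0) < e"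
        using FG[of k] by (intro exI[of _ "r k"]) force
    qed
  qed
qed

section \<open>Smooth bumps and test functions\<close>

text \<open>The functions P(1/x) exp(-1/x), extended by 0 to x \<le> 0, are closed under differentiation, which
  makes them smooth.\<close>

definition flat :: "real poly \<Rightarrow> real \<Rightarrow> real" where
  "flat P x = (if x > 0 then poly P (1 / x) * exp (- (1 / x)) else 0)"

lemma poly_mult_exp_minus_tendsto_0: "((\<lambda>y. poly Q y * exp (- y)) \<longlongrightarrow> (0::real)) at_top"
proof -
  have "((\<lambda>y. \<Sum>i\<le>degree Q. coeff Q i * (y ^ i / exp y)) \<longlongrightarrow> (\<Sum>i\<le>degree Q. coeff Q i * 0)) at_top"
    by (intro tendsto_sum tendsto_mult tendsto_const tendsto_power_div_exp_0)
  then show ?thesis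
    by (simp add: poly_altdef exp_minus sum_distrib_right divide_inverse mult.assoc)
qed

lemma flat_has_real_derivative:
  "(flat P has_real_derivative flat ([:0, 0, 1:] * (P - pderiv P)) x) (at x)"
proof (cases x "0::real" rule: linorder_cases)
  case less
  have "((\<lambda>_. 0) has_real_derivative 0) (at x)" by simp
  then have "(flat P has_real_derivative 0) (at x)"
  proof (rule has_field_derivative_transform_within_open[where S="{..<0}"])
    fix y :: real assume "y \<in> {..<0}" then show "0 = flat P y" by (simp add: flat_def)
  qed (use less in auto)
  then show ?thesis using less by (simp add: flat_def)
next
  case equal
  have "((\<lambda>h. flat P h / h) \<longlongrightarrow> 0) (at_right 0)"
  proof -
    have "((\<lambda>h. poly (pCons 0 P) (inverse h) * exp (- inverse h)) \<longlongrightarrow> 0) (at_right (0::real))"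
      by (rule filterlim_compose[OF poly_mult_exp_minus_tendsto_0 filterlim_inverse_at_top_right])
    then show ?thesis
      by (rule Lim_transform_eventually)
        (auto simp: flat_def eventually_at_filter field_simps)
  qed
  moreover have "((\<lambda>h. flat P h / h) \<longlongrightarrow> 0) (at_left 0)"
    by (rule tendsto_eventually) (auto simp: flat_def eventually_at_filter)
  ultimately have "((\<lambda>h. flat P h / h) \<longlongrightarrow> 0) (at 0)"
    by (simp add: filterlim_at_split)
  then show ?thesis unfolding equal by (simp add: DERIV_def flat_def)
next
  case greater
  have inv: "((\<lambda>x. 1 / x) has_real_derivative - (1 / x\<^sup>2)) (at x)"
    using DERIV_inverse[of x UNIV] greater by (simp add: inverse_eq_divide power2_eq_square)
  have "((\<lambda>x. poly P (1 / x) * exp (- (1 / x))) has_real_derivative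
      (poly (pderiv P) (1 / x) * - (1 / x\<^sup>2)) * exp (- (1 / x)) +
      (exp (- (1 / x)) * - (- (1 / x\<^sup>2))) * poly P (1 / x)) (at x)"
    by (intro DERIV_mult DERIV_chain2[OF poly_DERIV inv] DERIV_chain2[OF DERIV_exp DERIV_minus[OF inv]])
  also have "(poly (pderiv P) (1 / x) * - (1 / x\<^sup>2)) * exp (- (1 / x)) +
      (exp (- (1 / x)) * - (- (1 / x\<^sup>2))) * poly P (1 / x) = flat ([:0, 0, 1:] * (P - pderiv P)) x"
    using greater by (simp add: flat_def field_simps power2_eq_square)
  finally have "((\<lambda>x. poly P (1 / x) * exp (- (1 / x))) has_real_derivative
      flat ([:0, 0, 1:] * (P - pderiv P)) x) (at x)" .
  then show ?thesis
    by (rule has_field_derivative_transform_within_open[where S="{0<..}"])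
      (use greater in \<open>auto simp: flat_def\<close>)
qed

text \<open>A class of functions supported in an interval that contains the cutoffs and, by closure under sums,
  the derivatives of its members.\<close>

inductive bump :: "real \<Rightarrow> real \<Rightarrow> (real \<Rightarrow> real) \<Rightarrow> bool" for a b where
  prod: "c > 0 \<Longrightarrow> bump a b (\<lambda>x. flat P (c * (x - a)) * flat Q (c * (b - x)))"
| sum: "bump a b \<phi> \<Longrightarrow> bump a b \<psi> \<Longrightarrow> bump a b (\<lambda>x. \<phi> x + \<psi> x)"

lemma bump_deriv:
  "bump a b \<phi> \<Longrightarrow> \<exists>\<psi>. bump a b \<psi> \<and> (\<forall>x. (\<phi> has_real_derivative \<psi> x) (at x))"
proof (induction rule: bump.induct)
  case (prod c P Q)
  define D where "D R = [:0, 0, 1:] * (R - pderiv R)" for R :: "real poly"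
  have sm: "flat (smult k R) y = k * flat R y" for k R y by (simp add: flat_def)
  have d: "(flat R has_real_derivative flat (D R) y) (at y)" for R y
    unfolding D_def by (rule flat_has_real_derivative)
  define \<psi> where "\<psi> x = flat (smult c (D P)) (c * (x - a)) * flat Q (c * (b - x)) +
     flat P (c * (x - a)) * flat (smult (- c) (D Q)) (c * (b - x))" for x
  have "bump a b \<psi>" unfolding \<psi>_def by (intro bump.intros prod)
  moreover have "((\<lambda>x. flat P (c * (x - a)) * flat Q (c * (b - x))) has_real_derivative \<psi> x) (at x)" for x
    unfolding \<psi>_def sm
    by (rule derivative_eq_intros refl d[THEN DERIV_chain2] | simp)+
  ultimately show ?case by blast
next
  case (sum \<phi> \<psi>)
  then obtain \<phi>' \<psi>' where "bump a b \<phi>'" "bump a b \<psi>'"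
    and d: "\<And>x. (\<phi> has_real_derivative \<phi>' x) (at x)" "\<And>x. (\<psi> has_real_derivative \<psi>' x) (at x)"
    by auto
  then show ?case
    by (intro exI[of _ "\<lambda>x. \<phi>' x + \<psi>' x"] conjI bump.intros allI DERIV_add) auto
qed

lemma bump_outside: "bump a b \<phi> \<Longrightarrow> x \<notin> {a<..<b} \<Longrightarrow> \<phi> x = 0"
proof (induction rule: bump.induct)
  case (prod c P Q)
  then have "c * (x - a) \<le> 0 \<or> c * (b - x) \<le> 0"
    by (auto simp: mult_le_0_iff)
  then show ?case by (auto simp: flat_def)
qed auto

lemma bump_test_function:
  assumes "bump a b \<phi>" "0 < a" "b < pi"
  shows "\<phi> \<in> test_functions"
proof -
  have "\<exists>D. \<forall>n::nat. (bump a b (D n) \<and> (n = 0 \<longrightarrow> D n = \<phi>)) \<and>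
      (\<forall>x. (D n has_vector_derivative D (Suc n) x) (at x))"
  proof (rule dependent_nat_choice)
    show "\<exists>\<psi>. bump a b \<psi> \<and> ((0::nat) = 0 \<longrightarrow> \<psi> = \<phi>)" using assms by auto
    fix \<psi> and n :: nat
    assume "bump a b \<psi> \<and> (n = 0 \<longrightarrow> \<psi> = \<phi>)"
    then show "\<exists>\<zeta>. (bump a b \<zeta> \<and> (Suc n = 0 \<longrightarrow> \<zeta> = \<phi>)) \<and>
        (\<forall>x. (\<psi> has_vector_derivative \<zeta> x) (at x))"
      using bump_deriv[of a b \<psi>] by (simp add: has_real_derivative_iff_has_vector_derivative)
  qed
  moreover have "\<forall>x. x \<notin> {a..b} \<longrightarrow> \<phi> x = 0" using bump_outside[OF assms(1)] by auto
  ultimately show ?thesis using assms(2,3) unfolding test_functions_def by blast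
qed

definition cutoff :: "real \<Rightarrow> real \<Rightarrow> real \<Rightarrow> real \<Rightarrow> real" where
  "cutoff c a b x = flat 1 (c * (x - a)) * flat 1 (c * (b - x))"

lemma flat_1_bounds: "0 \<le> flat 1 x" "flat 1 x \<le> 1"
  by (auto simp: flat_def)

lemma cutoff_bounds: "0 \<le> cutoff c a b x" "cutoff c a b x \<le> 1"
  unfolding cutoff_def using flat_1_bounds by (auto intro: mult_le_one)

lemma cutoff_bump: "c > 0 \<Longrightarrow> bump a b (cutoff c a b)"
  unfolding cutoff_def[abs_def] by (rule bump.prod)

lemma cutoff_pos: "c > 0 \<Longrightarrow> a < x \<Longrightarrow> x < b \<Longrightarrow> cutoff c a b x > 0"
  by (simp add: cutoff_def flat_def)

text \<open>Steep cutoffs lie between 0 and 1 and converge to the indicator at every point, so dominated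
  convergence carries statements about test functions to intervals.\<close>

lemma cutoff_tendsto_indicator:
  "(\<lambda>n. cutoff (real (Suc n)) a b x) \<longlonglongrightarrow> indicator {a<..<b} x"
proof (cases "x \<in> {a<..<b}")
  case True
  have *: "(\<lambda>n. exp (- (1 / (real (Suc n) * y)))) \<longlonglongrightarrow> 1" if "y > 0" for y
  proof -
    have "(\<lambda>n. exp (- (inverse (real (Suc n)) * (1 / y)))) \<longlonglongrightarrow> exp (- (0 * (1 / y)))"
      by (intro tendsto_intros LIMSEQ_inverse_real_of_nat)
    then show ?thesis by (simp add: field_simps)
  qed
  have "(\<lambda>n. exp (- (1 / (real (Suc n) * (x - a)))) * exp (- (1 / (real (Suc n) * (b - x))))) \<longlonglongrightarrow> 1 * 1"
    using True by (intro tendsto_mult *) auto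
  then show ?thesis using True by (simp add: cutoff_def flat_def zero_less_mult_iff)
next
  case False
  then show ?thesis using bump_outside[OF cutoff_bump] by simp
qed

lemma test_functionsE:
  assumes "\<phi> \<in> test_functions"
  obtains \<psi> a b where "\<psi> \<in> test_functions" "\<And>x. (\<phi> has_vector_derivative \<psi> x) (at x)"
    "0 < a" "a \<le> b" "b < pi" "\<And>x. x \<notin> {a<..<b} \<Longrightarrow> \<phi> x = 0"
proof -
  from assms obtain D a b where D: "D 0 = \<phi>" "\<forall>k x. (D k has_vector_derivative D (Suc k) x) (at x)"
    and ab: "0 < a" "b < pi" "\<forall>x. x \<notin> {a..b} \<longrightarrow> \<phi> x = 0"
    unfolding test_functions_def by blast
  have D1: "D (Suc 0) x = 0" if "x \<notin> {a..b}" for x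
  proof -
    have "((\<lambda>_. 0) has_vector_derivative 0) (at x)" by simp
    then have "(\<phi> has_vector_derivative 0) (at x)"
      by (rule has_vector_derivative_transform_within_open[where S="- {a..b}"]) (use that ab in auto)
    then show ?thesis
      using D vector_derivative_at by metis
  qed
  have "D (Suc 0) \<in> test_functions"
    unfolding test_functions_def using D1 ab D by (auto intro!: exI[of _ "\<lambda>k. D (Suc k)"])
  moreover have "\<And>x. (\<phi> has_vector_derivative D (Suc 0) x) (at x)" using D by metis
  moreover have "0 < min a 1 / 2" "min a 1 / 2 \<le> (max b 1 + pi) / 2" "(max b 1 + pi) / 2 < pi"
    using ab pi_gt3 by (auto simp: min_def max_def)
  moreover have "\<phi> x = 0" if "x \<notin> {min a 1 / 2<..<(max b 1 + pi) / 2}" for x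
    using that ab pi_gt3 by (auto simp: min_def max_def split: if_splits)
  ultimately show ?thesis by (rule that)
qed

lemma LINT_eq_integral:
  fixes f :: "real \<Rightarrow> 'a::euclidean_space"
  assumes "integrable \<mu> f"
  shows "(LINT x|\<mu>. f x) = integral {0..pi} f"
  using lebesgue_integral_eq_integral[OF assms] integral_open_interval_real[of 0 pi f] by simp

lemma test_has_deriv:
  assumes "\<phi> \<in> test_functions"
  shows "(\<phi> has_vector_derivative vector_derivative \<phi> (at x)) (at x)"
  using assms vector_derivative_at by (metis test_functionsE)

lemma test_deriv_test:
  assumes "\<phi> \<in> test_functions"
  shows "(\<lambda>x. vector_derivative \<phi> (at x)) \<in> test_functions"
proof -
  obtain \<psi> where "\<psi> \<in> test_functions" "\<And>x. (\<phi> has_vector_derivative \<psi> x) (at x)"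
    using test_functionsE[OF assms] by metis
  then have "(\<lambda>x. vector_derivative \<phi> (at x)) = \<psi>" using vector_derivative_at by blast
  then show ?thesis using \<open>\<psi> \<in> test_functions\<close> by simp
qed

lemma test_continuous: "\<phi> \<in> test_functions \<Longrightarrow> continuous_on S \<phi>"
  by (rule continuous_on_vector_derivative)
    (auto intro: has_vector_derivative_at_within test_has_deriv)

lemma continuous_measurable_\<mu>:
  fixes f :: "real \<Rightarrow> 'a::euclidean_space"
  assumes "continuous_on {0<..<pi} f" shows "f \<in> borel_measurable \<mu>"
  by (rule continuous_imp_measurable_on_sets_lebesgue[OF assms]) simp

lemma test_bounded:
  assumes "\<phi> \<in> test_functions"
  obtains B where "\<And>x. norm (\<phi> x) \<le> B"
proof -
  obtain a b where ab: "\<And>x. x \<notin> {a<..<b} \<Longrightarrow> \<phi> x = 0"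
    using test_functionsE[OF assms] by metis
  have "compact (\<phi> ` {a..b})"
    by (intro compact_continuous_image test_continuous assms) auto
  then have "bounded (\<phi> ` {a..b})" by (rule compact_imp_bounded)
  then obtain B where B: "\<And>x. x \<in> {a..b} \<Longrightarrow> norm (\<phi> x) \<le> B"
    unfolding bounded_iff by blast
  have "norm (\<phi> x) \<le> max B 0" for x
    using B[of x] ab[of x] by (cases "x \<in> {a..b}") auto
  then show ?thesis by (rule that)
qed

lemma test_L2: "\<phi> \<in> test_functions \<Longrightarrow> \<phi> \<in> L2"
  by (metis bounded_in_L2(1) continuous_measurable_\<mu> test_continuous test_bounded AE_I2)

lemma test_endpoints:
  assumes "\<phi> \<in> test_functions" shows "\<phi> 0 = 0" "\<phi> pi = 0"
  using test_functionsE[OF assms] by (metis greaterThanLessThan_iff less_asym)+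

lemma test_bounded_linear:
  assumes "\<phi> \<in> test_functions" "bounded_linear T"
  shows "(\<lambda>x. T (\<phi> x)) \<in> test_functions"
    "vector_derivative (\<lambda>x. T (\<phi> x)) (at x) = T (vector_derivative \<phi> (at x))"
proof -
  obtain D a b where D: "D 0 = \<phi>" "\<forall>k x. (D k has_vector_derivative D (Suc k) x) (at x)"
    and ab: "0 < a" "b < pi" "\<forall>x. x \<notin> {a..b} \<longrightarrow> \<phi> x = 0"
    using assms(1) unfolding test_functions_def by blast
  have "\<forall>k x. ((\<lambda>x. T (D k x)) has_vector_derivative T (D (Suc k) x)) (at x)"
    using D(2) bounded_linear.has_vector_derivative[OF assms(2)] by blast
  moreover have "T 0 = 0" using assms(2) by (simp add: linear_0 bounded_linear.linear)
  ultimately show "(\<lambda>x. T (\<phi> x)) \<in> test_functions"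
    unfolding test_functions_def using D(1) ab
    by (intro CollectI conjI exI[of _ "\<lambda>k x. T (D k x)"] exI[of _ a] exI[of _ b]) auto
  show "vector_derivative (\<lambda>x. T (\<phi> x)) (at x) = T (vector_derivative \<phi> (at x))"
    by (intro vector_derivative_at bounded_linear.has_vector_derivative[OF assms(2)]
        test_has_deriv[OF assms(1)])
qed

lemma test_add:
  assumes "\<phi> \<in> test_functions" "\<psi> \<in> test_functions"
  shows "(\<lambda>x. \<phi> x + \<psi> x) \<in> test_functions"
    "vector_derivative (\<lambda>x. \<phi> x + \<psi> x) (at x) = vector_derivative \<phi> (at x) + vector_derivative \<psi> (at x)"
proof -
  obtain D a b where D: "D 0 = \<phi>" "\<forall>k x. (D k has_vector_derivative D (Suc k) x) (at x)"
    and ab: "0 < a" "b < pi" "\<forall>x. x \<notin> {a..b} \<longrightarrow> \<phi> x = 0"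
    using assms(1) unfolding test_functions_def by blast
  obtain E c d where E: "E 0 = \<psi>" "\<forall>k x. (E k has_vector_derivative E (Suc k) x) (at x)"
    and cd: "0 < c" "d < pi" "\<forall>x. x \<notin> {c..d} \<longrightarrow> \<psi> x = 0"
    using assms(2) unfolding test_functions_def by blast
  have "\<forall>k x. ((\<lambda>x. D k x + E k x) has_vector_derivative D (Suc k) x + E (Suc k) x) (at x)"
    using D(2) E(2) by (auto intro: has_vector_derivative_add)
  moreover have "\<phi> x + \<psi> x = 0" if "x \<notin> {min a c..max b d}" for x
  proof -
    have "x \<notin> {a..b}" "x \<notin> {c..d}" using that by auto
    then have "\<phi> x = 0" "\<psi> x = 0" using ab(3) cd(3) by blast+
    then show ?thesis by simp
  qed
  moreover have "0 < min a c" "max b d < pi" using ab cd by auto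
  ultimately show "(\<lambda>x. \<phi> x + \<psi> x) \<in> test_functions"
    unfolding test_functions_def using D(1) E(1)
    by (intro CollectI conjI exI[of _ "\<lambda>k x. D k x + E k x"] exI[of _ "min a c"] exI[of _ "max b d"]) auto
  show "vector_derivative (\<lambda>x. \<phi> x + \<psi> x) (at x) = vector_derivative \<phi> (at x) + vector_derivative \<psi> (at x)"
    by (intro vector_derivative_at has_vector_derivative_add test_has_deriv assms)
qed

lemma zero_test [simp]: "(\<lambda>_. 0) \<in> test_functions"
  unfolding test_functions_def
  by (auto intro!: exI[of _ "\<lambda>_ _. 0"] exI[of _ "1::real"] exI[of _ "2::real"]) (use pi_gt3 in linarith)

lemma test_integration_by_parts:
  fixes \<phi> :: "real \<Rightarrow> real" and \<psi> :: "real \<Rightarrow> 'a::euclidean_space"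
  assumes "\<phi> \<in> test_functions" "\<psi> \<in> test_functions"
  shows "(LINT x|\<mu>. vector_derivative \<phi> (at x) *\<^sub>R \<psi> x)
       = - (LINT x|\<mu>. \<phi> x *\<^sub>R vector_derivative \<psi> (at x))"
proof -
  note L = assms[THEN test_L2] assms[THEN test_deriv_test, THEN test_L2]
  have "((\<lambda>x. \<phi> x *\<^sub>R vector_derivative \<psi> (at x) + vector_derivative \<phi> (at x) *\<^sub>R \<psi> x)
      has_integral (\<phi> pi *\<^sub>R \<psi> pi - \<phi> 0 *\<^sub>R \<psi> 0)) {0..pi}"
  proof (rule fundamental_theorem_of_calculus)
    fix x assume "x \<in> {0..pi}"
    show "((\<lambda>x. \<phi> x *\<^sub>R \<psi> x) has_vector_derivative \<phi> x *\<^sub>R vector_derivative \<psi> (at x)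
        + vector_derivative \<phi> (at x) *\<^sub>R \<psi> x) (at x within {0..pi})"
      by (rule has_vector_derivative_at_within[OF has_vector_derivative_scaleR[OF
            test_has_deriv[OF assms(1), folded has_real_derivative_iff_has_vector_derivative]
            test_has_deriv[OF assms(2)]]])
  qed simp
  then have "integral {0..pi} (\<lambda>x. \<phi> x *\<^sub>R vector_derivative \<psi> (at x) + vector_derivative \<phi> (at x) *\<^sub>R \<psi> x) = 0"
    using test_endpoints[OF assms(1)] by (simp add: integral_unique)
  moreover have i: "integrable \<mu> (\<lambda>x. \<phi> x *\<^sub>R vector_derivative \<psi> (at x))"
      "integrable \<mu> (\<lambda>x. vector_derivative \<phi> (at x) *\<^sub>R \<psi> x)"
    using L by (auto intro: L2_scaleR_integrable)
  ultimately have "(LINT x|\<mu>. \<phi> x *\<^sub>R vector_derivative \<psi> (at x) + vector_derivative \<phi> (at x) *\<^sub>R \<psi> x) = 0"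
    by (subst LINT_eq_integral) auto
  then show ?thesis using i by (simp add: add_eq_0_iff)
qed

section \<open>Weak derivatives\<close>

lemma interval_indicator_measurable [simp]:
  "(\<lambda>x. indicator {c<..<d::real} x :: real) \<in> borel_measurable \<mu>"
  by (intro measurable_restrict_space1 measurable_completion) simp

text \<open>Intervals generate the Borel sets and are stable under intersection, so the integral vanishes over
  every Borel set.\<close>

lemma L2_integral_intervals_0_imp_AE_0:
  fixes h :: "real \<Rightarrow> 'a::euclidean_space"
  assumes h: "integrable \<mu> h"
    and 0: "\<And>c d. (LINT x|\<mu>. indicator {c<..<d} x *\<^sub>R h x) = 0"
  shows "AE x in \<mu>. h x = 0"
proof (rule \<mu>.density_zero[OF h])
  have int: "integrable \<mu> (\<lambda>x. indicator B x *\<^sub>R h x)" if "B \<in> sets borel" for B :: "real set"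
  proof -
    have "(\<lambda>x. indicator B x :: real) \<in> borel_measurable \<mu>"
      using that by (intro measurable_restrict_space1 measurable_completion) simp
    then show ?thesis using h
      by (intro Bochner_Integration.integrable_bound[OF h]) (auto split: split_indicator)
  qed
  have borel: "(LINT x|\<mu>. indicator B x *\<^sub>R h x) = 0" if "B \<in> sets borel" for B
  proof -
    have B: "B \<in> sigma_sets UNIV (range (\<lambda>(a, b). box a (b::real)))"
      using that by (simp add: borel_eq_box case_prod_unfold)
    have "Int_stable (range (\<lambda>(a, b). box a (b::real)))"
    proof (intro Int_stableI, safe)
      fix a b c d :: real
      show "box a b \<inter> box c d \<in> range (\<lambda>(a, b). box a b)"
        by (rule image_eqI[of _ _ "(max a c, min b d)"]) auto
    qed
    moreover have "range (\<lambda>(a, b). box a (b::real)) \<subseteq> Pow UNIV" by simp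
    ultimately show ?thesis using B
    proof (induction rule: sigma_sets_induct_disjoint)
      case (basic A) then show ?case using 0 by auto
    next
      case empty then show ?case by simp
    next
      case (compl A)
      then have A: "A \<in> sets borel" by (simp add: borel_eq_box case_prod_unfold)
      have "(LINT x|\<mu>. indicator (UNIV - A) x *\<^sub>R h x)
          = (LINT x|\<mu>. indicator {0<..<pi} x *\<^sub>R h x - indicator A x *\<^sub>R h x)"
        by (rule Bochner_Integration.integral_cong) (auto split: split_indicator)
      also have "\<dots> = 0" using compl 0 int[OF A] int[of "{0<..<pi}"] by simp
      finally show ?case .
    next
      case (union A)
      then have A: "A i \<in> sets borel" for i
        by (auto simp: borel_eq_box case_prod_unfold)
      have "(\<lambda>n. LINT x|\<mu>. indicator (\<Union>i<n. A i) x *\<^sub>R h x)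
          \<longlonglongrightarrow> (LINT x|\<mu>. indicator (\<Union>i. A i) x *\<^sub>R h x)"
      proof (rule integral_dominated_convergence[where w="\<lambda>x. norm (h x)"])
        show "(\<lambda>x. indicator (\<Union>i. A i) x *\<^sub>R h x) \<in> borel_measurable \<mu>"
          by (intro borel_measurable_integrable int) (use A in auto)
        show "(\<lambda>x. indicator (\<Union>i<n. A i) x *\<^sub>R h x) \<in> borel_measurable \<mu>" for n
          by (intro borel_measurable_integrable int) (use A in auto)
        show "AE x in \<mu>. (\<lambda>n. indicator (\<Union>i<n. A i) x *\<^sub>R h x) \<longlonglongrightarrow> indicator (\<Union>i. A i) x *\<^sub>R h x"
          by (intro AE_I2 tendsto_scaleR tendsto_const LIMSEQ_indicator_UN)
      qed (use h in \<open>auto split: split_indicator\<close>)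
      moreover have "(LINT x|\<mu>. indicator (\<Union>i<n. A i) x *\<^sub>R h x) = 0" for n
      proof (induction n)
        case (Suc n)
        have "disjnt (\<Union>i<n. A i) (A n)"
          using union(1) by (auto simp: disjnt_def disjoint_family_on_def) (metis IntI empty_iff less_irrefl)
        then have "(LINT x|\<mu>. indicator (\<Union>i<Suc n. A i) x *\<^sub>R h x)
           = (LINT x|\<mu>. indicator (\<Union>i<n. A i) x *\<^sub>R h x + indicator (A n) x *\<^sub>R h x)"
          by (intro Bochner_Integration.integral_cong)
            (auto simp: disjnt_def lessThan_Suc split: split_indicator)
        also have "\<dots> = 0"
          using Suc union int[OF A] int[of "\<Union>i<n. A i"] A by simp
        finally show ?case .
      qed simp
      ultimately show ?case using LIMSEQ_unique[OF _ tendsto_const] by simp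
    qed
  qed
  fix A assume A: "A \<in> sets \<mu>"
  then have "A \<in> sets lebesgue" by (auto simp: sets_restrict_space)
  then obtain S N N' where S: "A = S \<union> N" "N \<subseteq> N'" "N' \<in> null_sets lborel" "S \<in> sets lborel"
    by (rule sets_completionE)
  have "AE x in lebesgue. x \<notin> N'"
    using S(3) by (intro AE_not_in null_sets_completionI)
  then have "AE x in \<mu>. x \<notin> N'" by (auto simp: AE_restrict_space_iff elim: eventually_mono)
  then have "AE x in \<mu>. indicator A x *\<^sub>R h x = indicator S x *\<^sub>R h x"
    by (rule AE_mp) (use S in \<open>auto split: split_indicator\<close>)
  moreover have "(\<lambda>x. indicator A x *\<^sub>R h x) \<in> borel_measurable \<mu>"
    using h A by simp
  ultimately have "(LINT x|\<mu>. indicator A x *\<^sub>R h x) = (LINT x|\<mu>. indicator S x *\<^sub>R h x)"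
    using int[of S] S by (intro integral_cong_AE) auto
  then show "(LINT x:A|\<mu>. h x) = 0"
    using borel[of S] S by (simp add: set_lebesgue_integral_def)
qed

text \<open>The fundamental lemma of the calculus of variations: cutoffs converge boundedly to the
  indicators of intervals.\<close>

lemma fundamental_lemma:
  fixes h :: "real \<Rightarrow> 'a::euclidean_space"
  assumes h: "h \<in> L2"
    and 0: "\<And>\<phi> :: real \<Rightarrow> real. \<phi> \<in> test_functions \<Longrightarrow> (LINT x|\<mu>. \<phi> x *\<^sub>R h x) = 0"
  shows "AE x in \<mu>. h x = 0"
proof (rule L2_integral_intervals_0_imp_AE_0)
  note [measurable] = L2_D(1)[OF h]
  have inner: "(LINT x|\<mu>. indicator {c<..<d} x *\<^sub>R h x) = 0" if "0 < c" "d < pi" for c d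
  proof -
    have t: "cutoff (real (Suc n)) c d \<in> test_functions" for n
      using that by (intro bump_test_function[OF cutoff_bump]) auto
    have "(\<lambda>n. LINT x|\<mu>. cutoff (real (Suc n)) c d x *\<^sub>R h x)
        \<longlonglongrightarrow> (LINT x|\<mu>. indicator {c<..<d} x *\<^sub>R h x)"
    proof (rule integral_dominated_convergence[where w="\<lambda>x. norm (h x)"])
      show "(\<lambda>x. cutoff (real (Suc n)) c d x *\<^sub>R h x) \<in> borel_measurable \<mu>" for n
        using L2_D(1)[OF test_L2[OF t[of n]]] by simp
      show "(\<lambda>x. indicator {c<..<d} x *\<^sub>R h x) \<in> borel_measurable \<mu>"
        by (intro borel_measurable_scaleR interval_indicator_measurable L2_D(1)[OF h])
      show "AE x in \<mu>. (\<lambda>n. cutoff (real (Suc n)) c d x *\<^sub>R h x) \<longlonglongrightarrow> indicator {c<..<d} x *\<^sub>R h x"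
        by (intro AE_I2 tendsto_scaleR tendsto_const cutoff_tendsto_indicator)
      show "AE x in \<mu>. norm (cutoff (real (Suc n)) c d x *\<^sub>R h x) \<le> norm (h x)" for n
        using cutoff_bounds[of "real (Suc n)" c d]
        by (auto intro!: mult_left_le_one_le simp: abs_of_nonneg)
    qed (use L2_integrable[OF h] in simp)
    then show ?thesis using 0[OF t] LIMSEQ_unique[OF _ tendsto_const] by simp
  qed
  show "(LINT x|\<mu>. indicator {c<..<d} x *\<^sub>R h x) = 0" for c d
  proof -
    define c' d' where "c' n = max c (1 / real (Suc n))" "d' n = min d (pi - 1 / real (Suc n))" for n
    have "(\<lambda>n. LINT x|\<mu>. indicator {c' n<..<d' n} x *\<^sub>R h x)
        \<longlonglongrightarrow> (LINT x|\<mu>. indicator {c<..<d} x *\<^sub>R h x)"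
    proof (rule integral_dominated_convergence[where w="\<lambda>x. norm (h x)"])
      show "(\<lambda>x. indicator {a<..<b} x *\<^sub>R h x) \<in> borel_measurable \<mu>" for a b :: real
        by (intro borel_measurable_scaleR interval_indicator_measurable L2_D(1)[OF h])
      then show "(\<lambda>x. indicator {c' n<..<d' n} x *\<^sub>R h x) \<in> borel_measurable \<mu>" for n .
      show "AE x in \<mu>. (\<lambda>n. indicator {c' n<..<d' n} x *\<^sub>R h x) \<longlonglongrightarrow> indicator {c<..<d} x *\<^sub>R h x"
      proof (intro AE_I2 tendsto_scaleR tendsto_const)
        fix x assume x: "x \<in> space \<mu>"
        have l: "(\<lambda>n. 1 / real (Suc n)) \<longlonglongrightarrow> 0"
          using LIMSEQ_inverse_real_of_nat by (simp add: inverse_eq_divide)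
        have "\<forall>\<^sub>F n in sequentially. 1 / real (Suc n) < min x (pi - x)"
          by (rule order_tendstoD(2)[OF l]) (use x in simp)
        then have "\<forall>\<^sub>F n in sequentially.
            indicator {c' n<..<d' n} x = (indicator {c<..<d} x :: real)"
          by eventually_elim (auto simp: c'_d'_def split: split_indicator)
        then show "(\<lambda>n. indicator {c' n<..<d' n} x :: real) \<longlonglongrightarrow> indicator {c<..<d} x"
          by (rule tendsto_eventually)
      qed
    qed (use L2_integrable[OF h] in \<open>auto split: split_indicator\<close>)
    moreover have "(LINT x|\<mu>. indicator {c' n<..<d' n} x *\<^sub>R h x) = 0" for n
      by (rule inner) (auto simp: c'_d'_def less_max_iff_disj min_less_iff_disj)
    ultimately show ?thesis using LIMSEQ_unique[OF _ tendsto_const] by simp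
  qed
qed (rule L2_integrable[OF h])

text \<open>A function with some representative of its weak derivative. Keeping the derivative as an argument
  makes the class stable under the algebraic operations and limits, which a choice of representatives is
  not.\<close>

definition H1_pair :: "(real \<Rightarrow> 'a::euclidean_space) \<Rightarrow> (real \<Rightarrow> 'a) \<Rightarrow> bool" where
  "H1_pair f f' \<longleftrightarrow> f \<in> L2 \<and> f' \<in> L2 \<and> has_weak_deriv f f'"

lemma H1_pair_D: "H1_pair f f' \<Longrightarrow> f \<in> L2" "H1_pair f f' \<Longrightarrow> f' \<in> L2" "H1_pair f f' \<Longrightarrow> has_weak_deriv f f'"
  by (auto simp: H1_pair_def)

lemma H1_pair_unique:
  assumes "H1_pair f f1" "H1_pair f f2"
  shows "AE x in \<mu>. f1 x = f2 x"
proof -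
  note L = assms[THEN H1_pair_D(2)]
  have "AE x in \<mu>. f1 x - f2 x = 0"
  proof (rule fundamental_lemma[OF L2_diff(1)[OF L]])
    fix \<phi> :: "real \<Rightarrow> real" assume \<phi>: "\<phi> \<in> test_functions"
    have "(LINT x|\<mu>. \<phi> x *\<^sub>R f1 x) = (LINT x|\<mu>. \<phi> x *\<^sub>R f2 x)"
      using assms \<phi> by (auto simp: H1_pair_def has_weak_deriv_def)
    then show "(LINT x|\<mu>. \<phi> x *\<^sub>R (f1 x - f2 x)) = 0"
      using L2_scaleR_integrable[OF test_L2[OF \<phi>] L(1)] L2_scaleR_integrable[OF test_L2[OF \<phi>] L(2)]
      by (simp add: scaleR_diff_right)
  qed
  then show ?thesis by simp
qed

lemma H1_pair_weak_deriv: "H1_pair f f' \<Longrightarrow> H1_pair f (weak_deriv f)"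
  unfolding H1_pair_def weak_deriv_def
  by (auto intro: someI2_ex[where P="\<lambda>f'. f' \<in> L2 \<and> has_weak_deriv f f'"])

lemma weak_deriv_AE_eq: "H1_pair f f' \<Longrightarrow> AE x in \<mu>. weak_deriv f x = f' x"
  using H1_pair_unique[OF H1_pair_weak_deriv] by blast

lemma Hk_1_iff: "f \<in> Hk 1 \<longleftrightarrow> H1_pair f (weak_deriv f)"
proof
  assume "f \<in> Hk 1"
  then have "\<exists>f'. H1_pair f f'" by (auto simp: Hk_def H1_pair_def)
  then show "H1_pair f (weak_deriv f)" using H1_pair_weak_deriv by blast
next
  assume "H1_pair f (weak_deriv f)"
  then show "f \<in> Hk 1" unfolding Hk_def H1_pair_def
    by (intro CollectI exI[of _ "\<lambda>j. if j = 0 then f else weak_deriv f"]) auto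
qed

lemma H1_pair_Hk: "H1_pair f f' \<Longrightarrow> f \<in> Hk 1"
  using Hk_1_iff H1_pair_weak_deriv by blast

lemma has_weak_deriv_cong_AE:
  assumes "AE x in \<mu>. f x = g x" "f \<in> borel_measurable \<mu>" "g \<in> borel_measurable \<mu>"
  shows "has_weak_deriv f h \<longleftrightarrow> has_weak_deriv g h"
proof -
  have "(LINT x|\<mu>. vector_derivative \<phi> (at x) *\<^sub>R f x) = (LINT x|\<mu>. vector_derivative \<phi> (at x) *\<^sub>R g x)"
    if "\<phi> \<in> test_functions" for \<phi> :: "real \<Rightarrow> real"
    using test_L2[OF test_deriv_test[OF that], THEN L2_D(1)] assms
    by (intro integral_cong_AE borel_measurable_scaleR) auto
  then show ?thesis by (simp add: has_weak_deriv_def)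
qed

text \<open>The two chosen derivatives are equal everywhere, because they are chosen by the same predicate.\<close>

lemma weak_deriv_cong_AE:
  assumes "AE x in \<mu>. f x = g x" "f \<in> borel_measurable \<mu>" "g \<in> borel_measurable \<mu>"
  shows "weak_deriv f = weak_deriv g"
  unfolding weak_deriv_def has_weak_deriv_cong_AE[OF assms] ..

lemma Hk_ge_1_D: "f \<in> Hk m \<Longrightarrow> m \<ge> 1 \<Longrightarrow> f \<in> Hk 1"
  unfolding Hk_def by fastforce

lemma Hk_ge_2_D:
  assumes "f \<in> Hk m" "m \<ge> 2"
  shows "H1_pair f (weak_deriv f)" "H1_pair (weak_deriv f) (weak_deriv (weak_deriv f))"
proof -
  show 1: "H1_pair f (weak_deriv f)" using Hk_ge_1_D[OF assms(1)] assms(2) Hk_1_iff by auto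
  obtain D where D: "D 0 = f" "\<And>j. j \<le> m \<Longrightarrow> D j \<in> L2" "\<And>j. j < m \<Longrightarrow> has_weak_deriv (D j) (D (Suc j))"
    using assms(1) unfolding Hk_def by blast
  have "H1_pair f (D 1)" using D(2)[of 0] D(2)[of 1] D(3)[of 0] D(1) assms(2) by (auto simp: H1_pair_def)
  then have ae: "AE x in \<mu>. weak_deriv f x = D 1 x" by (rule weak_deriv_AE_eq)
  have "has_weak_deriv (weak_deriv f) (D 2)"
    using D(3)[of 1] D(2)[of 1] assms(2) has_weak_deriv_cong_AE[OF ae] 1
    by (auto simp: H1_pair_def numeral_2_eq_2)
  then have "H1_pair (weak_deriv f) (D 2)" using 1 D(2)[of 2] assms(2) by (auto simp: H1_pair_def)
  then show "H1_pair (weak_deriv f) (weak_deriv (weak_deriv f))" by (rule H1_pair_weak_deriv)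
qed

lemma Hk_norm_1: "Hk_norm 1 f = sqrt ((L2_norm f)\<^sup>2 + (L2_norm (weak_deriv f))\<^sup>2)"
  by (simp add: Hk_norm_def)

lemma Hk_norm_nonneg [simp]: "0 \<le> Hk_norm m f"
  by (simp add: Hk_norm_def sum_nonneg)

lemma Hk_norm_mono: "m \<le> n \<Longrightarrow> Hk_norm m f \<le> Hk_norm n f"
  unfolding Hk_norm_def by (intro real_sqrt_le_mono sum_mono2) auto

lemma H1_pair_norm:
  assumes "H1_pair f f'" shows "Hk_norm 1 f = sqrt ((L2_norm f)\<^sup>2 + (L2_norm f')\<^sup>2)"
proof -
  have "L2_norm (weak_deriv f) = L2_norm f'"
    using H1_pair_weak_deriv[OF assms] assms weak_deriv_AE_eq[OF assms]
    by (intro L2_norm_cong_AE) (auto simp: H1_pair_def)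
  then show ?thesis by (simp only: Hk_norm_1)
qed

lemma H1_pair_norm_bounds:
  assumes "H1_pair f f'"
  shows "L2_norm f \<le> Hk_norm 1 f" "L2_norm f' \<le> Hk_norm 1 f"
    "Hk_norm 1 f \<le> L2_norm f + L2_norm f'"
  unfolding H1_pair_norm[OF assms]
  by (auto intro: real_le_rsqrt real_le_lsqrt simp: power2_sum)

lemma Hk_norm_1_cong_AE:
  assumes "AE x in \<mu>. f x = g x" "f \<in> borel_measurable \<mu>" "g \<in> borel_measurable \<mu>"
  shows "Hk_norm 1 f = Hk_norm 1 g"
  unfolding Hk_norm_1 weak_deriv_cong_AE[OF assms] L2_norm_cong_AE[OF assms] ..

lemma H1_pair_add:
  assumes "H1_pair f f'" "H1_pair g g'"
  shows "H1_pair (\<lambda>x. f x + g x) (\<lambda>x. f' x + g' x)"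
proof -
  note L = assms[THEN H1_pair_D(1)] assms[THEN H1_pair_D(2)]
  have "has_weak_deriv (\<lambda>x. f x + g x) (\<lambda>x. f' x + g' x)"
    unfolding has_weak_deriv_def
  proof
    fix \<phi> :: "real \<Rightarrow> real" assume \<phi>: "\<phi> \<in> test_functions"
    note I = L2_scaleR_integrable[OF test_L2[OF \<phi>] L(3)] L2_scaleR_integrable[OF test_L2[OF \<phi>] L(4)]
      L2_scaleR_integrable[OF test_L2[OF test_deriv_test[OF \<phi>]] L(1)]
      L2_scaleR_integrable[OF test_L2[OF test_deriv_test[OF \<phi>]] L(2)]
    show "(LINT x|\<mu>. vector_derivative \<phi> (at x) *\<^sub>R (f x + g x)) = - (LINT x|\<mu>. \<phi> x *\<^sub>R (f' x + g' x))"
      using assms[THEN H1_pair_D(3)] \<phi> I by (simp add: has_weak_deriv_def scaleR_add_right)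
  qed
  then show ?thesis using L by (simp add: H1_pair_def L2_add)
qed

lemma H1_pair_bounded_linear:
  assumes "H1_pair f f'" "bounded_linear T"
  shows "H1_pair (\<lambda>x. T (f x)) (\<lambda>x. T (f' x))"
proof -
  note L = H1_pair_D(1,2)[OF assms(1)]
  have "has_weak_deriv (\<lambda>x. T (f x)) (\<lambda>x. T (f' x))"
    unfolding has_weak_deriv_def
  proof
    fix \<phi> :: "real \<Rightarrow> real" assume \<phi>: "\<phi> \<in> test_functions"
    note I = L2_scaleR_integrable[OF test_L2[OF \<phi>] L(2)]
      L2_scaleR_integrable[OF test_L2[OF test_deriv_test[OF \<phi>]] L(1)]
    have sc: "c *\<^sub>R T y = T (c *\<^sub>R y)" for c y
      using assms(2) by (simp add: linear_cmul bounded_linear.linear)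
    have "T (- y) = - T y" for y using sc[of "-1" y] by simp
    then show "(LINT x|\<mu>. vector_derivative \<phi> (at x) *\<^sub>R T (f x)) = - (LINT x|\<mu>. \<phi> x *\<^sub>R T (f' x))"
      using H1_pair_D(3)[OF assms(1)] \<phi>
      unfolding sc integral_bounded_linear[OF assms(2) I(1)] integral_bounded_linear[OF assms(2) I(2)]
      by (simp add: has_weak_deriv_def)
  qed
  then show ?thesis using L assms(2) by (simp add: H1_pair_def L2_bounded_linear)
qed

lemma H1_pair_scaleR: "H1_pair f f' \<Longrightarrow> H1_pair (\<lambda>x. c *\<^sub>R f x) (\<lambda>x. c *\<^sub>R f' x)"
  by (rule H1_pair_bounded_linear[OF _ bounded_linear_scaleR_right])

lemma H1_pair_diff:
  assumes "H1_pair f f'" "H1_pair g g'"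
  shows "H1_pair (\<lambda>x. f x - g x) (\<lambda>x. f' x - g' x)"
  using H1_pair_add[OF assms(1) H1_pair_scaleR[OF assms(2), of "-1"]] by simp

lemma H1_pair_zero: "H1_pair (\<lambda>_. 0) (\<lambda>_. 0)"
  by (simp add: H1_pair_def has_weak_deriv_def)

lemma L2_scaleR_pairing_tendsto:
  assumes "\<And>n. F n \<in> L2" "G \<in> L2" "(\<lambda>n. L2_norm (\<lambda>x. F n x - G x)) \<longlonglongrightarrow> 0" "h \<in> L2"
  shows "(\<lambda>n. LINT x|\<mu>. h x *\<^sub>R F n x) \<longlonglongrightarrow> (LINT x|\<mu>. h x *\<^sub>R G x)"
proof (rule LIM_zero_cancel, rule Lim_null_comparison)
  show "(\<lambda>n. L2_norm h * L2_norm (\<lambda>x. F n x - G x)) \<longlonglongrightarrow> 0"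
    using tendsto_mult_right_zero[OF assms(3)] by simp
  have "(LINT x|\<mu>. h x *\<^sub>R F n x) - (LINT x|\<mu>. h x *\<^sub>R G x) = (LINT x|\<mu>. h x *\<^sub>R (F n x - G x))" for n
    using L2_scaleR_integrable[OF assms(4,1)] L2_scaleR_integrable[OF assms(4,2)]
    by (simp add: scaleR_diff_right)
  then show "\<forall>\<^sub>F n in sequentially. norm ((LINT x|\<mu>. h x *\<^sub>R F n x) - (LINT x|\<mu>. h x *\<^sub>R G x))
      \<le> L2_norm h * L2_norm (\<lambda>x. F n x - G x)"
    using L2_Cauchy_Schwarz_scaleR[OF assms(4) L2_diff(1)[OF assms(1,2)]] by auto
qed

lemma H1_pair_limit:
  assumes F: "\<And>n. H1_pair (F n) (F' n)" and L: "f \<in> L2" "f' \<in> L2"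
    and lim: "(\<lambda>n. L2_norm (\<lambda>x. F n x - f x)) \<longlonglongrightarrow> 0" "(\<lambda>n. L2_norm (\<lambda>x. F' n x - f' x)) \<longlonglongrightarrow> 0"
  shows "H1_pair f f'"
  unfolding H1_pair_def has_weak_deriv_def
proof (intro conjI L ballI)
  fix \<phi> :: "real \<Rightarrow> real" assume \<phi>: "\<phi> \<in> test_functions"
  have "(\<lambda>n. LINT x|\<mu>. vector_derivative \<phi> (at x) *\<^sub>R F n x)
      \<longlonglongrightarrow> (LINT x|\<mu>. vector_derivative \<phi> (at x) *\<^sub>R f x)"
    by (rule L2_scaleR_pairing_tendsto[OF H1_pair_D(1)[OF F] L(1) lim(1) test_L2[OF test_deriv_test[OF \<phi>]]])
  moreover have "(LINT x|\<mu>. vector_derivative \<phi> (at x) *\<^sub>R F n x) = - (LINT x|\<mu>. \<phi> x *\<^sub>R F' n x)" for n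
    using H1_pair_D(3)[OF F] \<phi> unfolding has_weak_deriv_def by blast
  then have "(\<lambda>n. LINT x|\<mu>. vector_derivative \<phi> (at x) *\<^sub>R F n x)
      \<longlonglongrightarrow> - (LINT x|\<mu>. \<phi> x *\<^sub>R f' x)"
    using tendsto_minus[OF L2_scaleR_pairing_tendsto[OF H1_pair_D(2)[OF F] L(2) lim(2) test_L2[OF \<phi>]]] by simp
  ultimately show "(LINT x|\<mu>. vector_derivative \<phi> (at x) *\<^sub>R f x) = - (LINT x|\<mu>. \<phi> x *\<^sub>R f' x)"
    by (rule LIMSEQ_unique)
qed

section \<open>The Dirichlet boundary condition\<close>

text \<open>The counterpart of \<^term>\<open>H1_pair\<close> for \<^term>\<open>H10\<close>, with the same freedom in the representative of the
  derivative.\<close>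

definition H10_pair :: "(real \<Rightarrow> 'a::euclidean_space) \<Rightarrow> (real \<Rightarrow> 'a) \<Rightarrow> bool" where
  "H10_pair f f' \<longleftrightarrow> f \<in> L2 \<and> f' \<in> L2 \<and> (\<forall>e>0. \<exists>\<phi>\<in>test_functions.
     L2_norm (\<lambda>x. \<phi> x - f x) < e \<and> L2_norm (\<lambda>x. vector_derivative \<phi> (at x) - f' x) < e)"

lemma H10_pair_L2: "H10_pair f f' \<Longrightarrow> f \<in> L2" "H10_pair f f' \<Longrightarrow> f' \<in> L2"
  by (auto simp: H10_pair_def)

lemma null_sequence_if_less_inverse:
  fixes a :: "nat \<Rightarrow> real"
  assumes "\<And>n. 0 \<le> a n" "\<And>n. a n < inverse (real (Suc n))"
  shows "a \<longlonglongrightarrow> 0"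
  by (rule tendsto_sandwich[OF always_eventually always_eventually tendsto_const LIMSEQ_inverse_real_of_nat])
    (use assms in \<open>auto intro: less_imp_le simp del: of_nat_Suc\<close>)

lemma H10_pair_sequence:
  assumes "H10_pair f f'"
  obtains \<phi> where "\<And>n. \<phi> n \<in> test_functions" "(\<lambda>n. L2_norm (\<lambda>x. \<phi> n x - f x)) \<longlonglongrightarrow> 0"
    "(\<lambda>n. L2_norm (\<lambda>x. vector_derivative (\<phi> n) (at x) - f' x)) \<longlonglongrightarrow> 0"
proof -
  have "\<forall>n. \<exists>\<phi>\<in>test_functions. L2_norm (\<lambda>x. \<phi> x - f x) < inverse (real (Suc n)) \<and>
      L2_norm (\<lambda>x. vector_derivative \<phi> (at x) - f' x) < inverse (real (Suc n))"
    using assms unfolding H10_pair_def by simp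
  then obtain \<phi> where "\<And>n. \<phi> n \<in> test_functions"
    "\<And>n. L2_norm (\<lambda>x. \<phi> n x - f x) < inverse (real (Suc n))"
    "\<And>n. L2_norm (\<lambda>x. vector_derivative (\<phi> n) (at x) - f' x) < inverse (real (Suc n))"
    by metis
  then show ?thesis by (intro that null_sequence_if_less_inverse) auto
qed

lemma test_H1_pair: "\<phi> \<in> test_functions \<Longrightarrow> H1_pair \<phi> (\<lambda>x. vector_derivative \<phi> (at x))"
  by (auto simp: H1_pair_def has_weak_deriv_def test_L2 test_deriv_test test_integration_by_parts)

lemma H10_pair_H1: assumes "H10_pair f f'" shows "H1_pair f f'"
proof -
  obtain \<phi> where \<phi>: "\<And>n. \<phi> n \<in> test_functions" "(\<lambda>n. L2_norm (\<lambda>x. \<phi> n x - f x)) \<longlonglongrightarrow> 0"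
    "(\<lambda>n. L2_norm (\<lambda>x. vector_derivative (\<phi> n) (at x) - f' x)) \<longlonglongrightarrow> 0"
    using H10_pair_sequence[OF assms] by blast
  show ?thesis
    by (rule H1_pair_limit[OF test_H1_pair[OF \<phi>(1)] H10_pair_L2[OF assms] \<phi>(2,3)])
qed

text \<open>The weak derivative of a difference is almost everywhere the difference of the weak derivatives, so
  approximation in the Sobolev norm is approximation of the function and of its derivative.\<close>

lemma H10_iff: "f \<in> H10 \<longleftrightarrow> H10_pair f (weak_deriv f)"
proof
  assume "f \<in> H10"
  then have f: "H1_pair f (weak_deriv f)"
    and ap: "\<And>e. e > 0 \<Longrightarrow> \<exists>\<phi>\<in>test_functions. Hk_norm 1 (\<lambda>x. f x - \<phi> x) < e"
    by (auto simp: H10_def Hk_1_iff[symmetric])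
  show "H10_pair f (weak_deriv f)"
    unfolding H10_pair_def
  proof (intro conjI allI impI)
    fix e :: real assume "e > 0"
    then obtain \<phi> where \<phi>: "\<phi> \<in> test_functions" "Hk_norm 1 (\<lambda>x. f x - \<phi> x) < e" using ap by blast
    note b = H1_pair_norm_bounds[OF H1_pair_diff[OF f test_H1_pair[OF \<phi>(1)]]]
    show "\<exists>\<phi>\<in>test_functions. L2_norm (\<lambda>x. \<phi> x - f x) < e \<and>
        L2_norm (\<lambda>x. vector_derivative \<phi> (at x) - weak_deriv f x) < e"
      using b \<phi> L2_norm_commute[of \<phi> f] L2_norm_commute[of "\<lambda>x. vector_derivative \<phi> (at x)" "weak_deriv f"]
      by (intro bexI[of _ \<phi>]) auto
  qed (use f in \<open>auto simp: H1_pair_def\<close>)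
next
  assume f: "H10_pair f (weak_deriv f)"
  note f1 = H10_pair_H1[OF f]
  show "f \<in> H10"
    unfolding H10_def
  proof (intro CollectI conjI allI impI H1_pair_Hk[OF f1])
    fix e :: real assume "e > 0"
    then obtain \<phi> where \<phi>: "\<phi> \<in> test_functions" "L2_norm (\<lambda>x. \<phi> x - f x) < e / 2"
        "L2_norm (\<lambda>x. vector_derivative \<phi> (at x) - weak_deriv f x) < e / 2"
      using f unfolding H10_pair_def by (meson half_gt_zero)
    note b = H1_pair_norm_bounds[OF H1_pair_diff[OF f1 test_H1_pair[OF \<phi>(1)]]]
    show "\<exists>\<phi>\<in>test_functions. Hk_norm 1 (\<lambda>x. f x - \<phi> x) < e"
      using b \<phi> L2_norm_commute[of \<phi> f] L2_norm_commute[of "\<lambda>x. vector_derivative \<phi> (at x)" "weak_deriv f"]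
      by (intro bexI[of _ \<phi>]) auto
  qed
qed

lemma H10_pair_cong_AE:
  assumes "H10_pair f f'" "AE x in \<mu>. f x = g x" "AE x in \<mu>. f' x = g' x"
    "g \<in> borel_measurable \<mu>" "g' \<in> borel_measurable \<mu>"
  shows "H10_pair g g'"
proof -
  have L: "f \<in> L2" "f' \<in> L2" using assms(1) by (auto simp: H10_pair_def)
  then have "g \<in> L2" "g' \<in> L2" using assms L2_cong_AE by blast+
  moreover have "L2_norm (\<lambda>x. \<phi> x - f x) = L2_norm (\<lambda>x. \<phi> x - g x)"
      "L2_norm (\<lambda>x. vector_derivative \<phi> (at x) - f' x) = L2_norm (\<lambda>x. vector_derivative \<phi> (at x) - g' x)"
      if "\<phi> \<in> test_functions" for \<phi>
    using L2_D(1)[OF test_L2[OF that]] L2_D(1)[OF test_L2[OF test_deriv_test[OF that]]]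
      assms L[THEN L2_D(1)]
    by (auto intro!: L2_norm_cong_AE borel_measurable_diff)
  ultimately show ?thesis using assms(1) unfolding H10_pair_def
    by (auto simp: Bex_def cong: conj_cong)
qed

lemma H10_pairI: assumes "H10_pair f f'" shows "f \<in> H10" "AE x in \<mu>. weak_deriv f x = f' x"
proof -
  note h1 = H10_pair_H1[OF assms]
  show ae: "AE x in \<mu>. weak_deriv f x = f' x" by (rule weak_deriv_AE_eq[OF h1])
  have "AE x in \<mu>. f' x = weak_deriv f x" using ae by eventually_elim simp
  then show "f \<in> H10"
    unfolding H10_iff using H1_pair_weak_deriv[OF h1] h1
    by (intro H10_pair_cong_AE[OF assms]) (auto simp: H1_pair_def)
qed

lemma H10_pair_limit:
  assumes F: "\<And>n. H10_pair (F n) (F' n)" and L: "f \<in> L2" "f' \<in> L2"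
    and lim: "(\<lambda>n. L2_norm (\<lambda>x. F n x - f x)) \<longlonglongrightarrow> 0" "(\<lambda>n. L2_norm (\<lambda>x. F' n x - f' x)) \<longlonglongrightarrow> 0"
  shows "H10_pair f f'"
  unfolding H10_pair_def
proof (intro conjI L allI impI)
  fix e :: real assume "e > 0"
  then have "\<forall>\<^sub>F n in sequentially. L2_norm (\<lambda>x. F n x - f x) < e/2 \<and> L2_norm (\<lambda>x. F' n x - f' x) < e/2"
    by (intro eventually_conj order_tendstoD(2)[OF lim(1)] order_tendstoD(2)[OF lim(2)]) auto
  then obtain n where n: "L2_norm (\<lambda>x. F n x - f x) < e/2" "L2_norm (\<lambda>x. F' n x - f' x) < e/2"
    by (auto simp: eventually_sequentially)
  obtain \<phi> where \<phi>: "\<phi> \<in> test_functions" "L2_norm (\<lambda>x. \<phi> x - F n x) < e / 2"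
      "L2_norm (\<lambda>x. vector_derivative \<phi> (at x) - F' n x) < e / 2"
    using F[of n] \<open>e > 0\<close> unfolding H10_pair_def by (meson half_gt_zero)
  show "\<exists>\<phi>\<in>test_functions. L2_norm (\<lambda>x. \<phi> x - f x) < e \<and> L2_norm (\<lambda>x. vector_derivative \<phi> (at x) - f' x) < e"
  proof (intro bexI[of _ \<phi>] conjI \<phi>(1))
    show "L2_norm (\<lambda>x. \<phi> x - f x) < e"
      using L2_norm_triangle[OF test_L2[OF \<phi>(1)] H10_pair_L2(1)[OF F[of n]] L(1)] n \<phi> by linarith
    show "L2_norm (\<lambda>x. vector_derivative \<phi> (at x) - f' x) < e"
      using L2_norm_triangle[OF test_L2[OF test_deriv_test[OF \<phi>(1)]] H10_pair_L2(2)[OF F[of n]] L(2)] n \<phi> by linarith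
  qed
qed

lemma test_H10_pair: "\<phi> \<in> test_functions \<Longrightarrow> H10_pair \<phi> (\<lambda>x. vector_derivative \<phi> (at x))"
  unfolding H10_pair_def
  by (intro conjI allI impI bexI[of _ \<phi>]) (auto simp: test_L2 test_deriv_test L2_norm_def)

lemma H10_pair_bounded_linear:
  assumes "H10_pair f f'" "bounded_linear T"
  shows "H10_pair (\<lambda>x. T (f x)) (\<lambda>x. T (f' x))"
proof -
  obtain \<phi> where \<phi>: "\<And>n. \<phi> n \<in> test_functions" "(\<lambda>n. L2_norm (\<lambda>x. \<phi> n x - f x)) \<longlonglongrightarrow> 0"
    "(\<lambda>n. L2_norm (\<lambda>x. vector_derivative (\<phi> n) (at x) - f' x)) \<longlonglongrightarrow> 0"
    using H10_pair_sequence[OF assms(1)] by blast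
  obtain C where C: "\<And>x. norm (T x) \<le> C * norm x" "C \<ge> 0"
    using bounded_linear.nonneg_bounded[OF assms(2)] by (auto simp: mult.commute)
  have Td: "T a - T b = T (a - b)" for a b
    using assms(2) by (simp add: linear_diff bounded_linear.linear)
  have lim: "(\<lambda>n. L2_norm (\<lambda>x. T (F n x) - T (G x))) \<longlonglongrightarrow> 0"
    if "\<And>n. F n \<in> L2" "G \<in> L2" "(\<lambda>n. L2_norm (\<lambda>x. F n x - G x)) \<longlonglongrightarrow> 0" for F G
  proof (rule Lim_null_comparison)
    show "(\<lambda>n. C * L2_norm (\<lambda>x. F n x - G x)) \<longlonglongrightarrow> 0" using tendsto_mult_right_zero[OF that(3)] by simp
    have "L2_norm (\<lambda>x. T (F n x - G x)) \<le> \<bar>C\<bar> * L2_norm (\<lambda>x. F n x - G x)" for n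
      by (intro L2_dominated(2) L2_diff that L2_D(1)[OF L2_bounded_linear[OF assms(2)]] AE_I2 C)
    then show "\<forall>\<^sub>F n in sequentially. norm (L2_norm (\<lambda>x. T (F n x) - T (G x))) \<le> C * L2_norm (\<lambda>x. F n x - G x)"
      using C(2) by (simp add: Td)
  qed
  have *: "H10_pair (\<lambda>x. T (\<phi> n x)) (\<lambda>x. T (vector_derivative (\<phi> n) (at x)))" for n
    using test_H10_pair[OF test_bounded_linear(1)[OF \<phi>(1)[of n] assms(2)]]
      test_bounded_linear(2)[OF \<phi>(1)[of n] assms(2)] by simp
  show ?thesis
    by (rule H10_pair_limit[OF * L2_bounded_linear[OF assms(2) H10_pair_L2(1)[OF assms(1)]]
          L2_bounded_linear[OF assms(2) H10_pair_L2(2)[OF assms(1)]]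
          lim[OF test_L2[OF \<phi>(1)] H10_pair_L2(1)[OF assms(1)] \<phi>(2)]
          lim[OF test_L2[OF test_deriv_test[OF \<phi>(1)]] H10_pair_L2(2)[OF assms(1)] \<phi>(3)]])
qed

lemma H10_pair_add:
  assumes "H10_pair f f'" "H10_pair g g'"
  shows "H10_pair (\<lambda>x. f x + g x) (\<lambda>x. f' x + g' x)"
  unfolding H10_pair_def
proof (intro conjI allI impI)
  fix e :: real assume "e > 0"
  then obtain \<phi> where \<phi>: "\<phi> \<in> test_functions" "L2_norm (\<lambda>x. \<phi> x - f x) < e / 2"
      "L2_norm (\<lambda>x. vector_derivative \<phi> (at x) - f' x) < e / 2"
    using assms(1) unfolding H10_pair_def by (meson half_gt_zero)
  from \<open>e > 0\<close> obtain \<psi> where \<psi>: "\<psi> \<in> test_functions" "L2_norm (\<lambda>x. \<psi> x - g x) < e / 2"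
      "L2_norm (\<lambda>x. vector_derivative \<psi> (at x) - g' x) < e / 2"
    using assms(2) unfolding H10_pair_def by (meson half_gt_zero)
  note L = H10_pair_L2[OF assms(1)] H10_pair_L2[OF assms(2)] \<phi>(1)[THEN test_L2] \<psi>(1)[THEN test_L2]
    \<phi>(1)[THEN test_deriv_test, THEN test_L2] \<psi>(1)[THEN test_deriv_test, THEN test_L2]
  have "L2_norm (\<lambda>x. (\<phi> x - f x) + (\<psi> x - g x)) < e"
    using L2_add(2)[OF L2_diff(1)[OF L(5,1)] L2_diff(1)[OF L(6,3)]] \<phi> \<psi> by linarith
  moreover have "L2_norm (\<lambda>x. (vector_derivative \<phi> (at x) - f' x) + (vector_derivative \<psi> (at x) - g' x)) < e"
    using L2_add(2)[OF L2_diff(1)[OF L(7,2)] L2_diff(1)[OF L(8,4)]] \<phi> \<psi> by linarith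
  ultimately show "\<exists>\<phi>\<in>test_functions. L2_norm (\<lambda>x. \<phi> x - (f x + g x)) < e \<and>
      L2_norm (\<lambda>x. vector_derivative \<phi> (at x) - (f' x + g' x)) < e"
    by (intro bexI[of _ "\<lambda>x. \<phi> x + \<psi> x"] test_add(1) \<phi> \<psi>)
      (simp add: test_add(2)[OF \<phi>(1) \<psi>(1)] algebra_simps)
qed (use assms in \<open>auto intro: L2_add simp: H10_pair_def\<close>)

lemma H10_pair_zero: "H10_pair (\<lambda>_. 0) (\<lambda>_. 0)"
  using test_H10_pair[OF zero_test] by simp

lemma H10_pair_diff:
  assumes "H10_pair f f'" "H10_pair g g'"
  shows "H10_pair (\<lambda>x. f x - g x) (\<lambda>x. f' x - g' x)"
  using H10_pair_add[OF assms(1) H10_pair_bounded_linear[OF assms(2) bounded_linear_minus[OF bounded_linear_ident]]]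
  by simp

lemma H10_pair_cmult:
  fixes f :: "real \<Rightarrow> 'a::{euclidean_space, real_normed_algebra}"
  shows "H10_pair f f' \<Longrightarrow> H10_pair (\<lambda>x. c * f x) (\<lambda>x. c * f' x)"
  by (rule H10_pair_bounded_linear[OF _ bounded_linear_mult_right])

lemma H10_pair_sum:
  assumes "\<And>i. i \<in> I \<Longrightarrow> H10_pair (f i) (f' i)"
  shows "H10_pair (\<lambda>x. \<Sum>i\<in>I. f i x) (\<lambda>x. \<Sum>i\<in>I. f' i x)"
  using assms by (induction I rule: infinite_finite_induct) (auto intro: H10_pair_add H10_pair_zero)

text \<open>An integral over the whole space with an indicator, so that integrability, linearity and bounds are
  those of the space of square integrable functions. To the left of the interval the value is 0.\<close>

definition antideriv :: "(real \<Rightarrow> 'a::euclidean_space) \<Rightarrow> real \<Rightarrow> 'a" where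
  "antideriv v x = (LINT y|\<mu>. indicator {..x} y *\<^sub>R v y)"

lemma atMost_indicator_measurable [simp]: "(\<lambda>y. indicator {..x::real} y :: real) \<in> borel_measurable \<mu>"
  by (intro measurable_restrict_space1 measurable_completion) simp

lemma antideriv_integrable:
  fixes v :: "real \<Rightarrow> 'a::euclidean_space"
  assumes "integrable \<mu> v" shows "integrable \<mu> (\<lambda>y. indicator {..x::real} y *\<^sub>R v y)"
  by (rule Bochner_Integration.integrable_bound[OF assms])
    (use assms in \<open>auto intro!: borel_measurable_scaleR split: split_indicator\<close>)

lemma antideriv_norm_le_integral:
  assumes "integrable \<mu> v" shows "norm (antideriv v x) \<le> (LINT y|\<mu>. norm (v y))"
  unfolding antideriv_def
  by (intro order_trans[OF integral_norm_bound] integral_mono integrable_norm antideriv_integrable assms)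
    (auto split: split_indicator)

lemma antideriv_norm_le:
  assumes "v \<in> L2" shows "norm (antideriv v x) \<le> sqrt pi * L2_norm v"
  using antideriv_norm_le_integral[OF L2_integrable[OF assms]] L2_integral_norm_le[OF assms]
  by (rule order_trans)

lemma antideriv_diff:
  assumes "u \<in> L2" "v \<in> L2"
  shows "antideriv (\<lambda>x. u x - v x) x = antideriv u x - antideriv v x"
  using antideriv_integrable[OF L2_integrable[OF assms(1)]] antideriv_integrable[OF L2_integrable[OF assms(2)]]
  unfolding antideriv_def by (simp add: scaleR_diff_right)

lemma antideriv_sum:
  assumes "\<And>i. i \<in> I \<Longrightarrow> v i \<in> L2"
  shows "antideriv (\<lambda>x. \<Sum>i\<in>I. c i *\<^sub>R v i x) x = (\<Sum>i\<in>I. c i *\<^sub>R antideriv (v i) x)"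
proof -
  have "antideriv (\<lambda>x. \<Sum>i\<in>I. c i *\<^sub>R v i x) x
      = (LINT y|\<mu>. (\<Sum>i\<in>I. c i *\<^sub>R (indicator {..x} y *\<^sub>R v i y)))"
    unfolding antideriv_def by (simp add: scaleR_sum_right mult.commute)
  also have "\<dots> = (\<Sum>i\<in>I. LINT y|\<mu>. c i *\<^sub>R (indicator {..x} y *\<^sub>R v i y))"
    by (intro Bochner_Integration.integral_sum integrable_scaleR_right antideriv_integrable L2_integrable assms)
  also have "\<dots> = (\<Sum>i\<in>I. c i *\<^sub>R antideriv (v i) x)"
    unfolding antideriv_def by (intro sum.cong refl integral_scaleR_right)
  finally show ?thesis .
qed

lemma antideriv_increment:
  assumes "v \<in> L2" "a \<le> b"
  shows "antideriv v b - antideriv v a = (LINT y|\<mu>. indicator {a<..b} y *\<^sub>R v y)"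
proof -
  have "antideriv v b - antideriv v a
      = (LINT y|\<mu>. indicator {..b} y *\<^sub>R v y - indicator {..a} y *\<^sub>R v y)"
    unfolding antideriv_def using antideriv_integrable[OF L2_integrable[OF assms(1)]] by simp
  also have "\<dots> = (LINT y|\<mu>. indicator {a<..b} y *\<^sub>R v y)"
    using assms(2) by (intro Bochner_Integration.integral_cong) (auto split: split_indicator)
  finally show ?thesis .
qed

lemma L2_indicator_Ioc:
  assumes "a \<le> b"
  shows "(\<lambda>y. indicator {a<..b} y :: real) \<in> L2" "L2_norm (\<lambda>y. indicator {a<..b} y :: real) \<le> sqrt (b - a)"
proof -
  have m: "(\<lambda>y. indicator {a<..b} y :: real) \<in> borel_measurable \<mu>"
    by (intro measurable_restrict_space1 measurable_completion) simp
  show "(\<lambda>y. indicator {a<..b} y :: real) \<in> L2"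
    by (rule bounded_in_L2(1)[OF m, of 1]) (auto split: split_indicator)
  have "(LINT x|\<mu>. (norm (indicator {a<..b} x :: real))\<^sup>2) = (LINT x|\<mu>. indicator ({a<..b} \<inter> {0<..<pi}) x)"
    by (intro Bochner_Integration.integral_cong) (auto split: split_indicator)
  also have "\<dots> = measure lebesgue ({a<..b} \<inter> {0<..<pi})"
    by (simp add: measure_restrict_space Int_absorb2)
  also have "\<dots> \<le> measure lebesgue {a..b}"
    by (rule measure_mono_fmeasurable) (auto simp: fmeasurable_cbox)
  finally show "L2_norm (\<lambda>y. indicator {a<..b} y :: real) \<le> sqrt (b - a)"
    using assms by (simp add: L2_norm_def)
qed

lemma antideriv_Hoelder:
  assumes "v \<in> L2"
  shows "norm (antideriv v b - antideriv v a) \<le> sqrt \<bar>b - a\<bar> * L2_norm v"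
proof -
  have *: "norm (antideriv v b - antideriv v a) \<le> sqrt (b - a) * L2_norm v" if "a \<le> b" for a b
    unfolding antideriv_increment[OF assms that]
    using L2_Cauchy_Schwarz_scaleR[OF L2_indicator_Ioc(1)[OF that] assms]
      mult_right_mono[OF L2_indicator_Ioc(2)[OF that], of "L2_norm v"] by simp
  show ?thesis
    using *[of a b] *[of b a] by (cases "a \<le> b") (auto simp: norm_minus_commute)
qed

lemma antideriv_continuous:
  assumes "v \<in> L2" shows "continuous_on S (antideriv v)"
proof (rule continuous_at_imp_continuous_on, intro ballI)
  fix a
  have "((\<lambda>b. sqrt \<bar>b - a\<bar> * L2_norm v) \<longlongrightarrow> sqrt \<bar>a - a\<bar> * L2_norm v) (at a)"
    by (intro tendsto_intros)
  then have lim: "((\<lambda>b. sqrt \<bar>b - a\<bar> * L2_norm v) \<longlongrightarrow> 0) (at a)" by simp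
  have "((\<lambda>b. antideriv v b - antideriv v a) \<longlongrightarrow> 0) (at a)"
    by (rule Lim_null_comparison[OF always_eventually lim]) (blast intro: antideriv_Hoelder[OF assms])
  then show "isCont (antideriv v) a" by (simp add: isCont_def LIM_zero_iff)
qed

lemma antideriv_L2: "v \<in> L2 \<Longrightarrow> antideriv v \<in> L2"
  by (rule bounded_in_L2(1)[OF continuous_measurable_\<mu>[OF antideriv_continuous]])
    (auto intro: antideriv_norm_le)

lemma antideriv_eq_integral:
  assumes "integrable \<mu> v" "0 \<le> x" "x \<le> pi"
  shows "antideriv v x = integral {0..x} v"
proof -
  have "antideriv v x = integral {0..pi} (\<lambda>y. indicator {..x} y *\<^sub>R v y)"
    unfolding antideriv_def by (rule LINT_eq_integral[OF antideriv_integrable[OF assms(1)]])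
  also have "(\<lambda>y. indicator {..x} y *\<^sub>R v y) = (\<lambda>y. if y \<in> {..x} then v y else 0)"
    by (auto split: split_indicator)
  also have "integral {0..pi} \<dots> = integral ({..x} \<inter> {0..pi}) v"
    by (rule integral_restrict_Int)
  also have "{..x} \<inter> {0..pi} = {0..x}" using assms(3) by auto
  finally show ?thesis .
qed

lemma antideriv_test_deriv:
  assumes "\<phi> \<in> test_functions" "0 \<le> x" "x \<le> pi"
  shows "antideriv (\<lambda>x. vector_derivative \<phi> (at x)) x = \<phi> x"
proof -
  have "((\<lambda>x. vector_derivative \<phi> (at x)) has_integral \<phi> x - \<phi> 0) {0..x}"
    by (rule fundamental_theorem_of_calculus[OF assms(2)])
      (rule has_vector_derivative_at_within[OF test_has_deriv[OF assms(1)]])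
  then show ?thesis
    using antideriv_eq_integral[OF L2_integrable[OF test_L2[OF test_deriv_test[OF assms(1)]]] assms(2,3)]
      test_endpoints[OF assms(1)] by (simp add: integral_unique)
qed

lemma L2_norm_le_sup:
  assumes "f \<in> borel_measurable \<mu>" "\<And>x. x \<in> {0<..<pi} \<Longrightarrow> norm (f x) \<le> B" "0 \<le> B"
  shows "L2_norm f \<le> B * sqrt pi"
  using bounded_in_L2(2)[OF assms(1) AE_I2, of B] assms(2,3) by simp

text \<open>Elements of \<^term>\<open>H10\<close> are the primitives, vanishing at both ends, of their derivatives: this
  passes from test functions to limits because \<^term>\<open>antideriv\<close> is continuous from
  \<^term>\<open>L2\<close> to bounded functions.\<close>

lemma H10_AE_antideriv:
  assumes "H10_pair f f'"
  shows "AE x in \<mu>. f x = antideriv f' x"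
proof -
  obtain \<phi> where \<phi>: "\<And>n. \<phi> n \<in> test_functions" "(\<lambda>n. L2_norm (\<lambda>x. \<phi> n x - f x)) \<longlonglongrightarrow> 0"
    "(\<lambda>n. L2_norm (\<lambda>x. vector_derivative (\<phi> n) (at x) - f' x)) \<longlonglongrightarrow> 0"
    using H10_pair_sequence[OF assms] by blast
  note L = H10_pair_L2[OF assms]
  note A = antideriv_L2[OF L(2)]
  have tL: "\<phi> n \<in> L2" "(\<lambda>x. vector_derivative (\<phi> n) (at x)) \<in> L2" for n
    using \<phi>(1) test_L2 test_deriv_test by blast+
  have "L2_norm (\<lambda>x. f x - antideriv f' x)
      \<le> L2_norm (\<lambda>x. \<phi> n x - f x) + pi * L2_norm (\<lambda>x. vector_derivative (\<phi> n) (at x) - f' x)" for n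
  proof -
    have "L2_norm (\<lambda>x. \<phi> n x - antideriv f' x)
        \<le> (sqrt pi * L2_norm (\<lambda>x. vector_derivative (\<phi> n) (at x) - f' x)) * sqrt pi"
    proof (rule L2_norm_le_sup)
      fix x assume "x \<in> {0<..<pi}"
      then have "\<phi> n x - antideriv f' x = antideriv (\<lambda>x. vector_derivative (\<phi> n) (at x) - f' x) x"
        using antideriv_test_deriv[OF \<phi>(1)] by (simp add: antideriv_diff[OF tL(2) L(2)])
      then show "norm (\<phi> n x - antideriv f' x) \<le> sqrt pi * L2_norm (\<lambda>x. vector_derivative (\<phi> n) (at x) - f' x)"
        using antideriv_norm_le[OF L2_diff(1)[OF tL(2) L(2)]] by simp
    qed (use tL A in auto)
    moreover have "L2_norm (\<lambda>x. f x - antideriv f' x)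
        \<le> L2_norm (\<lambda>x. f x - \<phi> n x) + L2_norm (\<lambda>x. \<phi> n x - antideriv f' x)"
      by (rule L2_norm_triangle[OF L(1) tL(1) A])
    moreover have "(sqrt pi * c) * sqrt pi = pi * c" for c by (simp add: mult.commute mult.left_commute)
    ultimately show ?thesis using L2_norm_commute[of f "\<phi> n"] by simp
  qed
  moreover have "(\<lambda>n. L2_norm (\<lambda>x. \<phi> n x - f x) + pi * L2_norm (\<lambda>x. vector_derivative (\<phi> n) (at x) - f' x))
      \<longlonglongrightarrow> 0 + pi * 0"
    by (intro tendsto_intros \<phi>)
  ultimately have "L2_norm (\<lambda>x. f x - antideriv f' x) \<le> 0 + pi * 0"
    by (intro tendsto_lowerbound) auto
  then have "L2_norm (\<lambda>x. f x - antideriv f' x) = 0" by (simp add: antisym)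
  then show ?thesis by (simp add: L2_norm_eq_0_iff[OF L2_diff(1)[OF L(1) A]])
qed

text \<open>The derivatives of test functions have mean zero, and the mean is continuous.\<close>

lemma H10_antideriv_pi:
  assumes "H10_pair f f'" shows "antideriv f' pi = 0"
proof -
  obtain \<phi> where \<phi>: "\<And>n. \<phi> n \<in> test_functions"
    "(\<lambda>n. L2_norm (\<lambda>x. vector_derivative (\<phi> n) (at x) - f' x)) \<longlonglongrightarrow> 0"
    using H10_pair_sequence[OF assms] by blast
  note L = H10_pair_L2[OF assms]
  have tL: "(\<lambda>x. vector_derivative (\<phi> n) (at x)) \<in> L2" for n
    using \<phi>(1) test_L2 test_deriv_test by blast
  have le: "norm (antideriv f' pi) \<le> sqrt pi * L2_norm (\<lambda>x. vector_derivative (\<phi> n) (at x) - f' x)" for n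
    using antideriv_norm_le[OF L2_diff(1)[OF tL L(2)], of n pi]
      antideriv_test_deriv[OF \<phi>(1), of pi n] test_endpoints(2)[OF \<phi>(1)]
    by (simp add: antideriv_diff[OF tL L(2)])
  have lim: "(\<lambda>n. sqrt pi * L2_norm (\<lambda>x. vector_derivative (\<phi> n) (at x) - f' x)) \<longlonglongrightarrow> sqrt pi * 0"
    by (intro tendsto_intros \<phi>)
  have "norm (antideriv f' pi) \<le> sqrt pi * 0" using LIMSEQ_le_const[OF lim] le by blast
  then show ?thesis by simp
qed

lemma H10_AE_bound:
  assumes "H10_pair f f'" shows "AE x in \<mu>. norm (f x) \<le> sqrt pi * L2_norm f'"
  using H10_AE_antideriv[OF assms]
  by eventually_elim (use antideriv_norm_le[OF H10_pair_L2(2)[OF assms]] in auto)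

lemma H10_Poincare:
  assumes "H10_pair f f'" shows "L2_norm f \<le> pi * L2_norm f'"
  using bounded_in_L2(2)[OF L2_D(1)[OF H10_pair_L2(1)[OF assms]] H10_AE_bound[OF assms]]
  by (simp add: mult.commute mult.left_commute)

text \<open>For a test function u this is the definition of the weak derivative of z, applied to the real and the
  imaginary part of u; both sides are continuous in u.\<close>

lemma H10_integration_by_parts:
  fixes u z :: "real \<Rightarrow> complex"
  assumes u: "H10_pair u u'" and z: "H1_pair z z'"
  shows "(LINT x|\<mu>. u' x * z x) = - (LINT x|\<mu>. u x * z' x)"
proof -
  note Z = H1_pair_D[OF z] and U = H10_pair_L2[OF u]
  have test: "(LINT x|\<mu>. vector_derivative \<phi> (at x) * z x) = - (LINT x|\<mu>. \<phi> x * z' x)"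
    if \<phi>: "\<phi> \<in> test_functions" for \<phi> :: "real \<Rightarrow> complex"
  proof -
    define a where "a x = Re (\<phi> x)" for x
    define b where "b x = Im (\<phi> x)" for x
    have a: "a \<in> test_functions" "\<And>x. vector_derivative a (at x) = Re (vector_derivative \<phi> (at x))"
      using test_bounded_linear[OF \<phi> bounded_linear_Re] by (auto simp: a_def[abs_def])
    have b: "b \<in> test_functions" "\<And>x. vector_derivative b (at x) = Im (vector_derivative \<phi> (at x))"
      using test_bounded_linear[OF \<phi> bounded_linear_Im] by (auto simp: b_def[abs_def])
    have split: "w * y = Re w *\<^sub>R y + \<i> * (Im w *\<^sub>R y)" for w y :: complex
      by (simp add: complex_eq_iff)
    note I = L2_scaleR_integrable[OF test_L2[OF a(1)] Z(2)] L2_scaleR_integrable[OF test_L2[OF b(1)] Z(2)]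
      L2_scaleR_integrable[OF test_L2[OF test_deriv_test[OF a(1)]] Z(1)]
      L2_scaleR_integrable[OF test_L2[OF test_deriv_test[OF b(1)]] Z(1)]
    have "(LINT x|\<mu>. vector_derivative \<phi> (at x) * z x)
        = (LINT x|\<mu>. vector_derivative a (at x) *\<^sub>R z x) + \<i> * (LINT x|\<mu>. vector_derivative b (at x) *\<^sub>R z x)"
      unfolding split[of "vector_derivative \<phi> (at _)"] using I(3,4)
      by (subst Bochner_Integration.integral_add) (simp_all only: a b integrable_mult_right integral_mult_right_zero)
    also have "\<dots> = - ((LINT x|\<mu>. a x *\<^sub>R z' x) + \<i> * (LINT x|\<mu>. b x *\<^sub>R z' x))"
      using Z(3) a(1) b(1) by (simp add: has_weak_deriv_def)
    also have "(LINT x|\<mu>. a x *\<^sub>R z' x) + \<i> * (LINT x|\<mu>. b x *\<^sub>R z' x) = (LINT x|\<mu>. \<phi> x * z' x)"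
      unfolding split[of "\<phi> _"] using I(1,2)
      by (subst Bochner_Integration.integral_add) (simp_all only: a_def b_def integrable_mult_right integral_mult_right_zero)
    finally show ?thesis .
  qed
  obtain \<phi> where \<phi>: "\<And>n. \<phi> n \<in> test_functions" "(\<lambda>n. L2_norm (\<lambda>x. \<phi> n x - u x)) \<longlonglongrightarrow> 0"
    "(\<lambda>n. L2_norm (\<lambda>x. vector_derivative (\<phi> n) (at x) - u' x)) \<longlonglongrightarrow> 0"
    using H10_pair_sequence[OF u] by blast
  have "(\<lambda>n. LINT x|\<mu>. vector_derivative (\<phi> n) (at x) * z x) \<longlonglongrightarrow> (LINT x|\<mu>. u' x * z x)"
    by (rule L2_pairing_tendsto[OF test_L2[OF test_deriv_test[OF \<phi>(1)]] U(2) \<phi>(3) Z(1)])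
  moreover have "(\<lambda>n. - (LINT x|\<mu>. \<phi> n x * z' x)) \<longlonglongrightarrow> - (LINT x|\<mu>. u x * z' x)"
    by (intro tendsto_minus L2_pairing_tendsto[OF test_L2[OF \<phi>(1)] U(1) \<phi>(2) Z(2)])
  ultimately show ?thesis using test[OF \<phi>(1)] LIMSEQ_unique by simp
qed

text \<open>Functions and derivatives converge separately in \<^term>\<open>L2\<close>, and the pairs are closed under such
  limits.\<close>

lemma H10_complete:
  fixes F F' :: "nat \<Rightarrow> real \<Rightarrow> 'a::euclidean_space"
  assumes F: "\<And>n. H10_pair (F n) (F' n)"
    and cauchy: "\<And>e. e > 0 \<Longrightarrow> \<exists>N. \<forall>m\<ge>N. \<forall>n\<ge>N. Hk_norm 1 (\<lambda>x. F m x - F n x) < e"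
  obtains w w' where "H10_pair w w'" "(\<lambda>n. Hk_norm 1 (\<lambda>x. w x - F n x)) \<longlonglongrightarrow> 0"
proof -
  have b: "L2_norm (\<lambda>x. F m x - F n x) \<le> Hk_norm 1 (\<lambda>x. F m x - F n x)"
    "L2_norm (\<lambda>x. F' m x - F' n x) \<le> Hk_norm 1 (\<lambda>x. F m x - F n x)" for m n
    using H1_pair_norm_bounds[OF H1_pair_diff[OF F[THEN H10_pair_H1] F[THEN H10_pair_H1]]] by auto
  have c: "\<exists>N. \<forall>m\<ge>N. \<forall>n\<ge>N. L2_norm (\<lambda>x. F m x - F n x) < e"
    "\<exists>N. \<forall>m\<ge>N. \<forall>n\<ge>N. L2_norm (\<lambda>x. F' m x - F' n x) < e" if "e > 0" for e
    using cauchy[OF that] le_less_trans[OF b(1)] le_less_trans[OF b(2)] by meson+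
  obtain w where w: "w \<in> L2" "(\<lambda>n. L2_norm (\<lambda>x. F n x - w x)) \<longlonglongrightarrow> 0"
    using L2_complete[OF H10_pair_L2(1)[OF F] c(1)] by blast
  obtain w' where w': "w' \<in> L2" "(\<lambda>n. L2_norm (\<lambda>x. F' n x - w' x)) \<longlonglongrightarrow> 0"
    using L2_complete[OF H10_pair_L2(2)[OF F] c(2)] by blast
  have p: "H10_pair w w'" by (rule H10_pair_limit[OF F w(1) w'(1) w(2) w'(2)])
  have "(\<lambda>n. Hk_norm 1 (\<lambda>x. w x - F n x)) \<longlonglongrightarrow> 0"
  proof (rule Lim_null_comparison)
    show "(\<lambda>n. L2_norm (\<lambda>x. F n x - w x) + L2_norm (\<lambda>x. F' n x - w' x)) \<longlonglongrightarrow> 0"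
      using tendsto_add[OF w(2) w'(2)] by simp
    show "\<forall>\<^sub>F n in sequentially. norm (Hk_norm 1 (\<lambda>x. w x - F n x))
        \<le> L2_norm (\<lambda>x. F n x - w x) + L2_norm (\<lambda>x. F' n x - w' x)"
      using H1_pair_norm_bounds(3)[OF H1_pair_diff[OF H10_pair_H1[OF p] H10_pair_H1[OF F]]]
      by (simp add: L2_norm_commute[of w] L2_norm_commute[of w'])
  qed
  with p show ?thesis by (rule that)
qed

section \<open>The uniform bound for continuous elements of the first Sobolev space\<close>

text \<open>Mean zero is what makes the primitive vanish to the right of the support.\<close>

lemma antideriv_test:
  fixes \<psi> :: "real \<Rightarrow> 'a::euclidean_space"
  assumes "\<psi> \<in> test_functions" "(LINT x|\<mu>. \<psi> x) = 0"
  shows "antideriv \<psi> \<in> test_functions" "vector_derivative (antideriv \<psi>) (at x) = \<psi> x"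
proof -
  obtain D a b where D: "D 0 = \<psi>" "\<forall>k x. (D k has_vector_derivative D (Suc k) x) (at x)"
    and ab: "0 < a" "b < pi" "\<forall>x. x \<notin> {a..b} \<longrightarrow> \<psi> x = 0"
    using assms(1) unfolding test_functions_def by blast
  have left: "antideriv \<psi> x = 0" if "x < a" for x
    unfolding antideriv_def using that ab
    by (intro integral_eq_zero_AE) (auto split: split_indicator)
  have right: "antideriv \<psi> x = 0" if "b < x" for x
  proof -
    have "antideriv \<psi> x = (LINT x|\<mu>. \<psi> x)"
      unfolding antideriv_def using that ab
      by (intro Bochner_Integration.integral_cong) (auto split: split_indicator)
    then show ?thesis using assms(2) by simp
  qed
  have d: "(antideriv \<psi> has_vector_derivative \<psi> x) (at x)" for x
  proof (cases "0 < x \<and> x < pi")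
    case True
    have "((\<lambda>u. integral {0..u} \<psi>) has_vector_derivative \<psi> x) (at x within {0..pi})"
      using True by (intro integral_has_vector_derivative test_continuous assms) auto
    then have "((\<lambda>u. integral {0..u} \<psi>) has_vector_derivative \<psi> x) (at x)"
      using True by (simp add: at_within_Icc_at)
    then show ?thesis
      by (rule has_vector_derivative_transform_within_open[where S="{0<..<pi}"])
        (use True antideriv_eq_integral[OF L2_integrable[OF test_L2[OF assms(1)]]] in auto)
  next
    case False
    then consider "x < a" | "b < x" using ab(1,2) by fastforce
    then show ?thesis
    proof cases
      case 1
      have "((\<lambda>_. 0) has_vector_derivative \<psi> x) (at x)" using 1 ab by simp
      then show ?thesis
        by (rule has_vector_derivative_transform_within_open[where S="{..<a}"]) (use 1 left in auto)
    next
      case 2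
      have "((\<lambda>_. 0) has_vector_derivative \<psi> x) (at x)" using 2 ab by simp
      then show ?thesis
        by (rule has_vector_derivative_transform_within_open[where S="{b<..}"]) (use 2 right in auto)
    qed
  qed
  show "vector_derivative (antideriv \<psi>) (at x) = \<psi> x" by (rule vector_derivative_at[OF d])
  define E where "E k = (case k of 0 \<Rightarrow> antideriv \<psi> | Suc j \<Rightarrow> D j)" for k
  have "\<forall>k x. (E k has_vector_derivative E (Suc k) x) (at x)"
    using d D by (auto simp: E_def split: nat.split)
  moreover have "\<forall>x. x \<notin> {a..b} \<longrightarrow> antideriv \<psi> x = 0" using left right by auto
  ultimately show "antideriv \<psi> \<in> test_functions"
    unfolding test_functions_def using ab(1,2)
    by (intro CollectI conjI exI[of _ E] exI[of _ a] exI[of _ b]) (auto simp: E_def)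
qed

text \<open>A normalised cutoff around the point, supported where the function is within e of its value
  at the point.\<close>

lemma approximate_identity:
  assumes a: "0 < a" "a < pi" and f: "continuous_on {0<..<pi} (f :: real \<Rightarrow> real)" "f \<in> L2" and e: "e > 0"
  obtains \<kappa> where "\<kappa> \<in> test_functions" "\<And>x. 0 \<le> \<kappa> x" "(LINT x|\<mu>. \<kappa> x) = 1"
    "\<bar>(LINT x|\<mu>. \<kappa> x * f x) - f a\<bar> \<le> e"
proof -
  have "isCont f a" using f(1) a by (simp add: continuous_on_eq_continuous_at)
  then obtain d where d: "d > 0" "\<And>x. \<bar>x - a\<bar> < d \<Longrightarrow> \<bar>f x - f a\<bar> < e"
    using e unfolding continuous_at_eps_delta dist_real_def by blast
  define r where "r = min d (min a (pi - a)) / 2"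
  have r: "0 < r" "r < d" "0 < a - r" "a + r < pi" using d(1) a by (auto simp: r_def min_def field_simps)
  define k where "k = cutoff 1 (a - r) (a + r)"
  have kt: "k \<in> test_functions" unfolding k_def by (rule bump_test_function[OF cutoff_bump]) (use r in auto)
  have k0: "0 \<le> k x" for x unfolding k_def by (rule cutoff_bounds)
  have kout: "k x = 0" if "\<not> \<bar>x - a\<bar> < d" for x
    unfolding k_def using that r by (intro bump_outside[OF cutoff_bump]) auto
  note ki = L2_integrable[OF test_L2[OF kt]]
  have "(LINT x|\<mu>. k x) \<noteq> 0"
  proof
    assume "(LINT x|\<mu>. k x) = 0"
    then have "AE x in \<mu>. k x = 0"
      using integral_nonneg_eq_0_iff_AE[OF ki] k0 by auto
    then have "AE x in lebesgue. x \<notin> {a - r<..<a + r}"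
      unfolding AE_restrict_space_iff[of "{0<..<pi}" lebesgue, simplified]
    proof (rule eventually_mono)
      fix x assume *: "0 < x \<and> x < pi \<longrightarrow> k x = 0"
      show "x \<notin> {a - r<..<a + r}"
      proof
        assume x: "x \<in> {a - r<..<a + r}"
        then have "k x > 0" unfolding k_def by (intro cutoff_pos) auto
        with * x r show False by auto
      qed
    qed
    then have "emeasure lebesgue {a - r<..<a + r} = 0"
      by (subst (asm) AE_iff_measurable[where N="{a - r<..<a + r}"]) auto
    then show False using r(1) by simp
  qed
  moreover have "(LINT x|\<mu>. k x) \<ge> 0" by (rule Bochner_Integration.integral_nonneg) (rule k0)
  ultimately have c: "(LINT x|\<mu>. k x) > 0" by simp
  define \<kappa> where "\<kappa> x = (1 / (LINT x|\<mu>. k x)) *\<^sub>R k x" for x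
  have \<kappa>t: "\<kappa> \<in> test_functions"
    unfolding \<kappa>_def[abs_def] by (rule test_bounded_linear(1)[OF kt bounded_linear_scaleR_right])
  have \<kappa>0: "0 \<le> \<kappa> x" for x using k0 c by (simp add: \<kappa>_def)
  have \<kappa>1: "(LINT x|\<mu>. \<kappa> x) = 1" using c by (simp add: \<kappa>_def)
  note \<kappa>L = test_L2[OF \<kappa>t]
  note i = L2_mult_integrable[OF \<kappa>L f(2)] L2_integrable[OF \<kappa>L]
  have "(LINT x|\<mu>. \<kappa> x * f x) - f a = (LINT x|\<mu>. \<kappa> x * f x) - (LINT x|\<mu>. \<kappa> x * f a)"
    using \<kappa>1 by simp
  also have "\<dots> = (LINT x|\<mu>. \<kappa> x * (f x - f a))"
    using i by (simp add: right_diff_distrib)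
  also have "\<bar>\<dots>\<bar> \<le> (LINT x|\<mu>. \<kappa> x * e)"
  proof (rule order_trans[OF integral_abs_bound integral_mono])
    show "integrable \<mu> (\<lambda>x. \<bar>\<kappa> x * (f x - f a)\<bar>)"
      using i by (simp add: right_diff_distrib)
    show "integrable \<mu> (\<lambda>x. \<kappa> x * e)" using i by simp
    fix x
    show "\<bar>\<kappa> x * (f x - f a)\<bar> \<le> \<kappa> x * e"
    proof (cases "\<bar>x - a\<bar> < d")
      case True
      then have "\<kappa> x * \<bar>f x - f a\<bar> \<le> \<kappa> x * e"
        using d(2)[of x] \<kappa>0[of x] by (intro mult_left_mono) auto
      then show ?thesis using \<kappa>0[of x] by (simp add: abs_mult)
    next
      case False
      then show ?thesis using kout[of x] by (simp add: \<kappa>_def)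
    qed
  qed
  also have "\<dots> = e" using \<kappa>1 by simp
  finally show ?thesis by (rule that[OF \<kappa>t \<kappa>0 \<kappa>1])
qed

text \<open>Testing against the primitive of the difference of two approximate identities compares the
  values of a continuous function at two points; the primitive is bounded by 2.\<close>

lemma continuous_H1_oscillation:
  fixes f :: "real \<Rightarrow> real"
  assumes f: "continuous_on {0<..<pi} f" "H1_pair f f'" and a: "0 < a" "a < pi" and b: "0 < b" "b < pi"
  shows "\<bar>f a - f b\<bar> \<le> 2 * sqrt pi * L2_norm f'"
proof (rule field_le_epsilon)
  fix e :: real assume "e > 0"
  note L = H1_pair_D[OF f(2)]
  obtain \<kappa> where \<kappa>: "\<kappa> \<in> test_functions" "\<And>x. 0 \<le> \<kappa> x" "(LINT x|\<mu>. \<kappa> x) = 1"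
    "\<bar>(LINT x|\<mu>. \<kappa> x * f x) - f a\<bar> \<le> e / 2"
    using approximate_identity[OF a f(1) L(1), of "e/2"] \<open>e > 0\<close> by auto
  obtain k where k: "k \<in> test_functions" "\<And>x. 0 \<le> k x" "(LINT x|\<mu>. k x) = 1"
    "\<bar>(LINT x|\<mu>. k x * f x) - f b\<bar> \<le> e / 2"
    using approximate_identity[OF b f(1) L(1), of "e/2"] \<open>e > 0\<close> by auto
  define \<psi> where "\<psi> x = \<kappa> x + (-1) *\<^sub>R k x" for x
  have t: "\<psi> \<in> test_functions" unfolding \<psi>_def[abs_def]
    by (intro test_add(1) \<kappa> test_bounded_linear(1)[OF k(1) bounded_linear_scaleR_right])
  note i = L2_integrable[OF test_L2[OF \<kappa>(1)]] L2_integrable[OF test_L2[OF k(1)]]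
    L2_mult_integrable[OF test_L2[OF \<kappa>(1)] L(1)] L2_mult_integrable[OF test_L2[OF k(1)] L(1)]
  have "(LINT x|\<mu>. \<psi> x) = 0" using i \<kappa> k by (simp add: \<psi>_def)
  note A = antideriv_test[OF t this]
  have b2: "\<bar>antideriv \<psi> x\<bar> \<le> 2" for x
  proof -
    have "\<bar>antideriv \<psi> x\<bar> \<le> (LINT y|\<mu>. \<bar>\<psi> y\<bar>)"
      using antideriv_norm_le_integral[OF L2_integrable[OF test_L2[OF t]]] by simp
    also have "\<dots> \<le> (LINT y|\<mu>. \<kappa> y + k y)"
      using \<kappa>(2) k(2) i L2_integrable[OF test_L2[OF t]]
      by (intro integral_mono) (auto simp: \<psi>_def abs_le_iff intro: add_increasing add_increasing2)
    also have "\<dots> = 2" using i \<kappa> k by simp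
    finally show ?thesis .
  qed
  have "(LINT x|\<mu>. \<psi> x * f x) = - (LINT x|\<mu>. antideriv \<psi> x * f' x)"
    using L(3) A unfolding has_weak_deriv_def by fastforce
  also have "\<bar>\<dots>\<bar> \<le> (LINT x|\<mu>. 2 * \<bar>f' x\<bar>)"
    unfolding abs_minus_cancel
    using b2 L2_norm_product_integrable[OF test_L2[OF A(1)] L(2)] L2_integrable[OF L(2)]
    by (intro order_trans[OF integral_abs_bound] integral_mono) (auto simp: abs_mult intro: mult_right_mono)
  also have "\<dots> \<le> 2 * (sqrt pi * L2_norm f')"
    using L2_integral_norm_le[OF L(2)] by simp
  finally have "\<bar>(LINT x|\<mu>. \<psi> x * f x)\<bar> \<le> 2 * sqrt pi * L2_norm f'" by simp
  moreover have "(LINT x|\<mu>. \<psi> x * f x) = (LINT x|\<mu>. \<kappa> x * f x) - (LINT x|\<mu>. k x * f x)"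
    using i by (simp add: \<psi>_def left_diff_distrib)
  ultimately show "\<bar>f a - f b\<bar> \<le> 2 * sqrt pi * L2_norm f' + e"
    using \<kappa>(4) k(4) by linarith
qed

text \<open>The value at a is compared with the mean value of f. The estimate holds at every point, not only almost
  everywhere.\<close>

lemma continuous_H1_sup_bound:
  fixes f :: "real \<Rightarrow> real"
  assumes f: "continuous_on {0<..<pi} f" "f \<in> Hk 1" and a: "a \<in> {0<..<pi}"
  shows "\<bar>f a\<bar> \<le> 6 * Hk_norm 1 f"
proof -
  have p: "H1_pair f (weak_deriv f)" using f(2) Hk_1_iff by blast
  note L = H1_pair_D[OF p]
  have "pi * \<bar>f a\<bar> = (LINT x|\<mu>. \<bar>f a\<bar>)" using measure_\<mu>_space by simp
  also have "\<dots> \<le> (LINT x|\<mu>. \<bar>f x\<bar> + 2 * sqrt pi * L2_norm (weak_deriv f))"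
  proof (rule integral_mono_AE)
    show "AE x in \<mu>. \<bar>f a\<bar> \<le> \<bar>f x\<bar> + 2 * sqrt pi * L2_norm (weak_deriv f)"
    proof (rule AE_I2)
      fix x assume "x \<in> space \<mu>"
      then show "\<bar>f a\<bar> \<le> \<bar>f x\<bar> + 2 * sqrt pi * L2_norm (weak_deriv f)"
        using continuous_H1_oscillation[OF f(1) p, of a x] a by auto
    qed
  qed (use L2_integrable[OF L(1)] in auto)
  also have "\<dots> = (LINT x|\<mu>. \<bar>f x\<bar>) + pi * (2 * sqrt pi * L2_norm (weak_deriv f))"
    using L2_integrable[OF L(1)] measure_\<mu>_space by simp
  also have "\<dots> \<le> sqrt pi * L2_norm f + pi * (2 * sqrt pi * L2_norm (weak_deriv f))"
    using L2_integral_norm_le[OF L(1)] by simp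
  also have "\<dots> \<le> pi * (Hk_norm 1 f) + pi * (2 * sqrt pi * Hk_norm 1 f)"
  proof (intro add_mono mult_mono mult_left_mono H1_pair_norm_bounds[OF p])
    show "sqrt pi \<le> pi" using pi_gt3 by (intro real_le_lsqrt) (auto simp: power2_eq_square)
  qed auto
  also have "\<dots> = pi * ((1 + 2 * sqrt pi) * Hk_norm 1 f)" by (simp add: algebra_simps)
  finally have "\<bar>f a\<bar> \<le> (1 + 2 * sqrt pi) * Hk_norm 1 f" by simp
  also have "\<dots> \<le> 6 * Hk_norm 1 f"
  proof (rule mult_right_mono)
    have "sqrt pi \<le> 2" using pi_less_4 by (intro real_le_lsqrt) auto
    then show "1 + 2 * sqrt pi \<le> 6" by simp
  qed simp
  finally show ?thesis .
qed

section \<open>The nonlinearity\<close>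

lemma Hk_norm_1_triangle:
  assumes "f \<in> Hk 1" "g \<in> Hk 1"
  shows "Hk_norm 1 (\<lambda>x. f x + g x) \<le> Hk_norm 1 f + Hk_norm 1 g"
proof -
  note p = assms[unfolded Hk_1_iff]
  have "Hk_norm 1 (\<lambda>x. f x + g x)
      \<le> sqrt ((L2_norm f + L2_norm g)\<^sup>2 + (L2_norm (weak_deriv f) + L2_norm (weak_deriv g))\<^sup>2)"
    unfolding H1_pair_norm[OF H1_pair_add[OF p]]
    by (intro real_sqrt_le_mono add_mono power_mono L2_add(2) H1_pair_D[OF p(1)] H1_pair_D[OF p(2)]) auto
  also have "\<dots> \<le> Hk_norm 1 f + Hk_norm 1 g"
    unfolding Hk_norm_1 by (rule real_sqrt_sum_squares_triangle_ineq)
  finally show ?thesis .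
qed

lemma Hk_1_scale:
  fixes f :: "real \<Rightarrow> real"
  assumes "f \<in> Hk 1"
  shows "(\<lambda>x. c * f x) \<in> Hk 1" "Hk_norm 1 (\<lambda>x. c * f x) = \<bar>c\<bar> * Hk_norm 1 f"
proof -
  note p = assms[unfolded Hk_1_iff]
  have q: "H1_pair (\<lambda>x. c * f x) (\<lambda>x. c * weak_deriv f x)"
    using H1_pair_scaleR[OF p, of c] by simp
  then show "(\<lambda>x. c * f x) \<in> Hk 1" by (rule H1_pair_Hk)
  show "Hk_norm 1 (\<lambda>x. c * f x) = \<bar>c\<bar> * Hk_norm 1 f"
    unfolding H1_pair_norm[OF q] Hk_norm_1 L2_norm_cmult
    by (simp add: power_mult_distrib real_sqrt_mult flip: distrib_left)
qed

lemma Hk_1_add: "f \<in> Hk 1 \<Longrightarrow> g \<in> Hk 1 \<Longrightarrow> (\<lambda>x. f x + g x) \<in> Hk 1"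
  using H1_pair_add H1_pair_Hk Hk_1_iff by metis

lemma Hk_1_diff: "f \<in> Hk 1 \<Longrightarrow> g \<in> Hk 1 \<Longrightarrow> (\<lambda>x. f x - g x) \<in> Hk 1"
  using H1_pair_diff H1_pair_Hk Hk_1_iff by metis

text \<open>A curve that is differentiable in the Sobolev norm satisfies a local Lipschitz estimate at each
  point, with any constant larger than the norm of the derivative.\<close>

lemma Hk_curve_local_bound:
  fixes D :: "nat \<Rightarrow> real \<Rightarrow> real \<Rightarrow> real"
  assumes H: "\<And>k y. D k y \<in> Hk 2"
    and lim: "\<And>k y. ((\<lambda>h. Hk_norm 2 (\<lambda>x. (D k (y + h) x - D k y x) / h - D (Suc k) y x)) \<longlongrightarrow> 0) (at 0)"
  obtains d where "d > 0"
    "\<And>h. \<bar>h\<bar> < d \<Longrightarrow> Hk_norm 1 (\<lambda>x. D k (y + h) x - D k y x) \<le> \<bar>h\<bar> * (Hk_norm 1 (D (Suc k) y) + 1)"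
proof -
  have H1: "D k y \<in> Hk 1" for k y using Hk_ge_1_D[OF H] by simp
  have "\<forall>\<^sub>F h in at 0. Hk_norm 2 (\<lambda>x. (D k (y + h) x - D k y x) / h - D (Suc k) y x) < 1"
    by (rule order_tendstoD(2)[OF lim]) simp
  then obtain d where d: "d > 0" "\<And>h. h \<noteq> 0 \<Longrightarrow> \<bar>h\<bar> < d \<Longrightarrow>
      Hk_norm 2 (\<lambda>x. (D k (y + h) x - D k y x) / h - D (Suc k) y x) < 1"
    unfolding eventually_at by (auto simp: dist_real_def)
  show ?thesis
  proof (rule that[OF d(1)])
    fix h :: real assume h: "\<bar>h\<bar> < d"
    show "Hk_norm 1 (\<lambda>x. D k (y + h) x - D k y x) \<le> \<bar>h\<bar> * (Hk_norm 1 (D (Suc k) y) + 1)"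
    proof (cases "h = 0")
      case True
      have "Hk_norm 1 (\<lambda>x::real. 0::real) = 0"
        unfolding H1_pair_norm[OF H1_pair_zero] by (simp add: L2_norm_def)
      then show ?thesis using True by simp
    next
      case False
      define q where "q x = (D k (y + h) x - D k y x) / h - D (Suc k) y x" for x
      have q1: "q \<in> Hk 1"
        unfolding q_def[abs_def] using Hk_1_scale(1)[OF Hk_1_diff[OF H1 H1], of "1 / h"]
        by (intro Hk_1_diff H1) simp
      have "Hk_norm 1 q < 1"
        using d(2)[OF False h] Hk_norm_mono[of 1 2 q] unfolding q_def[abs_def] by simp
      have "Hk_norm 1 (\<lambda>x. D k (y + h) x - D k y x) = Hk_norm 1 (\<lambda>x. h * (q x + D (Suc k) y x))"
        using False by (simp add: q_def)
      also have "\<dots> = \<bar>h\<bar> * Hk_norm 1 (\<lambda>x. q x + D (Suc k) y x)"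
        by (rule Hk_1_scale(2)[OF Hk_1_add[OF q1 H1]])
      also have "\<dots> \<le> \<bar>h\<bar> * (Hk_norm 1 (D (Suc k) y) + 1)"
        using Hk_norm_1_triangle[OF q1 H1[of "Suc k" y]] \<open>Hk_norm 1 q < 1\<close>
        by (intro mult_left_mono) linarith+
      finally show ?thesis .
    qed
  qed
qed

text \<open>These conditions make the superposition with g a Lipschitz map of square integrable functions on each
  ball of bounded functions. The constant is uniform in the position but only local in the amplitude,
  because nothing restricts the growth of g.\<close>

definition uniformly_Lipschitz :: "(real \<Rightarrow> real \<Rightarrow> real) \<Rightarrow> bool" where
  "uniformly_Lipschitz g \<longleftrightarrow> (\<forall>y. continuous_on {0<..<pi} (\<lambda>x. g x y)) \<and> (\<forall>x\<in>{0<..<pi}. g x 0 = 0) \<and>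
     (\<forall>M. \<exists>L\<ge>0. \<forall>x\<in>{0<..<pi}. \<forall>y z. \<bar>y\<bar> \<le> M \<longrightarrow> \<bar>z\<bar> \<le> M \<longrightarrow> \<bar>g x y - g x z\<bar> \<le> L * \<bar>y - z\<bar>)"

text \<open>The derivative in the amplitude is continuous for the Sobolev norm, hence bounded on compact sets of
  amplitudes, and the uniform bound for continuous elements of the Sobolev space turns this into a local
  Lipschitz estimate at each position. Bisection of the interval of amplitudes makes it global. The value
  at amplitude 0 is the limit of values that vanish at least to first order.\<close>

lemma nonlinearity_uniformly_Lipschitz:
  assumes "nonlinearity p g"
  shows "uniformly_Lipschitz g"
proof -
  from assms obtain D where p: "even p" "p \<ge> 4"
    and c: "\<And>y. continuous_on {0<..<pi} (\<lambda>x. g x y)"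
    and D0: "\<And>y. D 0 y = (\<lambda>x. g x y)" and H: "\<And>k y. D k y \<in> Hk 2"
    and lim: "\<And>k y. ((\<lambda>h. Hk_norm 2 (\<lambda>x. (D k (y + h) x - D k y x) / h - D (Suc k) y x)) \<longlongrightarrow> 0) (at 0)"
    and O: "(\<lambda>y. Hk_norm 2 (\<lambda>x. g x y)) \<in> O[at 0](\<lambda>y. \<bar>y\<bar> ^ ((p - 2) div 2))"
    unfolding nonlinearity_def by blast
  have H1: "D k y \<in> Hk 1" for k y using Hk_ge_1_D[OF H] by simp
  note loc = Hk_curve_local_bound[of D, OF H lim]
  have cont: "isCont (\<lambda>y. Hk_norm 1 (D 1 y)) y" for y
  proof -
    obtain d where d: "d > 0" "\<And>h. \<bar>h\<bar> < d \<Longrightarrow>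
        Hk_norm 1 (\<lambda>x. D 1 (y + h) x - D 1 y x) \<le> \<bar>h\<bar> * (Hk_norm 1 (D (Suc 1) y) + 1)"
      using loc[of 1 y] by blast
    have "((\<lambda>h. \<bar>h\<bar> * (Hk_norm 1 (D (Suc 1) y) + 1)) \<longlongrightarrow> \<bar>0\<bar> * (Hk_norm 1 (D (Suc 1) y) + 1)) (at 0)"
      by (intro tendsto_intros)
    then have l0: "((\<lambda>h. \<bar>h\<bar> * (Hk_norm 1 (D (Suc 1) y) + 1)) \<longlongrightarrow> 0) (at 0)" by simp
    have "((\<lambda>h. Hk_norm 1 (D 1 (y + h)) - Hk_norm 1 (D 1 y)) \<longlongrightarrow> 0) (at 0)"
    proof (rule Lim_null_comparison[OF _ l0])
      show "\<forall>\<^sub>F h in at 0. norm (Hk_norm 1 (D 1 (y + h)) - Hk_norm 1 (D 1 y)) \<le> \<bar>h\<bar> * (Hk_norm 1 (D (Suc 1) y) + 1)"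
        unfolding eventually_at
      proof (intro exI[of _ d] conjI d(1) ballI impI)
        fix h :: real assume "h \<noteq> 0 \<and> dist h 0 < d"
        then have b: "Hk_norm 1 (\<lambda>x. D 1 (y + h) x - D 1 y x) \<le> \<bar>h\<bar> * (Hk_norm 1 (D (Suc 1) y) + 1)"
          using d(2) by (simp add: dist_real_def)
        have "Hk_norm 1 (\<lambda>x. - 1 * (D 1 (y + h) x - D 1 y x)) = \<bar>-1\<bar> * Hk_norm 1 (\<lambda>x. D 1 (y + h) x - D 1 y x)"
          by (rule Hk_1_scale(2)[OF Hk_1_diff[OF H1 H1]])
        then have "Hk_norm 1 (\<lambda>x. D 1 y x - D 1 (y + h) x) = Hk_norm 1 (\<lambda>x. D 1 (y + h) x - D 1 y x)"
          by simp
        then show "norm (Hk_norm 1 (D 1 (y + h)) - Hk_norm 1 (D 1 y)) \<le> \<bar>h\<bar> * (Hk_norm 1 (D (Suc 1) y) + 1)"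
          using Hk_norm_1_triangle[OF Hk_1_diff[OF H1 H1] H1, of 1 "y + h" 1 y 1 y]
            Hk_norm_1_triangle[OF Hk_1_diff[OF H1 H1] H1, of 1 y 1 "y + h" 1 "y + h"] b
          by (simp del: One_nat_def)
      qed
    qed
    then show ?thesis unfolding isCont_iff by (simp add: LIM_zero_iff)
  qed
  have lip: "\<exists>L\<ge>0. \<forall>x\<in>{0<..<pi}. \<forall>y z. \<bar>y\<bar> \<le> M \<longrightarrow> \<bar>z\<bar> \<le> M \<longrightarrow> \<bar>g x y - g x z\<bar> \<le> L * \<bar>y - z\<bar>" for M
  proof -
    have "compact ((\<lambda>y. Hk_norm 1 (D 1 y)) ` {- M..M})"
      by (intro compact_continuous_image continuous_at_imp_continuous_on ballI cont) auto
    then have "bounded ((\<lambda>y. Hk_norm 1 (D 1 y)) ` {- M..M})" by (rule compact_imp_bounded)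
    then obtain B0 where B0: "\<And>y. y \<in> {- M..M} \<Longrightarrow> norm (Hk_norm 1 (D 1 y)) \<le> B0"
      unfolding bounded_iff by blast
    define B where "B = max B0 0"
    have B: "B \<ge> 0" "\<And>y. y \<in> {- M..M} \<Longrightarrow> Hk_norm 1 (D 1 y) \<le> B"
      using B0 by (force simp: B_def)+
    define K where "K = 6 * (B + 1)"
    have K: "K \<ge> 0" using B by (simp add: K_def)
    have mono: "\<bar>g x z - g x y\<bar> \<le> K * (z - y)" if x: "x \<in> {0<..<pi}" and yz: "- M \<le> y" "y \<le> z" "z \<le> M" for x y z
    proof -
      have "- M \<le> y \<longrightarrow> z \<le> M \<longrightarrow> \<bar>g x z - g x y\<bar> \<le> K * (z - y)"
        using yz(2)
      proof (induction rule: Bolzano)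
        case (trans a b c)
        show ?case
        proof (intro impI)
          assume "- M \<le> a" "c \<le> M"
          then have "\<bar>g x b - g x a\<bar> \<le> K * (b - a)" "\<bar>g x c - g x b\<bar> \<le> K * (c - b)"
            using trans by auto
          then have "\<bar>g x c - g x a\<bar> \<le> K * (b - a) + K * (c - b)" by linarith
          then show "\<bar>g x c - g x a\<bar> \<le> K * (c - a)" by (simp add: algebra_simps)
        qed
      next
        case (local w)
        then have w: "w \<in> {- M..M}" using yz by auto
        obtain d where d: "d > 0" "\<And>h. \<bar>h\<bar> < d \<Longrightarrow>
            Hk_norm 1 (\<lambda>x. D 0 (w + h) x - D 0 w x) \<le> \<bar>h\<bar> * (Hk_norm 1 (D (Suc 0) w) + 1)"
          using loc[of 0 w] by blast
        have near: "\<bar>g x v - g x w\<bar> \<le> K * \<bar>v - w\<bar>" if "\<bar>v - w\<bar> < d" for v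
        proof -
          have "\<bar>g x v - g x w\<bar> \<le> 6 * Hk_norm 1 (\<lambda>x. g x v - g x w)"
            using H1[of 0] c x unfolding D0
            by (intro continuous_H1_sup_bound continuous_intros Hk_1_diff) auto
          also have "Hk_norm 1 (\<lambda>x. g x v - g x w) \<le> \<bar>v - w\<bar> * (Hk_norm 1 (D (Suc 0) w) + 1)"
            using d(2)[OF that] by (simp add: D0)
          also have "\<dots> \<le> \<bar>v - w\<bar> * (B + 1)"
            using B(2)[OF w] by (intro mult_left_mono) auto
          finally show ?thesis by (simp add: K_def algebra_simps)
        qed
        show ?case
        proof (intro exI[of _ d] conjI d(1) allI impI)
          fix a b assume ab: "a \<le> w \<and> w \<le> b \<and> b - a < d"
          then have "\<bar>g x b - g x w\<bar> \<le> K * (b - w)" "\<bar>g x a - g x w\<bar> \<le> K * (w - a)"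
            using near[of a] near[of b] by auto
          then have "\<bar>g x b - g x a\<bar> \<le> K * (b - w) + K * (w - a)" by linarith
          then show "\<bar>g x b - g x a\<bar> \<le> K * (b - a)" by (simp add: algebra_simps)
        qed
      qed
      then show ?thesis using yz by simp
    qed
    show ?thesis
    proof (intro exI[of _ K] conjI K ballI allI impI)
      fix x y z assume x: "x \<in> {0<..<pi}" and "\<bar>y\<bar> \<le> M" "\<bar>z\<bar> \<le> M"
      then show "\<bar>g x y - g x z\<bar> \<le> K * \<bar>y - z\<bar>"
        using mono[OF x, of y z] mono[OF x, of z y] by (cases "y \<le> z") (auto simp: abs_minus_commute)
    qed
  qed
  have zero: "g x 0 = 0" if x: "x \<in> {0<..<pi}" for x
  proof -
    define k where "k = (p - 2) div 2"
    have k: "k \<ge> 1" using p unfolding k_def by linarith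
    obtain C where C: "C > 0" "\<forall>\<^sub>F y in at 0. norm (Hk_norm 2 (\<lambda>x. g x y)) \<le> C * norm (\<bar>y\<bar> ^ k)"
      using landau_o.bigE[OF O[folded k_def]] by blast
    obtain L where L: "L \<ge> 0" "\<And>y z. \<bar>y\<bar> \<le> 1 \<Longrightarrow> \<bar>z\<bar> \<le> 1 \<Longrightarrow> \<bar>g x y - g x z\<bar> \<le> L * \<bar>y - z\<bar>"
      using lip[of 1] x by blast
    have "\<forall>\<^sub>F y in at 0. \<bar>y\<bar> < (1::real)"
      unfolding eventually_at by (intro exI[of _ 1]) (auto simp: dist_real_def)
    with C(2) have ev: "\<forall>\<^sub>F y in at 0. \<bar>g x 0\<bar> \<le> 6 * C * \<bar>y\<bar> ^ k + L * \<bar>y\<bar>"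
    proof eventually_elim
      case (elim y)
      have "\<bar>g x y\<bar> \<le> 6 * Hk_norm 1 (\<lambda>x. g x y)"
        using H1[of 0 y] c x unfolding D0 by (intro continuous_H1_sup_bound) auto
      also have "\<dots> \<le> 6 * Hk_norm 2 (\<lambda>x. g x y)" using Hk_norm_mono[of 1 2] by simp
      also have "\<dots> \<le> 6 * C * \<bar>y\<bar> ^ k" using elim(1) by (simp add: power_abs)
      finally have "\<bar>g x y\<bar> \<le> 6 * C * \<bar>y\<bar> ^ k" .
      moreover have "\<bar>g x 0 - g x y\<bar> \<le> L * \<bar>y\<bar>" using L(2)[of 0 y] elim by simp
      ultimately show ?case by linarith
    qed
    have "((\<lambda>y. 6 * C * \<bar>y\<bar> ^ k + L * \<bar>y\<bar>) \<longlongrightarrow> 6 * C * \<bar>0\<bar> ^ k + L * \<bar>0\<bar>) (at 0)"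
      by (intro tendsto_intros)
    then have "\<bar>g x 0\<bar> \<le> 6 * C * \<bar>0\<bar> ^ k + L * \<bar>0\<bar>"
      by (rule tendsto_lowerbound[OF _ ev]) simp
    moreover have "(0::real) ^ k = 0" using k by (simp add: power_0_left)
    ultimately show ?thesis by simp
  qed
  show ?thesis unfolding uniformly_Lipschitz_def using c zero lip by blast
qed

text \<open>Joint continuity makes the superposition with a Lebesgue measurable function measurable.\<close>

lemma jointly_continuous:
  fixes k :: "real \<Rightarrow> real \<Rightarrow> real"
  assumes c: "\<And>y. y \<in> Y \<Longrightarrow> continuous_on {0<..<pi} (\<lambda>x. k x y)"
    and L: "\<And>M. \<exists>L\<ge>0. \<forall>x\<in>{0<..<pi}. \<forall>y\<in>Y. \<forall>z\<in>Y. \<bar>y\<bar> \<le> M \<longrightarrow> \<bar>z\<bar> \<le> M \<longrightarrow> \<bar>k x y - k x z\<bar> \<le> L * \<bar>y - z\<bar>"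
  shows "continuous_on ({0<..<pi} \<times> Y) (\<lambda>(x, y). k x y)"
  unfolding continuous_on_def
proof safe
  fix x y :: real assume x: "x \<in> {0<..<pi}" and y: "y \<in> Y"
  let ?F = "at (x, y) within {0<..<pi} \<times> Y"
  obtain L where L: "L \<ge> 0"
      "\<And>x' z. x' \<in> {0<..<pi} \<Longrightarrow> z \<in> Y \<Longrightarrow> \<bar>z\<bar> \<le> \<bar>y\<bar> + 1 \<Longrightarrow> \<bar>k x' z - k x' y\<bar> \<le> L * \<bar>z - y\<bar>"
    using L[of "\<bar>y\<bar> + 1"] y by fastforce
  have fstlim: "(fst \<longlongrightarrow> x) ?F" and sndlim: "(snd \<longlongrightarrow> y) ?F"
    using tendsto_fst[OF tendsto_ident_at, of "(x, y)"] tendsto_snd[OF tendsto_ident_at, of "(x, y)"] by auto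
  have "((\<lambda>x'. k x' y) \<longlongrightarrow> k x y) (at x)"
    using c[OF y] x by (simp add: continuous_on_eq_continuous_at isCont_def)
  then have a: "((\<lambda>q. k (fst q) y) \<longlongrightarrow> k x y) ?F"
    by (rule isCont_tendsto_compose[OF _ fstlim, unfolded isCont_def])
  have "((\<lambda>q. L * \<bar>snd q - y\<bar>) \<longlongrightarrow> L * \<bar>y - y\<bar>) ?F" by (intro tendsto_intros sndlim)
  then have l0: "((\<lambda>q. L * \<bar>snd q - y\<bar>) \<longlongrightarrow> 0) ?F" by simp
  have "\<forall>\<^sub>F q in ?F. dist (snd q) y < 1" by (rule tendstoD[OF sndlim]) simp
  moreover have "\<forall>\<^sub>F q in ?F. q \<in> {0<..<pi} \<times> Y"
    by (simp add: eventually_at_filter)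
  ultimately have "\<forall>\<^sub>F q in ?F. norm (k (fst q) (snd q) - k (fst q) y) \<le> L * \<bar>snd q - y\<bar>"
  proof eventually_elim
    case (elim q)
    then show ?case by (auto simp: dist_real_def intro!: L(2))
  qed
  from Lim_null_comparison[OF this l0] a
  have "((\<lambda>q. (k (fst q) (snd q) - k (fst q) y) + k (fst q) y) \<longlongrightarrow> 0 + k x y) ?F"
    by (rule tendsto_add)
  then show "((\<lambda>(x, y). k x y) \<longlongrightarrow> k x y) ?F" by (simp add: case_prod_unfold)
qed

lemma jointly_continuous_measurable:
  fixes k :: "real \<Rightarrow> real \<Rightarrow> real"
  assumes k: "continuous_on ({0<..<pi} \<times> Y) (\<lambda>(x, y). k x y)"
    and w: "w \<in> borel_measurable \<mu>" "\<And>x. w x \<in> Y"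
  shows "(\<lambda>x. k x (w x)) \<in> borel_measurable \<mu>"
proof -
  have "(\<lambda>(x, y). k x y) \<in> borel_measurable (restrict_space borel ({0<..<pi} \<times> Y))"
    by (rule borel_measurable_continuous_on_restrict[OF k])
  moreover have "(\<lambda>x. (x, w x)) \<in> \<mu> \<rightarrow>\<^sub>M restrict_space borel ({0<..<pi} \<times> Y)"
  proof (rule measurable_restrict_space2)
    show "(\<lambda>x. (x, w x)) \<in> borel_measurable \<mu>"
      using w(1) id_borel_measurable_lebesgue_on[of "{0<..<pi}"]
      by (intro borel_measurable_Pair) (auto simp: id_def)
  qed (use w(2) in auto)
  ultimately have "(\<lambda>(x, y). k x y) \<circ> (\<lambda>x. (x, w x)) \<in> borel_measurable \<mu>"
    by (rule measurable_comp[rotated])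
  then show ?thesis by (simp add: comp_def)
qed

context
  fixes g :: "real \<Rightarrow> real \<Rightarrow> real"
  assumes g: "uniformly_Lipschitz g"
begin

lemma nl_Lipschitz:
  obtains L where "L \<ge> 0"
    "\<And>x y z. x \<in> {0<..<pi} \<Longrightarrow> \<bar>y\<bar> \<le> M \<Longrightarrow> \<bar>z\<bar> \<le> M \<Longrightarrow> \<bar>g x y - g x z\<bar> \<le> L * \<bar>y - z\<bar>"
    "\<And>x y. x \<in> {0<..<pi} \<Longrightarrow> \<bar>y\<bar> \<le> M \<Longrightarrow> \<bar>g x y\<bar> \<le> L * \<bar>y\<bar>"
proof -
  obtain L where L: "L \<ge> 0"
    "\<And>x y z. x \<in> {0<..<pi} \<Longrightarrow> \<bar>y\<bar> \<le> M \<Longrightarrow> \<bar>z\<bar> \<le> M \<Longrightarrow> \<bar>g x y - g x z\<bar> \<le> L * \<bar>y - z\<bar>"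
    using g unfolding uniformly_Lipschitz_def by metis
  have "\<bar>g x y\<bar> \<le> L * \<bar>y\<bar>" if "x \<in> {0<..<pi}" "\<bar>y\<bar> \<le> M" for x y
    using L(2)[OF that, of 0] that g by (auto simp: uniformly_Lipschitz_def)
  with L show ?thesis by (rule that)
qed

lemma nl_jointly_continuous: "continuous_on ({0<..<pi} \<times> UNIV) (\<lambda>(x, y). g x y)"
  using g by (intro jointly_continuous) (auto simp: uniformly_Lipschitz_def)

lemma nl_measurable: "w \<in> borel_measurable \<mu> \<Longrightarrow> (\<lambda>x. g x (w x)) \<in> borel_measurable \<mu>"
  by (rule jointly_continuous_measurable[OF nl_jointly_continuous]) auto

lemma nl_continuous: assumes "x \<in> {0<..<pi}" shows "continuous_on S (g x)"
proof -
  have "continuous_on S ((\<lambda>(x, y). g x y) \<circ> Pair x)"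
    using assms by (intro continuous_on_compose continuous_intros continuous_on_subset[OF nl_jointly_continuous]) auto
  then show ?thesis by (simp add: comp_def)
qed

lemma primitive_has_derivative:
  assumes x: "x \<in> {0<..<pi}" shows "(primitive g x has_real_derivative g x y) (at y)"
proof -
  have "((\<lambda>u. LBINT z=0..u. g x z) has_vector_derivative g x y) (at y within {- \<bar>y\<bar> - 1..\<bar>y\<bar> + 1})"
    using interval_integral_FTC2[of "- \<bar>y\<bar> - 1" 0 "\<bar>y\<bar> + 1" "g x" y] nl_continuous[OF x]
    by (simp add: zero_ereal_def)
  moreover have "at y within {- \<bar>y\<bar> - 1..\<bar>y\<bar> + 1} = at y" by (rule at_within_Icc_at) auto
  ultimately show ?thesis
    by (simp add: primitive_def[abs_def] has_real_derivative_iff_has_vector_derivative)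
qed

lemma primitive_0 [simp]: "primitive g x 0 = 0"
  by (simp add: primitive_def zero_ereal_def[symmetric])

text \<open>The mean value theorem with \<open>g x 0 = 0\<close>: on the amplitudes of size at most m the derivative is at most
  a multiple of m.\<close>

lemma primitive_Lipschitz:
  obtains L where "L \<ge> 0"
    "\<And>x y z. x \<in> {0<..<pi} \<Longrightarrow> \<bar>y\<bar> \<le> M \<Longrightarrow> \<bar>z\<bar> \<le> M \<Longrightarrow> \<bar>primitive g x y - primitive g x z\<bar> \<le> L * \<bar>y - z\<bar>"
    "\<And>x y. x \<in> {0<..<pi} \<Longrightarrow> \<bar>y\<bar> \<le> M \<Longrightarrow> \<bar>primitive g x y\<bar> \<le> L * y\<^sup>2"
proof -
  obtain L where L: "L \<ge> 0" "\<And>x y. x \<in> {0<..<pi} \<Longrightarrow> \<bar>y\<bar> \<le> M \<Longrightarrow> \<bar>g x y\<bar> \<le> L * \<bar>y\<bar>"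
    using nl_Lipschitz[of M] by metis
  have mv: "\<bar>primitive g x y - primitive g x z\<bar> \<le> (L * m) * \<bar>y - z\<bar>"
    if "x \<in> {0<..<pi}" "\<bar>y\<bar> \<le> m" "\<bar>z\<bar> \<le> m" "m \<le> M" for x y z m
  proof -
    have "norm (primitive g x y - primitive g x z) \<le> (L * m) * norm (y - z)"
    proof (rule field_differentiable_bound[where S="{- m..m}" and f'="g x"])
      show "(primitive g x has_real_derivative g x u) (at u within {- m..m})" for u
        by (rule has_field_derivative_at_within[OF primitive_has_derivative[OF that(1)]])
      fix u assume "u \<in> {- m..m}"
      then have "\<bar>u\<bar> \<le> m" by auto
      then have "\<bar>g x u\<bar> \<le> L * \<bar>u\<bar>" "L * \<bar>u\<bar> \<le> L * m"
        using L(2)[of x u] L(1) that by (auto intro: mult_left_mono)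
      then show "norm (g x u) \<le> L * m" by simp
    qed (use that in auto)
    then show ?thesis by simp
  qed
  show ?thesis
  proof (rule that[of "L * (1 + \<bar>M\<bar>)"])
    show "0 \<le> L * (1 + \<bar>M\<bar>)" using L by simp
    show "\<bar>primitive g x y - primitive g x z\<bar> \<le> L * (1 + \<bar>M\<bar>) * \<bar>y - z\<bar>"
      if "x \<in> {0<..<pi}" "\<bar>y\<bar> \<le> M" "\<bar>z\<bar> \<le> M" for x y z
    proof -
      have "L * M \<le> L * (1 + \<bar>M\<bar>)" using L(1) by (intro mult_left_mono) auto
      then show ?thesis using mv[OF that order_refl] mult_right_mono[of "L * M" "L * (1 + \<bar>M\<bar>)" "\<bar>y - z\<bar>"] by simp
    qed
    show "\<bar>primitive g x y\<bar> \<le> L * (1 + \<bar>M\<bar>) * y\<^sup>2" if "x \<in> {0<..<pi}" "\<bar>y\<bar> \<le> M" for x y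
    proof -
      have "\<bar>primitive g x y\<bar> \<le> (L * \<bar>y\<bar>) * \<bar>y\<bar>" using mv[OF that(1), of y "\<bar>y\<bar>" 0] that by simp
      also have "\<dots> = L * y\<^sup>2" by (simp add: power2_eq_square)
      also have "\<dots> \<le> L * (1 + \<bar>M\<bar>) * y\<^sup>2" using L(1) by (intro mult_right_mono mult_left_le) (auto simp: distrib_left)
      finally show ?thesis .
    qed
  qed
qed

lemma primitive_measurable:
  assumes w: "w \<in> borel_measurable \<mu>" "\<And>x. 0 \<le> w x"
  shows "(\<lambda>x. primitive g x (w x)) \<in> borel_measurable \<mu>"
proof (rule jointly_continuous_measurable[where k="primitive g" and w=w and Y="{0..}"])
  show "continuous_on ({0<..<pi} \<times> {0..}) (\<lambda>(x, y). primitive g x y)"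
  proof (rule jointly_continuous)
    fix y :: real assume "y \<in> {0..}"
    then have y: "0 \<le> y" by simp
    have "continuous_on {0<..<pi} (\<lambda>x. integral (cbox 0 y) (g x))"
      by (intro integral_continuous_on_param continuous_on_subset[OF nl_jointly_continuous]) auto
    moreover have "integral (cbox 0 y) (g x) = primitive g x y" if "x \<in> {0<..<pi}" for x
      using interval_integral_eq_integral[OF y borel_integrable_atLeastAtMost'[OF nl_continuous[OF that]]]
      by (simp add: primitive_def zero_ereal_def)
    ultimately show "continuous_on {0<..<pi} (\<lambda>x. primitive g x y)"
      using continuous_on_cong[OF refl, of "{0<..<pi}" "\<lambda>x. integral (cbox 0 y) (g x)" "\<lambda>x. primitive g x y"] by auto
  next
    fix M
    obtain L where "L \<ge> 0"
      "\<And>x y z. x \<in> {0<..<pi} \<Longrightarrow> \<bar>y\<bar> \<le> M \<Longrightarrow> \<bar>z\<bar> \<le> M \<Longrightarrow> \<bar>primitive g x y - primitive g x z\<bar> \<le> L * \<bar>y - z\<bar>"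
      using primitive_Lipschitz[of M] by metis
    then show "\<exists>L\<ge>0. \<forall>x\<in>{0<..<pi}. \<forall>y\<in>{0..}. \<forall>z\<in>{0..}. \<bar>y\<bar> \<le> M \<longrightarrow> \<bar>z\<bar> \<le> M \<longrightarrow>
        \<bar>primitive g x y - primitive g x z\<bar> \<le> L * \<bar>y - z\<bar>" by blast
  qed
qed (use w in auto)

end

section \<open>Spectral expansions\<close>

lemma eigen_coeff_cong_AE:
  assumes "AE x in \<mu>. u x = v x" "u \<in> borel_measurable \<mu>" "v \<in> borel_measurable \<mu>" "f n \<in> borel_measurable \<mu>"
  shows "eigen_coeff f u n = eigen_coeff f v n"
  unfolding eigen_coeff_def using assms
  by (intro integral_cong_AE borel_measurable_times borel_measurable_of_real) (auto elim: eventually_mono)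

locale dirichlet =
  fixes V :: "real \<Rightarrow> real" and lam :: "nat \<Rightarrow> real" and f :: "nat \<Rightarrow> real \<Rightarrow> real" and \<rho> :: real
  assumes V_Linf: "V \<in> Linf" and V_bound: "Linf_norm V \<le> ereal \<rho>" and \<rho>_pos: "\<rho> > 0"
    and spectrum: "dirichlet_spectrum V lam f"
begin

text \<open>The shift by \<rho> + 1 makes the potential at least 1, so that the shifted quadratic form
  \<open>energy\<close> is equivalent to the square of the Sobolev norm.\<close>

abbreviation W :: "real \<Rightarrow> real" where "W x \<equiv> V x + (\<rho> + 1)"

definition Lam :: "nat \<Rightarrow> real" where "Lam n = lam n + (\<rho> + 1)"

definition form :: "(real \<Rightarrow> complex) \<Rightarrow> (real \<Rightarrow> complex) \<Rightarrow> (real \<Rightarrow> complex) \<Rightarrow> (real \<Rightarrow> complex) \<Rightarrow> complex" where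
  "form u u' w w' = (LINT x|\<mu>. u' x * w' x) + (LINT x|\<mu>. complex_of_real (W x) * u x * w x)"

definition energy :: "(real \<Rightarrow> complex) \<Rightarrow> (real \<Rightarrow> complex) \<Rightarrow> real" where
  "energy u u' = (LINT x|\<mu>. (cmod (u' x))\<^sup>2) + (LINT x|\<mu>. W x * (cmod (u x))\<^sup>2)"

text \<open>The continuous representatives of the eigenfunctions and of their derivatives.\<close>

definition ef :: "nat \<Rightarrow> real \<Rightarrow> real" where "ef n = antideriv (weak_deriv (f n))"
definition ec :: "nat \<Rightarrow> real \<Rightarrow> complex" where "ec n x = complex_of_real (ef n x)"
definition ec' :: "nat \<Rightarrow> real \<Rightarrow> complex" where "ec' n x = complex_of_real (weak_deriv (f n) x)"

abbreviation coef :: "(real \<Rightarrow> complex) \<Rightarrow> nat \<Rightarrow> complex" where "coef \<equiv> eigen_coeff f"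

lemma V_measurable [measurable]: "V \<in> borel_measurable \<mu>"
  using V_Linf by (simp add: Linf_def)

lemma V_AE_bound: "AE x in \<mu>. \<bar>V x\<bar> \<le> \<rho>"
proof -
  have "AE x in \<mu>. ereal \<bar>V x\<bar> \<le> Linf_norm V" unfolding Linf_norm_def by (rule esssup_AE)
  then show ?thesis
  proof eventually_elim
    case (elim x)
    then have "ereal \<bar>V x\<bar> \<le> ereal \<rho>" using V_bound order_trans by blast
    then show ?case by simp
  qed
qed

lemma W_AE: "AE x in \<mu>. 1 \<le> W x \<and> W x \<le> 2 * \<rho> + 1"
  using V_AE_bound by eventually_elim auto

lemma W_mult_L2:
  fixes u :: "real \<Rightarrow> complex"
  assumes "u \<in> L2"
  shows "(\<lambda>x. complex_of_real (W x) * u x) \<in> L2"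
    "L2_norm (\<lambda>x. complex_of_real (W x) * u x) \<le> (2 * \<rho> + 1) * L2_norm u"
proof -
  have m: "(\<lambda>x. complex_of_real (W x) * u x) \<in> borel_measurable \<mu>" using assms by simp
  have b: "AE x in \<mu>. norm (complex_of_real (W x) * u x) \<le> (2 * \<rho> + 1) * norm (u x)"
    using W_AE by eventually_elim (auto simp: norm_mult simp flip: of_real_add intro!: mult_right_mono)
  show "(\<lambda>x. complex_of_real (W x) * u x) \<in> L2" by (rule L2_dominated(1)[OF assms m b])
  show "L2_norm (\<lambda>x. complex_of_real (W x) * u x) \<le> (2 * \<rho> + 1) * L2_norm u"
    using L2_dominated(2)[OF assms m b] \<rho>_pos by simp
qed

lemma W_square_integrable:
  fixes u :: "real \<Rightarrow> complex"
  assumes "u \<in> L2" shows "integrable \<mu> (\<lambda>x. W x * (cmod (u x))\<^sup>2)"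
proof (rule Bochner_Integration.integrable_bound)
  show "integrable \<mu> (\<lambda>x. (2 * \<rho> + 1) * (cmod (u x))\<^sup>2)" using assms by simp
  show "(\<lambda>x. W x * (cmod (u x))\<^sup>2) \<in> borel_measurable \<mu>" using assms by simp
  show "AE x in \<mu>. norm (W x * (cmod (u x))\<^sup>2) \<le> norm ((2 * \<rho> + 1) * (cmod (u x))\<^sup>2)"
    using W_AE by eventually_elim (auto simp: abs_mult intro!: mult_right_mono)
qed

lemma energy_bounds:
  fixes u :: "real \<Rightarrow> complex"
  assumes "H1_pair u u'"
  shows "(Hk_norm 1 u)\<^sup>2 \<le> energy u u'" "energy u u' \<le> (2 * \<rho> + 1) * (Hk_norm 1 u)\<^sup>2"
    "(L2_norm u)\<^sup>2 \<le> energy u u'" "(L2_norm u')\<^sup>2 \<le> energy u u'" "0 \<le> energy u u'"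
proof -
  note L = H1_pair_D(1,2)[OF assms]
  have h: "(Hk_norm 1 u)\<^sup>2 = (L2_norm u)\<^sup>2 + (L2_norm u')\<^sup>2"
    unfolding H1_pair_norm[OF assms] by simp
  have "(L2_norm u)\<^sup>2 \<le> (LINT x|\<mu>. W x * (cmod (u x))\<^sup>2)"
    unfolding L2_norm_sq
    by (rule integral_mono_AE[OF L2_D(2)[OF L(1)] W_square_integrable[OF L(1)]])
      (use W_AE in \<open>eventually_elim, auto simp: mult_le_cancel_right1 intro!: mult_right_mono[of 1, simplified]\<close>)
  then show 1: "(Hk_norm 1 u)\<^sup>2 \<le> energy u u'" unfolding h energy_def by (simp add: L2_norm_sq)
  have "(LINT x|\<mu>. W x * (cmod (u x))\<^sup>2) \<le> (LINT x|\<mu>. (2 * \<rho> + 1) * (cmod (u x))\<^sup>2)"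
  proof (rule integral_mono_AE[OF W_square_integrable[OF L(1)]])
    show "AE x in \<mu>. W x * (cmod (u x))\<^sup>2 \<le> (2 * \<rho> + 1) * (cmod (u x))\<^sup>2"
      using W_AE by eventually_elim (rule mult_right_mono, auto)
  qed (use L in auto)
  also have "\<dots> = (2 * \<rho> + 1) * (L2_norm u)\<^sup>2" by (simp add: L2_norm_sq)
  finally show "energy u u' \<le> (2 * \<rho> + 1) * (Hk_norm 1 u)\<^sup>2"
    unfolding h energy_def L2_norm_sq[of u', symmetric] distrib_left
    using \<rho>_pos mult_right_mono[of 1 "2 * \<rho> + 1" "(L2_norm u')\<^sup>2"] by simp
  show "(L2_norm u)\<^sup>2 \<le> energy u u'" "(L2_norm u')\<^sup>2 \<le> energy u u'" "0 \<le> energy u u'"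
    using 1 unfolding h by (smt (verit) zero_le_power2)+
qed

lemma f_props:
  assumes "n \<ge> 1"
  shows "H10_pair (f n) (weak_deriv (f n))" "H1_pair (weak_deriv (f n)) (weak_deriv (weak_deriv (f n)))"
    "AE x in \<mu>. - weak_deriv (weak_deriv (f n)) x + V x * f n x = lam n * f n x"
    "\<And>m. m \<ge> 1 \<Longrightarrow> (LINT x|\<mu>. f m x * f n x) = (if m = n then 1 else 0)"
proof -
  have n: "f n \<in> Hk 2" "f n \<in> H10" using spectrum assms by (auto simp: dirichlet_spectrum_def)
  show "H10_pair (f n) (weak_deriv (f n))" using n(2) by (simp add: H10_iff)
  show "H1_pair (weak_deriv (f n)) (weak_deriv (weak_deriv (f n)))" using Hk_ge_2_D(2)[OF n(1)] by simp
  show "AE x in \<mu>. - weak_deriv (weak_deriv (f n)) x + V x * f n x = lam n * f n x"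
    using spectrum assms by (auto simp: dirichlet_spectrum_def numeral_2_eq_2)
  show "\<And>m. m \<ge> 1 \<Longrightarrow> (LINT x|\<mu>. f m x * f n x) = (if m = n then 1 else 0)"
    using spectrum assms by (auto simp: dirichlet_spectrum_def)
qed

lemma f_L2: "n \<ge> 1 \<Longrightarrow> f n \<in> L2" "n \<ge> 1 \<Longrightarrow> weak_deriv (f n) \<in> L2"
  using f_props(1) H10_pair_L2 by blast+

lemma ef_AE: "n \<ge> 1 \<Longrightarrow> AE x in \<mu>. f n x = ef n x"
  unfolding ef_def by (rule H10_AE_antideriv[OF f_props(1)])

lemma ef_L2: "n \<ge> 1 \<Longrightarrow> ef n \<in> L2"
  unfolding ef_def by (rule antideriv_L2[OF f_L2(2)])

lemma ec_L2: "n \<ge> 1 \<Longrightarrow> ec n \<in> L2" "n \<ge> 1 \<Longrightarrow> ec' n \<in> L2"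
  using L2_bounded_linear[OF bounded_linear_of_real ef_L2]
    L2_bounded_linear[OF bounded_linear_of_real f_L2(2)]
  unfolding ec_def[abs_def] ec'_def[abs_def] by blast+

lemma ef_bounded: "n \<ge> 1 \<Longrightarrow> \<bar>ef n x\<bar> \<le> sqrt pi * L2_norm (weak_deriv (f n))"
  unfolding ef_def using antideriv_norm_le[OF f_L2(2)] by simp

lemma ec_antideriv: assumes "n \<ge> 1" shows "ec n x = antideriv (ec' n) x"
proof -
  have "antideriv (ec' n) x = (LINT y|\<mu>. complex_of_real (indicator {..x} y *\<^sub>R weak_deriv (f n) y))"
    unfolding antideriv_def ec'_def by (simp add: scaleR_conv_of_real)
  also have "\<dots> = complex_of_real (antideriv (weak_deriv (f n)) x)"
    unfolding antideriv_def by (rule integral_complex_of_real)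
  finally show ?thesis by (simp add: ec_def ef_def)
qed

lemma ec_pair: assumes "n \<ge> 1" shows "H10_pair (ec n) (ec' n)"
proof -
  have p: "H10_pair (\<lambda>x. complex_of_real (f n x)) (ec' n)"
    using H10_pair_bounded_linear[OF f_props(1)[OF assms] bounded_linear_of_real]
    unfolding ec'_def[abs_def] .
  show ?thesis
    by (rule H10_pair_cong_AE[OF p])
      (use ef_AE[OF assms] ec_L2[OF assms] in \<open>auto simp: ec_def elim: eventually_mono\<close>)
qed

lemma coef_ec: assumes "u \<in> L2" "n \<ge> 1" shows "coef u n = (LINT x|\<mu>. u x * ec n x)"
  unfolding eigen_coeff_def
proof (rule integral_cong_AE)
  show "AE x in \<mu>. u x * complex_of_real (f n x) = u x * ec n x"
    using ef_AE[OF assms(2)] by eventually_elim (simp add: ec_def)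
qed (use assms ec_L2 f_L2 in auto)

lemma ef_orthonormal:
  assumes "m \<ge> 1" "n \<ge> 1" shows "(LINT x|\<mu>. ef m x * ef n x) = (if m = n then 1 else 0)"
proof -
  have "(LINT x|\<mu>. ef m x * ef n x) = (LINT x|\<mu>. f m x * f n x)"
  proof (rule integral_cong_AE)
    show "AE x in \<mu>. ef m x * ef n x = f m x * f n x"
      using ef_AE[OF assms(1)] ef_AE[OF assms(2)] by eventually_elim simp
  qed (use assms ef_L2 f_L2 in auto)
  then show ?thesis using f_props(4)[OF assms(2,1)] by simp
qed

lemma coef_ec_ec: assumes "m \<ge> 1" "n \<ge> 1" shows "coef (ec m) n = (if m = n then 1 else 0)"
proof -
  have "coef (ec m) n = (LINT x|\<mu>. complex_of_real (ef m x * ef n x))"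
    unfolding coef_ec[OF ec_L2(1)[OF assms(1)] assms(2)] by (simp add: ec_def)
  also have "\<dots> = complex_of_real (LINT x|\<mu>. ef m x * ef n x)" by (rule integral_complex_of_real)
  finally show ?thesis using ef_orthonormal[OF assms] by simp
qed

lemma coef_diff: assumes "u \<in> L2" "v \<in> L2" "n \<ge> 1" shows "coef (\<lambda>x. u x - v x) n = coef u n - coef v n"
  unfolding coef_ec[OF L2_diff(1)[OF assms(1,2)] assms(3)] coef_ec[OF assms(1,3)] coef_ec[OF assms(2,3)]
  using L2_mult_integrable[OF assms(1) ec_L2(1)[OF assms(3)]] L2_mult_integrable[OF assms(2) ec_L2(1)[OF assms(3)]]
  by (simp add: left_diff_distrib)

lemma coef_cmult: assumes "u \<in> L2" "n \<ge> 1" shows "coef (\<lambda>x. c * u x) n = c * coef u n"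
  unfolding coef_ec[OF L2_cmult[OF assms(1)] assms(2)] coef_ec[OF assms]
  by (simp add: mult.assoc)

lemma coef_le: assumes "u \<in> L2" "n \<ge> 1" shows "cmod (coef u n) \<le> L2_norm u"
proof -
  have "L2_norm (ec n) = 1"
    using ef_orthonormal[OF assms(2,2)] by (simp add: L2_norm_def ec_def power2_eq_square)
  then show ?thesis
    using L2_Cauchy_Schwarz[OF assms(1) ec_L2(1)[OF assms(2)]] by (simp add: coef_ec[OF assms])
qed

text \<open>Integration by parts of the eigenvalue equation: the boundary terms vanish with u. It makes the
  eigenfunctions orthogonal for the form as well.\<close>

lemma form_eigen:
  assumes u: "H10_pair u u'" and n: "n \<ge> 1"
  shows "form u u' (ec n) (ec' n) = of_real (Lam n) * coef u n"
proof -
  define d where "d x = complex_of_real (weak_deriv (weak_deriv (f n)) x)" for x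
  have z: "H1_pair (ec' n) d"
    unfolding ec'_def[abs_def] d_def[abs_def]
    by (rule H1_pair_bounded_linear[OF f_props(2)[OF n] bounded_linear_of_real])
  note U = H10_pair_L2[OF u] and E = ec_L2[OF n] and D = H1_pair_D(2)[OF z]
  have "form u u' (ec n) (ec' n) = - (LINT x|\<mu>. u x * d x) + (LINT x|\<mu>. complex_of_real (W x) * u x * ec n x)"
    unfolding form_def H10_integration_by_parts[OF u z] ..
  also have "\<dots> = (LINT x|\<mu>. - (u x * d x) + complex_of_real (W x) * u x * ec n x)"
    using L2_mult_integrable[OF U(1) D] L2_mult_integrable[OF W_mult_L2(1)[OF U(1)] E(1)] by simp
  also have "\<dots> = (LINT x|\<mu>. of_real (Lam n) * (u x * ec n x))"
  proof (rule integral_cong_AE)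
    show "AE x in \<mu>. - (u x * d x) + complex_of_real (W x) * u x * ec n x = of_real (Lam n) * (u x * ec n x)"
      using f_props(3)[OF n] ef_AE[OF n]
    proof eventually_elim
      case (elim x)
      then have *: "weak_deriv (weak_deriv (f n)) x = (V x - lam n) * ef n x" by (simp add: algebra_simps)
      show ?case unfolding d_def ec_def Lam_def * by (simp add: algebra_simps)
    qed
  qed (use U E D in auto)
  also have "\<dots> = of_real (Lam n) * coef u n" by (simp add: coef_ec[OF U(1) n])
  finally show ?thesis .
qed

lemma energy_ec: assumes n: "n \<ge> 1" shows "energy (ec n) (ec' n) = Lam n"
proof -
  have "complex_of_real (energy (ec n) (ec' n)) = form (ec n) (ec' n) (ec n) (ec' n)"
    unfolding energy_def form_def of_real_add integral_complex_of_real[symmetric]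
    by (simp add: ec_def ec'_def power2_eq_square mult.assoc)
  then show ?thesis using form_eigen[OF ec_pair[OF n] n] coef_ec_ec[OF n n] by simp
qed

lemma Lam_ge_1: assumes "n \<ge> 1" shows "1 \<le> Lam n"
proof -
  have "1 = (L2_norm (ec n))\<^sup>2"
    using ef_orthonormal[OF assms assms] by (simp add: L2_norm_def ec_def power2_eq_square)
  also have "\<dots> \<le> Lam n"
    using energy_bounds(3)[OF H10_pair_H1[OF ec_pair[OF assms]]] energy_ec[OF assms] by simp
  finally show ?thesis .
qed

lemma Lam_mono: "1 \<le> m \<Longrightarrow> m \<le> n \<Longrightarrow> Lam m \<le> Lam n"
  using spectrum unfolding dirichlet_spectrum_def Lam_def
  by (cases "m = n") (auto dest!: strict_mono_onD[of _ _ m n])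

lemma norm_sq_diff_real_multiple:
  "(cmod (r - a * complex_of_real y))\<^sup>2
     = (cmod r)\<^sup>2 - 2 * Re (cnj a * (r * complex_of_real y)) + (cmod a)\<^sup>2 * y\<^sup>2"
  unfolding cmod_power2 by (simp add: algebra_simps power2_eq_square)

lemma integral_expanded_square:
  assumes "integrable \<mu> A" "integrable \<mu> B" "integrable \<mu> C"
  shows "(LINT x|\<mu>. A x - 2 * Re (k * B x) + m * C x)
    = (LINT x|\<mu>. A x) - 2 * Re (k * (LINT x|\<mu>. B x)) + (m :: real) * (LINT x|\<mu>. C x)"
proof -
  define h where "h x = k * B x" for x
  have h: "integrable \<mu> h" unfolding h_def using assms(2) by simp
  have "(LINT x|\<mu>. A x - 2 * Re (h x) + m * C x)
      = (LINT x|\<mu>. A x) - 2 * (LINT x|\<mu>. Re (h x)) + m * (LINT x|\<mu>. C x)"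
    using assms integrable_Re[OF h] by simp
  moreover have "(LINT x|\<mu>. Re (h x)) = Re (k * (LINT x|\<mu>. B x))"
    using integral_Re[OF h] by (simp add: h_def[abs_def])
  ultimately show ?thesis by (simp add: h_def)
qed

lemma L2_norm_sq_step:
  assumes "r \<in> L2" "n \<ge> 1"
  shows "(L2_norm (\<lambda>x. r x - a * ec n x))\<^sup>2 = (L2_norm r)\<^sup>2 - 2 * Re (cnj a * coef r n) + (cmod a)\<^sup>2"
proof -
  note i = L2_mult_integrable[OF assms(1) ec_L2(1)[OF assms(2)]]
  have i2: "integrable \<mu> (\<lambda>x. (ef n x)\<^sup>2)" using L2_D(2)[OF ef_L2[OF assms(2)]] by simp
  have "(L2_norm (\<lambda>x. r x - a * ec n x))\<^sup>2
      = (LINT x|\<mu>. (cmod (r x))\<^sup>2 - 2 * Re (cnj a * (r x * ec n x)) + (cmod a)\<^sup>2 * (ef n x)\<^sup>2)"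
    unfolding L2_norm_sq by (simp add: ec_def norm_sq_diff_real_multiple)
  also have "\<dots> = (L2_norm r)\<^sup>2 - 2 * Re (cnj a * coef r n) + (cmod a)\<^sup>2 * (LINT x|\<mu>. (ef n x)\<^sup>2)"
    unfolding integral_expanded_square[OF L2_D(2)[OF assms(1)] i i2] L2_norm_sq coef_ec[OF assms] ..
  also have "(LINT x|\<mu>. (ef n x)\<^sup>2) = 1" using ef_orthonormal[OF assms(2,2)] by (simp add: power2_eq_square)
  finally show ?thesis by simp
qed

lemma energy_step:
  assumes r: "H10_pair r r'" and n: "n \<ge> 1"
  shows "energy (\<lambda>x. r x - a * ec n x) (\<lambda>x. r' x - a * ec' n x)
     = energy r r' - 2 * Lam n * Re (cnj a * coef r n) + Lam n * (cmod a)\<^sup>2"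
proof -
  note R = H10_pair_L2[OF r] and E = ec_L2[OF n]
  define y where "y = weak_deriv (f n)"
  have y: "y \<in> L2" unfolding y_def by (rule f_L2[OF n])
  have ec'y: "ec' n x = complex_of_real (y x)" for x by (simp add: ec'_def y_def)
  note i = L2_mult_integrable[OF R(2) E(2)] L2_mult_integrable[OF W_mult_L2(1)[OF R(1)] E(1)]
  have i2: "integrable \<mu> (\<lambda>x. (y x)\<^sup>2)" using L2_D(2)[OF y] by simp
  have i3: "integrable \<mu> (\<lambda>x. W x * (ef n x)\<^sup>2)" using W_square_integrable[OF E(1)] by (simp add: ec_def)
  have A: "(LINT x|\<mu>. (cmod (r' x - a * ec' n x))\<^sup>2)
      = (LINT x|\<mu>. (cmod (r' x))\<^sup>2) - 2 * Re (cnj a * (LINT x|\<mu>. r' x * ec' n x)) + (cmod a)\<^sup>2 * (LINT x|\<mu>. (y x)\<^sup>2)"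
  proof -
    have "(LINT x|\<mu>. (cmod (r' x - a * ec' n x))\<^sup>2)
      = (LINT x|\<mu>. (cmod (r' x))\<^sup>2 - 2 * Re (cnj a * (r' x * ec' n x)) + (cmod a)\<^sup>2 * (y x)\<^sup>2)"
      by (simp only: ec'y norm_sq_diff_real_multiple)
    also have "\<dots> = (LINT x|\<mu>. (cmod (r' x))\<^sup>2) - 2 * Re (cnj a * (LINT x|\<mu>. r' x * ec' n x))
        + (cmod a)\<^sup>2 * (LINT x|\<mu>. (y x)\<^sup>2)"
      by (rule integral_expanded_square[OF L2_D(2)[OF R(2)] i(1) i2])
    finally show ?thesis .
  qed
  have B: "(LINT x|\<mu>. W x * (cmod (r x - a * ec n x))\<^sup>2)
      = (LINT x|\<mu>. W x * (cmod (r x))\<^sup>2) - 2 * Re (cnj a * (LINT x|\<mu>. complex_of_real (W x) * r x * ec n x))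
        + (cmod a)\<^sup>2 * (LINT x|\<mu>. W x * (ef n x)\<^sup>2)"
  proof -
    have "W x * (cmod (r x - a * ec n x))\<^sup>2 = W x * (cmod (r x))\<^sup>2
        - 2 * Re (cnj a * (complex_of_real (W x) * r x * ec n x)) + (cmod a)\<^sup>2 * (W x * (ef n x)\<^sup>2)" for x
    proof -
      have "Re (cnj a * (complex_of_real (W x) * r x * ec n x)) = W x * Re (cnj a * (r x * ec n x))"
        using Re_complex_of_real by (simp add: ec_def algebra_simps)
      then show ?thesis unfolding ec_def norm_sq_diff_real_multiple by (simp only: ring_distribs mult_ac)
    qed
    then have "(LINT x|\<mu>. W x * (cmod (r x - a * ec n x))\<^sup>2) = (LINT x|\<mu>. W x * (cmod (r x))\<^sup>2
        - 2 * Re (cnj a * (complex_of_real (W x) * r x * ec n x)) + (cmod a)\<^sup>2 * (W x * (ef n x)\<^sup>2))"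
      by (simp only:)
    also have "\<dots> = (LINT x|\<mu>. W x * (cmod (r x))\<^sup>2)
        - 2 * Re (cnj a * (LINT x|\<mu>. complex_of_real (W x) * r x * ec n x))
        + (cmod a)\<^sup>2 * (LINT x|\<mu>. W x * (ef n x)\<^sup>2)"
      by (rule integral_expanded_square[OF W_square_integrable[OF R(1)] i(2) i3])
    finally show ?thesis .
  qed
  have Q: "(LINT x|\<mu>. (y x)\<^sup>2) + (LINT x|\<mu>. W x * (ef n x)\<^sup>2) = Lam n"
    using energy_ec[OF n] unfolding energy_def ec'y by (simp add: ec_def)
  have F: "(LINT x|\<mu>. r' x * ec' n x) + (LINT x|\<mu>. complex_of_real (W x) * r x * ec n x) = of_real (Lam n) * coef r n"
    using form_eigen[OF r n] by (simp add: form_def)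
  have "energy (\<lambda>x. r x - a * ec n x) (\<lambda>x. r' x - a * ec' n x) = energy r r'
      - 2 * Re (cnj a * ((LINT x|\<mu>. r' x * ec' n x) + (LINT x|\<mu>. complex_of_real (W x) * r x * ec n x)))
      + (cmod a)\<^sup>2 * ((LINT x|\<mu>. (y x)\<^sup>2) + (LINT x|\<mu>. W x * (ef n x)\<^sup>2))"
    unfolding energy_def A B by (simp add: algebra_simps)
  also have "\<dots> = energy r r' - 2 * Lam n * Re (cnj a * coef r n) + Lam n * (cmod a)\<^sup>2"
    unfolding Q F by (simp add: algebra_simps)
  finally show ?thesis .
qed

text \<open>The second sum is the derivative of the first, with the representatives of the derivatives that belong
  to the eigenfunctions.\<close>

definition psum :: "(nat \<Rightarrow> complex) \<Rightarrow> nat \<Rightarrow> real \<Rightarrow> complex" where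
  "psum a N x = (\<Sum>n=1..N. a n * ec n x)"

definition psum' :: "(nat \<Rightarrow> complex) \<Rightarrow> nat \<Rightarrow> real \<Rightarrow> complex" where
  "psum' a N x = (\<Sum>n=1..N. a n * ec' n x)"

lemma psum_pair: "H10_pair (psum a N) (psum' a N)"
  unfolding psum_def[abs_def] psum'_def[abs_def]
  by (intro H10_pair_sum H10_pair_cmult ec_pair) auto

lemma psum_L2: "psum a N \<in> L2" "psum' a N \<in> L2"
  using H10_pair_L2[OF psum_pair] by auto

lemma coef_psum: assumes "m \<ge> 1" shows "coef (psum a N) m = (if m \<le> N then a m else 0)"
proof -
  have "coef (psum a N) m = (LINT x|\<mu>. (\<Sum>n=1..N. a n * (ec n x * ec m x)))"
    unfolding coef_ec[OF psum_L2(1) assms] by (simp add: psum_def sum_distrib_right mult.assoc)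
  also have "\<dots> = (\<Sum>n=1..N. LINT x|\<mu>. a n * (ec n x * ec m x))"
    using L2_mult_integrable[OF ec_L2(1) ec_L2(1)] assms
    by (intro Bochner_Integration.integral_sum integrable_mult_right) auto
  also have "\<dots> = (\<Sum>n=1..N. a n * coef (ec n) m)"
    using coef_ec[OF ec_L2(1) assms] by (intro sum.cong) auto
  also have "\<dots> = (\<Sum>n=1..N. if n = m then a m else 0)"
    using coef_ec_ec assms by (intro sum.cong) auto
  finally show ?thesis using assms by simp
qed

lemma psum_Suc: "psum a (Suc N) x = psum a N x + a (Suc N) * ec (Suc N) x"
  "psum' a (Suc N) x = psum' a N x + a (Suc N) * ec' (Suc N) x"
  by (simp_all add: psum_def psum'_def)

lemma L2_norm_sq_psum:
  assumes "u \<in> L2"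
  shows "(L2_norm (\<lambda>x. u x - psum a N x))\<^sup>2
    = (L2_norm u)\<^sup>2 + (\<Sum>n=1..N. (cmod (a n))\<^sup>2 - 2 * Re (cnj (a n) * coef u n))"
proof (induction N)
  case 0 then show ?case by (simp add: psum_def)
next
  case (Suc N)
  have c: "coef (\<lambda>x. u x - psum a N x) (Suc N) = coef u (Suc N)"
    by (subst coef_diff[OF assms psum_L2(1)]) (simp_all add: coef_psum)
  have "(\<lambda>x. u x - psum a (Suc N) x) = (\<lambda>x. (u x - psum a N x) - a (Suc N) * ec (Suc N) x)"
    by (simp add: psum_Suc fun_eq_iff algebra_simps)
  then show ?case
    using L2_norm_sq_step[OF L2_diff(1)[OF assms psum_L2(1)[of a N]], of "Suc N" "a (Suc N)"] Suc
    unfolding c by simp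
qed

lemma energy_psum:
  assumes "H10_pair u u'"
  shows "energy (\<lambda>x. u x - psum a N x) (\<lambda>x. u' x - psum' a N x)
    = energy u u' + (\<Sum>n=1..N. Lam n * ((cmod (a n))\<^sup>2 - 2 * Re (cnj (a n) * coef u n)))"
proof (induction N)
  case 0 then show ?case by (simp add: psum_def psum'_def)
next
  case (Suc N)
  have c: "coef (\<lambda>x. u x - psum a N x) (Suc N) = coef u (Suc N)"
    by (subst coef_diff[OF H10_pair_L2(1)[OF assms] psum_L2(1)]) (simp_all add: coef_psum)
  have "(\<lambda>x. u x - psum a (Suc N) x) = (\<lambda>x. (u x - psum a N x) - a (Suc N) * ec (Suc N) x)"
    "(\<lambda>x. u' x - psum' a (Suc N) x) = (\<lambda>x. (u' x - psum' a N x) - a (Suc N) * ec' (Suc N) x)"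
    by (simp_all add: psum_Suc fun_eq_iff algebra_simps)
  then show ?case
    using energy_step[OF H10_pair_diff[OF assms psum_pair[of a N]], of "Suc N" "a (Suc N)"] Suc
    unfolding c by (simp add: algebra_simps)
qed

lemma cnj_self_Re: "(cmod z)\<^sup>2 - 2 * Re (cnj z * z) = - (cmod z)\<^sup>2"
  unfolding cmod_power2 by (simp add: power2_eq_square)

lemma L2_norm_sq_projection:
  assumes "u \<in> L2"
  shows "(L2_norm (\<lambda>x. u x - psum (coef u) N x))\<^sup>2 = (L2_norm u)\<^sup>2 - (\<Sum>n=1..N. (cmod (coef u n))\<^sup>2)"
  unfolding L2_norm_sq_psum[OF assms] cnj_self_Re by (simp add: sum_negf)

lemma energy_projection:
  assumes "H10_pair u u'"
  shows "energy (\<lambda>x. u x - psum (coef u) N x) (\<lambda>x. u' x - psum' (coef u) N x)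
    = energy u u' - (\<Sum>n=1..N. Lam n * (cmod (coef u n))\<^sup>2)"
  unfolding energy_psum[OF assms] cnj_self_Re by (simp add: sum_negf)

lemma Bessel: "u \<in> L2 \<Longrightarrow> (\<Sum>n=1..N. (cmod (coef u n))\<^sup>2) \<le> (L2_norm u)\<^sup>2"
  using L2_norm_sq_projection[of u N] zero_le_power2[of "L2_norm (\<lambda>x. u x - psum (coef u) N x)"] by linarith

lemma energy_Bessel: "H10_pair u u' \<Longrightarrow> (\<Sum>n=1..N. Lam n * (cmod (coef u n))\<^sup>2) \<le> energy u u'"
  using energy_projection[of u u' N] energy_bounds(5)[OF H10_pair_H1[OF H10_pair_diff[OF _ psum_pair]]]
  by (metis diff_ge_0_iff_ge)

lemma energy_of_psum: "energy (psum a N) (psum' a N) = (\<Sum>n=1..N. Lam n * (cmod (a n))\<^sup>2)"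
proof -
  have "energy (\<lambda>x. 0 - psum a N x) (\<lambda>x. 0 - psum' a N x) = (\<Sum>n=1..N. Lam n * (cmod (a n))\<^sup>2)"
    unfolding energy_psum[OF H10_pair_zero] by (simp add: energy_def eigen_coeff_def)
  then show ?thesis by (simp add: energy_def)
qed

text \<open>Completeness in \<^term>\<open>L2\<close>: the projection is the best approximation.\<close>

lemma projection_tendsto:
  assumes u: "u \<in> L2"
  shows "(\<lambda>N. L2_norm (\<lambda>x. u x - psum (coef u) N x)) \<longlonglongrightarrow> 0"
proof (rule LIMSEQ_I)
  fix e :: real assume e: "e > 0"
  have dense: "\<And>h e. h \<in> L2 \<Longrightarrow> e > 0 \<Longrightarrow> \<exists>N c. L2_norm (\<lambda>x. h x - (\<Sum>n=1..N. c n * f n x)) < e"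
    using spectrum unfolding dirichlet_spectrum_def by blast
  have re: "(\<lambda>x. Re (u x)) \<in> L2" and im: "(\<lambda>x. Im (u x)) \<in> L2"
    using L2_bounded_linear[OF bounded_linear_Re u] L2_bounded_linear[OF bounded_linear_Im u] by auto
  obtain N1 c1 where 1: "L2_norm (\<lambda>x. Re (u x) - (\<Sum>n=1..N1. c1 n * f n x)) < e / 2"
    using dense[OF re, of "e/2"] e by auto
  obtain N2 c2 where 2: "L2_norm (\<lambda>x. Im (u x) - (\<Sum>n=1..N2. c2 n * f n x)) < e / 2"
    using dense[OF im, of "e/2"] e by auto
  define M where "M = max N1 N2"
  define a where "a n = Complex (if n \<le> N1 then c1 n else 0) (if n \<le> N2 then c2 n else 0)" for n
  define s1 where "s1 x = Re (u x) - (\<Sum>n=1..N1. c1 n * f n x)" for x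
  define s2 where "s2 x = Im (u x) - (\<Sum>n=1..N2. c2 n * f n x)" for x
  have sL: "s1 \<in> L2" "s2 \<in> L2"
    unfolding s1_def[abs_def] s2_def[abs_def]
    by (intro L2_diff re im L2_sum L2_cmult f_L2; simp)+
  have lift: "(\<lambda>x. complex_of_real (s1 x)) \<in> L2" "(\<lambda>x. \<i> * complex_of_real (s2 x)) \<in> L2"
    using L2_bounded_linear[OF bounded_linear_of_real sL(1)] L2_cmult[OF L2_bounded_linear[OF bounded_linear_of_real sL(2)]] by auto
  have "AE x in \<mu>. \<forall>n\<in>{1..M}. f n x = ef n x"
    by (intro AE_finite_allI ef_AE) auto
  then have "AE x in \<mu>. u x - psum a M x = complex_of_real (s1 x) + \<i> * complex_of_real (s2 x)"
  proof eventually_elim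
    case (elim x)
    have "(\<Sum>n=1..N1. c1 n * f n x) = (\<Sum>n=1..M. (if n \<le> N1 then c1 n else 0) * ef n x)"
      by (rule sum.mono_neutral_cong_left) (use elim in \<open>auto simp: M_def\<close>)
    moreover have "(\<Sum>n=1..N2. c2 n * f n x) = (\<Sum>n=1..M. (if n \<le> N2 then c2 n else 0) * ef n x)"
      by (rule sum.mono_neutral_cong_left) (use elim in \<open>auto simp: M_def\<close>)
    ultimately show ?case
      by (simp add: complex_eq_iff s1_def s2_def psum_def a_def ec_def Re_sum Im_sum)
  qed
  then have "L2_norm (\<lambda>x. u x - psum a M x) = L2_norm (\<lambda>x. complex_of_real (s1 x) + \<i> * complex_of_real (s2 x))"
    using L2_D(1)[OF L2_diff(1)[OF u psum_L2(1)]] L2_D(1)[OF L2_add(1)[OF lift]] by (intro L2_norm_cong_AE) auto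
  also have "\<dots> \<le> L2_norm (\<lambda>x. complex_of_real (s1 x)) + L2_norm (\<lambda>x. \<i> * complex_of_real (s2 x))"
    by (rule L2_add(2)[OF lift])
  also have "\<dots> = L2_norm s1 + L2_norm s2" by (simp add: L2_norm_def norm_mult)
  also have "\<dots> < e" using 1 2 unfolding s1_def[abs_def] s2_def[abs_def] by simp
  finally have M: "L2_norm (\<lambda>x. u x - psum a M x) < e" .
  have "L2_norm (\<lambda>x. u x - psum (coef u) N x) < e" if "N \<ge> M" for N
  proof -
    have "(L2_norm (\<lambda>x. u x - psum (coef u) N x))\<^sup>2 \<le> (L2_norm (\<lambda>x. u x - psum (coef u) M x))\<^sup>2"
      unfolding L2_norm_sq_projection[OF u] using that by (simp add: sum_mono2)
    also have "\<dots> \<le> (L2_norm (\<lambda>x. u x - psum a M x))\<^sup>2"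
    proof -
      have "- (cmod w)\<^sup>2 \<le> (cmod z)\<^sup>2 - 2 * Re (cnj z * w)" for z w
        using zero_le_power2[of "cmod (w - z)"] unfolding cmod_power2
        by (simp add: algebra_simps power2_eq_square)
      then have "(\<Sum>n=1..M. - (cmod (coef u n))\<^sup>2) \<le> (\<Sum>n=1..M. (cmod (a n))\<^sup>2 - 2 * Re (cnj (a n) * coef u n))"
        by (intro sum_mono)
      then show ?thesis
        unfolding L2_norm_sq_projection[OF u] L2_norm_sq_psum[OF u, of a] by (simp add: sum_negf)
    qed
    finally have "L2_norm (\<lambda>x. u x - psum (coef u) N x) \<le> L2_norm (\<lambda>x. u x - psum a M x)"
      by (rule power2_le_imp_le) simp
    then show ?thesis using M by simp
  qed
  then show "\<exists>no. \<forall>N\<ge>no. norm (L2_norm (\<lambda>x. u x - psum (coef u) N x) - 0) < e" by auto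
qed

lemma Parseval:
  assumes "u \<in> L2" shows "(\<lambda>N. \<Sum>n=1..N. (cmod (coef u n))\<^sup>2) \<longlonglongrightarrow> (L2_norm u)\<^sup>2"
proof -
  have "(\<lambda>N. (L2_norm u)\<^sup>2 - (L2_norm (\<lambda>x. u x - psum (coef u) N x))\<^sup>2) \<longlonglongrightarrow> (L2_norm u)\<^sup>2 - 0\<^sup>2"
    by (intro tendsto_intros projection_tendsto assms)
  then show ?thesis by (simp add: L2_norm_sq_projection[OF assms])
qed

text \<open>The energy of a block of the expansion is the corresponding block of the bounded sum of
  nonnegative terms, so the partial sums are a Cauchy sequence in the energy norm.\<close>

lemma psum_converges:
  assumes b: "\<And>N. (\<Sum>n=1..N. Lam n * (cmod (a n))\<^sup>2) \<le> B"
  obtains w w' where "H10_pair w w'" "(\<lambda>N. Hk_norm 1 (\<lambda>x. w x - psum a N x)) \<longlonglongrightarrow> 0"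
    "\<And>n. n \<ge> 1 \<Longrightarrow> coef w n = a n"
proof -
  define S where "S N = (\<Sum>n=1..N. Lam n * (cmod (a n))\<^sup>2)" for N
  have inc: "incseq S" unfolding S_def
  proof (intro incseq_SucI)
    fix N show "(\<Sum>n=1..N. Lam n * (cmod (a n))\<^sup>2) \<le> (\<Sum>n=1..Suc N. Lam n * (cmod (a n))\<^sup>2)"
      using Lam_ge_1[of "Suc N"] by simp
  qed
  have "S N \<le> B" for N using b unfolding S_def by blast
  then have "convergent S" using incseq_convergent[OF inc, of B] convergentI by blast
  then have "Cauchy S" by (simp add: Cauchy_convergent_iff)
  have diff: "Hk_norm 1 (\<lambda>x. psum a M x - psum a N x) \<le> sqrt \<bar>S M - S N\<bar>" for M N
  proof -
    have *: "Hk_norm 1 (\<lambda>x. psum a M x - psum a N x) \<le> sqrt (S M - S N)" if "N \<le> M" for M N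
    proof -
      define b where "b n = (if n \<le> N then 0 else a n)" for n
      have split: "psum a M x - psum a N x = psum b M x" "psum' a M x - psum' a N x = psum' b M x" for x
      proof -
        have "(\<Sum>n=1..N. h n) = (\<Sum>n=1..M. if n \<le> N then h n else 0)" for h :: "nat \<Rightarrow> complex"
          by (rule sum.mono_neutral_cong_left) (use that in auto)
        then show "psum a M x - psum a N x = psum b M x" "psum' a M x - psum' a N x = psum' b M x"
          unfolding psum_def psum'_def b_def by (auto simp flip: sum_subtractf intro!: sum.cong)
      qed
      have "(Hk_norm 1 (psum b M))\<^sup>2 \<le> energy (psum b M) (psum' b M)"
        by (rule energy_bounds(1)[OF H10_pair_H1[OF psum_pair]])
      also have "\<dots> = S M - S N"
      proof -
        have "S N = (\<Sum>n=1..M. if n \<le> N then Lam n * (cmod (a n))\<^sup>2 else 0)"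
          unfolding S_def by (rule sum.mono_neutral_cong_left) (use that in auto)
        then show ?thesis unfolding energy_of_psum S_def b_def
          by (auto simp flip: sum_subtractf intro!: sum.cong)
      qed
      finally show ?thesis unfolding split by (intro real_le_rsqrt) simp
    qed
    show ?thesis
    proof (cases "N \<le> M")
      case True
      have "S N \<le> S M" using inc True by (simp add: incseqD)
      then show ?thesis using *[OF True] by simp
    next
      case False
      have "Hk_norm 1 (\<lambda>x. psum a M x - psum a N x) = Hk_norm 1 (\<lambda>x. psum a N x - psum a M x)"
        unfolding H1_pair_norm[OF H1_pair_diff[OF H10_pair_H1[OF psum_pair] H10_pair_H1[OF psum_pair]]]
        by (simp add: L2_norm_commute[of "psum a M"] L2_norm_commute[of "psum' a M"])
      moreover have "S M \<le> S N" using inc False by (simp add: incseqD)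
      ultimately show ?thesis using *[of M N] False by simp
    qed
  qed
  have "\<exists>N. \<forall>m\<ge>N. \<forall>n\<ge>N. Hk_norm 1 (\<lambda>x. psum a m x - psum a n x) < e" if "e > 0" for e
  proof -
    obtain N where N: "\<And>m n. m \<ge> N \<Longrightarrow> n \<ge> N \<Longrightarrow> \<bar>S m - S n\<bar> < e\<^sup>2"
      using CauchyD[OF \<open>Cauchy S\<close>, of "e\<^sup>2"] \<open>e > 0\<close> by auto
    have "Hk_norm 1 (\<lambda>x. psum a m x - psum a n x) < e" if "m \<ge> N" "n \<ge> N" for m n
      using order_le_less_trans[OF diff[of m n]] real_sqrt_less_mono[OF N[OF that]] \<open>e > 0\<close> by simp
    then show ?thesis by blast
  qed
  then obtain w w' where w: "H10_pair w w'" "(\<lambda>N. Hk_norm 1 (\<lambda>x. w x - psum a N x)) \<longlonglongrightarrow> 0"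
    using H10_complete[of "psum a" "psum' a", OF psum_pair] by blast
  have "coef w n = a n" if n: "n \<ge> 1" for n
  proof -
    have "(\<lambda>N. coef w n - coef (psum a N) n) \<longlonglongrightarrow> 0"
    proof (rule Lim_null_comparison[OF _ w(2)], rule always_eventually, rule allI)
      fix N
      have "coef w n - coef (psum a N) n = coef (\<lambda>x. w x - psum a N x) n"
        by (rule coef_diff[OF H10_pair_L2(1)[OF w(1)] psum_L2(1) n, symmetric])
      then show "cmod (coef w n - coef (psum a N) n) \<le> Hk_norm 1 (\<lambda>x. w x - psum a N x)"
        using coef_le[OF H10_pair_L2(1)[OF H10_pair_diff[OF w(1) psum_pair]] n, of a N]
          H1_pair_norm_bounds(1)[OF H10_pair_H1[OF H10_pair_diff[OF w(1) psum_pair]], of a N] by simp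
    qed
    moreover have "\<forall>\<^sub>F N in sequentially. coef w n - coef (psum a N) n = coef w n - a n"
      using eventually_ge_at_top[of n] by eventually_elim (simp add: coef_psum[OF n])
    ultimately have "(\<lambda>N::nat. coef w n - a n) \<longlonglongrightarrow> 0" using tendsto_cong by fast
    then show ?thesis by (simp add: LIMSEQ_const_iff)
  qed
  with w show ?thesis by (rule that)
qed

text \<open>By Bessel's inequality for the energy the expansion converges to some limit; the limit has the same
  coefficients as u, hence equals it by Parseval's identity.\<close>

lemma projection_tendsto_H1:
  assumes u: "H10_pair u u'"
  shows "(\<lambda>N. Hk_norm 1 (\<lambda>x. u x - psum (coef u) N x)) \<longlonglongrightarrow> 0"
proof -
  obtain w w' where w: "H10_pair w w'" "(\<lambda>N. Hk_norm 1 (\<lambda>x. w x - psum (coef u) N x)) \<longlonglongrightarrow> 0"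
    "\<And>n. n \<ge> 1 \<Longrightarrow> coef w n = coef u n"
    using psum_converges[of "coef u" "energy u u'"] energy_Bessel[OF u] by blast
  note L = H10_pair_L2(1)[OF u] H10_pair_L2(1)[OF w(1)]
  have "(\<lambda>N. \<Sum>n=1..N. (cmod (coef (\<lambda>x. w x - u x) n))\<^sup>2) \<longlonglongrightarrow> (L2_norm (\<lambda>x. w x - u x))\<^sup>2"
    by (rule Parseval[OF L2_diff(1)[OF L(2,1)]])
  moreover have "(\<Sum>n=1..N. (cmod (coef (\<lambda>x. w x - u x) n))\<^sup>2) = 0" for N
    using coef_diff[OF L(2,1)] w(3) by simp
  ultimately have "L2_norm (\<lambda>x. w x - u x) = 0" by (simp add: LIMSEQ_const_iff)
  then have ae: "AE x in \<mu>. w x = u x" by (simp add: L2_norm_eq_0_iff[OF L2_diff(1)[OF L(2,1)]])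
  have "Hk_norm 1 (\<lambda>x. u x - psum (coef u) N x) = Hk_norm 1 (\<lambda>x. w x - psum (coef u) N x)" for N
    by (rule Hk_norm_1_cong_AE) (use ae L psum_L2 in \<open>auto elim: eventually_mono\<close>)
  then show ?thesis using w(2) by simp
qed

lemma energy_Parseval:
  assumes u: "H10_pair u u'"
  shows "(\<lambda>N. \<Sum>n=1..N. Lam n * (cmod (coef u n))\<^sup>2) \<longlonglongrightarrow> energy u u'"
proof -
  have "(\<lambda>N. energy (\<lambda>x. u x - psum (coef u) N x) (\<lambda>x. u' x - psum' (coef u) N x)) \<longlonglongrightarrow> 0"
  proof (rule Lim_null_comparison)
    have "(\<lambda>N. (2 * \<rho> + 1) * (Hk_norm 1 (\<lambda>x. u x - psum (coef u) N x))\<^sup>2) \<longlonglongrightarrow> (2 * \<rho> + 1) * 0\<^sup>2"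
      by (intro tendsto_intros projection_tendsto_H1[OF u])
    then show "(\<lambda>N. (2 * \<rho> + 1) * (Hk_norm 1 (\<lambda>x. u x - psum (coef u) N x))\<^sup>2) \<longlonglongrightarrow> 0" by simp
    show "\<forall>\<^sub>F N in sequentially. norm (energy (\<lambda>x. u x - psum (coef u) N x) (\<lambda>x. u' x - psum' (coef u) N x))
        \<le> (2 * \<rho> + 1) * (Hk_norm 1 (\<lambda>x. u x - psum (coef u) N x))\<^sup>2"
      using energy_bounds(2,5)[OF H10_pair_H1[OF H10_pair_diff[OF u psum_pair]]] by simp
  qed
  then have "(\<lambda>N. energy u u' - energy (\<lambda>x. u x - psum (coef u) N x) (\<lambda>x. u' x - psum' (coef u) N x))
      \<longlonglongrightarrow> energy u u' - 0" by (intro tendsto_intros)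
  then show ?thesis by (simp add: energy_projection[OF u])
qed

text \<open>At most linearly many eigenvalues lie below a level: the values of the first eigenfunctions at a
  point, taken as coefficients, give a trial function to which the embedding into bounded functions
  applies.\<close>

lemma index_le_Lam: assumes "N \<ge> 1" shows "real N \<le> pi\<^sup>2 * Lam N"
proof -
  have S: "(\<Sum>n=1..N. (ef n x)\<^sup>2) \<le> pi * Lam N" for x
  proof -
    define a where "a n = complex_of_real (ef n x)" for n
    define T where "T = (\<Sum>n=1..N. (ef n x)\<^sup>2)"
    have T0: "T \<ge> 0" unfolding T_def by (rule sum_nonneg) simp
    have "psum a N x = complex_of_real T"
      unfolding psum_def T_def a_def ec_def by (simp add: power2_eq_square)
    moreover have "psum a N x = antideriv (psum' a N) x"
    proof -
      have "psum a N x = (\<Sum>n=1..N. ef n x *\<^sub>R antideriv (ec' n) x)"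
        unfolding psum_def a_def by (simp add: ec_antideriv scaleR_conv_of_real)
      also have "\<dots> = antideriv (\<lambda>y. \<Sum>n=1..N. ef n x *\<^sub>R ec' n y) x"
        by (rule antideriv_sum[symmetric]) (use ec_L2 in auto)
      finally show ?thesis by (simp add: psum'_def[abs_def] a_def scaleR_conv_of_real)
    qed
    ultimately have "T \<le> sqrt pi * L2_norm (psum' a N)"
      using antideriv_norm_le[OF psum_L2(2), of a N x] T0 by simp
    then have "T\<^sup>2 \<le> (sqrt pi * L2_norm (psum' a N))\<^sup>2" using T0 by (intro power_mono)
    also have "\<dots> = pi * (L2_norm (psum' a N))\<^sup>2" by (simp add: power_mult_distrib)
    also have "\<dots> \<le> pi * (\<Sum>n=1..N. Lam n * (ef n x)\<^sup>2)"
      using energy_bounds(4)[OF H10_pair_H1[OF psum_pair[of a N]]] energy_of_psum[of a N] by (simp add: a_def)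
    also have "\<dots> \<le> pi * (\<Sum>n=1..N. Lam N * (ef n x)\<^sup>2)"
      by (intro mult_left_mono sum_mono mult_right_mono Lam_mono) auto
    also have "\<dots> = pi * Lam N * T" unfolding T_def by (simp add: sum_distrib_left mult.assoc)
    finally have "T * T \<le> pi * Lam N * T" by (simp add: power2_eq_square)
    then have "T \<le> pi * Lam N"
      using T0 Lam_ge_1[OF assms] by (cases "T = 0") (auto simp: mult_le_cancel_right)
    then show ?thesis by (simp add: T_def)
  qed
  have i: "integrable \<mu> (\<lambda>x. (ef n x)\<^sup>2)" if "n \<ge> 1" for n using L2_D(2)[OF ef_L2[OF that]] by simp
  have "real N = (\<Sum>n=1..N. LINT x|\<mu>. (ef n x)\<^sup>2)"
    using ef_orthonormal by (simp add: power2_eq_square)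
  also have "\<dots> = (LINT x|\<mu>. (\<Sum>n=1..N. (ef n x)\<^sup>2))"
    using i by (intro Bochner_Integration.integral_sum[symmetric]) auto
  also have "\<dots> \<le> (LINT x|\<mu>. pi * Lam N)"
    using i S by (intro integral_mono Bochner_Integration.integrable_sum) auto
  also have "\<dots> = pi\<^sup>2 * Lam N" using measure_\<mu>_space by (simp add: power2_eq_square)
  finally show ?thesis .
qed

end

section \<open>Decay of the expansion of a smoother datum\<close>

context dirichlet
begin

lemma form_add:
  assumes "u \<in> L2" "u' \<in> L2" "v \<in> L2" "v' \<in> L2" "w \<in> L2" "w' \<in> L2"
  shows "form u u' (\<lambda>x. v x + w x) (\<lambda>x. v' x + w' x) = form u u' v v' + form u u' w w'"
  unfolding form_def
  using L2_mult_integrable[OF assms(2,4)] L2_mult_integrable[OF assms(2,6)]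
    L2_mult_integrable[OF W_mult_L2(1)[OF assms(1)] assms(3)]
    L2_mult_integrable[OF W_mult_L2(1)[OF assms(1)] assms(5)]
  by (simp add: distrib_left)

lemma form_cmult: "form u u' (\<lambda>x. c * w x) (\<lambda>x. c * w' x) = c * form u u' w w'"
proof -
  have "(LINT x|\<mu>. u' x * (c * w' x)) = c * (LINT x|\<mu>. u' x * w' x)"
    by (simp add: mult.left_commute flip: integral_mult_right_zero)
  moreover have "(LINT x|\<mu>. complex_of_real (W x) * u x * (c * w x)) = c * (LINT x|\<mu>. complex_of_real (W x) * u x * w x)"
    by (simp only: mult.left_commute[of _ c] flip: integral_mult_right_zero)
  ultimately show ?thesis unfolding form_def by (simp add: distrib_left)
qed

lemma form_psum:
  assumes "H10_pair u u'"
  shows "form u u' (psum b N) (psum' b N) = (\<Sum>n=1..N. b n * (of_real (Lam n) * coef u n))"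
proof (induction N)
  case 0 then show ?case by (simp add: psum_def[abs_def] psum'_def[abs_def] form_def)
next
  case (Suc N)
  note U = H10_pair_L2[OF assms]
  have "form u u' (\<lambda>x. psum b N x + b (Suc N) * ec (Suc N) x) (\<lambda>x. psum' b N x + b (Suc N) * ec' (Suc N) x)
      = form u u' (psum b N) (psum' b N) + form u u' (\<lambda>x. b (Suc N) * ec (Suc N) x) (\<lambda>x. b (Suc N) * ec' (Suc N) x)"
    by (intro form_add U psum_L2 L2_cmult ec_L2) auto
  then show ?case
    unfolding psum_Suc[abs_def] form_cmult using form_eigen[OF assms, of "Suc N"] Suc by simp
qed

lemma form_cnj: "form u u' (\<lambda>x. cnj (u x)) (\<lambda>x. cnj (u' x)) = complex_of_real (energy u u')"
  unfolding form_def energy_def of_real_add integral_complex_of_real[symmetric]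
  by (simp add: complex_norm_square mult.assoc del: of_real_power)

text \<open>Every mode of the remainder carries a weight of at least \<^term>\<open>Lam (Suc N)\<close> in its energy.\<close>

lemma remainder_L2_bound:
  assumes u: "H10_pair u u'"
  shows "(L2_norm (\<lambda>x. u x - psum (coef u) N x))\<^sup>2
    \<le> (energy u u' - (\<Sum>n=1..N. Lam n * (cmod (coef u n))\<^sup>2)) / Lam (Suc N)"
proof -
  define r where "r x = u x - psum (coef u) N x" for x
  define r' where "r' x = u' x - psum' (coef u) N x" for x
  have r: "H10_pair r r'" unfolding r_def[abs_def] r'_def[abs_def] by (rule H10_pair_diff[OF u psum_pair])
  have L1: "Lam (Suc N) \<ge> 1" by (rule Lam_ge_1) simp
  have c: "coef r n = (if n \<le> N then 0 else coef u n)" if "n \<ge> 1" for n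
    unfolding r_def[abs_def] using coef_diff[OF H10_pair_L2(1)[OF u] psum_L2(1) that] coef_psum[OF that] by simp
  have "(\<Sum>n=1..M. (cmod (coef r n))\<^sup>2) \<le> energy r r' / Lam (Suc N)" for M
  proof -
    have "(\<Sum>n=1..M. Lam (Suc N) * (cmod (coef r n))\<^sup>2) \<le> (\<Sum>n=1..M. Lam n * (cmod (coef r n))\<^sup>2)"
    proof (rule sum_mono)
      fix n assume n: "n \<in> {1..M}"
      show "Lam (Suc N) * (cmod (coef r n))\<^sup>2 \<le> Lam n * (cmod (coef r n))\<^sup>2"
        using c[of n] n Lam_mono[of "Suc N" n] by (cases "n \<le> N") (auto intro: mult_right_mono)
    qed
    also have "\<dots> \<le> energy r r'" by (rule energy_Bessel[OF r])
    finally show ?thesis using L1 by (simp add: sum_distrib_left[symmetric] field_simps)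
  qed
  then have "(L2_norm r)\<^sup>2 \<le> energy r r' / Lam (Suc N)"
    using Parseval[OF H10_pair_L2(1)[OF r]] by (intro LIMSEQ_le_const2) auto
  then show ?thesis
    unfolding r_def[abs_def] r'_def[abs_def] energy_projection[OF u] .
qed

text \<open>The remainder is orthogonal to the partial sum, so its energy is the form of the function against
  the conjugated remainder; there the derivative may be replaced by a Sobolev function, at the price
  of the error, and moved onto it by parts.\<close>

lemma energy_tail_bound:
  assumes u: "H10_pair u u'" and z: "H1_pair z z'"
  shows "sqrt (energy u u' - (\<Sum>n=1..N. Lam n * (cmod (coef u n))\<^sup>2))
    \<le> L2_norm (\<lambda>x. u' x - z x) + (L2_norm z' + (2 * \<rho> + 1) * L2_norm u) / sqrt (Lam (Suc N))"
proof -
  define T where "T = energy u u' - (\<Sum>n=1..N. Lam n * (cmod (coef u n))\<^sup>2)"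
  define r where "r x = u x - psum (coef u) N x" for x
  define r' where "r' x = u' x - psum' (coef u) N x" for x
  define q where "q x = cnj (r x)" for x
  define q' where "q' x = cnj (r' x)" for x
  note U = H10_pair_L2[OF u] and Z = H1_pair_D[OF z]
  have r: "H10_pair r r'" unfolding r_def[abs_def] r'_def[abs_def] by (rule H10_pair_diff[OF u psum_pair])
  have q: "H10_pair q q'" unfolding q_def[abs_def] q'_def[abs_def] by (rule H10_pair_bounded_linear[OF r bounded_linear_cnj])
  note R = H10_pair_L2[OF r] and Q = H10_pair_L2[OF q]
  have T: "T = energy r r'" unfolding T_def r_def[abs_def] r'_def[abs_def] by (rule energy_projection[OF u, symmetric])
  have nq: "L2_norm q = L2_norm r" "L2_norm q' = L2_norm r'" by (simp_all add: L2_norm_def q_def q'_def)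
  have T0: "T \<ge> 0" and r'T: "L2_norm r' \<le> sqrt T"
    unfolding T using energy_bounds[OF H10_pair_H1[OF r]] by (auto intro: real_le_rsqrt)
  have L1: "Lam (Suc N) \<ge> 1" by (rule Lam_ge_1) simp
  have rT: "L2_norm r \<le> sqrt T / sqrt (Lam (Suc N))"
    using remainder_L2_bound[OF u, of N] unfolding r_def[abs_def] T_def
    by (simp add: real_le_rsqrt flip: real_sqrt_divide)
  have "form u u' q q' = complex_of_real T"
  proof -
    define b where "b n = - cnj (coef u n)" for n
    have qs: "q = (\<lambda>x. cnj (u x) + psum b N x)" "q' = (\<lambda>x. cnj (u' x) + psum' b N x)"
      by (simp_all add: fun_eq_iff q_def q'_def r_def r'_def psum_def psum'_def b_def ec_def ec'_def sum_negf)
    have "form u u' q q' = form u u' (\<lambda>x. cnj (u x)) (\<lambda>x. cnj (u' x)) + form u u' (psum b N) (psum' b N)"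
      unfolding qs by (intro form_add U psum_L2 L2_bounded_linear[OF bounded_linear_cnj])
    also have "\<dots> = complex_of_real (energy u u') + (\<Sum>n=1..N. b n * (of_real (Lam n) * coef u n))"
      unfolding form_cnj form_psum[OF u] ..
    also have "(\<Sum>n=1..N. b n * (of_real (Lam n) * coef u n)) = complex_of_real (\<Sum>n=1..N. - (Lam n * (cmod (coef u n))\<^sup>2))"
      unfolding of_real_sum b_def by (intro sum.cong refl) (simp add: complex_norm_square del: of_real_power)
    finally show ?thesis by (simp add: T_def sum_negf)
  qed
  moreover have "form u u' q q' = (LINT x|\<mu>. (u' x - z x) * q' x) - (LINT x|\<mu>. q x * z' x)
      + (LINT x|\<mu>. complex_of_real (W x) * u x * q x)"
  proof -
    have "(LINT x|\<mu>. u' x * q' x) = (LINT x|\<mu>. (u' x - z x) * q' x + q' x * z x)"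
      by (simp add: algebra_simps)
    also have "\<dots> = (LINT x|\<mu>. (u' x - z x) * q' x) + (LINT x|\<mu>. q' x * z x)"
      by (intro Bochner_Integration.integral_add L2_mult_integrable L2_diff U Q Z)
    finally show ?thesis unfolding form_def H10_integration_by_parts[OF q z] by simp
  qed
  ultimately have "T \<le> cmod ((LINT x|\<mu>. (u' x - z x) * q' x) - (LINT x|\<mu>. q x * z' x)
      + (LINT x|\<mu>. complex_of_real (W x) * u x * q x))"
    using T0 by (metis norm_of_real abs_of_nonneg order_refl)
  also have "\<dots> \<le> cmod (LINT x|\<mu>. (u' x - z x) * q' x) + cmod (LINT x|\<mu>. q x * z' x)
      + cmod (LINT x|\<mu>. complex_of_real (W x) * u x * q x)"
    by (intro order_trans[OF norm_triangle_ineq] add_mono norm_triangle_ineq4 order_refl)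
  also have "\<dots> \<le> L2_norm (\<lambda>x. u' x - z x) * L2_norm q' + L2_norm q * L2_norm z'
      + L2_norm (\<lambda>x. complex_of_real (W x) * u x) * L2_norm q"
    by (intro add_mono L2_Cauchy_Schwarz L2_diff U Q Z W_mult_L2)
  also have "\<dots> \<le> L2_norm (\<lambda>x. u' x - z x) * sqrt T + (sqrt T / sqrt (Lam (Suc N))) * L2_norm z'
      + ((2 * \<rho> + 1) * L2_norm u) * (sqrt T / sqrt (Lam (Suc N)))"
    unfolding nq using \<rho>_pos T0 L1
    by (intro add_mono mult_mono mult_left_mono mult_right_mono r'T rT W_mult_L2(2) U) auto
  also have "\<dots> = sqrt T * (L2_norm (\<lambda>x. u' x - z x) + (L2_norm z' + (2 * \<rho> + 1) * L2_norm u) / sqrt (Lam (Suc N)))"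
    by (simp add: add_divide_distrib algebra_simps)
  finally have "sqrt T * sqrt T \<le> sqrt T * (L2_norm (\<lambda>x. u' x - z x) + (L2_norm z' + (2 * \<rho> + 1) * L2_norm u) / sqrt (Lam (Suc N)))"
    using T0 by simp
  moreover have "0 \<le> L2_norm (\<lambda>x. u' x - z x) + (L2_norm z' + (2 * \<rho> + 1) * L2_norm u) / sqrt (Lam (Suc N))"
    using \<rho>_pos L1 by (intro add_nonneg_nonneg divide_nonneg_nonneg mult_nonneg_nonneg) auto
  ultimately have "sqrt T \<le> L2_norm (\<lambda>x. u' x - z x) + (L2_norm z' + (2 * \<rho> + 1) * L2_norm u) / sqrt (Lam (Suc N))"
    using T0 mult_left_le_imp_le[of "sqrt T" "sqrt T"] by (cases "T = 0") auto
  then show ?thesis unfolding T_def .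
qed

end

text \<open>Translates of a function on the interval are not defined on the whole interval. Contractions followed
  by translations, mapping the interval into itself, serve in their place.\<close>

lemma affine_integral:
  fixes w :: "real \<Rightarrow> 'b::euclidean_space"
  assumes w: "integrable \<mu> w" and a: "0 < \<alpha>" "0 \<le> c" "\<alpha> * pi + c \<le> pi"
  shows "integrable \<mu> (\<lambda>x. w (\<alpha> * x + c))"
    "(\<And>y. y \<notin> {c<..<\<alpha> * pi + c} \<Longrightarrow> w y = 0) \<Longrightarrow> (LINT x|\<mu>. w (\<alpha> * x + c)) = (LINT x|\<mu>. w x) /\<^sub>R \<alpha>"
proof -
  define G where "G y = indicator {0<..<pi} y *\<^sub>R w y" for y
  have "has_bochner_integral lebesgue G (LINT x|\<mu>. w x)"
    using has_bochner_integral_restrict_space[of "{0<..<pi}" lebesgue w "LINT x|\<mu>. w x"]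
      has_bochner_integral_integrable[OF w] unfolding G_def[abs_def] by simp
  then have G: "has_bochner_integral lebesgue (\<lambda>x. G (c + \<alpha> * x)) ((LINT x|\<mu>. w x) /\<^sub>R \<alpha>)"
    using has_bochner_integral_lebesgue_real_affine_iff[of \<alpha> G "LINT x|\<mu>. w x" c] a by simp
  have in_range: "c + \<alpha> * x \<in> {0<..<pi}" if "x \<in> {0<..<pi}" for x
  proof -
    have "0 < \<alpha> * x" "\<alpha> * x < \<alpha> * pi" using that a by simp_all
    then have "0 < c + \<alpha> * x" "c + \<alpha> * x < pi" using a(2,3) by linarith+
    then show ?thesis by simp
  qed
  have "integrable lebesgue (\<lambda>x. indicator {0<..<pi} x *\<^sub>R G (c + \<alpha> * x))"
    by (rule integrable_mult_indicator) (use G in \<open>auto simp: has_bochner_integral_iff\<close>)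
  moreover have "indicator {0<..<pi} x *\<^sub>R G (c + \<alpha> * x) = indicator {0<..<pi} x *\<^sub>R w (\<alpha> * x + c)" for x
    using in_range[of x] by (auto simp: G_def add.commute split: split_indicator)
  ultimately show "integrable \<mu> (\<lambda>x. w (\<alpha> * x + c))"
    by (simp add: integrable_restrict_space)
  assume out: "\<And>y. y \<notin> {c<..<\<alpha> * pi + c} \<Longrightarrow> w y = 0"
  have "G (c + \<alpha> * x) = indicator {0<..<pi} x *\<^sub>R w (\<alpha> * x + c)" for x
  proof (cases "x \<in> {0<..<pi}")
    case True then show ?thesis using in_range[of x] by (simp add: G_def add.commute)
  next
    case False
    then have "\<alpha> * x + c \<notin> {c<..<\<alpha> * pi + c}" using a by (auto simp: zero_less_mult_iff)
    then show ?thesis using False out by (simp add: G_def add.commute)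
  qed
  then have "has_bochner_integral lebesgue (\<lambda>x. indicator {0<..<pi} x *\<^sub>R w (\<alpha> * x + c)) ((LINT x|\<mu>. w x) /\<^sub>R \<alpha>)"
    using G by simp
  then have "has_bochner_integral \<mu> (\<lambda>x. w (\<alpha> * x + c)) ((LINT x|\<mu>. w x) /\<^sub>R \<alpha>)"
    by (subst has_bochner_integral_restrict_space) simp_all
  then show "(LINT x|\<mu>. w (\<alpha> * x + c)) = (LINT x|\<mu>. w x) /\<^sub>R \<alpha>"
    by (rule has_bochner_integral_integral_eq)
qed

lemma affine_L2:
  assumes v: "v \<in> L2" and a: "0 < \<alpha>" "0 \<le> c" "\<alpha> * pi + c \<le> pi"
  shows "(\<lambda>x. v (\<alpha> * x + c)) \<in> L2" "(L2_norm (\<lambda>x. v (\<alpha> * x + c)))\<^sup>2 \<le> (L2_norm v)\<^sup>2 / \<alpha>"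
proof -
  from affine_integral(1)[OF L2_integrable[OF v] a] affine_integral(1)[OF L2_D(2)[OF v] a]
  show "(\<lambda>x. v (\<alpha> * x + c)) \<in> L2" by (simp add: L2_def del: L2_D)
  define w where "w y = indicator {c<..<\<alpha> * pi + c} y *\<^sub>R (norm (v y))\<^sup>2" for y
  have w: "integrable \<mu> w"
  proof (rule Bochner_Integration.integrable_bound[OF L2_D(2)[OF v]])
    show "w \<in> borel_measurable \<mu>"
      unfolding w_def by (intro borel_measurable_scaleR interval_indicator_measurable) (use v in simp)
  qed (auto simp: w_def split: split_indicator)
  have "(LINT x|\<mu>. (norm (v (\<alpha> * x + c)))\<^sup>2) = (LINT x|\<mu>. w (\<alpha> * x + c))"
    using a by (intro Bochner_Integration.integral_cong) (auto simp: w_def)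
  also have "\<dots> = (LINT x|\<mu>. w x) / \<alpha>"
    by (subst affine_integral(2)[OF w a]) (auto simp: w_def divide_inverse)
  also have "\<dots> \<le> (LINT x|\<mu>. (norm (v x))\<^sup>2) / \<alpha>"
    by (intro divide_right_mono integral_mono[OF w L2_D(2)[OF v]])
      (use a in \<open>auto simp: w_def split: split_indicator\<close>)
  finally show "(L2_norm (\<lambda>x. v (\<alpha> * x + c)))\<^sup>2 \<le> (L2_norm v)\<^sup>2 / \<alpha>" by (simp add: L2_norm_sq)
qed

lemma affine_test:
  fixes \<phi> :: "real \<Rightarrow> real"
  assumes \<phi>: "\<phi> \<in> test_functions" and a: "0 < \<alpha>" "0 \<le> c" "\<alpha> * pi + c \<le> pi"
  shows "(\<lambda>y. \<phi> ((y - c) / \<alpha>)) \<in> test_functions"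
    "vector_derivative (\<lambda>y. \<phi> ((y - c) / \<alpha>)) (at y) = vector_derivative \<phi> (at ((y - c) / \<alpha>)) / \<alpha>"
    "y \<notin> {c<..<\<alpha> * pi + c} \<Longrightarrow> \<phi> ((y - c) / \<alpha>) = 0"
proof -
  have chain: "((\<lambda>y. h ((y - c) / \<alpha>)) has_vector_derivative (1 / \<alpha>) *\<^sub>R h') (at y)"
    if "(h has_vector_derivative h') (at ((y - c) / \<alpha>))" for h :: "real \<Rightarrow> real" and h' y
  proof -
    have "((\<lambda>y. (y - c) / \<alpha>) has_vector_derivative 1 / \<alpha>) (at y)"
      unfolding has_real_derivative_iff_has_vector_derivative[symmetric]
      using a(1) by (auto intro!: derivative_eq_intros)
    from vector_diff_chain_at[of "\<lambda>y. (y - c) / \<alpha>" "1 / \<alpha>" y h h', OF this that]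
    show ?thesis by (simp add: comp_def)
  qed
  obtain D b d where D: "D 0 = \<phi>" "\<forall>k x. (D k has_vector_derivative D (Suc k) x) (at x)"
    and bd: "0 < b" "d < pi" "\<forall>x. x \<notin> {b..d} \<longrightarrow> \<phi> x = 0"
    using \<phi> unfolding test_functions_def by blast
  define E where "E k y = (1 / \<alpha>) ^ k *\<^sub>R D k ((y - c) / \<alpha>)" for k y
  have E: "\<forall>k y. (E k has_vector_derivative E (Suc k) y) (at y)"
  proof (intro allI)
    fix k y
    have "((\<lambda>y. (1 / \<alpha>) ^ k *\<^sub>R D k ((y - c) / \<alpha>)) has_vector_derivative
        (1 / \<alpha>) ^ k *\<^sub>R ((1 / \<alpha>) *\<^sub>R D (Suc k) ((y - c) / \<alpha>))) (at y)"
      using D(2) by (intro bounded_linear.has_vector_derivative[OF bounded_linear_scaleR_right] chain) blast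
    then show "(E k has_vector_derivative E (Suc k) y) (at y)" by (simp add: E_def[abs_def] mult.assoc)
  qed
  have "\<alpha> * d < \<alpha> * pi" "0 < \<alpha> * b" using a(1) bd by auto
  then have ends: "0 < \<alpha> * b + c" "\<alpha> * d + c < pi" using a(2,3) by linarith+
  have outside: "\<phi> ((y - c) / \<alpha>) = 0" if "y \<notin> {\<alpha> * b + c..\<alpha> * d + c}" for y
  proof -
    have "(y - c) / \<alpha> \<notin> {b..d}" using that a(1) by (auto simp: field_simps)
    then show ?thesis using bd(3) by blast
  qed
  have E0: "E 0 = (\<lambda>y. \<phi> ((y - c) / \<alpha>))" using D(1) by (simp add: E_def[abs_def])
  show "(\<lambda>y. \<phi> ((y - c) / \<alpha>)) \<in> test_functions"
    unfolding test_functions_def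
    by (intro CollectI conjI exI[of _ E] exI[of _ "\<alpha> * b + c"] exI[of _ "\<alpha> * d + c"])
      (fact E0, fact E, fact ends, fact ends, use outside in blast)
  show "vector_derivative (\<lambda>y. \<phi> ((y - c) / \<alpha>)) (at y) = vector_derivative \<phi> (at ((y - c) / \<alpha>)) / \<alpha>"
    using vector_derivative_at[OF chain[OF test_has_deriv[OF \<phi>], of y]] by simp
  assume "y \<notin> {c<..<\<alpha> * pi + c}"
  then have "(y - c) / \<alpha> \<notin> {0<..<pi}" using a(1) by (auto simp: field_simps)
  then have "(y - c) / \<alpha> \<notin> {b..d}" using bd by auto
  then show "\<phi> ((y - c) / \<alpha>) = 0" using bd(3) by blast
qed

lemma affine_H1_pair:
  assumes u: "H1_pair u v" and a: "0 < \<alpha>" "0 \<le> c" "\<alpha> * pi + c \<le> pi"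
  shows "H1_pair (\<lambda>x. u (\<alpha> * x + c)) (\<lambda>x. \<alpha> *\<^sub>R v (\<alpha> * x + c))"
proof -
  note U = H1_pair_D[OF u]
  have "has_weak_deriv (\<lambda>x. u (\<alpha> * x + c)) (\<lambda>x. \<alpha> *\<^sub>R v (\<alpha> * x + c))"
    unfolding has_weak_deriv_def
  proof
    fix \<phi> :: "real \<Rightarrow> real" assume \<phi>: "\<phi> \<in> test_functions"
    define \<psi> where "\<psi> y = \<phi> ((y - c) / \<alpha>)" for y
    note t = affine_test[OF \<phi> a, folded \<psi>_def]
    have t1: "\<psi> \<in> test_functions" using t(1) by (simp add: \<psi>_def[abs_def])
    have t2: "vector_derivative \<psi> (at y) = vector_derivative \<phi> (at ((y - c) / \<alpha>)) / \<alpha>" for y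
      using t(2) by (simp add: \<psi>_def[abs_def])
    have out': "vector_derivative \<psi> (at y) = 0" if "y \<notin> {c<..<\<alpha> * pi + c}" for y
      unfolding t2 using affine_test(3)[OF test_deriv_test[OF \<phi>] a that] by simp
    have "(LINT x|\<mu>. vector_derivative \<phi> (at x) *\<^sub>R u (\<alpha> * x + c))
        = (LINT x|\<mu>. \<alpha> *\<^sub>R (vector_derivative \<psi> (at (\<alpha> * x + c)) *\<^sub>R u (\<alpha> * x + c)))"
      using a(1) by (simp add: t2)
    also have "\<dots> = \<alpha> *\<^sub>R (LINT x|\<mu>. vector_derivative \<psi> (at (\<alpha> * x + c)) *\<^sub>R u (\<alpha> * x + c))"
      by (rule integral_scaleR_right)
    also have "\<dots> = (LINT x|\<mu>. vector_derivative \<psi> (at x) *\<^sub>R u x)"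
      using a(1) by (subst affine_integral(2)[OF L2_scaleR_integrable[OF test_L2[OF test_deriv_test[OF t1]] U(1)] a])
        (simp_all add: out')
    also have "\<dots> = - (LINT x|\<mu>. \<psi> x *\<^sub>R v x)"
      using U(3) t1 by (simp add: has_weak_deriv_def)
    also have "(LINT x|\<mu>. \<psi> x *\<^sub>R v x) = \<alpha> *\<^sub>R (LINT x|\<mu>. \<psi> (\<alpha> * x + c) *\<^sub>R v (\<alpha> * x + c))"
      using a(1) by (subst affine_integral(2)[OF L2_scaleR_integrable[OF test_L2[OF t1] U(2)] a])
        (simp_all add: t(3))
    also have "\<dots> = (LINT x|\<mu>. \<alpha> *\<^sub>R (\<psi> (\<alpha> * x + c) *\<^sub>R v (\<alpha> * x + c)))"
      by (rule integral_scaleR_right[symmetric])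
    also have "\<dots> = (LINT x|\<mu>. \<phi> x *\<^sub>R (\<alpha> *\<^sub>R v (\<alpha> * x + c)))"
      using a(1) by (simp add: \<psi>_def mult.commute)
    finally show "(LINT x|\<mu>. vector_derivative \<phi> (at x) *\<^sub>R u (\<alpha> * x + c))
        = - (LINT x|\<mu>. \<phi> x *\<^sub>R (\<alpha> *\<^sub>R v (\<alpha> * x + c)))" .
  qed
  then show ?thesis using affine_L2(1)[OF U(1) a] L2_scaleR[OF affine_L2(1)[OF U(2) a]] by (simp add: H1_pair_def)
qed

text \<open>Averages over a window that slides along the interval without leaving it. They approximate a
  function with finite Gagliardo seminorm at a rate given by the length of the window, which is h \<pi>; the
  window at x is a subinterval of the interval that contains x.\<close>

definition window_mean :: "real \<Rightarrow> (real \<Rightarrow> 'a::euclidean_space) \<Rightarrow> real \<Rightarrow> 'a" where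
  "window_mean h v x = (1 / (h * pi)) *\<^sub>R (antideriv v ((1 - h) * x + h * pi) - antideriv v ((1 - h) * x))"

lemma window_mean_H1_pair:
  assumes v: "H1_pair (antideriv v) v" and h: "0 < h" "h < 1"
  shows "H1_pair (window_mean h v)
      (\<lambda>x. (1 / (h * pi)) *\<^sub>R ((1 - h) *\<^sub>R v ((1 - h) * x + h * pi) - (1 - h) *\<^sub>R v ((1 - h) * x)))" (is "H1_pair _ ?d")
    "L2_norm (\<lambda>x. (1 / (h * pi)) *\<^sub>R ((1 - h) *\<^sub>R v ((1 - h) * x + h * pi) - (1 - h) *\<^sub>R v ((1 - h) * x)))
       \<le> 1 / h * L2_norm v"
proof -
  have a: "0 < 1 - h" "0 \<le> h * pi" "(1 - h) * pi + h * pi \<le> pi" "0 \<le> (0::real)" "(1 - h) * pi + 0 \<le> pi"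
    using h by (auto simp: algebra_simps)
  note p = affine_H1_pair[OF v a(1,2,3)] affine_H1_pair[OF v a(1,4,5), simplified]
  show "H1_pair (window_mean h v) ?d"
    unfolding window_mean_def[abs_def] by (intro H1_pair_scaleR H1_pair_diff p)
  note V = H1_pair_D(2)[OF v]
  note L = affine_L2[OF V a(1,2,3)] affine_L2[OF V a(1,4,5), simplified]
  have s: "L2_norm (\<lambda>x. (1 - h) *\<^sub>R v ((1 - h) * x + c)) \<le> L2_norm v"
    if "(L2_norm (\<lambda>x. v ((1 - h) * x + c)))\<^sup>2 \<le> (L2_norm v)\<^sup>2 / (1 - h)" for c
  proof (rule power2_le_imp_le)
    have "(L2_norm (\<lambda>x. (1 - h) *\<^sub>R v ((1 - h) * x + c)))\<^sup>2 = (1 - h)\<^sup>2 * (L2_norm (\<lambda>x. v ((1 - h) * x + c)))\<^sup>2"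
      unfolding L2_norm_scaleR using h by (simp add: power_mult_distrib)
    also have "\<dots> \<le> (1 - h)\<^sup>2 * ((L2_norm v)\<^sup>2 / (1 - h))" using that by (intro mult_left_mono) auto
    also have "\<dots> = (1 - h) * (L2_norm v)\<^sup>2" using h by (simp add: power2_eq_square)
    also have "\<dots> \<le> (L2_norm v)\<^sup>2" using h by (intro mult_left_le_one_le) auto
    finally show "(L2_norm (\<lambda>x. (1 - h) *\<^sub>R v ((1 - h) * x + c)))\<^sup>2 \<le> (L2_norm v)\<^sup>2" .
  qed simp
  have "L2_norm (\<lambda>x. (1 - h) *\<^sub>R v ((1 - h) * x + h * pi) - (1 - h) *\<^sub>R v ((1 - h) * x)) \<le> L2_norm v + L2_norm v"
    using L2_diff(2)[OF L2_scaleR[OF L(1), of "1 - h"] L2_scaleR[OF L(3), of "1 - h"]] s[OF L(2)] s[of 0] L(4) by simp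
  then have "L2_norm ?d \<le> \<bar>1 / (h * pi)\<bar> * (L2_norm v + L2_norm v)"
    unfolding L2_norm_scaleR by (intro mult_left_mono) auto
  also have "\<dots> = (2 / pi) * (1 / h * L2_norm v)" using h by simp
  also have "\<dots> \<le> 1 * (1 / h * L2_norm v)" using h pi_gt3 by (intro mult_right_mono) auto
  finally show "L2_norm ?d \<le> 1 / h * L2_norm v" by simp
qed

text \<open>By the Cauchy-Schwarz inequality the squared error at x is at most the mean over the window of
  \<open>(norm (v x - v y))\<^sup>2\<close>; there the distance of x and y is at most the length of the window, so
  the Gagliardo integrand bounds it.\<close>

lemma window_mean_error:
  fixes v :: "real \<Rightarrow> 'a::euclidean_space"
  assumes v: "v \<in> L2" and h: "0 < h" "h \<le> 1" and \<sigma>: "0 < \<sigma>"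
    and gag: "integrable (\<mu> \<Otimes>\<^sub>M \<mu>) (gagliardo_integrand \<sigma> v)"
  shows "window_mean h v \<in> L2"
    "(L2_norm (\<lambda>x. v x - window_mean h v x))\<^sup>2
       \<le> (h * pi) powr (2 * \<sigma>) * (LINT z|(\<mu> \<Otimes>\<^sub>M \<mu>). gagliardo_integrand \<sigma> v z)"
proof -
  interpret P: pair_sigma_finite \<mu> \<mu> ..
  have "continuous_on {0<..<pi} (window_mean h v)"
    unfolding window_mean_def
    by (intro continuous_intros continuous_on_compose2[OF antideriv_continuous[OF v, of UNIV]]) auto
  then have m: "window_mean h v \<in> borel_measurable \<mu>" by (rule continuous_measurable_\<mu>)
  have "norm (window_mean h v x) \<le> \<bar>1 / (h * pi)\<bar> * (2 * (sqrt pi * L2_norm v))" for x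
    unfolding window_mean_def norm_scaleR
    using norm_triangle_ineq4[of "antideriv v ((1 - h) * x + h * pi)" "antideriv v ((1 - h) * x)"]
      antideriv_norm_le[OF v, of "(1 - h) * x + h * pi"] antideriv_norm_le[OF v, of "(1 - h) * x"]
    by (intro mult_left_mono) auto
  then show z: "window_mean h v \<in> L2" by (intro bounded_in_L2(1)[OF m]) auto
  define k where "k = h * pi"
  have k: "0 < k" using h by (simp add: k_def)
  define \<Gamma> where "\<Gamma> x y = gagliardo_integrand \<sigma> v (x, y)" for x y
  have G: "integrable (\<mu> \<Otimes>\<^sub>M \<mu>) (\<lambda>(x, y). \<Gamma> x y)" using gag by (simp add: \<Gamma>_def)
  have pointwise: "(norm (v x - window_mean h v x))\<^sup>2 \<le> k powr (2 * \<sigma>) * (LINT y|\<mu>. \<Gamma> x y)"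
    if x: "x \<in> {0<..<pi}" and i: "integrable \<mu> (\<Gamma> x)" for x
  proof -
    define lo where "lo = (1 - h) * x"
    define hi where "hi = lo + k"
    have hx: "h * x < h * pi" "0 < h * x" using h x by auto
    have lo: "0 \<le> lo" "lo \<le> x" "x \<le> hi" using h x hx by (auto simp: lo_def hi_def k_def algebra_simps)
    have "hi = pi - (1 - h) * (pi - x)" by (simp add: hi_def lo_def k_def algebra_simps)
    moreover have "0 \<le> (1 - h) * (pi - x)" using h x by simp
    ultimately have hi: "lo < hi" "hi \<le> pi" using k by (auto simp: hi_def)
    define I where "I y = (indicator {lo<..hi} y :: real)" for y
    have IL: "I \<in> L2" and In: "L2_norm I \<le> sqrt k"
      using L2_indicator_Ioc[of lo hi] hi by (auto simp: I_def[abs_def] hi_def)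
    have I1: "(LINT y|\<mu>. I y) = k"
    proof -
      have "(LINT y|\<mu>. I y) = antideriv (\<lambda>_. 1) hi - antideriv (\<lambda>_. 1 :: real) lo"
        using antideriv_increment[of "\<lambda>_. 1::real" lo hi] hi by (simp add: I_def)
      also have "\<dots> = k"
        using lo hi antideriv_eq_integral[of "\<lambda>_. 1::real"] by (simp add: hi_def)
      finally show ?thesis .
    qed
    define w where "w y = I y *\<^sub>R (v x - v y)" for y
    have wL: "w \<in> L2"
    proof (rule L2_dominated(1)[OF L2_diff(1)[OF L2_const v], where C=1])
      show "w \<in> borel_measurable \<mu>" unfolding w_def using L2_D(1)[OF IL] L2_D(1)[OF v] by simp
    qed (auto simp: w_def I_def split: split_indicator)
    have "v x - window_mean h v x = (1 / k) *\<^sub>R (LINT y|\<mu>. I y *\<^sub>R w y)"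
    proof -
      have "window_mean h v x = (1 / k) *\<^sub>R (LINT y|\<mu>. I y *\<^sub>R v y)"
        using antideriv_increment[OF v, of lo hi] hi
        by (simp add: window_mean_def I_def lo_def hi_def k_def)
      moreover have "v x = (1 / k) *\<^sub>R (LINT y|\<mu>. I y *\<^sub>R v x)"
        using k I1 L2_integrable[OF IL] by simp
      ultimately have "v x - window_mean h v x = (1 / k) *\<^sub>R ((LINT y|\<mu>. I y *\<^sub>R v x) - (LINT y|\<mu>. I y *\<^sub>R v y))"
        by (metis scaleR_diff_right)
      also have "(LINT y|\<mu>. I y *\<^sub>R v x) - (LINT y|\<mu>. I y *\<^sub>R v y) = (LINT y|\<mu>. I y *\<^sub>R v x - I y *\<^sub>R v y)"
        by (rule Bochner_Integration.integral_diff[OF L2_scaleR_integrable[OF IL L2_const] L2_scaleR_integrable[OF IL v], symmetric])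
      also have "\<dots> = (LINT y|\<mu>. I y *\<^sub>R w y)"
        by (intro Bochner_Integration.integral_cong) (auto simp: w_def I_def scaleR_diff_right split: split_indicator)
      finally show ?thesis .
    qed
    also have "norm \<dots> \<le> (1 / k) * (sqrt k * L2_norm w)"
      using L2_Cauchy_Schwarz_scaleR[OF IL wL] mult_right_mono[OF In, of "L2_norm w"] k
      by (simp add: divide_right_mono)
    finally have "(norm (v x - window_mean h v x))\<^sup>2 \<le> ((1 / k) * (sqrt k * L2_norm w))\<^sup>2"
      by (intro power_mono) auto
    also have "\<dots> = (1 / k)\<^sup>2 * ((sqrt k)\<^sup>2 * (L2_norm w)\<^sup>2)" by (simp only: power_mult_distrib)
    also have "\<dots> = (1 / k) * (L2_norm w)\<^sup>2" using k by (simp add: power_one_over) (simp add: power2_eq_square)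
    also have "(L2_norm w)\<^sup>2 \<le> (LINT y|\<mu>. k powr (1 + 2 * \<sigma>) * \<Gamma> x y)"
      unfolding L2_norm_sq
    proof (rule integral_mono[OF L2_D(2)[OF wL]])
      show "integrable \<mu> (\<lambda>y. k powr (1 + 2 * \<sigma>) * \<Gamma> x y)" using i by simp
      fix y
      have G0: "0 \<le> \<Gamma> x y" by (simp add: \<Gamma>_def gagliardo_integrand_def)
      show "(norm (w y))\<^sup>2 \<le> k powr (1 + 2 * \<sigma>) * \<Gamma> x y"
      proof (cases "y \<in> {lo<..hi} \<and> x \<noteq> y")
        case True
        then have "\<bar>x - y\<bar> \<le> k" using lo by (auto simp: hi_def)
        then have "\<bar>x - y\<bar> powr (1 + 2 * \<sigma>) \<le> k powr (1 + 2 * \<sigma>)" using \<sigma> by (intro powr_mono2) auto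
        moreover have "0 < \<bar>x - y\<bar> powr (1 + 2 * \<sigma>)" using True by simp
        ultimately have "1 \<le> k powr (1 + 2 * \<sigma>) / \<bar>x - y\<bar> powr (1 + 2 * \<sigma>)" by simp
        then have "1 * (norm (v x - v y))\<^sup>2 \<le> k powr (1 + 2 * \<sigma>) / \<bar>x - y\<bar> powr (1 + 2 * \<sigma>) * (norm (v x - v y))\<^sup>2"
          by (rule mult_right_mono) simp
        then show ?thesis using True by (simp add: w_def I_def \<Gamma>_def gagliardo_integrand_def)
      next
        case False
        then have "w y = 0" by (auto simp: w_def I_def)
        then show ?thesis using G0 by simp
      qed
    qed
    also have "\<dots> = k * (k powr (2 * \<sigma>) * (LINT y|\<mu>. \<Gamma> x y))" using k by (simp add: powr_add)
    finally show ?thesis using k by (simp add: divide_right_mono mult_left_mono)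
  qed
  have "AE x in \<mu>. integrable \<mu> (\<lambda>y. \<Gamma> x y)" using P.AE_integrable_fst'[OF G] by simp
  then have ae: "AE x in \<mu>. (norm (v x - window_mean h v x))\<^sup>2 \<le> k powr (2 * \<sigma>) * (LINT y|\<mu>. \<Gamma> x y)"
    using AE_space by eventually_elim (use pointwise in simp)
  have "(L2_norm (\<lambda>x. v x - window_mean h v x))\<^sup>2 \<le> (LINT x|\<mu>. k powr (2 * \<sigma>) * (LINT y|\<mu>. \<Gamma> x y))"
    unfolding L2_norm_sq
    by (rule integral_mono_AE[OF L2_D(2)[OF L2_diff(1)[OF v z]] _ ae])
      (use P.integrable_fst'[OF G] in simp)
  also have "\<dots> = k powr (2 * \<sigma>) * (LINT z|(\<mu> \<Otimes>\<^sub>M \<mu>). gagliardo_integrand \<sigma> v z)"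
    using P.integral_fst'[OF G] by (simp add: \<Gamma>_def)
  finally show "(L2_norm (\<lambda>x. v x - window_mean h v x))\<^sup>2
       \<le> (h * pi) powr (2 * \<sigma>) * (LINT z|(\<mu> \<Otimes>\<^sub>M \<mu>). gagliardo_integrand \<sigma> v z)"
    by (simp add: k_def)
qed


lemma gagliardo_nonneg: "0 \<le> gagliardo_integrand \<sigma> v z"
  by (cases z) (simp add: gagliardo_integrand_def)

lemma Hs_norm_sq_ge_Hk: "(Hk_norm (nat \<lfloor>s\<rfloor>) u)\<^sup>2 \<le> (Hs_norm s u)\<^sup>2"
  unfolding Hs_norm_def by (simp add: Bochner_Integration.integral_nonneg gagliardo_nonneg)

lemma Hs_norm_nonneg [simp]: "0 \<le> Hs_norm s u"
  unfolding Hs_norm_def by (simp add: Bochner_Integration.integral_nonneg gagliardo_nonneg)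

lemma Hk_1_le_Hs_norm: assumes "s > 1" shows "Hk_norm 1 u \<le> Hs_norm s u"
proof -
  have "1 \<le> nat \<lfloor>s\<rfloor>" using assms by (simp add: le_nat_iff le_floor_iff)
  then have "Hk_norm 1 u \<le> Hk_norm (nat \<lfloor>s\<rfloor>) u" by (rule Hk_norm_mono)
  also have "\<dots> \<le> Hs_norm s u" by (rule power2_le_imp_le[OF Hs_norm_sq_ge_Hk]) simp
  finally show ?thesis .
qed

lemma Hs_second_derivative:
  assumes s: "s \<ge> 2" and u: "u \<in> Hs s"
  shows "H1_pair (weak_deriv u) (weak_deriv (weak_deriv u))"
    "(Hk_norm 1 u)\<^sup>2 + (L2_norm (weak_deriv (weak_deriv u)))\<^sup>2 \<le> (Hs_norm s u)\<^sup>2"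
proof -
  have m: "2 \<le> nat \<lfloor>s\<rfloor>" using s by (simp add: le_nat_iff le_floor_iff)
  show "H1_pair (weak_deriv u) (weak_deriv (weak_deriv u))"
    using Hk_ge_2_D(2)[OF _ m] u by (auto simp: Hs_def)
  have "(Hk_norm 1 u)\<^sup>2 + (L2_norm (weak_deriv (weak_deriv u)))\<^sup>2 = (Hk_norm 2 u)\<^sup>2"
    unfolding Hk_norm_def by (simp add: numeral_2_eq_2 sum_nonneg)
  also have "\<dots> \<le> (Hk_norm (nat \<lfloor>s\<rfloor>) u)\<^sup>2" by (intro power_mono Hk_norm_mono m) simp
  also have "\<dots> \<le> (Hs_norm s u)\<^sup>2" by (rule Hs_norm_sq_ge_Hk)
  finally show "(Hk_norm 1 u)\<^sup>2 + (L2_norm (weak_deriv (weak_deriv u)))\<^sup>2 \<le> (Hs_norm s u)\<^sup>2" .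
qed

lemma Hs_fractional:
  assumes s: "1 < s" "s < 2" and u: "u \<in> Hs s"
  shows "integrable (\<mu> \<Otimes>\<^sub>M \<mu>) (gagliardo_integrand (s - 1) (weak_deriv u))"
    "(Hs_norm s u)\<^sup>2 = (Hk_norm 1 u)\<^sup>2 + (LINT z|(\<mu> \<Otimes>\<^sub>M \<mu>). gagliardo_integrand (s - 1) (weak_deriv u) z)"
proof -
  have f: "\<lfloor>s\<rfloor> = 1" using s by (simp add: floor_eq_iff)
  then have fr: "frac s = s - 1" by (simp add: frac_def)
  show "integrable (\<mu> \<Otimes>\<^sub>M \<mu>) (gagliardo_integrand (s - 1) (weak_deriv u))"
    using u s unfolding Hs_def f fr by auto
  show "(Hs_norm s u)\<^sup>2 = (Hk_norm 1 u)\<^sup>2 + (LINT z|(\<mu> \<Otimes>\<^sub>M \<mu>). gagliardo_integrand (s - 1) (weak_deriv u) z)"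
    using s unfolding Hs_norm_def f fr
    by (simp add: Bochner_Integration.integral_nonneg gagliardo_nonneg)
qed

text \<open>The primitive is a continuous representative of u, as window means require.\<close>

lemma H10_antideriv_pair:
  assumes "u \<in> H10"
  shows "H1_pair (antideriv (weak_deriv u)) (weak_deriv u)"
proof -
  have p: "H10_pair u (weak_deriv u)" using assms by (simp add: H10_iff)
  have "H10_pair (antideriv (weak_deriv u)) (weak_deriv u)"
    by (rule H10_pair_cong_AE[OF p H10_AE_antideriv[OF p]])
      (auto intro!: L2_D(1) antideriv_L2 H10_pair_L2(2)[OF p])
  then show ?thesis by (rule H10_pair_H1)
qed

text \<open>Smoothing of the derivative of a datum of regularity s: window averages of length proportional
  to the inverse fourth root of L, or no smoothing when there are two derivatives.\<close>

lemma Hs_approximation: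
  assumes s: "s > 1"
  obtains a C :: real where "a > 0" "C \<ge> 0"
    "\<And>(u :: real \<Rightarrow> complex) L. u \<in> Hs s \<inter> H10 \<Longrightarrow> L \<ge> 1 \<Longrightarrow> \<exists>z z'. H1_pair z z' \<and>
       L2_norm (\<lambda>x. weak_deriv u x - z x) \<le> C * L powr (- a) * Hs_norm s u \<and>
       L2_norm z' \<le> C * L powr (1/4) * Hs_norm s u"
proof (cases "s \<ge> 2")
  case True
  show ?thesis
  proof (rule that[of 1 1])
    fix u :: "real \<Rightarrow> complex" and L :: real assume u: "u \<in> Hs s \<inter> H10" and L: "L \<ge> 1"
    have "(L2_norm (weak_deriv (weak_deriv u)))\<^sup>2 \<le> (Hs_norm s u)\<^sup>2"
      using Hs_second_derivative(2)[OF True IntD1[OF u]] zero_le_power2[of "Hk_norm 1 u"] by linarith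
    then have "L2_norm (weak_deriv (weak_deriv u)) \<le> Hs_norm s u" by (rule power2_le_imp_le) simp
    also have "\<dots> \<le> L powr (1/4) * Hs_norm s u"
      using L mult_right_mono[of 1 "L powr (1/4)" "Hs_norm s u"] by (simp add: ge_one_powr_ge_zero)
    finally show "\<exists>z z'. H1_pair z z' \<and>
       L2_norm (\<lambda>x. weak_deriv u x - z x) \<le> 1 * L powr (- 1) * Hs_norm s u \<and>
       L2_norm z' \<le> 1 * L powr (1/4) * Hs_norm s u"
      using Hs_second_derivative(1)[OF True] u
      by (intro exI[of _ "weak_deriv u"] exI[of _ "weak_deriv (weak_deriv u)"]) (auto simp: L2_norm_def)
  qed auto
next
  case False
  define \<sigma> where "\<sigma> = s - 1"
  have \<sigma>: "0 < \<sigma>" "\<sigma> < 1" using s False by (auto simp: \<sigma>_def)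
  show ?thesis
  proof (rule that[of "\<sigma> / 4" 4])
    fix u :: "real \<Rightarrow> complex" and L :: real assume u: "u \<in> Hs s \<inter> H10" and L: "L \<ge> 1"
    define v where "v = weak_deriv u"
    define h where "h = L powr (- (1/4)) / 2"
    have "0 < L powr (- (1/4))" "L powr (- (1/4)) \<le> 1" using L powr_mono[of "- (1/4)" 0 L] by auto
    then have h: "0 < h" "h < 1" by (auto simp: h_def)
    have p: "H1_pair (antideriv v) v" unfolding v_def using H10_antideriv_pair u by blast
    have gag: "integrable (\<mu> \<Otimes>\<^sub>M \<mu>) (gagliardo_integrand \<sigma> v)"
      and Hs: "(Hs_norm s u)\<^sup>2 = (Hk_norm 1 u)\<^sup>2 + (LINT z|(\<mu> \<Otimes>\<^sub>M \<mu>). gagliardo_integrand \<sigma> v z)"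
      using Hs_fractional[of s u] s False u by (auto simp: \<sigma>_def v_def)
    have "(L2_norm (\<lambda>x. v x - window_mean h v x))\<^sup>2 \<le> (h * pi) powr (2 * \<sigma>) * (Hs_norm s u)\<^sup>2"
    proof -
      have "(LINT z|(\<mu> \<Otimes>\<^sub>M \<mu>). gagliardo_integrand \<sigma> v z) \<le> (Hs_norm s u)\<^sup>2" unfolding Hs by simp
      then have "(h * pi) powr (2 * \<sigma>) * (LINT z|(\<mu> \<Otimes>\<^sub>M \<mu>). gagliardo_integrand \<sigma> v z) \<le> (h * pi) powr (2 * \<sigma>) * (Hs_norm s u)\<^sup>2"
        by (rule mult_left_mono) simp
      then show ?thesis
        using window_mean_error(2)[OF H1_pair_D(2)[OF p] h(1) less_imp_le[OF h(2)] \<sigma>(1) gag] by linarith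
    qed
    also have "\<dots> = ((h * pi) powr \<sigma> * Hs_norm s u)\<^sup>2"
      by (simp add: power_mult_distrib power2_eq_square flip: powr_add)
    finally have "L2_norm (\<lambda>x. v x - window_mean h v x) \<le> (h * pi) powr \<sigma> * Hs_norm s u"
      by (rule power2_le_imp_le) simp
    also have "(h * pi) powr \<sigma> \<le> 4 * L powr (- (\<sigma> / 4))"
    proof -
      have "(h * pi) powr \<sigma> = (L powr (- (1/4))) powr \<sigma> * (pi / 2) powr \<sigma>"
        using L by (simp add: h_def flip: powr_mult)
      also have "(L powr (- (1/4))) powr \<sigma> = L powr (- (\<sigma> / 4))" by (simp add: powr_powr)
      finally have eq: "(h * pi) powr \<sigma> = L powr (- (\<sigma> / 4)) * (pi / 2) powr \<sigma>" .
      have "(pi / 2) powr \<sigma> \<le> (pi / 2) powr 1" using \<sigma> pi_gt3 by (intro powr_mono) auto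
      also have "\<dots> \<le> 4" using pi_less_4 by simp
      finally have "L powr (- (\<sigma> / 4)) * (pi / 2) powr \<sigma> \<le> L powr (- (\<sigma> / 4)) * 4"
        by (rule mult_left_mono) simp
      then show ?thesis unfolding eq by simp
    qed
    finally have e: "L2_norm (\<lambda>x. v x - window_mean h v x) \<le> 4 * L powr (- (\<sigma> / 4)) * Hs_norm s u"
      by (simp add: mult_right_mono)
    have "L2_norm v \<le> Hs_norm s u"
      using H1_pair_norm_bounds(2)[of u v] Hk_1_le_Hs_norm[OF s, of u] u
      by (auto simp: v_def H10_def Hk_1_iff[symmetric])
    moreover have "1 / h = 2 * L powr (1/4)" by (simp add: h_def powr_minus_divide)
    ultimately have "1 / h * L2_norm v \<le> 4 * L powr (1/4) * Hs_norm s u"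
      by (intro mult_mono) auto
    note d = order_trans[OF window_mean_H1_pair(2)[OF p h] this]
    show "\<exists>z z'. H1_pair z z' \<and>
       L2_norm (\<lambda>x. weak_deriv u x - z x) \<le> 4 * L powr (- (\<sigma> / 4)) * Hs_norm s u \<and>
       L2_norm z' \<le> 4 * L powr (1/4) * Hs_norm s u"
      by (intro exI conjI, rule window_mean_H1_pair(1)[OF p h], use e v_def in simp, rule d)
  qed (use \<sigma> in auto)
qed

text \<open>A nonzero datum in \<^term>\<open>H10\<close> has a strictly larger norm in the space of order s than in that of
  order 1, because its derivative has mean zero and hence is not constant.\<close>

lemma Hs_norm_eq_imp_zero:
  fixes u :: "real \<Rightarrow> complex"
  assumes s: "s > 1" and u: "u \<in> Hs s \<inter> H10" and eq: "Hs_norm s u = Hk_norm 1 u"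
  shows "Hk_norm 1 u = 0"
proof -
  define v where "v = weak_deriv u"
  have p: "H10_pair u v" using u by (simp add: v_def H10_iff)
  note L = H10_pair_L2[OF p]
  have "L2_norm v = 0"
  proof (cases "s \<ge> 2")
    case True
    have "(L2_norm (weak_deriv v))\<^sup>2 = 0"
      using Hs_second_derivative(2)[OF True IntD1[OF u]] zero_le_power2[of "L2_norm (weak_deriv v)"]
      unfolding v_def eq by linarith
    have q: "H1_pair (\<lambda>x. cnj (v x)) (\<lambda>x. cnj (weak_deriv v x))"
      unfolding v_def
      by (rule H1_pair_bounded_linear[OF Hs_second_derivative(1)[OF True IntD1[OF u]] bounded_linear_cnj])
    have "complex_of_real ((L2_norm v)\<^sup>2) = (LINT x|\<mu>. v x * cnj (v x))"
      unfolding L2_norm_sq integral_complex_of_real[symmetric] complex_norm_square ..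
    also have "\<dots> = - (LINT x|\<mu>. u x * cnj (weak_deriv v x))" by (rule H10_integration_by_parts[OF p q])
    finally have "cmod (complex_of_real ((L2_norm v)\<^sup>2)) \<le> L2_norm u * L2_norm (\<lambda>x. cnj (weak_deriv v x))"
      using L2_Cauchy_Schwarz[OF L(1) H1_pair_D(2)[OF q]] by simp
    also have "L2_norm (\<lambda>x. cnj (weak_deriv v x)) = 0"
      using \<open>(L2_norm (weak_deriv v))\<^sup>2 = 0\<close> by (simp add: L2_norm_def)
    finally show ?thesis by simp
  next
    case False
    have "(Hk_norm 1 u)\<^sup>2 = (Hs_norm s u)\<^sup>2" using eq by simp
    then have "(LINT z|(\<mu> \<Otimes>\<^sub>M \<mu>). gagliardo_integrand (s - 1) v z) = 0"
      and gag: "integrable (\<mu> \<Otimes>\<^sub>M \<mu>) (gagliardo_integrand (s - 1) v)"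
      using Hs_fractional[of s u] s False u by (auto simp: v_def)
    then have "(L2_norm (\<lambda>x. v x - window_mean 1 v x))\<^sup>2 \<le> 0"
      using window_mean_error(2)[OF L(2) _ _ _ gag, of 1] s by simp
    moreover have "antideriv v 0 = 0"
      using antideriv_eq_integral[OF L2_integrable[OF L(2)], of 0] by simp
    then have "window_mean 1 v = (\<lambda>_. 0)"
      using H10_antideriv_pi[OF p] by (simp add: window_mean_def[abs_def])
    ultimately show ?thesis by simp
  qed
  moreover have "L2_norm u = 0" using H10_Poincare[OF p] calculation by (simp add: antisym)
  ultimately show ?thesis unfolding H1_pair_norm[OF H10_pair_H1[OF p]] by simp
qed

section \<open>Differentiation and comparison in time\<close>

lemma has_derivative_under_integral:
  fixes \<phi> \<phi>' :: "real \<Rightarrow> real \<Rightarrow> real"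
  assumes d: "\<And>x s. x \<in> {0<..<pi} \<Longrightarrow> (\<phi> x has_real_derivative \<phi>' x s) (at s)"
    and b: "\<And>x s. x \<in> {0<..<pi} \<Longrightarrow> \<bar>\<phi>' x s\<bar> \<le> B"
    and i: "\<And>s. integrable \<mu> (\<lambda>x. \<phi> x s)" and m: "\<And>s. (\<lambda>x. \<phi>' x s) \<in> borel_measurable \<mu>"
  shows "((\<lambda>s. LINT x|\<mu>. \<phi> x s) has_real_derivative (LINT x|\<mu>. \<phi>' x t)) (at t)"
  unfolding DERIV_def tendsto_at_iff_sequentially
proof (intro allI impI)
  fix h :: "nat \<Rightarrow> real" assume h: "\<forall>k. h k \<in> UNIV - {0}" "h \<longlonglongrightarrow> 0"
  have "(\<lambda>k. LINT x|\<mu>. (\<phi> x (t + h k) - \<phi> x t) / h k) \<longlonglongrightarrow> (LINT x|\<mu>. \<phi>' x t)"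
  proof (rule integral_dominated_convergence[where w="\<lambda>_. B"])
    show "(\<lambda>x. \<phi>' x t) \<in> borel_measurable \<mu>" by (rule m)
    show "(\<lambda>x. (\<phi> x (t + h k) - \<phi> x t) / h k) \<in> borel_measurable \<mu>" for k
      using i[of t] i[of "t + h k"] by simp
    show "AE x in \<mu>. (\<lambda>k. (\<phi> x (t + h k) - \<phi> x t) / h k) \<longlonglongrightarrow> \<phi>' x t"
    proof (rule AE_I2)
      fix x assume "x \<in> space \<mu>"
      then have "((\<lambda>h. (\<phi> x (t + h) - \<phi> x t) / h) \<longlongrightarrow> \<phi>' x t) (at 0)"
        using d[of x t] by (simp add: DERIV_def)
      then show "(\<lambda>k. (\<phi> x (t + h k) - \<phi> x t) / h k) \<longlonglongrightarrow> \<phi>' x t"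
        using h unfolding tendsto_at_iff_sequentially comp_def by blast
    qed
    show "AE x in \<mu>. norm ((\<phi> x (t + h k) - \<phi> x t) / h k) \<le> B" for k
    proof (rule AE_I2)
      fix x assume "x \<in> space \<mu>"
      then have x: "x \<in> {0<..<pi}" by simp
      have "norm (\<phi> x (t + h k) - \<phi> x t) \<le> B * norm ((t + h k) - t)"
        by (rule field_differentiable_bound[where S=UNIV and f'="\<phi>' x"]) (use d[OF x] b[OF x] in auto)
      then show "norm ((\<phi> x (t + h k) - \<phi> x t) / h k) \<le> B" using h(1) by (simp add: divide_le_eq)
    qed
  qed simp
  moreover have "(LINT x|\<mu>. (\<phi> x (t + h k) - \<phi> x t) / h k) = ((LINT x|\<mu>. \<phi> x (t + h k)) - (LINT x|\<mu>. \<phi> x t)) / h k" for k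
    using Bochner_Integration.integral_diff[OF i i, of "t + h k" t] by (simp only: integral_divide_zero)
  ultimately show "((\<lambda>h. ((LINT x|\<mu>. \<phi> x (t + h)) - (LINT x|\<mu>. \<phi> x t)) / h) \<circ> h) \<longlonglongrightarrow> (LINT x|\<mu>. \<phi>' x t)"
    by (simp only: comp_def)
qed

text \<open>Conservation laws are proved in this form: the truncated quantities S are differentiable in time and
  conserved up to a small error, and dominated convergence of their derivatives carries over to the
  limit, which is not known to be differentiable beforehand.\<close>

lemma limit_constant:
  fixes S S' :: "nat \<Rightarrow> real \<Rightarrow> real"
  assumes d: "\<And>N t. (S N has_real_derivative S' N t) (at t)" and b: "\<And>N t. \<bar>S' N t\<bar> \<le> B"
    and z: "\<And>t. (\<lambda>N. S' N t) \<longlonglongrightarrow> 0" and l: "\<And>t. (\<lambda>N. S N t) \<longlonglongrightarrow> \<phi> t"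
  shows "\<phi> t = \<phi> 0"
proof -
  have *: "\<phi> b = \<phi> a" if ab: "a \<le> b" for a b
  proof -
    have I: "(S' N has_integral S N b - S N a) {a..b}" for N
      by (rule fundamental_theorem_of_calculus[OF ab])
        (rule has_vector_derivative_at_within[OF d[unfolded has_real_derivative_iff_has_vector_derivative]])
    have "(\<lambda>N. integral {a..b} (S' N)) \<longlonglongrightarrow> integral {a..b} (\<lambda>_. 0)"
      by (rule dominated_convergence(2)[where h="\<lambda>_. B"]) (use I b z in \<open>auto simp: integrable_on_def\<close>)
    then have "(\<lambda>N. S N b - S N a) \<longlonglongrightarrow> 0" by (simp add: integral_unique[OF I])
    moreover have "(\<lambda>N. S N b - S N a) \<longlonglongrightarrow> \<phi> b - \<phi> a" by (intro tendsto_diff l)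
    ultimately have "\<phi> b - \<phi> a = 0" using LIMSEQ_unique by blast
    then show ?thesis by simp
  qed
  show ?thesis using *[of 0 t] *[of t 0] by (cases "0 \<le> t") auto
qed

text \<open>Gronwall's inequality for a bounded limit of functions that vanish initially, by iteration: each
  pass gains one term of the exponential series.\<close>

lemma limit_Gronwall:
  fixes S S' :: "nat \<Rightarrow> real \<Rightarrow> real"
  assumes d: "\<And>N t. (S N has_real_derivative S' N t) (at t)" and b: "\<And>N t. \<bar>S' N t\<bar> \<le> \<kappa> * \<phi> t"
    and S0: "\<And>N. S N 0 = 0" and l: "\<And>t. (\<lambda>N. S N t) \<longlonglongrightarrow> \<phi> t"
    and B: "\<And>t. \<phi> t \<le> B" and \<kappa>: "\<kappa> \<ge> 0"
  shows "\<phi> t \<le> 0"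
proof -
  have pos: "\<phi> t \<le> 0"
    if d: "\<And>N t. (S N has_real_derivative S' N t) (at t)" and b: "\<And>N t. \<bar>S' N t\<bar> \<le> \<kappa> * \<phi> t"
    and S0: "\<And>N. S N 0 = 0" and l: "\<And>t. (\<lambda>N. S N t) \<longlonglongrightarrow> \<phi> t"
    and B: "\<And>t. \<phi> t \<le> B" and t: "t \<ge> 0" for S S' :: "nat \<Rightarrow> real \<Rightarrow> real" and \<phi> :: "real \<Rightarrow> real" and t
  proof -
    have iter: "\<phi> s \<le> B * (\<kappa> * s) ^ k / fact k" if "0 \<le> s" for k s
      using that
    proof (induction k arbitrary: s)
      case 0 then show ?case using B by simp
    next
      case (Suc k)
      define D where "D r = B * (\<kappa> * r) ^ Suc k / fact (Suc k)" for r
      have D: "(D has_real_derivative \<kappa> * (B * (\<kappa> * r) ^ k / fact k)) (at r)" for r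
      proof -
        define c where "c = B * \<kappa> ^ Suc k / fact (Suc k)"
        have "D = (\<lambda>r. c * r ^ Suc k)"
          by (simp add: fun_eq_iff D_def c_def power_mult_distrib)
        moreover have "((\<lambda>r. c * r ^ Suc k) has_real_derivative c * (real (Suc k) * r ^ k)) (at r)"
          using DERIV_cmult[OF DERIV_pow[of "Suc k" r UNIV], of c] by simp
        moreover have "c * (real (Suc k) * r ^ k) = \<kappa> * (B * (\<kappa> * r) ^ k / fact k)"
          unfolding c_def fact_Suc by (simp add: power_mult_distrib del: of_nat_Suc)
        ultimately show ?thesis by simp
      qed
      have "S N s \<le> D s" for N
      proof -
        have "D 0 - S N 0 \<le> D s - S N s"
        proof (rule DERIV_nonneg_imp_nondecreasing[OF Suc.prems])
          fix r assume r: "0 \<le> r" "r \<le> s"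
          have "S' N r \<le> \<kappa> * \<phi> r" using b[of N r] by linarith
          also have "\<dots> \<le> \<kappa> * (B * (\<kappa> * r) ^ k / fact k)"
            by (rule mult_left_mono[OF Suc.IH[OF r(1)] \<kappa>])
          finally show "\<exists>y. ((\<lambda>s. D s - S N s) has_real_derivative y) (at r) \<and> 0 \<le> y"
            using DERIV_diff[OF D[of r] d[of N r]] by (intro exI conjI) auto
        qed
        then show ?thesis by (simp add: D_def S0)
      qed
      then show ?case using l[of s] unfolding D_def by (intro LIMSEQ_le_const2) auto
    qed
    have "(\<lambda>k. B * ((\<kappa> * t) ^ k / fact k)) \<longlonglongrightarrow> B * 0"
      using summable_LIMSEQ_zero[OF summable_exp[of "\<kappa> * t"]]
      by (intro tendsto_mult tendsto_const) (simp add: divide_inverse mult.commute)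
    then show ?thesis using iter[OF t] by (intro LIMSEQ_le_const[of _ 0]) auto
  qed
  show ?thesis
  proof (cases "t \<ge> 0")
    case True
    then show ?thesis using pos[OF d b S0 l B] by blast
  next
    case False
    have "\<phi> (- (- t)) \<le> 0"
    proof (rule pos[of "\<lambda>N t. S N (- t)" "\<lambda>N t. - S' N (- t)" "\<lambda>t. \<phi> (- t)"])
      show "((\<lambda>t. S N (- t)) has_real_derivative - S' N (- s)) (at s)" for N s
        using d[of N "- s"] by (simp add: DERIV_mirror)
    qed (use assms False in auto)
    then show ?thesis by simp
  qed
qed

section \<open>Solutions of the Schroedinger equation, mode by mode\<close>

definition nl :: "(real \<Rightarrow> real \<Rightarrow> real) \<Rightarrow> (real \<Rightarrow> complex) \<Rightarrow> real \<Rightarrow> complex" where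
  "nl g v x = complex_of_real (g x ((cmod (v x))\<^sup>2)) * v x"

lemma nl_measurable_comp:
  assumes "uniformly_Lipschitz g" "v \<in> borel_measurable \<mu>"
  shows "nl g v \<in> borel_measurable \<mu>"
proof -
  have "(\<lambda>x. g x ((cmod (v x))\<^sup>2)) \<in> borel_measurable \<mu>"
    using assms(2) by (intro nl_measurable[OF assms(1)]) simp
  then show ?thesis unfolding nl_def[abs_def] using assms(2) by simp
qed

definition nl_Lipschitz_on_ball :: "(real \<Rightarrow> real \<Rightarrow> real) \<Rightarrow> real \<Rightarrow> real \<Rightarrow> bool" where
  "nl_Lipschitz_on_ball g R K \<longleftrightarrow> K \<ge> 0 \<and>
     (\<forall>v w. v \<in> L2 \<longrightarrow> w \<in> L2 \<longrightarrow> (AE x in \<mu>. cmod (v x) \<le> R) \<longrightarrow> (AE x in \<mu>. cmod (w x) \<le> R) \<longrightarrow>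
       nl g v \<in> L2 \<and> L2_norm (\<lambda>x. nl g v x - nl g w x) \<le> K * L2_norm (\<lambda>x. v x - w x))"

lemma nl_Lipschitz_on_ball_exists:
  assumes g: "uniformly_Lipschitz g"
  shows "\<exists>K. nl_Lipschitz_on_ball g R K"
proof -
  obtain L where L: "L \<ge> 0"
    "\<And>x y z. x \<in> {0<..<pi} \<Longrightarrow> \<bar>y\<bar> \<le> R\<^sup>2 \<Longrightarrow> \<bar>z\<bar> \<le> R\<^sup>2 \<Longrightarrow> \<bar>g x y - g x z\<bar> \<le> L * \<bar>y - z\<bar>"
    "\<And>x y. x \<in> {0<..<pi} \<Longrightarrow> \<bar>y\<bar> \<le> R\<^sup>2 \<Longrightarrow> \<bar>g x y\<bar> \<le> L * \<bar>y\<bar>"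
    using nl_Lipschitz[OF g, of "R\<^sup>2"] by metis
  define K where "K = 3 * L * R\<^sup>2"
  have sq: "\<bar>(cmod a)\<^sup>2\<bar> \<le> R\<^sup>2" if "cmod a \<le> R" for a
    using that by (simp add: power_mono)
  have pw: "cmod (nl g v x - nl g w x) \<le> K * cmod (v x - w x)"
    if x: "x \<in> {0<..<pi}" and vw: "cmod (v x) \<le> R" "cmod (w x) \<le> R" for v w x
  proof -
    have R: "R \<ge> 0" using vw(1) norm_ge_zero order_trans by blast
    have a: "\<bar>g x ((cmod (v x))\<^sup>2)\<bar> \<le> L * R\<^sup>2"
      using L(3)[OF x sq[OF vw(1)]] mult_left_mono[OF sq[OF vw(1)] L(1)] by linarith
    have "\<bar>(cmod (v x))\<^sup>2 - (cmod (w x))\<^sup>2\<bar> = \<bar>cmod (v x) - cmod (w x)\<bar> * (cmod (v x) + cmod (w x))"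
      by (simp add: power2_eq_square abs_mult flip: square_diff_square_factored) (simp add: square_diff_square_factored abs_mult)
    also have "\<dots> \<le> cmod (v x - w x) * (2 * R)"
      using vw norm_triangle_ineq3[of "v x" "w x"] by (intro mult_mono) auto
    finally have "L * \<bar>(cmod (v x))\<^sup>2 - (cmod (w x))\<^sup>2\<bar> \<le> L * (cmod (v x - w x) * (2 * R))"
      using L(1) by (rule mult_left_mono)
    then have b: "\<bar>g x ((cmod (v x))\<^sup>2) - g x ((cmod (w x))\<^sup>2)\<bar> \<le> L * (cmod (v x - w x) * (2 * R))"
      using L(2)[OF x sq[OF vw(1)] sq[OF vw(2)]] by linarith
    have "nl g v x - nl g w x = complex_of_real (g x ((cmod (v x))\<^sup>2)) * (v x - w x)
        + complex_of_real (g x ((cmod (v x))\<^sup>2) - g x ((cmod (w x))\<^sup>2)) * w x"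
      by (simp add: nl_def algebra_simps)
    then have "cmod (nl g v x - nl g w x) \<le> \<bar>g x ((cmod (v x))\<^sup>2)\<bar> * cmod (v x - w x)
        + \<bar>g x ((cmod (v x))\<^sup>2) - g x ((cmod (w x))\<^sup>2)\<bar> * cmod (w x)"
      by (metis norm_mult norm_of_real norm_triangle_ineq)
    also have "\<dots> \<le> (L * R\<^sup>2) * cmod (v x - w x) + (L * (cmod (v x - w x) * (2 * R))) * R"
      using a b vw(2) L(1) R by (intro add_mono mult_mono) auto
    also have "\<dots> = K * cmod (v x - w x)" by (simp add: K_def algebra_simps power2_eq_square)
    finally show ?thesis .
  qed
  show ?thesis
    unfolding nl_Lipschitz_on_ball_def
  proof (intro exI[of _ K] conjI allI impI)
    show K0: "K \<ge> 0" using L(1) by (simp add: K_def)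
    fix v w assume v: "v \<in> L2" and w: "w \<in> L2" and vw: "AE x in \<mu>. cmod (v x) \<le> R" "AE x in \<mu>. cmod (w x) \<le> R"
    have nl0: "nl g (\<lambda>_. 0) = (\<lambda>_. 0)" by (simp add: nl_def[abs_def])
    note m = nl_measurable_comp[OF g L2_D(1)[OF v]] nl_measurable_comp[OF g L2_D(1)[OF w]]
    have "AE x in \<mu>. cmod (nl g v x) \<le> K * cmod (v x)"
      using vw(1) AE_space
    proof eventually_elim
      case (elim x)
      then have "0 \<le> R" using norm_ge_zero order_trans by blast
      then show ?case using pw[of x v "\<lambda>_. 0"] elim by (simp add: nl0)
    qed
    then show "nl g v \<in> L2" by (rule L2_dominated(1)[OF v m(1)])
    have "AE x in \<mu>. cmod (nl g v x - nl g w x) \<le> K * cmod (v x - w x)"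
      using vw AE_space by eventually_elim (use pw in simp)
    then show "L2_norm (\<lambda>x. nl g v x - nl g w x) \<le> K * L2_norm (\<lambda>x. v x - w x)"
      using L2_dominated(2)[OF L2_diff(1)[OF v w] borel_measurable_diff[OF m], of K] K0 by simp
  qed
qed

text \<open>The bound by some constant C ensures that the supremum in the dual norm is not a default value.\<close>

lemma Hm1_norm_bound:
  assumes b: "\<And>\<phi>. \<phi> \<in> H10 \<Longrightarrow> cmod (\<Phi> \<phi>) \<le> C * Hk_norm 1 \<phi>"
    and h: "\<And>c \<phi>. \<phi> \<in> H10 \<Longrightarrow> \<Phi> (\<lambda>x. c * \<phi> x) = c * \<Phi> \<phi>" and \<phi>: "\<phi> \<in> H10"
  shows "cmod (\<Phi> \<phi>) \<le> Hk_norm 1 \<phi> * Hm1_norm \<Phi>"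
proof (cases "Hk_norm 1 \<phi> = 0")
  case True
  then show ?thesis using b[OF \<phi>] by simp
next
  case False
  define K where "K = Hk_norm 1 \<phi>"
  have K: "K > 0" using False by (simp add: K_def less_le)
  define \<psi> where "\<psi> x = complex_of_real (1 / K) * \<phi> x" for x
  have p: "H10_pair \<phi> (weak_deriv \<phi>)" using \<phi> by (simp add: H10_iff)
  have q: "H10_pair \<psi> (\<lambda>x. complex_of_real (1 / K) * weak_deriv \<phi> x)"
    unfolding \<psi>_def[abs_def] by (rule H10_pair_cmult[OF p])
  have "cmod (complex_of_real (1 / K)) = 1 / K" using K by (simp add: norm_divide)
  then have "Hk_norm 1 \<psi> = sqrt ((1 / K)\<^sup>2 * ((L2_norm \<phi>)\<^sup>2 + (L2_norm (weak_deriv \<phi>))\<^sup>2))"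
    unfolding H1_pair_norm[OF H10_pair_H1[OF q]] unfolding \<psi>_def[abs_def] L2_norm_cmult
    by (simp only: power_mult_distrib distrib_left)
  also have "\<dots> = (1 / K) * K"
    unfolding real_sqrt_mult K_def Hk_norm_1[symmetric] using K by (simp add: K_def)
  finally have "Hk_norm 1 \<psi> = (1 / K) * K" .
  then have \<psi>: "\<psi> \<in> {\<phi> \<in> H10. Hk_norm 1 \<phi> \<le> 1}" using H10_pairI(1)[OF q] K by simp
  have "bdd_above ((\<lambda>\<phi>. cmod (\<Phi> \<phi>)) ` {\<phi> \<in> H10. Hk_norm 1 \<phi> \<le> 1})"
  proof (rule bdd_aboveI2)
    fix \<phi> :: "real \<Rightarrow> complex" assume f: "\<phi> \<in> {\<phi> \<in> H10. Hk_norm 1 \<phi> \<le> 1}"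
    then have "cmod (\<Phi> \<phi>) \<le> C * Hk_norm 1 \<phi>" using b by simp
    also have "\<dots> \<le> \<bar>C\<bar> * 1" using f by (intro mult_mono) auto
    finally show "cmod (\<Phi> \<phi>) \<le> \<bar>C\<bar>" by simp
  qed
  then have "cmod (\<Phi> \<psi>) \<le> Hm1_norm \<Phi>" unfolding Hm1_norm_def by (rule cSUP_upper[OF \<psi>])
  moreover have "\<Phi> \<psi> = complex_of_real (1 / K) * \<Phi> \<phi>" unfolding \<psi>_def[abs_def] by (rule h[OF \<phi>])
  ultimately have "(1 / K) * cmod (\<Phi> \<phi>) \<le> Hm1_norm \<Phi>" using K by (simp add: norm_divide)
  then show ?thesis using K by (simp add: field_simps K_def)
qed

locale nls_solution = dirichlet +
  fixes g :: "real \<Rightarrow> real \<Rightarrow> real" and u0 :: "real \<Rightarrow> complex" and u :: "real \<Rightarrow> real \<Rightarrow> complex"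
  assumes g: "uniformly_Lipschitz g" and sol: "global_solution V g u0 u"
begin

abbreviation du :: "real \<Rightarrow> real \<Rightarrow> complex" where "du t \<equiv> weak_deriv (u t)"
abbreviation cu :: "nat \<Rightarrow> real \<Rightarrow> complex" where "cu n t \<equiv> coef (u t) n"

lemma u_pair: "H10_pair (u t) (du t)"
  using sol by (simp add: global_solution_def H10_iff[symmetric])

lemma u_L2: "u t \<in> L2" "du t \<in> L2"
  using H10_pair_L2[OF u_pair] by auto

text \<open>A single radius R bounds pointwise the solution at all times and all partial sums of its expansion,
  since the energy of the partial sums does not exceed that of the solution. Hence one constant K serves
  for comparing the nonlinear terms of all of them.\<close>

definition B :: real where "B = (SOME B. \<forall>t. Hk_norm 1 (u t) \<le> B)"

lemma B: "Hk_norm 1 (u t) \<le> B" "0 \<le> B"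
proof -
  have "\<exists>B. \<forall>t. Hk_norm 1 (u t) \<le> B" using sol by (auto simp: global_solution_def)
  then have "\<forall>t. Hk_norm 1 (u t) \<le> B" unfolding B_def by (rule someI_ex)
  then show "Hk_norm 1 (u t) \<le> B" "0 \<le> B" using Hk_norm_nonneg order_trans by blast+
qed

lemma energy_le: "energy (u t) (du t) \<le> (2 * \<rho> + 1) * B\<^sup>2"
proof -
  have "(2 * \<rho> + 1) * (Hk_norm 1 (u t))\<^sup>2 \<le> (2 * \<rho> + 1) * B\<^sup>2"
    using \<rho>_pos by (intro mult_left_mono power_mono B) auto
  then show ?thesis using energy_bounds(2)[OF H10_pair_H1[OF u_pair[of t]]] by linarith
qed

definition R :: real where "R = sqrt pi * (sqrt (2 * \<rho> + 1) * B)"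

lemma R_nonneg: "0 \<le> R" using B(2) \<rho>_pos by (simp add: R_def)

lemma u_AE_le: "AE x in \<mu>. cmod (u t x) \<le> R"
proof -
  have "(L2_norm (du t))\<^sup>2 \<le> (sqrt (2 * \<rho> + 1) * B)\<^sup>2"
    using energy_bounds(4)[OF H10_pair_H1[OF u_pair[of t]]] energy_le[of t] \<rho>_pos by (simp add: power_mult_distrib)
  then have "L2_norm (du t) \<le> sqrt (2 * \<rho> + 1) * B"
    by (rule power2_le_imp_le) (use B(2) \<rho>_pos in simp)
  then have "sqrt pi * L2_norm (du t) \<le> R" unfolding R_def by (intro mult_left_mono) auto
  then show ?thesis using H10_AE_bound[OF u_pair[of t]] by (auto elim: eventually_mono)
qed

lemma psum_le: "cmod (psum (coef (u t)) N x) \<le> R"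
proof -
  have "psum (coef (u t)) N x = (\<Sum>n=1..N. cu n t * antideriv (ec' n) x)"
    unfolding psum_def by (intro sum.cong refl) (simp add: ec_antideriv)
  also have "\<dots> = antideriv (psum' (coef (u t)) N) x"
  proof -
    have "(\<Sum>n=1..N. cu n t * antideriv (ec' n) x) = (\<Sum>n=1..N. antideriv (\<lambda>y. cu n t * ec' n y) x)"
      unfolding antideriv_def
      by (intro sum.cong refl) (simp flip: integral_mult_right_zero add: scaleR_conv_of_real mult.left_commute)
    also have "\<dots> = antideriv (\<lambda>y. \<Sum>n=1..N. 1 *\<^sub>R (cu n t * ec' n y)) x"
      by (subst antideriv_sum) (auto intro!: L2_cmult ec_L2(2))
    finally show ?thesis by (simp add: psum'_def[abs_def])
  qed
  finally have "cmod (psum (coef (u t)) N x) \<le> sqrt pi * L2_norm (psum' (coef (u t)) N)"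
    using antideriv_norm_le[OF psum_L2(2)] by simp
  also have "\<dots> \<le> R" unfolding R_def
  proof (intro mult_left_mono)
    have "(L2_norm (psum' (coef (u t)) N))\<^sup>2 \<le> (\<Sum>n=1..N. Lam n * (cmod (cu n t))\<^sup>2)"
      using energy_bounds(4)[OF H10_pair_H1[OF psum_pair]] unfolding energy_of_psum .
    also have "\<dots> \<le> (2 * \<rho> + 1) * B\<^sup>2" using energy_Bessel[OF u_pair[of t], of N] energy_le[of t] by linarith
    also have "\<dots> = (sqrt (2 * \<rho> + 1) * B)\<^sup>2" using \<rho>_pos by (simp add: power_mult_distrib)
    finally show "L2_norm (psum' (coef (u t)) N) \<le> sqrt (2 * \<rho> + 1) * B"
      by (rule power2_le_imp_le) (use B(2) \<rho>_pos in simp)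
  qed simp
  finally show ?thesis .
qed

definition K :: real where "K = (SOME K. nl_Lipschitz_on_ball g R K)"

lemma K: "K \<ge> 0"
  "v \<in> L2 \<Longrightarrow> w \<in> L2 \<Longrightarrow> AE x in \<mu>. cmod (v x) \<le> R \<Longrightarrow> AE x in \<mu>. cmod (w x) \<le> R \<Longrightarrow>
     nl g v \<in> L2 \<and> L2_norm (\<lambda>x. nl g v x - nl g w x) \<le> K * L2_norm (\<lambda>x. v x - w x)"
  using someI_ex[OF nl_Lipschitz_on_ball_exists[OF g, of R], folded K_def]
  unfolding nl_Lipschitz_on_ball_def by blast+

lemma nl_L2: "nl g (u t) \<in> L2" "nl g (psum (coef (u t)) N) \<in> L2"
  using K(2)[OF u_L2(1) u_L2(1) u_AE_le u_AE_le, of t t]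
    K(2)[OF psum_L2(1) psum_L2(1) AE_I2 AE_I2, OF psum_le psum_le, of t N t N] by blast+

lemma nl_norm_le: "L2_norm (nl g (u t)) \<le> K * B"
proof -
  have "nl g (\<lambda>_. 0) = (\<lambda>_. 0)" by (simp add: nl_def[abs_def])
  then have "L2_norm (nl g (u t)) \<le> K * L2_norm (u t)"
    using K(2)[OF u_L2(1) L2_const[of 0] u_AE_le] R_nonneg by simp
  also have "\<dots> \<le> K * B"
    using H1_pair_norm_bounds(1)[OF H10_pair_H1[OF u_pair]] B(1) K(1) order_trans by (intro mult_left_mono) blast+
  finally show ?thesis .
qed

definition rhs :: "nat \<Rightarrow> real \<Rightarrow> complex" where
  "rhs n t = - \<i> * (of_real (lam n) * cu n t + coef (nl g (u t)) n)"

text \<open>Testing the equation in the dual space with an eigenfunction gives one ordinary differential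
  equation for each coefficient.\<close>

lemma mode_equation:
  assumes n: "n \<ge> 1"
  shows "(cu n has_vector_derivative rhs n t) (at t)"
proof -
  obtain ut where ut: "\<And>t. ut t \<in> Hm1"
    and lim: "((\<lambda>h. Hm1_norm (\<lambda>\<phi>. (L2_to_Hm1 (u (t + h)) \<phi> - L2_to_Hm1 (u t) \<phi>) / complex_of_real h - ut t \<phi>)) \<longlongrightarrow> 0) (at 0)"
    and eq: "\<And>\<phi>. \<phi> \<in> H10 \<Longrightarrow> \<i> * ut t \<phi> = neg_laplace (u t) \<phi> + L2_to_Hm1 (\<lambda>x. complex_of_real (V x) * u t x) \<phi>
           + L2_to_Hm1 (\<lambda>x. complex_of_real (g x ((cmod (u t x))\<^sup>2)) * u t x) \<phi>"
    using sol unfolding global_solution_def by blast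
  define e where "e x = complex_of_real (f n x)" for x
  have ep: "H10_pair e (ec' n)"
    using H10_pair_bounded_linear[OF f_props(1)[OF n] bounded_linear_of_real]
    unfolding ec'_def[abs_def] e_def[abs_def] .
  have eH: "e \<in> H10" by (rule H10_pairI(1)[OF ep])
  have cue: "L2_to_Hm1 v e = coef v n" for v
    by (simp add: L2_to_Hm1_def eigen_coeff_def e_def)
  have L2_H: "cmod (L2_to_Hm1 v \<phi>) \<le> L2_norm v * Hk_norm 1 \<phi>" "L2_to_Hm1 v (\<lambda>x. c * \<phi> x) = c * L2_to_Hm1 v \<phi>"
    if v: "v \<in> L2" and \<phi>: "\<phi> \<in> H10" for v \<phi> c
  proof -
    have p: "H10_pair \<phi> (weak_deriv \<phi>)" using \<phi> by (simp add: H10_iff)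
    show "cmod (L2_to_Hm1 v \<phi>) \<le> L2_norm v * Hk_norm 1 \<phi>"
      unfolding L2_to_Hm1_def
      by (rule order_trans[OF L2_Cauchy_Schwarz[OF v H10_pair_L2(1)[OF p]]
            mult_left_mono[OF H1_pair_norm_bounds(1)[OF H10_pair_H1[OF p]]]]) simp
    show "L2_to_Hm1 v (\<lambda>x. c * \<phi> x) = c * L2_to_Hm1 v \<phi>"
      unfolding L2_to_Hm1_def by (simp only: mult.left_commute[of _ c] integral_mult_right_zero)
  qed
  obtain C where C: "\<And>\<phi>. \<phi> \<in> H10 \<Longrightarrow> cmod (ut t \<phi>) \<le> C * Hk_norm 1 \<phi>"
    and hom: "\<And>c \<phi>. \<phi> \<in> H10 \<Longrightarrow> ut t (\<lambda>x. c * \<phi> x) = c * ut t \<phi>"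
    using ut[of t] unfolding Hm1_def by blast
  have bnd: "cmod ((cu n (t + h) - cu n t) / complex_of_real h - ut t e)
      \<le> Hk_norm 1 e * Hm1_norm (\<lambda>\<phi>. (L2_to_Hm1 (u (t + h)) \<phi> - L2_to_Hm1 (u t) \<phi>) / complex_of_real h - ut t \<phi>)" for h
  proof -
    define \<Phi> where "\<Phi> \<phi> = (L2_to_Hm1 (u (t + h)) \<phi> - L2_to_Hm1 (u t) \<phi>) / complex_of_real h - ut t \<phi>" for \<phi>
    have "cmod (\<Phi> e) \<le> Hk_norm 1 e * Hm1_norm \<Phi>"
    proof (rule Hm1_norm_bound[OF _ _ eH, where C="(L2_norm (u (t + h)) + L2_norm (u t)) / \<bar>h\<bar> + C"])
      fix \<phi> :: "real \<Rightarrow> complex" assume \<phi>: "\<phi> \<in> H10"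
      have "cmod (\<Phi> \<phi>) \<le> cmod (L2_to_Hm1 (u (t + h)) \<phi> - L2_to_Hm1 (u t) \<phi>) / \<bar>h\<bar> + cmod (ut t \<phi>)"
        unfolding \<Phi>_def by (rule order_trans[OF norm_triangle_ineq4]) (simp add: norm_divide)
      also have "\<dots> \<le> (L2_norm (u (t + h)) * Hk_norm 1 \<phi> + L2_norm (u t) * Hk_norm 1 \<phi>) / \<bar>h\<bar> + C * Hk_norm 1 \<phi>"
        by (intro add_mono divide_right_mono order_trans[OF norm_triangle_ineq4] L2_H(1) u_L2 \<phi> C) auto
      finally show "cmod (\<Phi> \<phi>) \<le> ((L2_norm (u (t + h)) + L2_norm (u t)) / \<bar>h\<bar> + C) * Hk_norm 1 \<phi>"
        by (simp add: algebra_simps add_divide_distrib)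
      show "\<Phi> (\<lambda>x. c * \<phi> x) = c * \<Phi> \<phi>" for c
        unfolding \<Phi>_def hom[OF \<phi>] L2_H(2)[OF u_L2(1) \<phi>] by (simp add: algebra_simps diff_divide_distrib)
    qed
    then show ?thesis unfolding \<Phi>_def cue .
  qed
  have "((\<lambda>h. Hk_norm 1 e * Hm1_norm (\<lambda>\<phi>. (L2_to_Hm1 (u (t + h)) \<phi> - L2_to_Hm1 (u t) \<phi>) / complex_of_real h - ut t \<phi>))
      \<longlongrightarrow> Hk_norm 1 e * 0) (at 0)"
    by (intro tendsto_mult tendsto_const lim)
  then have lim0: "((\<lambda>h. Hk_norm 1 e * Hm1_norm (\<lambda>\<phi>. (L2_to_Hm1 (u (t + h)) \<phi> - L2_to_Hm1 (u t) \<phi>) / complex_of_real h - ut t \<phi>))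
      \<longlongrightarrow> 0) (at 0)" by simp
  have "((\<lambda>h. norm (cu n (t + h) - cu n t - h *\<^sub>R ut t e) / norm h) \<longlongrightarrow> 0) (at 0)"
  proof (rule Lim_null_comparison[OF _ lim0])
    have "norm (norm (cu n (t + h) - cu n t - h *\<^sub>R ut t e) / norm h)
        = cmod ((cu n (t + h) - cu n t) / complex_of_real h - ut t e)" if "h \<noteq> 0" for h
    proof -
      have "cu n (t + h) - cu n t - h *\<^sub>R ut t e = complex_of_real h * ((cu n (t + h) - cu n t) / complex_of_real h - ut t e)"
        using that by (simp add: scaleR_conv_of_real right_diff_distrib diff_divide_distrib)
      then show ?thesis using that by (simp add: norm_mult)
    qed
    then show "\<forall>\<^sub>F h in at 0. norm (norm (cu n (t + h) - cu n t - h *\<^sub>R ut t e) / norm h)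
        \<le> Hk_norm 1 e * Hm1_norm (\<lambda>\<phi>. (L2_to_Hm1 (u (t + h)) \<phi> - L2_to_Hm1 (u t) \<phi>) / complex_of_real h - ut t \<phi>)"
      using bnd by (auto simp: eventually_at_filter)
  qed
  then have "(cu n has_vector_derivative ut t e) (at t)"
    unfolding has_vector_derivative_def has_derivative_at by (simp add: bounded_linear_scaleR_left)
  moreover have "ut t e = rhs n t"
  proof -
    have E: "(LINT x|\<mu>. du t x * weak_deriv e x) = (LINT x|\<mu>. du t x * ec' n x)"
    proof (rule integral_cong_AE)
      show "AE x in \<mu>. du t x * weak_deriv e x = du t x * ec' n x"
        using H10_pairI(2)[OF ep] by eventually_elim simp
      show "(\<lambda>x. du t x * weak_deriv e x) \<in> borel_measurable \<mu>"
        using u_L2 H1_pair_weak_deriv[OF H10_pair_H1[OF ep], THEN H1_pair_D(2)] by simp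
    qed (use u_L2 ec_L2[OF n] in simp)
    have Ve: "coef (\<lambda>x. complex_of_real (V x) * u t x) n
        = (LINT x|\<mu>. complex_of_real (W x) * u t x * ec n x) - of_real (\<rho> + 1) * coef (u t) n"
    proof -
      have "(\<lambda>x. complex_of_real (V x) * u t x) = (\<lambda>x. complex_of_real (W x) * u t x - of_real (\<rho> + 1) * u t x)"
        by (simp add: algebra_simps)
      then have "coef (\<lambda>x. complex_of_real (V x) * u t x) n
          = coef (\<lambda>x. complex_of_real (W x) * u t x) n - coef (\<lambda>x. of_real (\<rho> + 1) * u t x) n"
        using coef_diff[OF W_mult_L2(1)[OF u_L2(1)] L2_cmult[OF u_L2(1)] n] by metis
      then show ?thesis using coef_cmult[OF u_L2(1) n] coef_ec[OF W_mult_L2(1)[OF u_L2(1)] n] by simp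
    qed
    have "\<i> * ut t e = (LINT x|\<mu>. du t x * ec' n x) + coef (\<lambda>x. complex_of_real (V x) * u t x) n + coef (nl g (u t)) n"
      unfolding eq[OF eH] cue neg_laplace_def E nl_def[abs_def] ..
    also have "\<dots> = form (u t) (du t) (ec n) (ec' n) - of_real (\<rho> + 1) * coef (u t) n + coef (nl g (u t)) n"
      unfolding Ve form_def by simp
    also have "\<dots> = of_real (lam n) * cu n t + coef (nl g (u t)) n"
      unfolding form_eigen[OF u_pair n] Lam_def by (simp add: algebra_simps)
    finally have "- \<i> * (\<i> * ut t e) = rhs n t" by (simp add: rhs_def)
    then show ?thesis by simp
  qed
  ultimately show ?thesis by simp
qed

end

lemma sum_norm_mult_le:
  fixes x y :: "'i \<Rightarrow> complex"
  assumes "(\<Sum>i\<in>I. (cmod (x i))\<^sup>2) \<le> X\<^sup>2" "(\<Sum>i\<in>I. (cmod (y i))\<^sup>2) \<le> Y\<^sup>2" "0 \<le> X" "0 \<le> Y"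
  shows "(\<Sum>i\<in>I. cmod (x i) * cmod (y i)) \<le> X * Y"
proof -
  have "(\<Sum>i\<in>I. cmod (x i) * cmod (y i)) \<le> L2_set (\<lambda>i. cmod (x i)) I * L2_set (\<lambda>i. cmod (y i)) I"
    using L2_set_mult_ineq[of "\<lambda>i. cmod (x i)" "\<lambda>i. cmod (y i)" I] by simp
  also have "\<dots> \<le> X * Y"
    unfolding L2_set_def using assms by (intro mult_mono real_le_lsqrt sum_nonneg) (auto intro: sum_nonneg)
  finally show ?thesis .
qed

lemma cmod_sq_has_derivative:
  assumes "(z has_vector_derivative z') (at t)"
  shows "((\<lambda>t. (cmod (z t))\<^sup>2) has_real_derivative 2 * Re (cnj (z t) * z')) (at t)"
proof -
  have re: "((\<lambda>t. Re (z t)) has_real_derivative Re z') (at t)"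
    and im: "((\<lambda>t. Im (z t)) has_real_derivative Im z') (at t)"
    unfolding has_real_derivative_iff_has_vector_derivative
    using bounded_linear.has_vector_derivative[OF bounded_linear_Re assms]
      bounded_linear.has_vector_derivative[OF bounded_linear_Im assms] by auto
  have "((\<lambda>t. Re (z t) * Re (z t) + Im (z t) * Im (z t)) has_real_derivative
      (Re z' * Re (z t) + Re z' * Re (z t)) + (Im z' * Im (z t) + Im z' * Im (z t))) (at t)"
    by (intro DERIV_add DERIV_mult re im)
  then show ?thesis unfolding cmod_power2 by (simp add: power2_eq_square algebra_simps)
qed

context dirichlet
begin

lemma coef_pairing:
  assumes "h \<in> L2"
  shows "(\<Sum>n=1..N. coef h n * cnj (a n)) = (LINT x|\<mu>. h x * cnj (psum a N x))"
proof -
  have "(LINT x|\<mu>. h x * cnj (psum a N x)) = (LINT x|\<mu>. (\<Sum>n=1..N. cnj (a n) * (h x * ec n x)))"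
    by (simp add: psum_def ec_def sum_distrib_left mult.left_commute mult.commute)
  also have "\<dots> = (\<Sum>n=1..N. LINT x|\<mu>. cnj (a n) * (h x * ec n x))"
    by (intro Bochner_Integration.integral_sum integrable_mult_right L2_mult_integrable assms ec_L2) auto
  also have "\<dots> = (\<Sum>n=1..N. coef h n * cnj (a n))"
    using coef_ec[OF assms] by (intro sum.cong) auto
  finally show ?thesis ..
qed

end

section \<open>Conservation of mass and energy\<close>

context nls_solution
begin

abbreviation pu :: "nat \<Rightarrow> real \<Rightarrow> real \<Rightarrow> complex" where "pu N t \<equiv> psum (coef (u t)) N"

definition tail :: "nat \<Rightarrow> real \<Rightarrow> real" where
  "tail N t = energy (u t) (du t) - (\<Sum>n=1..N. Lam n * (cmod (cu n t))\<^sup>2)"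

definition Emax :: real where "Emax = (2 * \<rho> + 1) * B\<^sup>2"

lemma tail_bounds: "0 \<le> tail N t" "tail N t \<le> Emax"
proof -
  show "0 \<le> tail N t" using energy_Bessel[OF u_pair[of t], of N] by (simp add: tail_def)
  have "0 \<le> (\<Sum>n=1..N. Lam n * (cmod (cu n t))\<^sup>2)"
    using Lam_ge_1 by (intro sum_nonneg mult_nonneg_nonneg) (auto intro: order_trans[OF zero_le_one])
  then show "tail N t \<le> Emax" using energy_le[of t] unfolding tail_def Emax_def by linarith
qed

lemma tail_tendsto: "(\<lambda>N. tail N t) \<longlonglongrightarrow> 0"
  using tendsto_diff[OF tendsto_const energy_Parseval[OF u_pair[of t]], of "energy (u t) (du t)"]
  by (simp add: tail_def)

text \<open>Projecting the solution before or after applying the nonlinear term makes a difference that is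
  small by the inverse square root of the next eigenvalue.\<close>

definition dcoef :: "nat \<Rightarrow> nat \<Rightarrow> real \<Rightarrow> complex" where
  "dcoef N n t = coef (nl g (pu N t)) n - coef (nl g (u t)) n"

lemma dcoef_le: "(\<Sum>n=1..N. (cmod (dcoef N n t))\<^sup>2) \<le> (K * (sqrt (tail N t) / sqrt (Lam (Suc N))))\<^sup>2"
proof -
  define h where "h x = nl g (pu N t) x - nl g (u t) x" for x
  have h: "h \<in> L2" unfolding h_def[abs_def] by (intro L2_diff nl_L2)
  have "coef h n = dcoef N n t" if "n \<ge> 1" for n
    unfolding h_def[abs_def] dcoef_def by (rule coef_diff[OF nl_L2(2) nl_L2(1) that])
  then have "(\<Sum>n=1..N. (cmod (dcoef N n t))\<^sup>2) = (\<Sum>n=1..N. (cmod (coef h n))\<^sup>2)" by simp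
  also have "\<dots> \<le> (L2_norm h)\<^sup>2" by (rule Bessel[OF h])
  also have "\<dots> \<le> (K * (sqrt (tail N t) / sqrt (Lam (Suc N))))\<^sup>2"
  proof (rule power_mono)
    have "L2_norm h \<le> K * L2_norm (\<lambda>x. pu N t x - u t x)"
      unfolding h_def[abs_def] using K(2)[OF psum_L2(1) u_L2(1) AE_I2 u_AE_le] psum_le by blast
    also have "L2_norm (\<lambda>x. pu N t x - u t x) \<le> sqrt (tail N t) / sqrt (Lam (Suc N))"
      using remainder_L2_bound[OF u_pair[of t], of N]
      unfolding L2_norm_commute[of "pu N t"] tail_def
      by (simp add: real_le_rsqrt flip: real_sqrt_divide)
    finally show "L2_norm h \<le> K * (sqrt (tail N t) / sqrt (Lam (Suc N)))"
      using K(1) by (simp add: mult_left_mono)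
  qed simp
  finally show ?thesis .
qed

lemma dcoef_le': "(\<Sum>n=1..N. (cmod (dcoef N n t))\<^sup>2) \<le> (K * sqrt (tail N t))\<^sup>2"
proof -
  have L1: "Lam (Suc N) \<ge> 1" by (rule Lam_ge_1) simp
  have "sqrt (tail N t) / sqrt (Lam (Suc N)) \<le> sqrt (tail N t)"
    using tail_bounds(1)[of N t] L1 by (simp add: divide_le_eq mult_le_cancel_left1)
  then have "(K * (sqrt (tail N t) / sqrt (Lam (Suc N))))\<^sup>2 \<le> (K * sqrt (tail N t))\<^sup>2"
    using K(1) L1 tail_bounds(1)[of N t] by (intro power_mono mult_left_mono mult_nonneg_nonneg) auto
  then show ?thesis using dcoef_le[of N t] by linarith
qed

lemma u_norm_le: "L2_norm (u t) \<le> B"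
  using H1_pair_norm_bounds(1)[OF H10_pair_H1[OF u_pair[of t]]] B(1)[of t] by linarith

lemma tail_sqrt_tendsto: "(\<lambda>N. C * sqrt (tail N t)) \<longlonglongrightarrow> 0"
  using tendsto_mult[OF tendsto_const tendsto_real_sqrt[OF tail_tendsto[of t]], of C] by simp

lemma tail_sqrt_le: "0 \<le> C \<Longrightarrow> C * sqrt (tail N t) \<le> C * sqrt Emax"
  using tail_bounds by (intro mult_left_mono) auto

text \<open>If the nonlinear term were computed from the projected solution, the mass of the projection would be
  conserved exactly, because the pairing of \<^term>\<open>nl g v\<close> with v is real. The error is controlled by the
  energy of the high modes, which tends to 0.\<close>

theorem mass_conserved: "mass (u t) = mass (u 0)"
  unfolding mass_def
proof (rule limit_constant)
  define S where "S N t = (\<Sum>n=1..N. (cmod (cu n t))\<^sup>2)" for N t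
  define S' where "S' N t = (\<Sum>n=1..N. 2 * Re (cnj (cu n t) * rhs n t))" for N t
  show "(S N has_real_derivative S' N t) (at t)" for N t
    unfolding S_def[abs_def] S'_def
    by (intro DERIV_sum cmod_sq_has_derivative mode_equation) auto
  have bound: "\<bar>S' N t\<bar> \<le> (2 * B * K) * sqrt (tail N t)" for N t
  proof -
    have real: "Im (\<Sum>n=1..N. coef (nl g (pu N t)) n * cnj (cu n t)) = 0"
    proof -
      have "(LINT x|\<mu>. nl g (pu N t) x * cnj (pu N t x))
          = (LINT x|\<mu>. complex_of_real (g x ((cmod (pu N t x))\<^sup>2) * (cmod (pu N t x))\<^sup>2))"
        by (simp add: nl_def complex_norm_square mult.assoc del: of_real_power)
      then show ?thesis unfolding coef_pairing[OF nl_L2(2)] integral_complex_of_real by simp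
    qed
    have "Re (cnj (cu n t) * rhs n t)
        = Im (coef (nl g (pu N t)) n * cnj (cu n t)) - Im (dcoef N n t * cnj (cu n t))" for n
      by (simp add: rhs_def dcoef_def algebra_simps)
    then have "S' N t = 2 * Im (\<Sum>n=1..N. coef (nl g (pu N t)) n * cnj (cu n t)) - 2 * (\<Sum>n=1..N. Im (dcoef N n t * cnj (cu n t)))"
      unfolding S'_def by (simp only: Im_sum sum_subtractf right_diff_distrib flip: sum_distrib_left)
    then have "\<bar>S' N t\<bar> = 2 * \<bar>\<Sum>n=1..N. Im (dcoef N n t * cnj (cu n t))\<bar>" using real by simp
    also have "\<dots> \<le> 2 * (\<Sum>n=1..N. cmod (cu n t) * cmod (dcoef N n t))"
    proof (intro mult_left_mono order_trans[OF sum_abs] sum_mono)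
      fix n show "\<bar>Im (dcoef N n t * cnj (cu n t))\<bar> \<le> cmod (cu n t) * cmod (dcoef N n t)"
        using abs_Im_le_cmod[of "dcoef N n t * cnj (cu n t)"] by (simp add: norm_mult mult.commute)
    qed simp
    also have "\<dots> \<le> 2 * (B * (K * sqrt (tail N t)))"
    proof (intro mult_left_mono sum_norm_mult_le dcoef_le')
      have "(L2_norm (u t))\<^sup>2 \<le> B\<^sup>2" by (intro power_mono u_norm_le) simp
      then show "(\<Sum>n=1..N. (cmod (cu n t))\<^sup>2) \<le> B\<^sup>2" using Bessel[OF u_L2(1), of t N] by linarith
    qed (use B K tail_bounds in auto)
    finally show ?thesis by (simp add: mult.assoc)
  qed
  have c: "0 \<le> 2 * B * K" using B K by simp
  show "\<bar>S' N t\<bar> \<le> (2 * B * K) * sqrt Emax" for N t using bound[of N t] tail_sqrt_le[OF c, of N t] by linarith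
  show "(\<lambda>N. S' N t) \<longlonglongrightarrow> 0" for t
    by (rule Lim_null_comparison[OF always_eventually tail_sqrt_tendsto]) (use bound in auto)
  show "(\<lambda>N. S N t) \<longlonglongrightarrow> (L2_norm (u t))\<^sup>2" for t unfolding S_def by (rule Parseval[OF u_L2(1)])
qed

definition Gint :: "(real \<Rightarrow> complex) \<Rightarrow> real" where
  "Gint v = (LINT x|\<mu>. primitive g x ((cmod (v x))\<^sup>2))"

lemma primitive_integrable:
  assumes "v \<in> borel_measurable \<mu>" "AE x in \<mu>. cmod (v x) \<le> R"
  shows "integrable \<mu> (\<lambda>x. primitive g x ((cmod (v x))\<^sup>2))"
proof -
  obtain L where L: "L \<ge> 0"
    "\<And>x y. x \<in> {0<..<pi} \<Longrightarrow> \<bar>y\<bar> \<le> R\<^sup>2 \<Longrightarrow> \<bar>primitive g x y\<bar> \<le> L * y\<^sup>2"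
    using primitive_Lipschitz[OF g, of "R\<^sup>2"] by metis
  show ?thesis
  proof (rule \<mu>.integrable_const_bound[where B="L * (R\<^sup>2)\<^sup>2"])
    show "AE x in \<mu>. norm (primitive g x ((cmod (v x))\<^sup>2)) \<le> L * (R\<^sup>2)\<^sup>2"
      using assms(2) AE_space
    proof eventually_elim
      case (elim x)
      then have *: "(cmod (v x))\<^sup>2 \<le> R\<^sup>2" by (intro power_mono) auto
      then have "\<bar>primitive g x ((cmod (v x))\<^sup>2)\<bar> \<le> L * ((cmod (v x))\<^sup>2)\<^sup>2" using L(2)[of x "(cmod (v x))\<^sup>2"] elim by simp
      also have "\<dots> \<le> L * (R\<^sup>2)\<^sup>2" by (rule mult_left_mono[OF power_mono[OF *] L(1)]) simp
      finally show ?case by simp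
    qed
    show "(\<lambda>x. primitive g x ((cmod (v x))\<^sup>2)) \<in> borel_measurable \<mu>"
      using assms(1) by (intro primitive_measurable[OF g]) auto
  qed
qed

lemma rhs_le: "n \<ge> 1 \<Longrightarrow> cmod (rhs n t) \<le> \<bar>lam n\<bar> * B + K * B"
proof -
  assume n: "n \<ge> 1"
  have "cmod (rhs n t) \<le> \<bar>lam n\<bar> * cmod (cu n t) + cmod (coef (nl g (u t)) n)"
    unfolding rhs_def by (simp add: norm_mult order_trans[OF norm_triangle_ineq])
  also have "\<dots> \<le> \<bar>lam n\<bar> * B + K * B"
    using coef_le[OF u_L2(1) n, of t] u_norm_le[of t] coef_le[OF nl_L2(1) n, of t] nl_norm_le[of t]
    by (intro add_mono mult_left_mono) auto
  finally show ?thesis .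
qed

lemma psum_measurable: "psum a N \<in> borel_measurable \<mu>"
  by (rule L2_D(1)[OF psum_L2(1)])

text \<open>The projected solution is a finite sum of differentiable functions of time with bounded
  eigenfunctions as coefficients, so differentiation under the integral is possible.\<close>

lemma Gint_projection_derivative:
  "((\<lambda>t. Gint (pu N t)) has_real_derivative (\<Sum>n=1..N. 2 * Re (cnj (coef (nl g (pu N t)) n) * rhs n t))) (at t)"
proof -
  define v' where "v' s = psum (\<lambda>n. rhs n s) N" for s
  define \<phi>' where "\<phi>' x s = g x ((cmod (pu N s x))\<^sup>2) * (2 * Re (cnj (pu N s x) * v' s x))" for x s
  obtain L where L: "L \<ge> 0"
    "\<And>x y. x \<in> {0<..<pi} \<Longrightarrow> \<bar>y\<bar> \<le> R\<^sup>2 \<Longrightarrow> \<bar>g x y\<bar> \<le> L * \<bar>y\<bar>"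
    using nl_Lipschitz[OF g, of "R\<^sup>2"] by metis
  define C where "C = (\<Sum>n=1..N. (\<bar>lam n\<bar> * B + K * B) * (sqrt pi * L2_norm (weak_deriv (f n))))"
  have v'_le: "cmod (v' s x) \<le> C" for s x
    unfolding v'_def psum_def C_def
  proof (rule order_trans[OF norm_sum], rule sum_mono)
    fix n assume n: "n \<in> {1..N}"
    have "cmod (rhs n s * ec n x) = cmod (rhs n s) * \<bar>ef n x\<bar>" by (simp add: norm_mult ec_def)
    also have "\<dots> \<le> (\<bar>lam n\<bar> * B + K * B) * (sqrt pi * L2_norm (weak_deriv (f n)))"
      using n B K rhs_le[of n s] ef_bounded[of n x] by (intro mult_mono) auto
    finally show "cmod (rhs n s * ec n x) \<le> (\<bar>lam n\<bar> * B + K * B) * (sqrt pi * L2_norm (weak_deriv (f n)))" .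
  qed
  have vd: "((\<lambda>s. pu N s x) has_vector_derivative v' s x) (at s)" for x s
    unfolding psum_def v'_def
    by (intro has_vector_derivative_sum bounded_linear.has_vector_derivative[OF bounded_linear_mult_left] mode_equation) auto
  have "((\<lambda>s. LINT x|\<mu>. primitive g x ((cmod (pu N s x))\<^sup>2)) has_real_derivative (LINT x|\<mu>. \<phi>' x t)) (at t)"
  proof (rule has_derivative_under_integral)
    fix x s assume x: "x \<in> {0<..<pi}"
    show "((\<lambda>s. primitive g x ((cmod (pu N s x))\<^sup>2)) has_real_derivative \<phi>' x s) (at s)"
      unfolding \<phi>'_def
      by (rule DERIV_chain2[OF primitive_has_derivative[OF g x] cmod_sq_has_derivative[OF vd]])
    have p: "(cmod (pu N s x))\<^sup>2 \<le> R\<^sup>2" by (intro power_mono psum_le) simp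
    have "\<bar>g x ((cmod (pu N s x))\<^sup>2)\<bar> \<le> L * (cmod (pu N s x))\<^sup>2" using L(2)[OF x, of "(cmod (pu N s x))\<^sup>2"] p by simp
    also have "\<dots> \<le> L * R\<^sup>2" using p L(1) by (rule mult_left_mono)
    finally have 1: "\<bar>g x ((cmod (pu N s x))\<^sup>2)\<bar> \<le> L * R\<^sup>2" .
    have "\<bar>Re (cnj (pu N s x) * v' s x)\<bar> \<le> cmod (pu N s x) * cmod (v' s x)"
      using abs_Re_le_cmod[of "cnj (pu N s x) * v' s x"] by (simp add: norm_mult)
    also have "\<dots> \<le> R * C" using R_nonneg by (intro mult_mono psum_le v'_le) auto
    finally have 2: "\<bar>2 * Re (cnj (pu N s x) * v' s x)\<bar> \<le> 2 * (R * C)" by simp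
    show "\<bar>\<phi>' x s\<bar> \<le> (L * R\<^sup>2) * (2 * (R * C))"
      unfolding \<phi>'_def abs_mult[of "g x _"] using 1 2 L(1) by (intro mult_mono) auto
  next
    fix s
    show "integrable \<mu> (\<lambda>x. primitive g x ((cmod (pu N s x))\<^sup>2))"
      by (rule primitive_integrable[OF psum_measurable AE_I2[OF psum_le]])
    have "(\<lambda>x. g x ((cmod (pu N s x))\<^sup>2)) \<in> borel_measurable \<mu>"
      using psum_measurable by (intro nl_measurable[OF g]) simp
    moreover have "(\<lambda>x. Re (cnj (pu N s x) * v' s x)) \<in> borel_measurable \<mu>"
    proof -
      have "(\<lambda>x. cnj (pu N s x)) \<in> borel_measurable \<mu>"
        by (intro L2_D(1) L2_bounded_linear[OF bounded_linear_cnj] psum_L2)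
      then have "(\<lambda>x. cnj (pu N s x) * v' s x) \<in> borel_measurable \<mu>"
        unfolding v'_def using psum_measurable by (rule borel_measurable_times)
      then show ?thesis 
        by (rule measurable_compose[OF _ borel_measurable_continuous_onI[OF linear_continuous_on[OF bounded_linear_Re]]])
    qed
    ultimately show "(\<lambda>x. \<phi>' x s) \<in> borel_measurable \<mu>"
      unfolding \<phi>'_def by (rule borel_measurable_times[OF _ borel_measurable_times[OF borel_measurable_const]])
  qed
  moreover have "(LINT x|\<mu>. \<phi>' x t) = (\<Sum>n=1..N. 2 * Re (cnj (coef (nl g (pu N t)) n) * rhs n t))"
  proof -
    have i: "integrable \<mu> (\<lambda>x. nl g (pu N t) x * cnj (v' t x))"
      unfolding v'_def by (intro L2_mult_integrable nl_L2 L2_bounded_linear[OF bounded_linear_cnj] psum_L2)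
    have "\<phi>' x t = 2 * Re (nl g (pu N t) x * cnj (v' t x))" for x
      unfolding \<phi>'_def nl_def by (simp add: algebra_simps)
    then have "(LINT x|\<mu>. \<phi>' x t) = 2 * (LINT x|\<mu>. Re (nl g (pu N t) x * cnj (v' t x)))"
      by (simp only: integral_mult_right_zero)
    also have "(LINT x|\<mu>. Re (nl g (pu N t) x * cnj (v' t x))) = Re (LINT x|\<mu>. nl g (pu N t) x * cnj (v' t x))"
      by (rule integral_Re[OF i])
    also have "(LINT x|\<mu>. nl g (pu N t) x * cnj (v' t x)) = (\<Sum>n=1..N. coef (nl g (pu N t)) n * cnj (rhs n t))"
      unfolding v'_def by (rule coef_pairing[OF nl_L2(2), symmetric])
    also have "2 * Re (\<Sum>n=1..N. coef (nl g (pu N t)) n * cnj (rhs n t))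
        = (\<Sum>n=1..N. 2 * Re (cnj (coef (nl g (pu N t)) n) * rhs n t))"
      unfolding Re_sum sum_distrib_left by (intro sum.cong) (auto simp: algebra_simps)
    finally show ?thesis .
  qed
  ultimately show ?thesis unfolding Gint_def by simp
qed

lemma Gint_projection_tendsto: "(\<lambda>N. Gint (pu N t)) \<longlonglongrightarrow> Gint (u t)"
proof -
  obtain L where L: "L \<ge> 0"
    "\<And>x y z. x \<in> {0<..<pi} \<Longrightarrow> \<bar>y\<bar> \<le> R\<^sup>2 \<Longrightarrow> \<bar>z\<bar> \<le> R\<^sup>2 \<Longrightarrow> \<bar>primitive g x y - primitive g x z\<bar> \<le> L * \<bar>y - z\<bar>"
    using primitive_Lipschitz[OF g, of "R\<^sup>2"] by metis
  have "\<bar>Gint (pu N t) - Gint (u t)\<bar> \<le> (L * (2 * R) * sqrt pi) * L2_norm (\<lambda>x. u t x - pu N t x)" for N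
  proof -
    note i = primitive_integrable[OF psum_measurable AE_I2[OF psum_le], of t N]
      primitive_integrable[OF L2_D(1)[OF u_L2(1)] u_AE_le, of t]
    have d: "(\<lambda>x. u t x - pu N t x) \<in> L2" by (intro L2_diff u_L2 psum_L2)
    have "\<bar>Gint (pu N t) - Gint (u t)\<bar>
        = \<bar>LINT x|\<mu>. primitive g x ((cmod (pu N t x))\<^sup>2) - primitive g x ((cmod (u t x))\<^sup>2)\<bar>"
      unfolding Gint_def using i by simp
    also have "\<dots> \<le> (LINT x|\<mu>. (L * (2 * R)) * cmod (u t x - pu N t x))"
    proof (rule order_trans[OF integral_abs_bound], rule integral_mono_AE)
      show "AE x in \<mu>. \<bar>primitive g x ((cmod (pu N t x))\<^sup>2) - primitive g x ((cmod (u t x))\<^sup>2)\<bar>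
          \<le> (L * (2 * R)) * cmod (u t x - pu N t x)"
        using u_AE_le[of t] AE_space
      proof eventually_elim
        case (elim x)
        have le: "(cmod (pu N t x))\<^sup>2 \<le> R\<^sup>2" "(cmod (u t x))\<^sup>2 \<le> R\<^sup>2"
          using psum_le elim by (auto intro: power_mono)
        have "\<bar>(cmod (pu N t x))\<^sup>2 - (cmod (u t x))\<^sup>2\<bar> = \<bar>cmod (pu N t x) - cmod (u t x)\<bar> * (cmod (pu N t x) + cmod (u t x))"
          unfolding power2_eq_square square_diff_square_factored by (simp add: abs_mult mult.commute)
        also have "\<dots> \<le> cmod (u t x - pu N t x) * (2 * R)"
          using psum_le[of t N x] elim norm_triangle_ineq3[of "pu N t x" "u t x"]
          by (intro mult_mono) (auto simp: norm_minus_commute)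
        finally have "L * \<bar>(cmod (pu N t x))\<^sup>2 - (cmod (u t x))\<^sup>2\<bar> \<le> L * (cmod (u t x - pu N t x) * (2 * R))"
          using L(1) by (rule mult_left_mono)
        then show ?case using L(2)[of x "(cmod (pu N t x))\<^sup>2" "(cmod (u t x))\<^sup>2"] le elim by (simp add: mult_ac)
      qed
      show "integrable \<mu> (\<lambda>x. (L * (2 * R)) * cmod (u t x - pu N t x))"
        using L2_integrable[OF d] by (intro integrable_mult_right integrable_norm)
    qed (use i in simp)
    also have "\<dots> = (L * (2 * R)) * (LINT x|\<mu>. cmod (u t x - pu N t x))" by simp
    also have "\<dots> \<le> (L * (2 * R)) * (sqrt pi * L2_norm (\<lambda>x. u t x - pu N t x))"
      using L(1) R_nonneg by (intro mult_left_mono L2_integral_norm_le d) auto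
    finally show ?thesis by (simp add: mult.assoc)
  qed
  then have le: "norm (Gint (pu N t) - Gint (u t)) \<le> (L * (2 * R) * sqrt pi) * L2_norm (\<lambda>x. u t x - pu N t x)" for N
    by simp
  have "(\<lambda>N. (L * (2 * R) * sqrt pi) * L2_norm (\<lambda>x. u t x - pu N t x)) \<longlonglongrightarrow> 0"
    using tendsto_mult[OF tendsto_const projection_tendsto[OF u_L2(1)], of "L * (2 * R) * sqrt pi" t] by simp
  then have "(\<lambda>N. Gint (pu N t) - Gint (u t)) \<longlonglongrightarrow> 0"
    by (rule Lim_null_comparison[OF always_eventually[OF allI[OF le]]])
  then show ?thesis by (simp add: LIM_zero_iff)
qed

lemma hamiltonian_eq: "2 * hamiltonian V g (u t) = energy (u t) (du t) - (\<rho> + 1) * mass (u t) + Gint (u t)"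
proof -
  have i1: "integrable \<mu> (\<lambda>x. (cmod (du t x))\<^sup>2)" "integrable \<mu> (\<lambda>x. (cmod (u t x))\<^sup>2)"
    "integrable \<mu> (\<lambda>x. primitive g x ((cmod (u t x))\<^sup>2))"
    using L2_D(2)[OF u_L2(1)] L2_D(2)[OF u_L2(2)] primitive_integrable[OF L2_D(1)[OF u_L2(1)] u_AE_le] by auto
  note i2 = W_square_integrable[OF u_L2(1), of t]
  have V: "(LINT x|\<mu>. V x * (cmod (u t x))\<^sup>2) = (LINT x|\<mu>. W x * (cmod (u t x))\<^sup>2) - (\<rho> + 1) * (L2_norm (u t))\<^sup>2"
    and iV: "integrable \<mu> (\<lambda>x. V x * (cmod (u t x))\<^sup>2)"
  proof -
    have e: "V x * (cmod (u t x))\<^sup>2 = W x * (cmod (u t x))\<^sup>2 - (\<rho> + 1) * (cmod (u t x))\<^sup>2" for x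
      by (simp add: algebra_simps)
    show "(LINT x|\<mu>. V x * (cmod (u t x))\<^sup>2) = (LINT x|\<mu>. W x * (cmod (u t x))\<^sup>2) - (\<rho> + 1) * (L2_norm (u t))\<^sup>2"
      unfolding e L2_norm_sq using Bochner_Integration.integral_diff[OF i2 integrable_mult_right[OF i1(2), of "\<rho> + 1"]]
      by (simp only: integral_mult_right_zero)
    show "integrable \<mu> (\<lambda>x. V x * (cmod (u t x))\<^sup>2)"
      unfolding e by (intro Bochner_Integration.integrable_diff i2 integrable_mult_right i1)
  qed
  have "2 * hamiltonian V g (u t) = (LINT x|\<mu>. (cmod (du t x))\<^sup>2) + (LINT x|\<mu>. V x * (cmod (u t x))\<^sup>2) + Gint (u t)"
    unfolding hamiltonian_def Gint_def using i1 iV by simp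
  then show ?thesis unfolding V energy_def mass_def by simp
qed

text \<open>The truncated Hamiltonian changes at the rate given by the pairing of the velocities with
  \<^term>\<open>dcoef N\<close>. The velocities grow at most like the square root of \<^term>\<open>Lam (Suc N)\<close>, which is
  exactly what \<open>dcoef_le\<close> gains; what remains is the vanishing energy of the high modes.\<close>

theorem hamiltonian_conserved: "hamiltonian V g (u t) = hamiltonian V g (u 0)"
proof -
  define S where "S N t = (\<Sum>n=1..N. lam n * (cmod (cu n t))\<^sup>2) + Gint (pu N t)" for N t
  define S' where "S' N t = (\<Sum>n=1..N. lam n * (2 * Re (cnj (cu n t) * rhs n t)))
      + (\<Sum>n=1..N. 2 * Re (cnj (coef (nl g (pu N t)) n) * rhs n t))" for N t
  define C where "C = sqrt (2 * (\<rho> + 2)\<^sup>2 * Emax + 2 * (K * B)\<^sup>2)"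
  have Emax0: "0 \<le> Emax" using \<rho>_pos by (simp add: Emax_def)
  have C0: "0 \<le> C" using Emax0 by (simp add: C_def)
  have bound: "\<bar>S' N t\<bar> \<le> (2 * C * K) * sqrt (tail N t)" for N t
  proof -
    define b where "b n = of_real (lam n) * cu n t + coef (nl g (u t)) n" for n
    have L1: "Lam (Suc N) \<ge> 1" by (rule Lam_ge_1) simp
    \<comment> \<open>The velocity of a mode is b turned by a right angle, so its pairing with b has no real part.\<close>
    have summand: "lam n * (2 * Re (cnj (cu n t) * rhs n t)) + 2 * Re (cnj (coef (nl g (pu N t)) n) * rhs n t)
        = 2 * Re (cnj (dcoef N n t) * rhs n t)" for n
    proof -
      have "Re (cnj (b n) * rhs n t) = 0" unfolding rhs_def b_def[symmetric] by simp
      moreover have "lam n * Re (cnj (cu n t) * rhs n t) + Re (cnj (coef (nl g (pu N t)) n) * rhs n t)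
          = Re (cnj (b n) * rhs n t) + Re (cnj (dcoef N n t) * rhs n t)"
        by (simp add: b_def dcoef_def algebra_simps)
      ultimately show ?thesis by (simp add: algebra_simps)
    qed
    have "S' N t = (\<Sum>n=1..N. 2 * Re (cnj (dcoef N n t) * rhs n t))"
      unfolding S'_def sum.distrib[symmetric] summand ..
    then have "\<bar>S' N t\<bar> \<le> (\<Sum>n=1..N. \<bar>2 * Re (cnj (dcoef N n t) * rhs n t)\<bar>)" by simp
    also have "\<dots> \<le> (\<Sum>n=1..N. 2 * (cmod (b n) * cmod (dcoef N n t)))"
    proof (rule sum_mono)
      fix n
      have "cmod (rhs n t) = cmod (b n)" unfolding rhs_def b_def[symmetric] by (simp add: norm_mult)
      then show "\<bar>2 * Re (cnj (dcoef N n t) * rhs n t)\<bar> \<le> 2 * (cmod (b n) * cmod (dcoef N n t))"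
        using abs_Re_le_cmod[of "cnj (dcoef N n t) * rhs n t"] by (simp add: norm_mult mult.commute)
    qed
    also have "\<dots> = 2 * (\<Sum>n=1..N. cmod (b n) * cmod (dcoef N n t))" by (simp add: sum_distrib_left)
    also have "\<dots> \<le> 2 * ((sqrt (Lam (Suc N)) * C) * (K * (sqrt (tail N t) / sqrt (Lam (Suc N)))))"
    proof (intro mult_left_mono sum_norm_mult_le dcoef_le)
      have b: "(cmod (b n))\<^sup>2 \<le> 2 * (\<rho> + 2)\<^sup>2 * Lam (Suc N) * (Lam n * (cmod (cu n t))\<^sup>2) + 2 * (cmod (coef (nl g (u t)) n))\<^sup>2"
        if n: "n \<in> {1..N}" for n
      proof -
        have Ln: "1 \<le> Lam n" "Lam n \<le> Lam (Suc N)" using n Lam_ge_1[of n] Lam_mono[of n "Suc N"] by auto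
        have "\<bar>lam n\<bar> \<le> (\<rho> + 2) * Lam n"
        proof -
          have "\<bar>lam n\<bar> \<le> Lam n + (\<rho> + 1)" using Ln \<rho>_pos by (simp add: Lam_def)
          also have "\<dots> \<le> Lam n + (\<rho> + 1) * Lam n" using Ln \<rho>_pos by (simp add: mult_le_cancel_left1)
          finally show ?thesis by (simp add: algebra_simps)
        qed
        then have "(lam n)\<^sup>2 \<le> ((\<rho> + 2) * Lam n)\<^sup>2" using power_mono[of "\<bar>lam n\<bar>" _ 2] by simp
        also have "\<dots> = (\<rho> + 2)\<^sup>2 * (Lam n * Lam n)" by (simp add: power_mult_distrib power2_eq_square)
        also have "\<dots> \<le> (\<rho> + 2)\<^sup>2 * (Lam (Suc N) * Lam n)" using Ln by (intro mult_left_mono mult_right_mono) auto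
        finally have l: "(lam n)\<^sup>2 \<le> (\<rho> + 2)\<^sup>2 * (Lam (Suc N) * Lam n)" .
        have "(cmod (b n))\<^sup>2 \<le> (\<bar>lam n\<bar> * cmod (cu n t) + cmod (coef (nl g (u t)) n))\<^sup>2"
          unfolding b_def by (intro power_mono order_trans[OF norm_triangle_ineq]) (auto simp: norm_mult)
        also have "\<dots> \<le> 2 * (\<bar>lam n\<bar> * cmod (cu n t))\<^sup>2 + 2 * (cmod (coef (nl g (u t)) n))\<^sup>2"
          using sum_squares_bound[of "\<bar>lam n\<bar> * cmod (cu n t)" "cmod (coef (nl g (u t)) n)"]
          by (simp add: power2_sum)
        also have "(\<bar>lam n\<bar> * cmod (cu n t))\<^sup>2 \<le> (\<rho> + 2)\<^sup>2 * (Lam (Suc N) * Lam n) * (cmod (cu n t))\<^sup>2"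
          unfolding power_mult_distrib power2_abs by (rule mult_right_mono[OF l]) simp
        finally show ?thesis by (simp add: mult_ac)
      qed
      have "(\<Sum>n=1..N. (cmod (b n))\<^sup>2) \<le> (\<Sum>n=1..N. 2 * (\<rho> + 2)\<^sup>2 * Lam (Suc N) * (Lam n * (cmod (cu n t))\<^sup>2)
          + 2 * (cmod (coef (nl g (u t)) n))\<^sup>2)" by (rule sum_mono[OF b])
      also have "\<dots> = 2 * (\<rho> + 2)\<^sup>2 * Lam (Suc N) * (\<Sum>n=1..N. Lam n * (cmod (cu n t))\<^sup>2)
          + 2 * (\<Sum>n=1..N. (cmod (coef (nl g (u t)) n))\<^sup>2)"
        by (simp only: sum.distrib sum_distrib_left)
      also have "\<dots> \<le> 2 * (\<rho> + 2)\<^sup>2 * Lam (Suc N) * Emax + 2 * (Lam (Suc N) * (K * B)\<^sup>2)"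
      proof (intro add_mono mult_left_mono)
        show "(\<Sum>n=1..N. Lam n * (cmod (cu n t))\<^sup>2) \<le> Emax"
          using energy_Bessel[OF u_pair[of t], of N] energy_le[of t] by (simp add: Emax_def)
        have "(\<Sum>n=1..N. (cmod (coef (nl g (u t)) n))\<^sup>2) \<le> (L2_norm (nl g (u t)))\<^sup>2" by (rule Bessel[OF nl_L2(1)])
        also have "\<dots> \<le> (K * B)\<^sup>2" by (intro power_mono nl_norm_le) simp
        also have "\<dots> \<le> Lam (Suc N) * (K * B)\<^sup>2" using L1 by (simp add: mult_le_cancel_right1)
        finally show "(\<Sum>n=1..N. (cmod (coef (nl g (u t)) n))\<^sup>2) \<le> Lam (Suc N) * (K * B)\<^sup>2" .
      qed (use L1 in auto)
      also have "\<dots> = (sqrt (Lam (Suc N)) * C)\<^sup>2"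
        using L1 Emax0 by (simp add: C_def power_mult_distrib algebra_simps)
      finally show "(\<Sum>n=1..N. (cmod (b n))\<^sup>2) \<le> (sqrt (Lam (Suc N)) * C)\<^sup>2" .
    qed (use C0 K L1 tail_bounds in auto)
    also have "\<dots> = (2 * C * K) * sqrt (tail N t)" using L1 by simp
    finally show ?thesis .
  qed
  have "energy (u t) (du t) - (\<rho> + 1) * (L2_norm (u t))\<^sup>2 + Gint (u t)
      = energy (u 0) (du 0) - (\<rho> + 1) * (L2_norm (u 0))\<^sup>2 + Gint (u 0)"
  proof (rule limit_constant[of S S' "(2 * C * K) * sqrt Emax" "\<lambda>t. energy (u t) (du t) - (\<rho> + 1) * (L2_norm (u t))\<^sup>2 + Gint (u t)"])
    show "(S N has_real_derivative S' N t) (at t)" for N t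
      unfolding S_def[abs_def] S'_def
      by (intro DERIV_add DERIV_sum DERIV_cmult cmod_sq_has_derivative mode_equation Gint_projection_derivative) auto
    have c: "0 \<le> 2 * C * K" using C0 K by simp
    show "\<bar>S' N t\<bar> \<le> (2 * C * K) * sqrt Emax" for N t using bound[of N t] tail_sqrt_le[OF c, of N t] by linarith
    show "(\<lambda>N. S' N t) \<longlonglongrightarrow> 0" for t
      by (rule Lim_null_comparison[OF always_eventually tail_sqrt_tendsto]) (use bound in auto)
    show "(\<lambda>N. S N t) \<longlonglongrightarrow> energy (u t) (du t) - (\<rho> + 1) * (L2_norm (u t))\<^sup>2 + Gint (u t)" for t
    proof -
      have eq: "(\<Sum>n=1..N. lam n * (cmod (cu n t))\<^sup>2)
          = (\<Sum>n=1..N. Lam n * (cmod (cu n t))\<^sup>2) - (\<rho> + 1) * (\<Sum>n=1..N. (cmod (cu n t))\<^sup>2)" for N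
        unfolding sum_distrib_left sum_subtractf[symmetric] by (simp add: Lam_def algebra_simps)
      show ?thesis unfolding S_def eq
        by (rule tendsto_add[OF tendsto_diff[OF energy_Parseval[OF u_pair]
              tendsto_mult[OF tendsto_const Parseval[OF u_L2(1)]]] Gint_projection_tendsto])
    qed
  qed
  then show ?thesis using hamiltonian_eq[of t] hamiltonian_eq[of 0] unfolding mass_def by linarith
qed

end

section \<open>Uniqueness\<close>

text \<open>The linear part turns each mode of the difference without changing its modulus, so the squared norm
  of the difference grows at most at the rate given by the Lipschitz constant of the nonlinear term. Its
  truncations are differentiable in time.\<close>

theorem nls_unique:
  assumes "nls_solution V lam f \<rho> g u0 u" "nls_solution V lam f \<rho> g u0 v" "n \<ge> 1"
  shows "eigen_coeff f (u t) n = eigen_coeff f (v t) n"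
proof -
  interpret a: nls_solution V lam f \<rho> g u0 u by fact
  interpret b: nls_solution V lam f \<rho> g u0 v by fact
  obtain K where K: "nl_Lipschitz_on_ball g (max a.R b.R) K"
    using nl_Lipschitz_on_ball_exists[OF a.g] by blast
  define w where "w t x = u t x - v t x" for t x
  define H where "H t x = nl g (u t) x - nl g (v t) x" for t x
  have wL: "w t \<in> L2" for t unfolding w_def[abs_def] by (intro L2_diff a.u_L2 b.u_L2)
  have HL: "H t \<in> L2" for t unfolding H_def[abs_def] by (intro L2_diff a.nl_L2 b.nl_L2)
  have cw: "eigen_coeff f (w t) n = a.cu n t - b.cu n t" if "n \<ge> 1" for n t
    unfolding w_def[abs_def] by (rule a.coef_diff[OF a.u_L2(1) b.u_L2(1) that])
  have cH: "eigen_coeff f (H t) n = eigen_coeff f (nl g (u t)) n - eigen_coeff f (nl g (v t)) n" if "n \<ge> 1" for n t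
    unfolding H_def[abs_def] by (rule a.coef_diff[OF a.nl_L2(1) b.nl_L2(1) that])
  have HK: "L2_norm (H t) \<le> K * L2_norm (w t)" for t
  proof -
    have "AE x in \<mu>. cmod (u t x) \<le> max a.R b.R" "AE x in \<mu>. cmod (v t x) \<le> max a.R b.R"
      using a.u_AE_le[of t] b.u_AE_le[of t] by (auto elim: eventually_mono)
    then show ?thesis
      using K a.u_L2(1)[of t] b.u_L2(1)[of t] unfolding nl_Lipschitz_on_ball_def H_def[abs_def] w_def[abs_def] by blast
  qed
  define S where "S N t = (\<Sum>n=1..N. (cmod (a.cu n t - b.cu n t))\<^sup>2)" for N t
  define S' where "S' N t = (\<Sum>n=1..N. 2 * Re (cnj (a.cu n t - b.cu n t) * (a.rhs n t - b.rhs n t)))" for N t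
  have "(L2_norm (w t))\<^sup>2 \<le> 0"
  proof (rule limit_Gronwall[of S S' "1 + K\<^sup>2" "\<lambda>t. (L2_norm (w t))\<^sup>2" "(a.B + b.B)\<^sup>2"])
    show "(S N has_real_derivative S' N t) (at t)" for N t
      unfolding S_def[abs_def] S'_def
      by (intro DERIV_sum cmod_sq_has_derivative has_vector_derivative_diff a.mode_equation b.mode_equation) auto
    show "\<bar>S' N t\<bar> \<le> (1 + K\<^sup>2) * (L2_norm (w t))\<^sup>2" for N t
    proof -
      have "\<bar>2 * Re (cnj (a.cu n t - b.cu n t) * (a.rhs n t - b.rhs n t))\<bar>
          \<le> (cmod (eigen_coeff f (w t) n))\<^sup>2 + (cmod (eigen_coeff f (H t) n))\<^sup>2" if n: "n \<ge> 1" for n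
      proof -
        have r: "a.rhs n t - b.rhs n t = - \<i> * (of_real (lam n) * eigen_coeff f (w t) n + eigen_coeff f (H t) n)"
          unfolding a.rhs_def b.rhs_def cw[OF n] cH[OF n] by (simp add: algebra_simps)
        have im: "Re (cnj c * (- \<i> * (of_real l * c + d))) = Im (cnj c * d)" for c d l
          by (simp add: algebra_simps)
        have "\<bar>2 * Re (cnj (a.cu n t - b.cu n t) * (a.rhs n t - b.rhs n t))\<bar>
            = 2 * \<bar>Im (cnj (eigen_coeff f (w t) n) * eigen_coeff f (H t) n)\<bar>"
          unfolding r cw[OF n, symmetric] im by (simp only: abs_mult abs_numeral)
        also have "\<dots> \<le> 2 * cmod (eigen_coeff f (w t) n) * cmod (eigen_coeff f (H t) n)"
          using abs_Im_le_cmod[of "cnj (eigen_coeff f (w t) n) * eigen_coeff f (H t) n"] by (simp add: norm_mult)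
        also have "\<dots> \<le> (cmod (eigen_coeff f (w t) n))\<^sup>2 + (cmod (eigen_coeff f (H t) n))\<^sup>2"
          by (rule sum_squares_bound)
        finally show ?thesis .
      qed
      then have "\<bar>S' N t\<bar> \<le> (\<Sum>n=1..N. (cmod (eigen_coeff f (w t) n))\<^sup>2 + (cmod (eigen_coeff f (H t) n))\<^sup>2)"
        unfolding S'_def by (intro order_trans[OF sum_abs] sum_mono) auto
      also have "\<dots> \<le> (L2_norm (w t))\<^sup>2 + (L2_norm (H t))\<^sup>2"
        unfolding sum.distrib by (intro add_mono a.Bessel wL HL)
      also have "\<dots> \<le> (L2_norm (w t))\<^sup>2 + (K * L2_norm (w t))\<^sup>2" by (intro add_left_mono power_mono HK) simp
      finally show ?thesis by (simp add: algebra_simps power_mult_distrib)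
    qed
    show "S N 0 = 0" for N
    proof -
      have "AE x in \<mu>. u 0 x = u0 x" "AE x in \<mu>. v 0 x = u0 x"
        using a.sol b.sol by (auto simp: global_solution_def)
      then have "AE x in \<mu>. w 0 x = 0" by eventually_elim (simp add: w_def)
      then have "L2_norm (w 0) = 0" by (simp add: L2_norm_eq_0_iff[OF wL])
      then have "a.cu n 0 - b.cu n 0 = 0" if "n \<ge> 1" for n
        using a.coef_le[OF wL that, of 0] cw[OF that, of 0] by simp
      then show ?thesis by (simp add: S_def)
    qed
    show "(\<lambda>N. S N t) \<longlonglongrightarrow> (L2_norm (w t))\<^sup>2" for t
      using a.Parseval[OF wL[of t]] cw by (simp add: S_def)
    show "(L2_norm (w t))\<^sup>2 \<le> (a.B + b.B)\<^sup>2" for t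
      using L2_diff(2)[OF a.u_L2(1)[of t] b.u_L2(1)[of t]] a.u_norm_le[of t] b.u_norm_le[of t]
      unfolding w_def[abs_def] by (intro power_mono) auto
  qed simp
  then have "L2_norm (w t) = 0" by simp
  then show ?thesis using a.coef_le[OF wL assms(3), of t] cw[OF assms(3), of t] by simp
qed

section \<open>Comparison with the rotated datum\<close>

lemma phase_difference:
  "cmod (z - exp (\<i> * complex_of_real (Arg z - Arg w)) * w) = \<bar>cmod z - cmod w\<bar>"
proof (cases "z = 0 \<or> w = 0")
  case True
  then show ?thesis by (auto simp: norm_mult)
next
  case False
  then have z: "z = of_real (cmod z) * exp (\<i> * of_real (Arg z))" and w: "w = of_real (cmod w) * exp (\<i> * of_real (Arg w))"
    using Arg_eq by blast+
  have "exp (\<i> * complex_of_real (Arg z - Arg w)) * exp (\<i> * of_real (Arg w)) = exp (\<i> * of_real (Arg z))"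
    by (simp add: algebra_simps flip: exp_add)
  then have "exp (\<i> * complex_of_real (Arg z - Arg w)) * w = of_real (cmod w) * exp (\<i> * of_real (Arg z))"
    by (subst (2) w) (simp add: mult.left_commute)
  then have "z - exp (\<i> * complex_of_real (Arg z - Arg w)) * w = of_real (cmod z - cmod w) * exp (\<i> * of_real (Arg z))"
    by (subst (1) z) (simp add: left_diff_distrib)
  then show ?thesis by (simp add: norm_mult del: of_real_diff)
qed

lemma diff_squared_le: "0 \<le> a \<Longrightarrow> 0 \<le> b \<Longrightarrow> (a - b)\<^sup>2 \<le> \<bar>a\<^sup>2 - b\<^sup>2\<bar>" for a b :: real
proof -
  assume ab: "0 \<le> a" "0 \<le> b"
  have "(a - b)\<^sup>2 = \<bar>a - b\<bar> * \<bar>a - b\<bar>" by (simp add: power2_eq_square)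
  also have "\<dots> \<le> \<bar>a - b\<bar> * (a + b)" using ab by (intro mult_left_mono) auto
  also have "\<dots> = \<bar>a\<^sup>2 - b\<^sup>2\<bar>"
    using ab by (simp add: power2_eq_square square_diff_square_factored abs_mult mult.commute)
  finally show ?thesis .
qed

context nls_solution
begin

lemma energy_balance: "energy (u t) (du t) + Gint (u t) = energy (u 0) (du 0) + Gint (u 0)"
  using hamiltonian_eq[of t] hamiltonian_eq[of 0] hamiltonian_conserved[of t] mass_conserved[of t] by simp

definition drift :: "nat \<Rightarrow> real \<Rightarrow> real" where
  "drift N t = (\<Sum>n=1..N. Lam n * \<bar>(cmod (cu n t))\<^sup>2 - (cmod (cu n 0))\<^sup>2\<bar>)"

text \<open>Energy that has left the low modes can only be in the high ones, so the conservation law carries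
  the smallness of the high modes from the datum to all times.\<close>

lemma tail_comparison: "tail N t \<le> tail N 0 + drift N t + \<bar>Gint (u 0)\<bar> + \<bar>Gint (u t)\<bar>"
proof -
  have "(\<Sum>n=1..N. Lam n * (cmod (cu n 0))\<^sup>2) - (\<Sum>n=1..N. Lam n * (cmod (cu n t))\<^sup>2)
      = (\<Sum>n=1..N. Lam n * ((cmod (cu n 0))\<^sup>2 - (cmod (cu n t))\<^sup>2))"
    by (simp add: sum_subtractf right_diff_distrib)
  also have "\<dots> \<le> drift N t"
    unfolding drift_def
  proof (intro sum_mono mult_left_mono)
    fix n assume "n \<in> {1..N}"
    then show "0 \<le> Lam n" using Lam_ge_1[of n] by simp
  qed auto
  finally show ?thesis using energy_balance[of t] unfolding tail_def by linarith
qed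

text \<open>Up to N the distance of the coefficients is the difference of moduli, whose square is at most the
  change of the squared moduli; beyond N the two tails are added. The constants 3 and 4 include the
  replacement of the tail at time t by \<open>tail_comparison\<close>.\<close>

lemma rotated_datum:
  fixes \<theta> :: "nat \<Rightarrow> real"
  assumes \<theta>: "\<And>n. n \<ge> 1 \<Longrightarrow> cmod (cu n t - exp (\<i> * complex_of_real (\<theta> n)) * cu n 0) = \<bar>cmod (cu n t) - cmod (cu n 0)\<bar>"
  obtains w where
    "H1_sums (\<lambda>n x. exp (\<i> * complex_of_real (\<theta> n)) * cu n 0 * complex_of_real (f n x)) w"
    "\<And>N. (Hk_norm 1 (\<lambda>x. u t x - w x))\<^sup>2 \<le> 3 * drift N t + 4 * tail N 0 + 2 * \<bar>Gint (u 0)\<bar> + 2 * \<bar>Gint (u t)\<bar>"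
proof -
  define a where "a n = exp (\<i> * complex_of_real (\<theta> n)) * cu n 0" for n
  have na: "cmod (a n) = cmod (cu n 0)" for n by (simp add: a_def norm_mult)
  obtain w w' where w: "H10_pair w w'" "(\<lambda>N. Hk_norm 1 (\<lambda>x. w x - psum a N x)) \<longlonglongrightarrow> 0"
    "\<And>n. n \<ge> 1 \<Longrightarrow> coef w n = a n"
    using psum_converges[of a "energy (u 0) (du 0)"] energy_Bessel[OF u_pair[of 0]] unfolding na by blast
  have e: "H10_pair (\<lambda>x. complex_of_real (f n x)) (ec' n)" if "n \<ge> 1" for n
    using H10_pair_bounded_linear[OF f_props(1)[OF that] bounded_linear_of_real] unfolding ec'_def[abs_def] .
  have "H1_sums (\<lambda>n x. a n * complex_of_real (f n x)) w"
    unfolding H1_sums_def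
  proof (intro conjI allI impI)
    show "(\<lambda>x. a n * complex_of_real (f n x)) \<in> Hk 1" if "n \<ge> 1" for n
      by (rule H1_pair_Hk[OF H10_pair_H1[OF H10_pair_cmult[OF e[OF that]]]])
    show "w \<in> Hk 1" by (rule H1_pair_Hk[OF H10_pair_H1[OF w(1)]])
    have "Hk_norm 1 (\<lambda>x. w x - (\<Sum>n=1..N. a n * complex_of_real (f n x))) = Hk_norm 1 (\<lambda>x. w x - psum a N x)" for N
    proof (rule Hk_norm_1_cong_AE)
      have "AE x in \<mu>. \<forall>n\<in>{1..N}. f n x = ef n x" by (intro AE_finite_allI ef_AE) auto
      then show "AE x in \<mu>. w x - (\<Sum>n=1..N. a n * complex_of_real (f n x)) = w x - psum a N x"
        by eventually_elim (simp add: psum_def ec_def)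
      show "(\<lambda>x. w x - (\<Sum>n=1..N. a n * complex_of_real (f n x))) \<in> borel_measurable \<mu>"
        using e H10_pair_L2(1)[OF w(1)] by (intro L2_D(1) L2_diff L2_sum L2_cmult) (auto dest: H10_pair_L2)
      show "(\<lambda>x. w x - psum a N x) \<in> borel_measurable \<mu>"
        by (intro L2_D(1) L2_diff H10_pair_L2(1)[OF w(1)] psum_L2)
    qed
    then show "(\<lambda>N. Hk_norm 1 (\<lambda>x. w x - (\<Sum>n=1..N. a n * complex_of_real (f n x)))) \<longlonglongrightarrow> 0"
      using w(2) by simp
  qed
  moreover have "(Hk_norm 1 (\<lambda>x. u t x - w x))\<^sup>2 \<le> 3 * drift N t + 4 * tail N 0 + 2 * \<bar>Gint (u 0)\<bar> + 2 * \<bar>Gint (u t)\<bar>" for N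
  proof -
    have p: "H10_pair (\<lambda>x. u t x - w x) (\<lambda>x. du t x - w' x)" by (rule H10_pair_diff[OF u_pair w(1)])
    define d where "d n = coef (\<lambda>x. u t x - w x) n" for n
    have d: "d n = cu n t - a n" if "n \<ge> 1" for n
      unfolding d_def using coef_diff[OF u_L2(1) H10_pair_L2(1)[OF w(1)] that] w(3)[OF that] by simp
    have "(\<Sum>n=1..M. Lam n * (cmod (d n))\<^sup>2) \<le> drift N t + 2 * tail N t + 2 * tail N 0" for M
    proof -
      define M' where "M' = max M N"
      have "(\<Sum>n=1..M. Lam n * (cmod (d n))\<^sup>2) \<le> (\<Sum>n=1..M'. Lam n * (cmod (d n))\<^sup>2)"
      proof (rule sum_mono2)
        fix n assume "n \<in> {1..M'} - {1..M}"
        then show "0 \<le> Lam n * (cmod (d n))\<^sup>2" using Lam_ge_1[of n] by simp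
      qed (auto simp: M'_def)
      also have "\<dots> \<le> (\<Sum>n=1..M'. (if n \<le> N then Lam n * \<bar>(cmod (cu n t))\<^sup>2 - (cmod (cu n 0))\<^sup>2\<bar> else 0)
          + 2 * (if n \<le> N then 0 else Lam n * (cmod (cu n t))\<^sup>2) + 2 * (if n \<le> N then 0 else Lam n * (cmod (cu n 0))\<^sup>2))"
      proof (rule sum_mono)
        fix n assume "n \<in> {1..M'}"
        then have n: "n \<ge> 1" by simp
        have L0: "0 \<le> Lam n" using Lam_ge_1[OF n] by simp
        have dn: "cmod (d n) = \<bar>cmod (cu n t) - cmod (cu n 0)\<bar>"
          unfolding d[OF n] a_def by (rule \<theta>[OF n])
        have "(cmod (d n))\<^sup>2 \<le> \<bar>(cmod (cu n t))\<^sup>2 - (cmod (cu n 0))\<^sup>2\<bar>"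
          unfolding dn power2_abs by (rule diff_squared_le) auto
        moreover have "(cmod (d n))\<^sup>2 \<le> 2 * (cmod (cu n t))\<^sup>2 + 2 * (cmod (cu n 0))\<^sup>2"
          unfolding dn power2_abs using zero_le_power2[of "cmod (cu n t) + cmod (cu n 0)"]
          by (simp add: power2_eq_square algebra_simps)
        then have "Lam n * (cmod (d n))\<^sup>2 \<le> Lam n * (2 * (cmod (cu n t))\<^sup>2 + 2 * (cmod (cu n 0))\<^sup>2)"
          using L0 by (rule mult_left_mono)
        then have "Lam n * (cmod (d n))\<^sup>2 \<le> 2 * (Lam n * (cmod (cu n t))\<^sup>2) + 2 * (Lam n * (cmod (cu n 0))\<^sup>2)"
          by (simp add: algebra_simps)
        ultimately show "Lam n * (cmod (d n))\<^sup>2 \<le> (if n \<le> N then Lam n * \<bar>(cmod (cu n t))\<^sup>2 - (cmod (cu n 0))\<^sup>2\<bar> else 0)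
          + 2 * (if n \<le> N then 0 else Lam n * (cmod (cu n t))\<^sup>2) + 2 * (if n \<le> N then 0 else Lam n * (cmod (cu n 0))\<^sup>2)"
          using L0 by (simp add: mult_left_mono)
      qed
      also have "\<dots> = (\<Sum>n=1..M'. if n \<le> N then Lam n * \<bar>(cmod (cu n t))\<^sup>2 - (cmod (cu n 0))\<^sup>2\<bar> else 0)
          + 2 * (\<Sum>n=1..M'. if n \<le> N then 0 else Lam n * (cmod (cu n t))\<^sup>2)
          + 2 * (\<Sum>n=1..M'. if n \<le> N then 0 else Lam n * (cmod (cu n 0))\<^sup>2)"
        by (simp only: sum.distrib sum_distrib_left)
      also have "(\<Sum>n=1..M'. if n \<le> N then Lam n * \<bar>(cmod (cu n t))\<^sup>2 - (cmod (cu n 0))\<^sup>2\<bar> else 0) = drift N t"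
        unfolding drift_def by (rule sum.mono_neutral_cong_right) (auto simp: M'_def)
      also have "drift N t + 2 * (\<Sum>n=1..M'. if n \<le> N then 0 else Lam n * (cmod (cu n t))\<^sup>2)
          + 2 * (\<Sum>n=1..M'. if n \<le> N then 0 else Lam n * (cmod (cu n 0))\<^sup>2) \<le> drift N t + 2 * tail N t + 2 * tail N 0"
      proof -
        have "(\<Sum>n=1..M'. if n \<le> N then 0 else Lam n * (cmod (cu n s))\<^sup>2) \<le> tail N s" for s
        proof -
          have "(\<Sum>n=1..M'. Lam n * (cmod (cu n s))\<^sup>2) = (\<Sum>n=1..M'. (if n \<le> N then Lam n * (cmod (cu n s))\<^sup>2 else 0)
              + (if n \<le> N then 0 else Lam n * (cmod (cu n s))\<^sup>2))" by (intro sum.cong) auto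
          moreover have "(\<Sum>n=1..M'. if n \<le> N then Lam n * (cmod (cu n s))\<^sup>2 else 0) = (\<Sum>n=1..N. Lam n * (cmod (cu n s))\<^sup>2)"
            by (rule sum.mono_neutral_cong_right) (auto simp: M'_def)
          ultimately show ?thesis
            using energy_Bessel[OF u_pair[of s], of M'] by (simp add: sum.distrib tail_def)
        qed
        from this[of t] this[of 0] show ?thesis by linarith
      qed
      finally show ?thesis .
    qed
    then have "energy (\<lambda>x. u t x - w x) (\<lambda>x. du t x - w' x) \<le> drift N t + 2 * tail N t + 2 * tail N 0"
      using energy_Parseval[OF p] unfolding d_def by (intro LIMSEQ_le_const2) auto
    then show ?thesis
      using energy_bounds(1)[OF H10_pair_H1[OF p]] tail_comparison[of N t] by linarith
  qed
  ultimately show ?thesis unfolding a_def by (rule that)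
qed

lemma u_norm_0: assumes "u0 \<in> H10" shows "Hk_norm 1 (u 0) = Hk_norm 1 u0" "weak_deriv u0 = du 0"
proof -
  have ae: "AE x in \<mu>. u 0 x = u0 x" using sol by (auto simp: global_solution_def)
  have m: "u0 \<in> borel_measurable \<mu>" using assms H10_iff H10_pair_L2(1) L2_D(1) by blast
  note m' = L2_D(1)[OF u_L2(1)[of 0]]
  show "Hk_norm 1 (u 0) = Hk_norm 1 u0" by (rule Hk_norm_1_cong_AE[OF ae m' m])
  show "weak_deriv u0 = du 0" using weak_deriv_cong_AE[OF ae m' m] by simp
qed

lemma norm_continuous: "isCont (\<lambda>t. Hk_norm 1 (u t)) t"
proof -
  have lim: "((\<lambda>t'. Hk_norm 1 (\<lambda>x. u t' x - u t x)) \<longlongrightarrow> 0) (at t)"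
    using sol by (simp add: global_solution_def)
  have H: "u t \<in> Hk 1" for t by (rule H1_pair_Hk[OF H10_pair_H1[OF u_pair]])
  have "((\<lambda>t'. Hk_norm 1 (u t') - Hk_norm 1 (u t)) \<longlongrightarrow> 0) (at t)"
  proof (rule Lim_null_comparison[OF always_eventually lim], rule allI)
    fix t'
    have "Hk_norm 1 (\<lambda>x. u t x - u t' x) = Hk_norm 1 (\<lambda>x. u t' x - u t x)"
      unfolding H1_pair_norm[OF H1_pair_diff[OF H10_pair_H1[OF u_pair] H10_pair_H1[OF u_pair]]]
      by (simp add: L2_norm_commute[of "u t"] L2_norm_commute[of "du t"])
    then show "norm (Hk_norm 1 (u t') - Hk_norm 1 (u t)) \<le> Hk_norm 1 (\<lambda>x. u t' x - u t x)"
      using Hk_norm_1_triangle[OF Hk_1_diff[OF H H] H, of t' t t] Hk_norm_1_triangle[OF Hk_1_diff[OF H H] H, of t t' t']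
      by (simp del: One_nat_def)
  qed
  then show ?thesis by (simp add: isCont_def LIM_zero_iff)
qed

text \<open>The conserved energy confines the norm to two separated ranges, and by continuity it stays in
  the lower one.\<close>

lemma norm_bound:
  assumes e: "energy_constants g \<rho> eps \<Lambda>" and L1: "1 \<le> \<Lambda>" and small: "Hk_norm 1 (u 0) < eps"
  shows "Hk_norm 1 (u t) \<le> \<Lambda> * Hk_norm 1 (u 0)"
proof -
  define n where "n t = Hk_norm 1 (u t)" for t
  have coerc: "inverse \<Lambda> * (n t)\<^sup>2 \<le> hamiltonian V g (u t) + (\<rho> + 1) * mass (u t)"
      "hamiltonian V g (u t) + (\<rho> + 1) * mass (u t) \<le> \<Lambda> * (n t)\<^sup>2" if "n t \<le> \<Lambda> * eps" for t
    using e that V_Linf V_bound H10_pairI(1)[OF u_pair[of t]] unfolding energy_constants_def n_def by blast+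
  have "1 * n 0 \<le> \<Lambda> * n 0" using L1 by (rule mult_right_mono) (simp add: n_def)
  then have n0: "n 0 \<le> \<Lambda> * n 0" by simp
  have gap: "\<Lambda> * n 0 < \<Lambda> * eps"
    using small L1 unfolding n_def by (intro mult_strict_left_mono) auto
  have step: "n t \<le> \<Lambda> * n 0" if "n t \<le> \<Lambda> * eps" for t
  proof -
    have "inverse \<Lambda> * (n t)\<^sup>2 \<le> \<Lambda> * (n 0)\<^sup>2"
      using coerc(1)[OF that] coerc(2)[of 0] n0 gap hamiltonian_conserved[of t] mass_conserved[of t] by simp
    then have "(n t)\<^sup>2 \<le> (\<Lambda> * n 0)\<^sup>2" using L1 by (simp add: field_simps power2_eq_square)
    then show ?thesis by (rule power2_le_imp_le) (use L1 in \<open>simp add: n_def\<close>)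
  qed
  have "n t \<le> \<Lambda> * n 0"
  proof (rule ccontr)
    assume c: "\<not> n t \<le> \<Lambda> * n 0"
    define m where "m = (\<Lambda> * n 0 + \<Lambda> * eps) / 2"
    have m: "\<Lambda> * n 0 < m" "m < \<Lambda> * eps" using gap by (auto simp: m_def)
    have "m \<le> n t" using step[of t] c m by force
    then have "\<exists>s. n s = m"
      using IVT[of n 0 m t] IVT2[of n 0 m t] norm_continuous n0 m unfolding n_def[abs_def]
      by (cases "0 \<le> t") (metis less_imp_le order_trans, metis less_imp_le linorder_le_cases order_trans)
    then obtain s where "n s = m" by blast
    then show False using step[of s] m by simp
  qed
  then show ?thesis by (simp add: n_def)
qed

text \<open>The primitive of g is quadratic in the squared modulus, because g vanishes at amplitude 0, and the
  modulus is bounded by the Sobolev norm. Compared with the square of the norm this gains two powers.\<close>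

lemma Gint_le:
  assumes L: "L \<ge> 0" "\<And>x y. x \<in> {0<..<pi} \<Longrightarrow> \<bar>y\<bar> \<le> M \<Longrightarrow> \<bar>primitive g x y\<bar> \<le> L * y\<^sup>2"
    and M: "(sqrt pi * Hk_norm 1 (u t))\<^sup>2 \<le> M"
  shows "\<bar>Gint (u t)\<bar> \<le> pi * (L * (sqrt pi * Hk_norm 1 (u t)) ^ 4)"
proof -
  define b where "b = sqrt pi * Hk_norm 1 (u t)"
  have b: "AE x in \<mu>. \<bar>primitive g x ((cmod (u t x))\<^sup>2)\<bar> \<le> L * b ^ 4"
    using H10_AE_bound[OF u_pair[of t]] AE_space
  proof eventually_elim
    case (elim x)
    have "sqrt pi * L2_norm (du t) \<le> b"
      unfolding b_def by (intro mult_left_mono H1_pair_norm_bounds(2)[OF H10_pair_H1[OF u_pair]]) simp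
    then have "cmod (u t x) \<le> b" using elim by linarith
    then have s: "(cmod (u t x))\<^sup>2 \<le> b\<^sup>2" by (intro power_mono) auto
    then have "(cmod (u t x))\<^sup>2 \<le> M" using M unfolding b_def by linarith
    then have "\<bar>primitive g x ((cmod (u t x))\<^sup>2)\<bar> \<le> L * ((cmod (u t x))\<^sup>2)\<^sup>2"
      using elim by (intro L(2)) auto
    also have "\<dots> \<le> L * (b\<^sup>2)\<^sup>2" by (rule mult_left_mono[OF power_mono[OF s] L(1)]) simp
    finally show ?case by (simp flip: power_mult)
  qed
  have "\<bar>Gint (u t)\<bar> \<le> (LINT x|\<mu>. L * b ^ 4)"
    unfolding Gint_def
    using primitive_integrable[OF L2_D(1)[OF u_L2(1)] u_AE_le, of t] b
    by (intro order_trans[OF integral_abs_bound] integral_mono_AE) auto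
  also have "\<dots> = pi * (L * b ^ 4)" using measure_\<mu>_space by simp
  finally show ?thesis by (simp add: b_def)
qed

end

context dirichlet
begin

text \<open>At a multiple of the first eigenfunction of norm \<Lambda> eps, the upper and the lower bound enclose the
  same number, so that the inverse of \<Lambda> cannot exceed \<Lambda>.\<close>

lemma energy_constants_ge_1:
  assumes e: "energy_constants g \<rho> eps \<Lambda>" shows "1 \<le> \<Lambda>"
proof -
  have pos: "eps > 0" "\<Lambda> > 0" using e by (auto simp: energy_constants_def)
  have p: "H10_pair (ec 1) (ec' 1)" by (rule ec_pair) simp
  define n where "n = Hk_norm 1 (ec 1)"
  have "1 = (L2_norm (ec 1))\<^sup>2"
    using ef_orthonormal[of 1 1] by (simp add: L2_norm_def ec_def power2_eq_square)
  then have "L2_norm (ec 1) \<noteq> 0" by auto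
  moreover have "L2_norm (ec 1) \<le> n"
    unfolding n_def by (rule H1_pair_norm_bounds(1)[OF H10_pair_H1[OF p]])
  moreover have "0 \<le> L2_norm (ec 1)" by simp
  ultimately have n: "n > 0" by linarith
  define c where "c = \<Lambda> * eps / n"
  define v where "v x = c *\<^sub>R ec 1 x" for x
  have v: "H10_pair v (\<lambda>x. c *\<^sub>R ec' 1 x)"
    unfolding v_def[abs_def] by (rule H10_pair_bounded_linear[OF p bounded_linear_scaleR_right])
  have "Hk_norm 1 v = \<bar>c\<bar> * n"
    unfolding H1_pair_norm[OF H10_pair_H1[OF v]] unfolding v_def[abs_def] L2_norm_scaleR n_def
      H1_pair_norm[OF H10_pair_H1[OF p]]
    by (simp add: power_mult_distrib real_sqrt_mult flip: distrib_left)
  then have nv: "Hk_norm 1 v = \<Lambda> * eps" using n pos by (simp add: c_def)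
  then have "Hk_norm 1 v \<le> \<Lambda> * eps" by simp
  then have "inverse \<Lambda> * (Hk_norm 1 v)\<^sup>2 \<le> hamiltonian V g v + (\<rho> + 1) * mass v"
    "hamiltonian V g v + (\<rho> + 1) * mass v \<le> \<Lambda> * (Hk_norm 1 v)\<^sup>2"
    using e V_Linf V_bound H10_pairI(1)[OF v] unfolding energy_constants_def by blast+
  then have "inverse \<Lambda> * (\<Lambda> * eps)\<^sup>2 \<le> \<Lambda> * (\<Lambda> * eps)\<^sup>2" unfolding nv by linarith
  then have "inverse \<Lambda> \<le> \<Lambda>" using pos by (simp add: mult_le_cancel_right)
  then have "1 * 1 \<le> \<Lambda> * \<Lambda>" using pos by (simp add: field_simps)
  then show ?thesis by (rule power2_le_imp_le[unfolded power2_eq_square]) (use pos in simp)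
qed

lemma cutoff_index:
  assumes "L \<ge> 1"
  obtains N where "L < Lam (Suc N)" "\<And>n. n \<in> {1..N} \<Longrightarrow> Lam n \<le> L" "real N \<le> pi\<^sup>2 * L"
proof -
  obtain m :: nat where m: "pi\<^sup>2 * L < real m" using reals_Archimedean2 by blast
  have "L < Lam (Suc m)"
  proof -
    have "real (Suc m) \<le> pi\<^sup>2 * Lam (Suc m)" by (rule index_le_Lam) simp
    then have "pi\<^sup>2 * L < pi\<^sup>2 * Lam (Suc m)" using m unfolding of_nat_Suc by linarith
    then show ?thesis by (rule mult_left_less_imp_less) simp
  qed
  then have ex: "\<exists>N. L < Lam (Suc N)" by blast
  define N where "N = (LEAST N. L < Lam (Suc N))"
  have N: "L < Lam (Suc N)" unfolding N_def by (rule LeastI_ex[OF ex])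
  have le: "Lam n \<le> L" if n: "n \<in> {1..N}" for n
  proof -
    have "n - 1 < N" using n by auto
    then have "\<not> L < Lam (Suc (n - 1))" unfolding N_def by (rule not_less_Least)
    then show ?thesis using n by simp
  qed
  have "real N \<le> pi\<^sup>2 * L"
  proof (cases "N = 0")
    case True then show ?thesis using assms by simp
  next
    case False
    then have "real N \<le> pi\<^sup>2 * Lam N" by (intro index_le_Lam) simp
    also have "\<dots> \<le> pi\<^sup>2 * L" using le[of N] False by (intro mult_left_mono) auto
    finally show ?thesis .
  qed
  with N le show ?thesis by (rule that)
qed

text \<open>In \<open>energy_tail_bound\<close> the derivative z' may be as large as the fourth root of L, since it is
  divided by the square root of the eigenvalue; so both terms decay.\<close>

lemma smooth_tail:
  assumes s: "s > 1"
  obtains a C where "a > 0" "C > 0"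
    "\<And>u L N. u \<in> Hs s \<inter> H10 \<Longrightarrow> L \<ge> 1 \<Longrightarrow> L \<le> Lam (Suc N) \<Longrightarrow>
       energy u (weak_deriv u) - (\<Sum>n=1..N. Lam n * (cmod (coef u n))\<^sup>2) \<le> C * L powr (- a) * (Hs_norm s u)\<^sup>2"
proof -
  show ?thesis
  proof (rule Hs_approximation[OF s])
    fix a C :: real
    assume a: "a > 0" and C: "C \<ge> 0"
      and ap: "\<And>(u :: real \<Rightarrow> complex) L. u \<in> Hs s \<inter> H10 \<Longrightarrow> L \<ge> 1 \<Longrightarrow> \<exists>z z'. H1_pair z z' \<and>
         L2_norm (\<lambda>x. weak_deriv u x - z x) \<le> C * L powr (- a) * Hs_norm s u \<and>
         L2_norm z' \<le> C * L powr (1/4) * Hs_norm s u"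
    define b where "b = min a (1/4)"
    have b: "0 < b" "b \<le> a" "b \<le> 1/4" using a by (auto simp: b_def)
    define D where "D = C + (C + (2 * \<rho> + 1))"
    have D: "D > 0" using C \<rho>_pos by (simp add: D_def)
    show ?thesis
    proof (rule that[of "2 * b" "D\<^sup>2"])
      fix u :: "real \<Rightarrow> complex" and L N assume u: "u \<in> Hs s \<inter> H10" and L: "L \<ge> 1" "L \<le> Lam (Suc N)"
      define e where "e = Hs_norm s u"
      have e: "e \<ge> 0" by (simp add: e_def)
      have p: "H10_pair u (weak_deriv u)" using u by (simp add: H10_iff)
      define T where "T = energy u (weak_deriv u) - (\<Sum>n=1..N. Lam n * (cmod (coef u n))\<^sup>2)"
      have T0: "0 \<le> T" using energy_Bessel[OF p, of N] by (simp add: T_def)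
      obtain z z' where z: "H1_pair z z'" "L2_norm (\<lambda>x. weak_deriv u x - z x) \<le> C * L powr (- a) * e"
        "L2_norm z' \<le> C * L powr (1/4) * e"
        using ap[OF u L(1)] unfolding e_def by blast
      have un: "L2_norm u \<le> e"
        using H1_pair_norm_bounds(1)[OF H10_pair_H1[OF p]] Hk_1_le_Hs_norm[OF s, of u] by (simp add: e_def)
      have "sqrt T \<le> L2_norm (\<lambda>x. weak_deriv u x - z x) + (L2_norm z' + (2 * \<rho> + 1) * L2_norm u) / sqrt (Lam (Suc N))"
        unfolding T_def by (rule energy_tail_bound[OF p z(1)])
      also have "\<dots> \<le> C * L powr (- a) * e + (C * L powr (1/4) * e + (2 * \<rho> + 1) * (L powr (1/4) * e)) / sqrt L"
      proof (intro add_mono z(2) frac_le)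
        have "1 * e \<le> L powr (1/4) * e" using L e by (intro mult_right_mono) (auto simp: ge_one_powr_ge_zero)
        then show "(2 * \<rho> + 1) * L2_norm u \<le> (2 * \<rho> + 1) * (L powr (1/4) * e)"
          using un \<rho>_pos by (intro mult_left_mono) auto
      qed (use z(3) L C e \<rho>_pos in auto)
      also have "\<dots> = C * L powr (- a) * e + (C + (2 * \<rho> + 1)) * L powr (- (1/4)) * e"
      proof -
        have "L powr (1/4) / sqrt L = L powr (1/4 - 1/2)"
          using L by (simp only: powr_diff powr_half_sqrt)
        then have "L powr (1/4) / sqrt L = L powr (- (1/4))" by simp
        moreover have "(C * L powr (1/4) * e + (2 * \<rho> + 1) * (L powr (1/4) * e)) / sqrt L
            = (C + (2 * \<rho> + 1)) * (L powr (1/4) / sqrt L) * e" by (simp add: algebra_simps add_divide_distrib)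
        ultimately show ?thesis by simp
      qed
      also have "\<dots> \<le> C * L powr (- b) * e + (C + (2 * \<rho> + 1)) * L powr (- b) * e"
        using C e \<rho>_pos b L by (intro add_mono mult_right_mono mult_left_mono powr_mono) auto
      also have "\<dots> = D * L powr (- b) * e" by (simp add: D_def algebra_simps)
      finally have "(sqrt T)\<^sup>2 \<le> (D * L powr (- b) * e)\<^sup>2" using T0 by (intro power_mono) auto
      also have "\<dots> = D\<^sup>2 * (L powr (- b))\<^sup>2 * e\<^sup>2" by (simp add: power_mult_distrib)
      also have "(L powr (- b))\<^sup>2 = L powr (- (2 * b))"
        by (simp add: power2_eq_square flip: powr_add)
      finally show "energy u (weak_deriv u) - (\<Sum>n=1..N. Lam n * (cmod (coef u n))\<^sup>2) \<le> D\<^sup>2 * L powr (- (2 * b)) * (Hs_norm s u)\<^sup>2"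
        using T0 by (simp add: T_def e_def)
    qed (use b D in auto)
  qed
qed

end

text \<open>The threshold speaks of times up to a power of the norm of order 1, which is smaller than the norm of
  order s, so that its times are longer.\<close>

lemma before_time_mono:
  assumes "before_time e r t" "0 \<le> e'" "e' \<le> e" "0 \<le> r" shows "before_time e' r t"
proof (cases "e' = 0")
  case False
  then have "e' > 0" "e > 0" using assms by auto
  then have "e powr (- r) \<le> e' powr (- r)" using assms by (intro powr_mono2') auto
  then show ?thesis using assms \<open>e > 0\<close> unfolding before_time_def by auto
qed (simp add: before_time_def)

text \<open>With \<open>L = (e / e0) powr (- 1 / (\<beta> + 2))\<close> the first term is of order e cubed, and the second gains
  the factor \<open>e powr (a / (\<beta> + 2))\<close> over the square of e. The scaling by e0 keeps L at least 1.\<close>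

lemma balance_levels:
  fixes \<beta> a e0 A :: real
  assumes \<beta>: "\<beta> > 0" and a: "a > 0" and e0: "e0 > 0" and A: "A \<ge> 0"
  obtains K \<delta> where "K > 0" "\<delta> > 0"
    "\<And>e X. 0 \<le> e \<Longrightarrow> e \<le> e0 \<Longrightarrow> 0 \<le> X \<Longrightarrow>
       (\<And>L. L \<ge> 1 \<Longrightarrow> X\<^sup>2 \<le> A * (L powr (\<beta> + 2) * e ^ 4 + L powr (- a) * e\<^sup>2)) \<Longrightarrow> X \<le> K * e powr (1 + \<delta>)"
proof -
  define \<kappa> where "\<kappa> = 1 / (\<beta> + 2)"
  define \<delta> where "\<delta> = min (1/2) (a * \<kappa> / 2)"
  have \<kappa>: "\<kappa> > 0" using \<beta> by (simp add: \<kappa>_def)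
  have \<delta>: "0 < \<delta>" "2 + 2 * \<delta> \<le> 3" "2 + 2 * \<delta> \<le> 2 + a * \<kappa>" using a \<kappa> by (auto simp: \<delta>_def)
  define D where "D = A * (e0 ^ 4 + e0\<^sup>2)"
  have D: "D \<ge> 0" using A by (simp add: D_def)
  define K where "K = sqrt D * (1 / e0) powr (1 + \<delta>) + 1"
  show ?thesis
  proof (rule that[of K \<delta>])
    show "K > 0" using D by (simp add: K_def add_nonneg_pos)
    show "\<delta> > 0" by (rule \<delta>(1))
    fix e X :: real
    assume e: "0 \<le> e" "e \<le> e0" and X: "0 \<le> X"
      and b: "\<And>L. L \<ge> 1 \<Longrightarrow> X\<^sup>2 \<le> A * (L powr (\<beta> + 2) * e ^ 4 + L powr (- a) * e\<^sup>2)"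
    show "X \<le> K * e powr (1 + \<delta>)"
    proof (cases "e = 0")
      case True
      then show ?thesis using b[of 1] X by simp
    next
      case False
      define x where "x = e / e0"
      have x: "0 < x" "x \<le> 1" using e e0 False by (auto simp: x_def)
      have ex: "e = e0 * x" using e0 by (simp add: x_def)
      define L where "L = x powr (- \<kappa>)"
      have L: "L \<ge> 1"
        using powr_mono2'[of "- \<kappa>" x 1] x \<kappa> by (simp add: L_def)
      have "L powr (\<beta> + 2) * e ^ 4 = e0 ^ 4 * x powr 3"
      proof -
        have "L powr (\<beta> + 2) = x powr (- 1)"
          unfolding L_def powr_powr using \<beta> by (simp add: \<kappa>_def)
        moreover have "e ^ 4 = e0 ^ 4 * x powr 4"
          unfolding ex using x by (simp add: power_mult_distrib)
        ultimately show ?thesis using x by (simp add: divide_simps eval_nat_numeral)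
      qed
      also have "\<dots> \<le> e0 ^ 4 * x powr (2 + 2 * \<delta>)"
        using x \<delta>(2) by (intro mult_left_mono powr_mono') auto
      finally have 1: "L powr (\<beta> + 2) * e ^ 4 \<le> e0 ^ 4 * x powr (2 + 2 * \<delta>)" .
      have "L powr (- a) * e\<^sup>2 = e0\<^sup>2 * x powr (2 + a * \<kappa>)"
      proof -
        have "L powr (- a) = x powr (a * \<kappa>)" unfolding L_def powr_powr by (simp add: mult.commute)
        moreover have "e\<^sup>2 = e0\<^sup>2 * x powr 2" unfolding ex using x by (simp add: power_mult_distrib)
        ultimately show ?thesis by (simp add: powr_add)
      qed
      also have "\<dots> \<le> e0\<^sup>2 * x powr (2 + 2 * \<delta>)"
        using x \<delta>(3) by (intro mult_left_mono powr_mono') auto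
      finally have 2: "L powr (- a) * e\<^sup>2 \<le> e0\<^sup>2 * x powr (2 + 2 * \<delta>)" .
      have "X\<^sup>2 \<le> A * (e0 ^ 4 * x powr (2 + 2 * \<delta>) + e0\<^sup>2 * x powr (2 + 2 * \<delta>))"
        using b[OF L] mult_left_mono[OF add_mono[OF 1 2] A] by linarith
      also have "\<dots> = D * x powr (2 + 2 * \<delta>)" by (simp add: D_def algebra_simps)
      also have "\<dots> = (sqrt D * x powr (1 + \<delta>))\<^sup>2"
      proof -
        have "(x powr (1 + \<delta>))\<^sup>2 = x powr ((1 + \<delta>) + (1 + \<delta>))"
          by (simp only: power2_eq_square powr_add)
        then show ?thesis using D by (simp add: power_mult_distrib algebra_simps)
      qed
      finally have "X \<le> sqrt D * x powr (1 + \<delta>)" by (rule power2_le_imp_le) (use D in simp)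
      also have "x powr (1 + \<delta>) = (1 / e0) powr (1 + \<delta>) * e powr (1 + \<delta>)"
        unfolding x_def using e e0 by (simp flip: powr_mult)
      also have "sqrt D * ((1 / e0) powr (1 + \<delta>) * e powr (1 + \<delta>)) \<le> K * e powr (1 + \<delta>)"
        by (simp add: K_def algebra_simps)
      finally show ?thesis .
    qed
  qed
qed

theorem corollary1p14:
  fixes V :: "real \<Rightarrow> real" and g :: "real \<Rightarrow> real \<Rightarrow> real" and p :: nat
    and lam :: "nat \<Rightarrow> real" and f :: "nat \<Rightarrow> real \<Rightarrow> real"
    and eps0 s :: real
  assumes "nonlinearity p g"
    and "V \<in> Linf"
    and "dirichlet_spectrum V lam f"
    and "strongly_nonresonant lam"
    and "threshold V p g f eps0"
    and "s > 1"
  shows "\<exists>\<theta> :: (real \<Rightarrow> complex) \<Rightarrow> nat \<Rightarrow> real \<Rightarrow> real.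
    \<forall>r::real. r \<ge> 1 \<longrightarrow> (\<exists>K>0. \<exists>\<delta>>0. \<forall>u0 \<in> Hs s \<inter> H10. Hs_norm s u0 \<le> eps0 \<longrightarrow>
      (\<forall>u. global_solution V g u0 u \<longrightarrow>
        (\<forall>t. before_time (Hs_norm s u0) r t \<longrightarrow>
          (\<exists>w. H1_sums (\<lambda>n x. exp (\<i> * complex_of_real (\<theta> u0 n t)) * eigen_coeff f (u 0) n
                                 * complex_of_real (f n x)) w \<and>
               Hk_norm 1 (\<lambda>x. u t x - w x) \<le> K * Hs_norm s u0 powr (1 + \<delta>)))))"
proof -
  note s = assms(6)
  have p4: "p \<ge> 4" using assms(1) by (simp add: nonlinearity_def)
  have eps0: "eps0 > 0" using assms(5) by (simp add: threshold_def)
  obtain \<rho> eps \<Lambda> where \<rho>: "\<rho> > 0" "Linf_norm V \<le> ereal \<rho>"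
    and ec: "energy_constants g \<rho> eps \<Lambda>" and le_eps: "eps0 \<le> eps"
    using assms(5) unfolding threshold_def by blast
  have stable: "\<exists>\<beta>>0. \<exists>C>0. \<forall>u0\<in>H10. Hk_norm 1 u0 \<le> eps0 \<longrightarrow>
        (\<forall>u. global_solution V g u0 u \<longrightarrow> (\<forall>t. before_time (Hk_norm 1 u0) r t \<longrightarrow>
              (\<forall>n\<ge>1. \<bar>(cmod (eigen_coeff f (u t) n))\<^sup>2 - (cmod (eigen_coeff f (u 0) n))\<^sup>2\<bar>
                 \<le> C * jbracket (real n) powr \<beta> * Hk_norm 1 u0 ^ p)))" if "r \<ge> 1" for r :: real
    using assms(5) that unfolding threshold_def by blast
  interpret dirichlet V lam f \<rho>
    by unfold_locales (use assms \<rho> in auto)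
  have gL: "uniformly_Lipschitz g" by (rule nonlinearity_uniformly_Lipschitz[OF assms(1)])
  have \<Lambda>: "1 \<le> \<Lambda>" by (rule energy_constants_ge_1[OF ec])
  obtain a Cs where a: "a > 0" and Cs: "Cs > 0"
    and tail: "\<And>u L N. u \<in> Hs s \<inter> H10 \<Longrightarrow> L \<ge> 1 \<Longrightarrow> L \<le> Lam (Suc N) \<Longrightarrow>
       energy u (weak_deriv u) - (\<Sum>n=1..N. Lam n * (cmod (coef u n))\<^sup>2) \<le> Cs * L powr (- a) * (Hs_norm s u)\<^sup>2"
    using smooth_tail[OF s] by blast
  define M where "M = (sqrt pi * (\<Lambda> * eps0))\<^sup>2"
  obtain CG where CG: "CG \<ge> 0" "\<And>x y. x \<in> {0<..<pi} \<Longrightarrow> \<bar>y\<bar> \<le> M \<Longrightarrow> \<bar>primitive g x y\<bar> \<le> CG * y\<^sup>2"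
    using primitive_Lipschitz[OF gL, of M] by metis
  define CG' where "CG' = pi * (CG * (sqrt pi * \<Lambda>) ^ 4)"
  have CG': "CG' \<ge> 0" using CG \<Lambda> by (simp add: CG'_def)
  \<comment> \<open>The angles are read off from one solution; by uniqueness they serve for all.\<close>
  define some_sol where "some_sol u0 = (SOME u. global_solution V g u0 u)" for u0
  define \<theta> where "\<theta> u0 n t = Arg (coef (some_sol u0 t) n) - Arg (coef (some_sol u0 0) n)" for u0 n t
  show ?thesis
  proof (intro exI[of _ \<theta>] allI impI)
    fix r :: real assume r: "r \<ge> 1"
    obtain \<beta> C where \<beta>: "\<beta> > 0" and C: "C > 0"
      and stab: "\<And>u0 u t n. u0 \<in> H10 \<Longrightarrow> Hk_norm 1 u0 \<le> eps0 \<Longrightarrow> global_solution V g u0 u \<Longrightarrow>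
        before_time (Hk_norm 1 u0) r t \<Longrightarrow> n \<ge> 1 \<Longrightarrow>
        \<bar>(cmod (coef (u t) n))\<^sup>2 - (cmod (coef (u 0) n))\<^sup>2\<bar> \<le> C * jbracket (real n) powr \<beta> * Hk_norm 1 u0 ^ p"
      using stable[OF r] by blast
    define CQ where "CQ = pi\<^sup>2 * (C * (2 * pi\<^sup>2) powr \<beta>) * eps0 ^ (p - 4)"
    have CQ: "CQ \<ge> 0" using C eps0 by (simp add: CQ_def)
    define A where "A = 3 * CQ + 4 * Cs + 4 * CG'"
    have A: "A \<ge> 0" using CQ Cs CG' by (simp add: A_def)
    obtain K \<delta> where K: "K > 0" and \<delta>: "\<delta> > 0"
      and bal: "\<And>e X. 0 \<le> e \<Longrightarrow> e \<le> eps0 \<Longrightarrow> 0 \<le> X \<Longrightarrow>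
       (\<And>L. L \<ge> 1 \<Longrightarrow> X\<^sup>2 \<le> A * (L powr (\<beta> + 2) * e ^ 4 + L powr (- a) * e\<^sup>2)) \<Longrightarrow> X \<le> K * e powr (1 + \<delta>)"
      using balance_levels[OF \<beta> a eps0 A] by blast
    show "\<exists>K>0. \<exists>\<delta>>0. \<forall>u0 \<in> Hs s \<inter> H10. Hs_norm s u0 \<le> eps0 \<longrightarrow>
      (\<forall>u. global_solution V g u0 u \<longrightarrow>
        (\<forall>t. before_time (Hs_norm s u0) r t \<longrightarrow>
          (\<exists>w. H1_sums (\<lambda>n x. exp (\<i> * complex_of_real (\<theta> u0 n t)) * eigen_coeff f (u 0) n
                                 * complex_of_real (f n x)) w \<and>
               Hk_norm 1 (\<lambda>x. u t x - w x) \<le> K * Hs_norm s u0 powr (1 + \<delta>))))"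
    proof (rule exI[of _ K], rule conjI[OF K], rule exI[of _ \<delta>], rule conjI[OF \<delta>], intro ballI allI impI)
      fix u0 u t
      assume u0: "u0 \<in> Hs s \<inter> H10" and small: "Hs_norm s u0 \<le> eps0"
        and sol: "global_solution V g u0 u" and time: "before_time (Hs_norm s u0) r t"
      define e where "e = Hs_norm s u0"
      have e: "0 \<le> e" "e \<le> eps0" using small by (auto simp: e_def)
      interpret nls_solution V lam f \<rho> g u0 u by unfold_locales (rule gL sol)+
      have n0: "Hk_norm 1 (u 0) = Hk_norm 1 u0" and d0: "weak_deriv u0 = du 0" using u_norm_0 u0 by auto
      have ne: "Hk_norm 1 u0 \<le> e" unfolding e_def by (rule Hk_1_le_Hs_norm[OF s])
      \<comment> \<open>The norm of order 1 is strictly below the threshold, as the energy argument requires.\<close>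
      have "Hk_norm 1 (u 0) < eps"
      proof (cases "Hk_norm 1 u0 = e")
        case True
        then have "Hk_norm 1 u0 = 0" using Hs_norm_eq_imp_zero[OF s u0] by (simp add: e_def)
        then show ?thesis using n0 eps0 le_eps by simp
      next
        case False
        then show ?thesis using ne e le_eps n0 by simp
      qed
      then have nb: "Hk_norm 1 (u \<tau>) \<le> \<Lambda> * e" for \<tau>
      proof -
        assume lt: "Hk_norm 1 (u 0) < eps"
        have "\<Lambda> * Hk_norm 1 u0 \<le> \<Lambda> * e" using ne \<Lambda> by (intro mult_left_mono) auto
        then show ?thesis using norm_bound[OF ec \<Lambda> lt, of \<tau>, unfolded n0] by linarith
      qed
      have G: "\<bar>Gint (u \<tau>)\<bar> \<le> CG' * e ^ 4" for \<tau>
      proof -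
        have b: "sqrt pi * Hk_norm 1 (u \<tau>) \<le> sqrt pi * (\<Lambda> * e)" using nb[of \<tau>] by (intro mult_left_mono) auto
        have "sqrt pi * (\<Lambda> * e) \<le> sqrt pi * (\<Lambda> * eps0)" using e \<Lambda> by (intro mult_left_mono) auto
        then have "(sqrt pi * Hk_norm 1 (u \<tau>))\<^sup>2 \<le> M" unfolding M_def using b by (intro power_mono) auto
        then have "\<bar>Gint (u \<tau>)\<bar> \<le> pi * (CG * (sqrt pi * Hk_norm 1 (u \<tau>)) ^ 4)" by (intro Gint_le[where M=M] CG) auto
        also have "\<dots> \<le> pi * (CG * (sqrt pi * (\<Lambda> * e)) ^ 4)"
          using CG(1) by (intro mult_left_mono power_mono b) auto
        also have "\<dots> = CG' * e ^ 4" by (simp add: CG'_def power_mult_distrib)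
        finally show ?thesis .
      qed
      have "global_solution V g u0 (some_sol u0)" unfolding some_sol_def by (rule someI[of "global_solution V g u0", OF sol])
      then have "nls_solution V lam f \<rho> g u0 (some_sol u0)" by unfold_locales (rule gL)
      then have eq: "coef (some_sol u0 \<tau>) n = cu n \<tau>" if "n \<ge> 1" for n \<tau>
        using nls_unique[OF _ nls_solution_axioms that] by blast
      have "cmod (cu n t - exp (\<i> * complex_of_real (\<theta> u0 n t)) * cu n 0) = \<bar>cmod (cu n t) - cmod (cu n 0)\<bar>"
        if "n \<ge> 1" for n
        unfolding \<theta>_def eq[OF that] by (rule phase_difference)
      then obtain w where
        w: "H1_sums (\<lambda>n x. exp (\<i> * complex_of_real (\<theta> u0 n t)) * cu n 0 * complex_of_real (f n x)) w"
        and wb: "\<And>N. (Hk_norm 1 (\<lambda>x. u t x - w x))\<^sup>2 \<le> 3 * drift N t + 4 * nls_solution.tail V lam f \<rho> u N 0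
            + 2 * \<bar>Gint (u 0)\<bar> + 2 * \<bar>Gint (u t)\<bar>"
        using rotated_datum[of t "\<lambda>n. \<theta> u0 n t"] by blast
      have "Hk_norm 1 (\<lambda>x. u t x - w x) \<le> K * e powr (1 + \<delta>)"
      proof (rule bal[OF e])
        fix L :: real assume L: "L \<ge> 1"
        obtain N where N: "L < Lam (Suc N)" "\<And>n. n \<in> {1..N} \<Longrightarrow> Lam n \<le> L" "real N \<le> pi\<^sup>2 * L"
          using cutoff_index[OF L] by blast
        have "drift N t \<le> (\<Sum>n=1..N. L * (C * (2 * pi\<^sup>2 * L) powr \<beta> * (eps0 ^ (p - 4) * e ^ 4)))"
          unfolding drift_def
        proof (rule sum_mono)
          fix n assume n: "n \<in> {1..N}"
          have "\<bar>(cmod (cu n t))\<^sup>2 - (cmod (cu n 0))\<^sup>2\<bar> \<le> C * jbracket (real n) powr \<beta> * Hk_norm 1 u0 ^ p"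
            using n u0 ne e r by (intro stab sol before_time_mono[OF time]) (auto simp: e_def)
          also have "\<dots> \<le> C * (2 * pi\<^sup>2 * L) powr \<beta> * (eps0 ^ (p - 4) * e ^ 4)"
          proof (intro mult_mono mult_left_mono powr_mono2)
            have "jbracket (real n) \<le> 2 * real n"
              unfolding jbracket_def
            proof (rule real_le_lsqrt)
              have "1 \<le> (real n)\<^sup>2" using n by (intro one_le_power) auto
              moreover have "(2 * real n)\<^sup>2 = 4 * (real n)\<^sup>2" by (simp add: power_mult_distrib)
              ultimately show "1 + (real n)\<^sup>2 \<le> (2 * real n)\<^sup>2" by linarith
            qed simp
            also have "\<dots> \<le> 2 * pi\<^sup>2 * L" using n N(3) by simp
            finally show "jbracket (real n) \<le> 2 * pi\<^sup>2 * L" .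
            have "Hk_norm 1 u0 ^ p \<le> e ^ p" using ne by (intro power_mono) auto
            also have "\<dots> = e ^ (p - 4) * e ^ 4" using p4 by (simp flip: power_add)
            also have "\<dots> \<le> eps0 ^ (p - 4) * e ^ 4" using e by (intro mult_right_mono power_mono) auto
            finally show "Hk_norm 1 u0 ^ p \<le> eps0 ^ (p - 4) * e ^ 4" .
          qed (use C \<beta> in \<open>auto simp: jbracket_def\<close>)
          finally show "Lam n * \<bar>(cmod (cu n t))\<^sup>2 - (cmod (cu n 0))\<^sup>2\<bar>
              \<le> L * (C * (2 * pi\<^sup>2 * L) powr \<beta> * (eps0 ^ (p - 4) * e ^ 4))"
            using N(2)[OF n] L by (intro mult_mono) auto
        qed
        also have "\<dots> = real N * (L * (C * (2 * pi\<^sup>2 * L) powr \<beta> * (eps0 ^ (p - 4) * e ^ 4)))" by simp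
        also have "\<dots> \<le> (pi\<^sup>2 * L) * (L * (C * (2 * pi\<^sup>2 * L) powr \<beta> * (eps0 ^ (p - 4) * e ^ 4)))"
          using N(3) L C eps0 e by (intro mult_right_mono) auto
        also have "\<dots> = CQ * (L powr (\<beta> + 2) * e ^ 4)"
        proof -
          have "(2 * pi\<^sup>2 * L) powr \<beta> = (2 * pi\<^sup>2) powr \<beta> * L powr \<beta>" using L by (simp add: powr_mult)
          moreover have "L * L * L powr \<beta> = L powr (\<beta> + 2)" using L by (simp add: powr_add power2_eq_square)
          ultimately show ?thesis by (simp add: CQ_def mult_ac)
        qed
        finally have D: "drift N t \<le> CQ * (L powr (\<beta> + 2) * e ^ 4)" .
        have T: "nls_solution.tail V lam f \<rho> u N 0 \<le> Cs * (L powr (- a) * e\<^sup>2)"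
        proof -
          have ae: "AE x in \<mu>. u 0 x = u0 x" using sol by (auto simp: global_solution_def)
          have u0L: "u0 \<in> L2" using u0 H10_iff H10_pair_L2(1) by blast
          have "coef u0 n = cu n 0" if "n \<ge> 1" for n
            using eigen_coeff_cong_AE[where f=f and n=n, OF ae L2_D(1)[OF u_L2(1)[of 0]] L2_D(1)[OF u0L] L2_D(1)[OF f_L2(1)[OF that]]] by simp
          moreover have "energy u0 (weak_deriv u0) = energy (u 0) (du 0)"
          proof -
            have "(LINT x|\<mu>. W x * (cmod (u0 x))\<^sup>2) = (LINT x|\<mu>. W x * (cmod (u 0 x))\<^sup>2)"
              using ae u0L u_L2(1)[of 0] by (intro integral_cong_AE) (auto elim: eventually_mono)
            then show ?thesis unfolding energy_def d0 by simp
          qed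
          ultimately show ?thesis
            using tail[OF u0 L less_imp_le[OF N(1)]] by (simp add: tail_def e_def mult.assoc)
        qed
        have "1 * e ^ 4 \<le> L powr (\<beta> + 2) * e ^ 4"
          using L \<beta> e by (intro mult_right_mono) (auto simp: ge_one_powr_ge_zero)
        then have "CG' * e ^ 4 \<le> CG' * (L powr (\<beta> + 2) * e ^ 4)" using CG' by (intro mult_left_mono) auto
        then have "(Hk_norm 1 (\<lambda>x. u t x - w x))\<^sup>2 \<le> 3 * (CQ * (L powr (\<beta> + 2) * e ^ 4))
            + 4 * (Cs * (L powr (- a) * e\<^sup>2)) + 4 * (CG' * (L powr (\<beta> + 2) * e ^ 4))"
          using wb[of N] D T G[of 0] G[of t] by linarith
        also have "\<dots> \<le> A * (L powr (\<beta> + 2) * e ^ 4) + A * (L powr (- a) * e\<^sup>2)"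
        proof -
          have "(3 * CQ + 4 * CG') * (L powr (\<beta> + 2) * e ^ 4) \<le> A * (L powr (\<beta> + 2) * e ^ 4)"
            using Cs e by (intro mult_right_mono) (auto simp: A_def)
          moreover have "(4 * Cs) * (L powr (- a) * e\<^sup>2) \<le> A * (L powr (- a) * e\<^sup>2)"
            using CQ CG' by (intro mult_right_mono) (auto simp: A_def)
          ultimately show ?thesis by (simp only: distrib_right mult.assoc)
        qed
        finally show "(Hk_norm 1 (\<lambda>x. u t x - w x))\<^sup>2 \<le> A * (L powr (\<beta> + 2) * e ^ 4 + L powr (- a) * e\<^sup>2)"
          by (simp only: distrib_left)
      qed simp
      then show "\<exists>w. H1_sums (\<lambda>n x. exp (\<i> * complex_of_real (\<theta> u0 n t)) * eigen_coeff f (u 0) n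
                                 * complex_of_real (f n x)) w \<and>
               Hk_norm 1 (\<lambda>x. u t x - w x) \<le> K * Hs_norm s u0 powr (1 + \<delta>)"
        using w unfolding e_def by blast
    qed
  qed
qed

end
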